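(* Let $n\ge 2$ and let $F\in \mathrm{GL}_n(\mathbb C)$ be generic. Then the counit of the universal cosovereign Hopf algebra $\mathcal H(F)$ has a finite free resolution of length $3$, i.e. there is an exact sequence of right $\mathcal H(F)$-modules $0\to P_3\to P_2\to P_1\to P_0\to \mathbb C_\varepsilon\to 0$ with $P_0,P_1,P_2,P_3$ free. In particular, for arbitrary $K\in \mathrm{GL}_n(\mathbb C)$ there is a finite free resolution of length $3$ of the counit of $\mathrm{Pol}(U_K^+)$.
   Context: All vector spaces and algebras are over $\mathbb C$. For $F\in\mathrm{GL}_n(\mathbb C)$, $n\ge 2$, $\mathcal H(F)$ is the universal unital algebra generated by the entries of $u=(u_{ij})_{i,j=1}^n$ and $v=(v_{ij})_{i,j=1}^n$ subject to $uv^t=v^tu=I$, $vFu^tF^{-1}=Fu^tF^{-1}v=I$ (here $t$ denotes the transpose, $(u^t)_{ij}=u_{ji}$). It is a Hopf algebra with $\Delta(u_{ij})=\sum_k u_{ik}\otimes u_{kj}$, $\Delta(v_{ij})=\sum_k v_{ik}\otimes v_{kj}$, $\varepsilon(u_{ij})=\varepsilon(v_{ij})=\delta_{ij}$, $S(u)=v^t$, $S(v)=Fu^tF^{-1}$ (entrywise). $F$ is called normalizable if either $\mathrm{tr}(F)\ne0$ and $\mathrm{tr}(F^{-1})\neq 0$, or $\mathrm{tr}(F)=0=\mathrm{tr}(F^{-1})$. $F$ is called generic if it is normalizable and the solutions $q$ of $q^2-\sqrt{\mathrm{tr}(F)\mathrm{tr}(F^{-1})}\,q+1=0$ are not roots of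 unity of order $\ge 3$. For $K\in\mathrm{GL}_n(\mathbb C)$, $U_K^+$ is the free unitary compact quantum group: $\mathrm{Pol}(U_K^+)$ is the $*$-Hopf algebra generated by the entries of $u=(u_{ij})_{i,j=1}^n$ in the universal unital C$^*$-algebra generated by these entries subject to the relations making $u$ and $K\overline uK^{-1}$ unitary, where $(\overline u)_{ij}=u_{ij}^*$. There is a Hopf algebra isomorphism $\mathrm{Pol}(U_K^+)\cong\mathcal H(K^*K)$ given by $u\mapsto u$, $\overline u\mapsto v$. For a Hopf algebra $H$, $\mathbb C_\varepsilon$ is the right module $\mathbb C$ with $z\cdot h=z\varepsilon(h)$; a resolution of the counit of $H$ is a resolution of the right module $\mathbb C_\varepsilon$ by right $H$-modules. *)

theory Defs
  imports
    "HOL-Analysis.Analysis"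
    "HOL-Library.Poly_Mapping"
    "HOL-Algebra.Algebraic_Closure_Type"
begin

no_notation fps_nth (infixl \<open>$\<close> 75)

section \<open>Free algebras\<close>

text \<open>Words get a type of their own, so that they can carry the additive monoid structure (zero is the
  empty word, addition is concatenation) from which \<^theory>\<open>HOL-Library.Poly_Mapping\<close> builds the
  convolution product on finitely supported functions.\<close>

datatype 'g fword = Word (letters: "'g list")

instantiation fword :: (type) monoid_add
begin

definition zero_fword :: "'a fword" where "0 = Word []"

definition plus_fword :: "'a fword \<Rightarrow> 'a fword \<Rightarrow> 'a fword"
  where "v + w = Word (letters v @ letters w)"

instance by standard (simp_all add: zero_fword_def plus_fword_def)

end

type_synonym 'g free_alg = "'g fword \<Rightarrow>\<^sub>0 complex"

definition gen :: "'g \<Rightarrow> 'g free_alg"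
  where "gen g = Poly_Mapping.single (Word [g]) 1"

definition scal :: "complex \<Rightarrow> 'g free_alg"
  where "scal c = Poly_Mapping.single 0 c"

definition character_of :: "('g \<Rightarrow> complex) \<Rightarrow> 'g free_alg \<Rightarrow> complex"
  \<comment> \<open>the unital algebra homomorphism to the complex numbers with given values on the generators\<close>
  where "character_of \<phi> x =
    (\<Sum>w\<in>Poly_Mapping.keys x. Poly_Mapping.lookup x w * prod_list (map \<phi> (letters w)))"

definition scal_mat :: "complex^'n^'m \<Rightarrow> ('g free_alg)^'n^'m"
  where "scal_mat A = (\<chi> i j. scal (A $ i $ j))"

definition entries :: "'a^'n^'m \<Rightarrow> 'a set"
  where "entries A = {A $ i $ j | i j. True}"


section \<open>Right modules and resolutions\<close>

text \<open>Modules over unital complex algebras are modules over the underlying rings: the complex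
  scalars act through the algebra, and module maps are automatically complex linear.\<close>

record ('m, 'r) rmodule = "'m ring" +
  ract :: "'m \<Rightarrow> 'r \<Rightarrow> 'm"

text \<open>As in \<^theory>\<open>HOL-Algebra.Module\<close>, the multiplicative fields of the record are irrelevant.\<close>

locale right_module = R?: ring R + M?: abelian_group M
  for R :: "('r, 'x) ring_scheme" (structure) and M :: "('m, 'r, 'y) rmodule_scheme" (structure) +
  assumes ract_closed:
      "\<lbrakk>x \<in> carrier M; a \<in> carrier R\<rbrakk> \<Longrightarrow> ract M x a \<in> carrier M"
    and ract_add_left:
      "\<lbrakk>x \<in> carrier M; y \<in> carrier M; a \<in> carrier R\<rbrakk>
        \<Longrightarrow> ract M (x \<oplus>\<^bsub>M\<^esub> y) a = ract M x a \<oplus>\<^bsub>M\<^esub> ract M y a"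
    and ract_add_right:
      "\<lbrakk>x \<in> carrier M; a \<in> carrier R; b \<in> carrier R\<rbrakk>
        \<Longrightarrow> ract M x (a \<oplus>\<^bsub>R\<^esub> b) = ract M x a \<oplus>\<^bsub>M\<^esub> ract M x b"
    and ract_mult:
      "\<lbrakk>x \<in> carrier M; a \<in> carrier R; b \<in> carrier R\<rbrakk>
        \<Longrightarrow> ract M x (a \<otimes>\<^bsub>R\<^esub> b) = ract M (ract M x a) b"
    and ract_one: "x \<in> carrier M \<Longrightarrow> ract M x \<one>\<^bsub>R\<^esub> = x"

definition rmodule_hom ::
  "('r, 'x) ring_scheme \<Rightarrow> ('m, 'r, 'y) rmodule_scheme \<Rightarrow> ('k, 'r, 'z) rmodule_scheme \<Rightarrow> ('m \<Rightarrow> 'k) set"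
  where "rmodule_hom R M N = {f \<in> carrier M \<rightarrow> carrier N.
    (\<forall>x\<in>carrier M. \<forall>y\<in>carrier M. f (x \<oplus>\<^bsub>M\<^esub> y) = f x \<oplus>\<^bsub>N\<^esub> f y) \<and>
    (\<forall>x\<in>carrier M. \<forall>a\<in>carrier R. f (ract M x a) = ract N (f x) a)}"

definition rmodule_basis ::
  "('r, 'x) ring_scheme \<Rightarrow> ('m, 'r, 'y) rmodule_scheme \<Rightarrow> 'm set \<Rightarrow> bool"
  where "rmodule_basis R M B \<longleftrightarrow> finite B \<and> B \<subseteq> carrier M \<and>
    (\<forall>x\<in>carrier M. \<exists>!c. c \<in> B \<rightarrow>\<^sub>E carrier R \<and> x = (\<Oplus>\<^bsub>M\<^esub>b\<in>B. ract M b (c b)))"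

definition finite_free_rmodule ::
  "('r, 'x) ring_scheme \<Rightarrow> ('m, 'r, 'y) rmodule_scheme \<Rightarrow> bool"
  where "finite_free_rmodule R M \<longleftrightarrow> right_module R M \<and> (\<exists>B. rmodule_basis R M B)"

definition exact_at :: "('l \<Rightarrow> 'm) \<Rightarrow> ('m \<Rightarrow> 'k) \<Rightarrow> ('l, 'x) ring_scheme \<Rightarrow>
    ('m, 'y) ring_scheme \<Rightarrow> ('k, 'z) ring_scheme \<Rightarrow> bool"
  where "exact_at f g L M N \<longleftrightarrow> f ` carrier L = {x \<in> carrier M. g x = \<zero>\<^bsub>N\<^esub>}"

text \<open>The type \<^typ>\<open>nat \<Rightarrow> 'r\<close> is large enough for an isomorphic copy of every free module of finite
  rank over a ring with elements in \<^typ>\<open>'r\<close>, so fixing it does not restrict the resolutions.\<close>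

definition has_finite_free_resolution_of_length_3 ::
  "('r, 'x) ring_scheme \<Rightarrow> ('m, 'r) rmodule \<Rightarrow> bool"
  where "has_finite_free_resolution_of_length_3 R M \<longleftrightarrow> right_module R M \<and>
    (\<exists>(P\<^sub>0 :: (nat \<Rightarrow> 'r, 'r) rmodule) (P\<^sub>1 :: (nat \<Rightarrow> 'r, 'r) rmodule)
      (P\<^sub>2 :: (nat \<Rightarrow> 'r, 'r) rmodule) (P\<^sub>3 :: (nat \<Rightarrow> 'r, 'r) rmodule) d\<^sub>0 d\<^sub>1 d\<^sub>2 d\<^sub>3.
      finite_free_rmodule R P\<^sub>0 \<and> finite_free_rmodule R P\<^sub>1 \<and>
      finite_free_rmodule R P\<^sub>2 \<and> finite_free_rmodule R P\<^sub>3 \<and>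
      d\<^sub>3 \<in> rmodule_hom R P\<^sub>3 P\<^sub>2 \<and> d\<^sub>2 \<in> rmodule_hom R P\<^sub>2 P\<^sub>1 \<and>
      d\<^sub>1 \<in> rmodule_hom R P\<^sub>1 P\<^sub>0 \<and> d\<^sub>0 \<in> rmodule_hom R P\<^sub>0 M \<and>
      inj_on d\<^sub>3 (carrier P\<^sub>3) \<and>
      exact_at d\<^sub>3 d\<^sub>2 P\<^sub>3 P\<^sub>2 P\<^sub>1 \<and>
      exact_at d\<^sub>2 d\<^sub>1 P\<^sub>2 P\<^sub>1 P\<^sub>0 \<and>
      exact_at d\<^sub>1 d\<^sub>0 P\<^sub>1 P\<^sub>0 M \<and>
      d\<^sub>0 ` carrier P\<^sub>0 = carrier M)"

definition char_module :: "('r \<Rightarrow> complex) \<Rightarrow> (complex, 'r) rmodule"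
  where "char_module \<epsilon> = 
    \<lparr>carrier = UNIV, mult = (*), one = 1, zero = 0, add = (+), ract = (\<lambda>z h. z * \<epsilon> h)\<rparr>"


section \<open>The universal cosovereign Hopf algebras\<close>

text \<open>Of the Hopf algebra structure, resolutions of the counit involve the algebra and the counit
  only.\<close>

datatype 'n cosov_gen = U 'n 'n | V 'n 'n

definition cosov_u :: "('n cosov_gen free_alg)^'n^'n"
  where "cosov_u = (\<chi> i j. gen (U i j))"

definition cosov_v :: "('n cosov_gen free_alg)^'n^'n"
  where "cosov_v = (\<chi> i j. gen (V i j))"

definition cosov_relators :: "complex^'n^'n \<Rightarrow> 'n::finite cosov_gen free_alg set"
  where "cosov_relators F =
    (let u = cosov_u; v = cosov_v; f = scal_mat F; f' = scal_mat (matrix_inv F) in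
      entries (u ** transpose v - mat 1) \<union>
      entries (transpose v ** u - mat 1) \<union>
      entries (v ** f ** transpose u ** f' - mat 1) \<union>
      entries (f ** transpose u ** f' ** v - mat 1))"

definition cosov_ideal :: "complex^'n^'n \<Rightarrow> 'n::finite cosov_gen free_alg set"
  where "cosov_ideal F = genideal ring_of_type_algebra (cosov_relators F)"

definition cosov :: "complex^'n^'n \<Rightarrow> 'n::finite cosov_gen free_alg set ring"
  where "cosov F = ring_of_type_algebra Quot cosov_ideal F"

fun cosov_counit_gen :: "'n cosov_gen \<Rightarrow> complex"
  where
    "cosov_counit_gen (U i j) = (if i = j then 1 else 0)"
  | "cosov_counit_gen (V i j) = (if i = j then 1 else 0)"

text \<open>Elements of \<^term>\<open>cosov F\<close> are cosets; the counit is the common value of the character on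
  the representatives.\<close>

definition cosov_counit :: "'n cosov_gen free_alg set \<Rightarrow> complex"
  where "cosov_counit a = the_elem (character_of cosov_counit_gen ` a)"

definition normalizable :: "complex^'n^'n \<Rightarrow> bool"
  where "normalizable F \<longleftrightarrow>
    trace F \<noteq> 0 \<and> trace (matrix_inv F) \<noteq> 0 \<or> trace F = 0 \<and> trace (matrix_inv F) = 0"

definition root_of_unity_of_order :: "nat \<Rightarrow> complex \<Rightarrow> bool"
  where "root_of_unity_of_order m q \<longleftrightarrow> m > 0 \<and> q ^ m = 1 \<and> (\<forall>k. 0 < k \<and> k < m \<longrightarrow> q ^ k \<noteq> 1)"

text \<open>The other choice of the square root replaces \<open>q\<close> by \<open>- q\<close>; this does not affect the condition,
  since roots of unity of order at least 3 are those different from 1 and - 1.\<close>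

definition generic :: "complex^'n^'n \<Rightarrow> bool"
  where "generic F \<longleftrightarrow> normalizable F \<and>
    (\<forall>q. q\<^sup>2 - csqrt (trace F * trace (matrix_inv F)) * q + 1 = 0
      \<longrightarrow> \<not> (\<exists>m\<ge>3. root_of_unity_of_order m q))"


section \<open>Universal unital C*-algebras\<close>

datatype 'g starred = Gen 'g | Adj 'g

fun flip :: "'g starred \<Rightarrow> 'g starred"
  where
    "flip (Gen g) = Adj g"
  | "flip (Adj g) = Gen g"

definition star :: "'g starred free_alg \<Rightarrow> 'g starred free_alg"
  where "star x = (\<Sum>w\<in>Poly_Mapping.keys x.
    Poly_Mapping.single (Word (rev (map flip (letters w)))) (cnj (Poly_Mapping.lookup x w)))"

definition conj_mat :: "('g starred free_alg)^'n^'m \<Rightarrow> ('g starred free_alg)^'n^'m"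
  where "conj_mat A = (\<chi> i j. star (A $ i $ j))"

definition adj_mat :: "('g starred free_alg)^'n^'m \<Rightarrow> ('g starred free_alg)^'m^'n"
  where "adj_mat A = transpose (conj_mat A)"

definition unitary_relators :: "('g starred free_alg)^'n^'n \<Rightarrow> 'g starred free_alg set"
  where "unitary_relators A = entries (A ** adj_mat A - mat 1) \<union> entries (adj_mat A ** A - mat 1)"

definition cstar_seminorm :: "('g starred free_alg \<Rightarrow> real) \<Rightarrow> bool"
  where "cstar_seminorm p \<longleftrightarrow>
    (\<forall>x. 0 \<le> p x) \<and>
    (\<forall>x y. p (x + y) \<le> p x + p y) \<and>
    (\<forall>c x. p (scal c * x) = cmod c * p x) \<and>
    (\<forall>x y. p (x * y) \<le> p x * p y) \<and>
    (\<forall>x. p (star x * x) = (p x)\<^sup>2)"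

text \<open>The universal unital C*-algebra with relators \<open>S\<close> is the Hausdorff completion of the free unital
  *-algebra in the largest C*-seminorm vanishing on \<open>S\<close>. The supremum is meaningful only if the
  generators are bounded in these seminorms; for entries of unitary matrices the bound is 1.\<close>

definition univ_seminorm :: "'g starred free_alg set \<Rightarrow> 'g starred free_alg \<Rightarrow> real"
  where "univ_seminorm S x = (SUP p\<in>{p. cstar_seminorm p \<and> (\<forall>r\<in>S. p r = 0)}. p x)"

definition cauchy_ring :: "'g starred free_alg set \<Rightarrow> (nat \<Rightarrow> 'g starred free_alg) ring"
  where "cauchy_ring S =
    \<lparr>carrier = {s. \<forall>e>0. \<exists>N. \<forall>k\<ge>N. \<forall>l\<ge>N. univ_seminorm S (s k - s l) < e},
     mult = (\<lambda>s t k. s k * t k), one = (\<lambda>_. 1),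
     zero = (\<lambda>_. 0), add = (\<lambda>s t k. s k + t k)\<rparr>"

definition null_ideal :: "'g starred free_alg set \<Rightarrow> (nat \<Rightarrow> 'g starred free_alg) set"
  where "null_ideal S = {s. (\<lambda>k. univ_seminorm S (s k)) \<longlonglongrightarrow> 0}"

definition univ_cstar :: "'g starred free_alg set \<Rightarrow> (nat \<Rightarrow> 'g starred free_alg) set ring"
  where "univ_cstar S = cauchy_ring S Quot null_ideal S"

definition const_class ::
  "'g starred free_alg set \<Rightarrow> 'g starred free_alg \<Rightarrow> (nat \<Rightarrow> 'g starred free_alg) set"
  where "const_class S x = null_ideal S +>\<^bsub>cauchy_ring S\<^esub> (\<lambda>_. x)"

definition class_star ::
  "(nat \<Rightarrow> 'g starred free_alg) set \<Rightarrow> (nat \<Rightarrow> 'g starred free_alg) set"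
  where "class_star a = (\<lambda>s k. star (s k)) ` a"

inductive_set star_subalgebra_generated ::
    "'g starred free_alg set \<Rightarrow> (nat \<Rightarrow> 'g starred free_alg) set set
      \<Rightarrow> (nat \<Rightarrow> 'g starred free_alg) set set"
  for S :: "'g starred free_alg set" and G :: "(nat \<Rightarrow> 'g starred free_alg) set set"
  where
    base: "a \<in> G \<Longrightarrow> a \<in> star_subalgebra_generated S G"
  | scalar: "const_class S (scal c) \<in> star_subalgebra_generated S G"
  | add: "\<lbrakk>a \<in> star_subalgebra_generated S G; b \<in> star_subalgebra_generated S G\<rbrakk>
      \<Longrightarrow> a \<oplus>\<^bsub>univ_cstar S\<^esub> b \<in> star_subalgebra_generated S G"
  | mult: "\<lbrakk>a \<in> star_subalgebra_generated S G; b \<in> star_subalgebra_generated S G\<rbrakk>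
      \<Longrightarrow> a \<otimes>\<^bsub>univ_cstar S\<^esub> b \<in> star_subalgebra_generated S G"
  | star: "a \<in> star_subalgebra_generated S G \<Longrightarrow> class_star a \<in> star_subalgebra_generated S G"


section \<open>The free unitary quantum groups\<close>

definition free_unitary_u :: "(('n \<times> 'n) starred free_alg)^'n^'n"
  where "free_unitary_u = (\<chi> i j. gen (Gen (i, j)))"

definition free_unitary_relators :: "complex^'n^'n \<Rightarrow> ('n::finite \<times> 'n) starred free_alg set"
  where "free_unitary_relators K =
    unitary_relators free_unitary_u \<union>
    unitary_relators (scal_mat K ** conj_mat free_unitary_u ** scal_mat (matrix_inv K))"

definition pol_free_unitary ::
  "complex^'n^'n \<Rightarrow> (nat \<Rightarrow> ('n::finite \<times> 'n) starred free_alg) set ring"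
  where "pol_free_unitary K =
    (let S = free_unitary_relators K in
      univ_cstar S
        \<lparr>carrier := star_subalgebra_generated S (const_class S ` entries free_unitary_u)\<rparr>)"

fun free_unitary_counit_gen :: "('n \<times> 'n) starred \<Rightarrow> complex"
  where
    "free_unitary_counit_gen (Gen (i, j)) = (if i = j then 1 else 0)"
  | "free_unitary_counit_gen (Adj (i, j)) = (if i = j then 1 else 0)"

text \<open>The absolute value of the character below is a C*-seminorm vanishing on the relators, so the
  character is continuous and extends to classes of Cauchy sequences by taking limits.\<close>

definition free_unitary_counit :: "(nat \<Rightarrow> ('n \<times> 'n) starred free_alg) set \<Rightarrow> complex"
  where "free_unitary_counit a =
    the_elem ((\<lambda>s. lim (\<lambda>k. character_of free_unitary_counit_gen (s k))) ` a)"

end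

theory Submission
  imports Defs
begin

text \<open>Let I be the ideal of relations in a free algebra A. Free modules over A/I and maps
  between them are given by matrices over A, and exactness becomes a statement about congruences
  modulo I (\<open>quotient_map.resolution_from_matrices\<close>). The matrices
  \<open>D\<^sub>1\<close>, \<open>D\<^sub>2\<close>, \<open>D\<^sub>3\<close> connect free modules
  of ranks 1, 2n^2, 2n^2, 2. \<open>D\<^sub>1\<close> consists of x - ep(x) for all entries x of u
  and v. \<open>D\<^sub>2\<close> consists of the Fox derivatives of the column relators u v^t = 1
  and v F u^t = F. \<open>D\<^sub>3\<close> records the two syzygies that arise because a pair of
  neighbouring letters may be contracted first along columns and then along rows, or conversely.

  Exactness at the two lowest places is Fox calculus: \<open>fox_fundamental\<close> gives
  \<open>exact0\<close>; for \<open>exact1\<close>, Fox derivatives of elements of I are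
  combinations of those of the relators, and the row relators are redundant because of a cubic
  identity between relators (\<open>fox_row_relator\<close>).

  Exactness at the second place and injectivity of \<open>D\<^sub>3\<close> are proved dually. A
  functional \<psi> on the module of column relators that kills the image of
  \<open>D\<^sub>3\<close> has to be written as \<phi> after \<open>D\<^sub>2\<close>. Such a \<phi>
  is a function on words with a marked first letter that solves one linear equation for each pair of
  neighbouring letters of opposite kind. After a change of basis by an eigenvector of F^t, each
  equation determines the value at a leading word from smaller words. Leading words of two equations
  along the same index never overlap, since two distinct indices are available, and equations along
  different indices commute; so a diamond lemma applies (\<open>confluent_rules_solvable\<close>,
  \<open>functional_extension\<close>), and the remaining compatibilities are what naturality and
  the cycle condition on \<psi> provide (\<open>marked_extension\<close>,
  \<open>differential_functional\<close>). This yields \<open>exact2\<close>. The same lemma, with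
  values of \<phi> prescribed on words that begin with one letter \<open>x\<^sub>0\<close>, shows
  that \<open>x\<^sub>0\<close> is not a left zero divisor, and injectivity of
  \<open>D\<^sub>3\<close> follows (\<open>left_mult_injective\<close>, \<open>resolution\<close>).

  For the free unitary quantum group one has to know that passing to the universal C*-algebra
  identifies nothing beyond I, so that the polynomial algebra is a universal cosovereign algebra.
  The universal seminorm is finite because entries of a unitary matrix have seminorm at most 1; this
  rests on positivity of star x x for every C*-seminorm (\<open>pos_star_mult\<close>). Its kernel
  is I because there is a faithful Haar functional: after unitary diagonalization its moments are
  the kernel of the orthogonal projection onto the span of the noncrossing pairings. Every element
  is congruent to one whose coefficients are killed by all contractions, and on such elements only
  the nested pairing survives, with positive weight (\<open>haar_positive\<close>). The GNS
  construction turns this functional into a C*-seminorm with kernel I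
  (\<open>separating_seminorm\<close>).\<close>

section \<open>Free algebras: linear extension and substitution\<close>

definition mon :: "'g list \<Rightarrow> 'g free_alg"
  where "mon w = Poly_Mapping.single (Word w) 1"

lemma mon_Nil [simp]: "mon [] = 1"
  by (simp add: mon_def flip: zero_fword_def)

lemma mon_append: "mon (v @ w) = mon v * mon w"
  by (simp add: mon_def mult_single plus_fword_def)

lemma gen_eq_mon: "gen g = mon [g]"
  by (simp add: mon_def gen_def)

lemma mon_Cons: "mon (g # w) = gen g * mon w"
  using mon_append[of "[g]" w] by (simp add: gen_eq_mon)

lemma scal_mult_mon: "scal c * mon w = Poly_Mapping.single (Word w) c"
  by (simp add: mon_def scal_def mult_single)

lemma scal_add: "scal (a + b) = scal a + scal b"
  by (simp add: scal_def single_add)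

lemma scal_mult: "scal (a * b) = scal a * scal b"
  by (simp add: scal_def mult_single)

lemma scal_0 [simp]: "scal 0 = 0"
  by (simp add: scal_def)

lemma scal_1 [simp]: "scal 1 = 1"
  by (simp add: scal_def)

lemma scal_uminus: "scal (- a) = - scal a"
  by (simp add: scal_def single_uminus)

lemma scal_diff: "scal (a - b) = scal a - scal b"
  by (simp add: scal_def single_diff)

lemma scal_sum: "scal (sum f A) = (\<Sum>i\<in>A. scal (f i))"
  by (induction A rule: infinite_finite_induct) (auto simp: scal_add)

lemma scal_if: "scal (if P then a else b) = (if P then scal a else scal b)"
  by simp

lemma free_alg_induct [case_names scal_mon add]:
  fixes x :: "'g free_alg"
  assumes "\<And>c w. P (scal c * mon w)" and "\<And>x y. P x \<Longrightarrow> P y \<Longrightarrow> P (x + y)"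
  shows "P x"
proof (induction x rule: Poly_Mapping.update_induct)
  case const
  show ?case using assms(1)[of 0 "[]"] by simp
next
  case (update f a b)
  have "Poly_Mapping.update a b f = f + Poly_Mapping.single a b"
    using update(1)
    by (intro poly_mapping_eqI)
       (auto simp: lookup_update lookup_add lookup_single when_def not_in_keys_iff_lookup_eq_zero)
  moreover have "Poly_Mapping.single a b = scal b * mon (letters a)"
    by (simp add: scal_mult_mon)
  ultimately show ?case using assms update by simp
qed

lemma scal_commute: "x * scal c = scal c * x"
proof (induction x rule: free_alg_induct)
  case (scal_mon d w)
  have "mon w * scal c = scal c * mon w"
    by (simp add: mon_def scal_def mult_single)
  then have "scal d * mon w * scal c = scal d * (scal c * mon w)"
    by (simp only: mult.assoc)
  also have "\<dots> = scal c * (scal d * mon w)"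
    by (simp only: mult.assoc[symmetric] scal_mult[symmetric] mult.commute)
  finally show ?case .
qed (simp add: distrib_left distrib_right)

lemma scal_left_commute: "x * (scal c * y) = scal c * (x * y)"
  by (metis mult.assoc scal_commute)

text \<open>Every linear functional on the free algebra has this form
  (\<open>linear_eq_lin\<close>), so functionals can be constructed as plain functions on
  words.\<close>

definition lin :: "('g list \<Rightarrow> complex) \<Rightarrow> 'g free_alg \<Rightarrow> complex"
  where "lin f x = (\<Sum>w\<in>Poly_Mapping.keys x. Poly_Mapping.lookup x w * f (letters w))"

lemma lin_add: "lin f (x + y) = lin f x + lin f y"
  unfolding lin_def by (rule setsum_keys_plus_distrib) (auto simp: algebra_simps)

lemma lin_0 [simp]: "lin f 0 = 0"
  by (simp add: lin_def)

lemma lin_uminus: "lin f (- x) = - lin f x"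
  using lin_add[of f x "- x"] by (simp add: eq_neg_iff_add_eq_0 add.commute)

lemma lin_diff: "lin f (x - y) = lin f x - lin f y"
  using lin_add[of f x "- y"] by (simp add: lin_uminus)

lemma lin_sum: "lin f (sum g A) = (\<Sum>i\<in>A. lin f (g i))"
  by (induction A rule: infinite_finite_induct) (auto simp: lin_add)

lemma lin_scal_mon: "lin f (scal c * mon w) = c * f w"
  by (cases "c = 0") (auto simp: scal_mult_mon lin_def)

lemma lin_mon [simp]: "lin f (mon w) = f w"
  using lin_scal_mon[of f 1 w] by simp

lemma lin_scal: "lin f (scal c * x) = c * lin f x"
proof (induction x rule: free_alg_induct)
  case (scal_mon d w)
  then show ?case
    by (simp add: mult.assoc[symmetric] scal_mult[symmetric] lin_scal_mon)
qed (simp add: lin_add distrib_left)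

lemma lin_mon_mult: "lin f (mon v * x) = lin (\<lambda>w. f (v @ w)) x"
proof (induction x rule: free_alg_induct)
  case (scal_mon d w)
  then show ?case
    by (simp add: scal_left_commute lin_scal flip: mon_append)
qed (simp add: lin_add distrib_left)

lemma lin_mult_mon: "lin f (x * mon v) = lin (\<lambda>w. f (w @ v)) x"
proof (induction x rule: free_alg_induct)
  case (scal_mon d w)
  then show ?case
    by (simp add: mult.assoc lin_scal flip: mon_append)
qed (simp add: lin_add distrib_right)

lemma lin_gen_mult: "lin f (gen g * x) = lin (\<lambda>w. f (g # w)) x"
  by (simp add: gen_eq_mon lin_mon_mult)

lemma lin_linear_fun: "lin (\<lambda>w. a * f w + b * g w) x = a * lin f x + b * lin g x"
  unfolding lin_def by (simp add: sum.distrib sum_distrib_left algebra_simps)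

lemma lin_fun_sum: "lin (\<lambda>w. \<Sum>i\<in>A. f i w) x = (\<Sum>i\<in>A. lin (f i) x)"
  unfolding lin_def by (simp add: sum_distrib_left sum.swap[of _ A])

lemma lin_fun_mult: "lin (\<lambda>w. c * f w) x = c * lin f x"
  unfolding lin_def by (simp add: sum_distrib_left algebra_simps)

lemma linear_eq_lin:
  assumes "\<And>x y. h (x + y) = h x + h y" and "\<And>c x. h (scal c * x) = c * h x"
  shows "h x = lin (\<lambda>w. h (mon w)) x"
  by (induction x rule: free_alg_induct) (simp_all add: assms lin_add lin_scal)

lemma character_of_eq_lin: "character_of \<phi> = lin (\<lambda>w. prod_list (map \<phi> w))"
  by (simp add: fun_eq_iff character_of_def lin_def)

lemma character_of_add: "character_of \<phi> (x + y) = character_of \<phi> x + character_of \<phi> y"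
  by (simp add: character_of_eq_lin lin_add)

lemma character_of_mult: "character_of \<phi> (x * y) = character_of \<phi> x * character_of \<phi> y"
proof (induction x rule: free_alg_induct)
  case (scal_mon c w)
  then show ?case
    by (simp add: character_of_eq_lin mult.assoc lin_scal lin_mon_mult lin_fun_mult)
qed (simp add: character_of_add distrib_right)

lemma character_of_scal [simp]: "character_of \<phi> (scal c) = c"
  unfolding character_of_eq_lin using lin_scal_mon[of "\<lambda>w. prod_list (map \<phi> w)" c "[]"] by simp

lemma character_of_gen [simp]: "character_of \<phi> (gen g) = \<phi> g"
  by (simp add: character_of_eq_lin gen_eq_mon)

lemma character_of_0 [simp]: "character_of \<phi> 0 = 0"
  by (simp add: character_of_eq_lin)

lemma character_of_1 [simp]: "character_of \<phi> 1 = 1"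
  using character_of_scal[of \<phi> 1] by simp

lemma character_of_diff: "character_of \<phi> (x - y) = character_of \<phi> x - character_of \<phi> y"
  by (simp add: character_of_eq_lin lin_diff)

lemma character_of_sum: "character_of \<phi> (sum g A) = (\<Sum>i\<in>A. character_of \<phi> (g i))"
  by (simp add: character_of_eq_lin lin_sum)

definition ext :: "('g list \<Rightarrow> 'h free_alg) \<Rightarrow> 'g free_alg \<Rightarrow> 'h free_alg"
  where "ext F x =
    (\<Sum>w\<in>Poly_Mapping.keys x. scal (Poly_Mapping.lookup x w) * F (letters w))"

lemma ext_add: "ext F (x + y) = ext F x + ext F y"
  unfolding ext_def
  by (rule setsum_keys_plus_distrib[where f = "\<lambda>w c. scal c * F (letters w)"])
     (auto simp: scal_add distrib_right)

lemma ext_0 [simp]: "ext F 0 = 0"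
  by (simp add: ext_def)

lemma ext_uminus: "ext F (- x) = - ext F x"
  using ext_add[of F x "- x"] by (simp add: eq_neg_iff_add_eq_0 add.commute)

lemma ext_diff: "ext F (x - y) = ext F x - ext F y"
  using ext_add[of F x "- y"] by (simp add: ext_uminus)

lemma ext_sum: "ext F (sum g A) = (\<Sum>i\<in>A. ext F (g i))"
  by (induction A rule: infinite_finite_induct) (auto simp: ext_add)

lemma ext_scal_mon: "ext F (scal c * mon w) = scal c * F w"
  by (cases "c = 0") (auto simp: scal_mult_mon ext_def)

lemma ext_mon: "ext F (mon w) = F w"
  using ext_scal_mon[of F 1 w] by simp

lemma ext_scal_mult: "ext F (scal c * x) = scal c * ext F x"
proof (induction x rule: free_alg_induct)
  case (scal_mon d w)
  have "scal c * (scal d * mon w) = scal (c * d) * mon w"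
    by (simp add: scal_mult mult.assoc)
  then show ?case by (metis ext_scal_mon scal_mult mult.assoc)
qed (simp add: ext_add distrib_left)

definition subst :: "('g \<Rightarrow> 'h free_alg) \<Rightarrow> 'g free_alg \<Rightarrow> 'h free_alg"
  where "subst \<sigma> = ext (\<lambda>w. prod_list (map \<sigma> w))"

lemmas subst_add = ext_add[of "\<lambda>w. prod_list (map \<sigma> w)" for \<sigma>, folded subst_def]
  and subst_0 [simp] = ext_0[of "\<lambda>w. prod_list (map \<sigma> w)" for \<sigma>, folded subst_def]
  and subst_uminus = ext_uminus[of "\<lambda>w. prod_list (map \<sigma> w)" for \<sigma>, folded subst_def]
  and subst_diff = ext_diff[of "\<lambda>w. prod_list (map \<sigma> w)" for \<sigma>, folded subst_def]
  and subst_sum = ext_sum[of "\<lambda>w. prod_list (map \<sigma> w)" for \<sigma>, folded subst_def]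
  and subst_scal_mon = ext_scal_mon[of "\<lambda>w. prod_list (map \<sigma> w)" for \<sigma>, folded subst_def]
  and subst_mon = ext_mon[of "\<lambda>w. prod_list (map \<sigma> w)" for \<sigma>, folded subst_def]
  and subst_scal_mult = ext_scal_mult[of "\<lambda>w. prod_list (map \<sigma> w)" for \<sigma>, folded subst_def]

lemma subst_mult: "subst \<sigma> (x * y) = subst \<sigma> x * subst \<sigma> y"
proof (induction x rule: free_alg_induct)
  case (scal_mon c v)
  have "subst \<sigma> (mon v * y) = prod_list (map \<sigma> v) * subst \<sigma> y"
  proof (induction y rule: free_alg_induct)
    case (scal_mon d w)
    have "mon v * (scal d * mon w) = scal d * mon (v @ w)"
      by (simp add: scal_left_commute mon_append)
    then show ?case by (simp add: subst_scal_mon scal_left_commute)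
  qed (simp add: subst_add distrib_left)
  then show ?case by (simp add: subst_scal_mon subst_scal_mult subst_mon mult.assoc)
qed (simp add: subst_add distrib_right)

lemma subst_scal [simp]: "subst \<sigma> (scal c) = scal c"
  using subst_scal_mon[of \<sigma> c "[]"] by simp

lemma subst_1 [simp]: "subst \<sigma> 1 = 1"
  using subst_scal[of \<sigma> 1] by simp

lemma subst_gen [simp]: "subst \<sigma> (gen g) = \<sigma> g"
  using subst_scal_mon[of \<sigma> 1 "[g]"] by (simp add: gen_eq_mon)

lemma hom_eq_on_gens:
  assumes "\<And>x y. h (x + y) = h x + h y" and "\<And>x y. h (x * y) = h x * h y"
    and "\<And>c. h (scal c) = k (scal c)" and "\<And>g. h (gen g) = k (gen g)"
    and "\<And>x y. k (x + y) = k x + k y" and "\<And>x y. k (x * y) = k x * k y"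
  shows "h x = (k x :: 'a :: ring_1)"
proof (induction x rule: free_alg_induct)
  case (scal_mon c w)
  have "h (mon w) = k (mon w)"
  proof (induction w)
    case Nil
    show ?case using assms(3)[of 1] by simp
  qed (simp add: mon_Cons assms)
  then show ?case by (simp add: assms)
qed (simp add: assms)

lemma subst_subst: "subst \<tau> (subst \<sigma> x) = subst (\<lambda>g. subst \<tau> (\<sigma> g)) x"
  by (rule hom_eq_on_gens[where h = "\<lambda>x. subst \<tau> (subst \<sigma> x)"]) (simp_all add: subst_add subst_mult)

lemma subst_gen_id: "subst gen x = x"
  by (rule hom_eq_on_gens[where k = "\<lambda>x. x"]) (simp_all add: subst_add subst_mult)

lemma character_of_subst:
  "character_of \<phi> (subst \<sigma> x) = character_of (\<lambda>g. character_of \<phi> (\<sigma> g)) x"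
  by (rule hom_eq_on_gens[where h = "\<lambda>x. character_of \<phi> (subst \<sigma> x)"])
     (simp_all add: subst_add subst_mult character_of_add character_of_mult)


section \<open>Two-sided ideals given by generators, and what vanishes on them\<close>

section \<open>Two-sided ideals\<close>

text \<open>The library notion (\<open>two_sided_iff_ideal\<close>) in terms of type class
  operations; subtraction is covered because of multiplication by -1.\<close>

definition two_sided :: "'a::ring_1 set \<Rightarrow> bool"
  where "two_sided I \<longleftrightarrow> 0 \<in> I \<and> (\<forall>x\<in>I. \<forall>y\<in>I. x + y \<in> I) \<and> (\<forall>x\<in>I. \<forall>a. a * x \<in> I \<and> x * a \<in> I)"

abbreviation ideal_of :: "'a::ring_1 set \<Rightarrow> 'a set"
  where "ideal_of S \<equiv> genideal ring_of_type_algebra S"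

lemma ring_of_type_ring: "ring (ring_of_type_algebra :: 'a::ring_1 ring)"
proof -
  have "\<exists>y. x + y = 0" for x :: 'a
    using add.right_inverse by blast
  then show ?thesis
    by unfold_locales (auto simp: ring_of_type_algebra_def algebra_simps Units_def)
qed

lemma two_sided_iff_ideal: "two_sided I \<longleftrightarrow> ideal I (ring_of_type_algebra :: 'a::ring_1 ring)"
proof
  assume I: "two_sided I"
  have neg: "- x \<in> I" if "x \<in> I" for x
    using I that unfolding two_sided_def by (metis mult_minus1)
  show "ideal I ring_of_type_algebra"
  proof (rule idealI)
    have *: "inv\<^bsub>add_monoid ring_of_type_algebra\<^esub> x = - x" for x :: 'a
    proof -
      interpret ring "ring_of_type_algebra :: 'a ring" by (rule ring_of_type_ring)
      have "\<ominus>\<^bsub>ring_of_type_algebra\<^esub> x = - x"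
        by (rule minus_equality) (auto simp: ring_of_type_algebra_def)
      then show ?thesis by (simp add: a_inv_def)
    qed
    note ** = *[unfolded ring_of_type_algebra_def, simplified]
    have "group (add_monoid (ring_of_type_algebra :: 'a ring))"
      by (intro abelian_group.a_group ring.is_abelian_group ring_of_type_ring)
    then show "subgroup I (add_monoid (ring_of_type_algebra :: 'a ring))"
      using I neg by (intro group.subgroupI) (auto simp: ring_of_type_algebra_def ** two_sided_def)
  qed (use I ring_of_type_ring in \<open>auto simp: two_sided_def ring_of_type_algebra_def\<close>)
next
  assume "ideal I (ring_of_type_algebra :: 'a ring)"
  then interpret ideal I "ring_of_type_algebra :: 'a ring" .
  show "two_sided I"
    unfolding two_sided_def using additive_subgroup.a_closed[OF is_additive_subgroup] I_l_closed I_r_closed additive_subgroup.zero_closed[OF is_additive_subgroup]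
    by (auto simp: ring_of_type_algebra_def)
qed

lemma two_sided_ideal_of: "two_sided (ideal_of S)"
  unfolding two_sided_iff_ideal
  by (rule ring.genideal_ideal[OF ring_of_type_ring]) (simp add: ring_of_type_algebra_def)

lemma ideal_of_base: "x \<in> S \<Longrightarrow> x \<in> ideal_of S"
  using ring.genideal_self[OF ring_of_type_ring, of S] by (auto simp: ring_of_type_algebra_def)

lemma ideal_of_minimal: "two_sided J \<Longrightarrow> S \<subseteq> J \<Longrightarrow> ideal_of S \<subseteq> J"
  using ring.genideal_minimal[OF ring_of_type_ring, of J S] by (simp add: two_sided_iff_ideal)

context
  fixes I :: "'a::ring_1 set"
  assumes I: "two_sided I"
begin

lemma two_sided_0: "0 \<in> I"
  using I by (simp add: two_sided_def)

lemma two_sided_add: "x \<in> I \<Longrightarrow> y \<in> I \<Longrightarrow> x + y \<in> I"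
  using I by (simp add: two_sided_def)

lemma two_sided_mult_left: "x \<in> I \<Longrightarrow> a * x \<in> I"
  using I by (simp add: two_sided_def)

lemma two_sided_mult_right: "x \<in> I \<Longrightarrow> x * a \<in> I"
  using I by (simp add: two_sided_def)

lemma two_sided_uminus: "x \<in> I \<Longrightarrow> - x \<in> I"
  using two_sided_mult_left[of x "-1"] by simp

lemma two_sided_diff: "x \<in> I \<Longrightarrow> y \<in> I \<Longrightarrow> x - y \<in> I"
  using two_sided_add[of x "- y"] two_sided_uminus[of y] by simp

lemma two_sided_sum: "(\<And>i. i \<in> A \<Longrightarrow> g i \<in> I) \<Longrightarrow> sum g A \<in> I"
  by (induction A rule: infinite_finite_induct) (auto simp: two_sided_0 two_sided_add)

lemma two_sided_diff_mem_iff: "x - y \<in> I \<Longrightarrow> x \<in> I \<longleftrightarrow> y \<in> I"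
  using two_sided_add[of "x - y" y] two_sided_diff[of x "x - y"] by auto

end

lemma subst_ideal_of:
  assumes "two_sided J" and "\<And>r. r \<in> S \<Longrightarrow> subst \<sigma> r \<in> J" and "x \<in> ideal_of S"
  shows "subst \<sigma> x \<in> J"
proof -
  have "two_sided {x. subst \<sigma> x \<in> J}"
    using assms(1) by (auto simp: two_sided_def subst_add subst_mult)
  from ideal_of_minimal[OF this, of S] assms(2,3) show ?thesis by auto
qed

lemma character_of_ideal_of:
  assumes "\<And>r. r \<in> S \<Longrightarrow> character_of \<phi> r = 0" and "x \<in> ideal_of S"
  shows "character_of \<phi> x = 0"
proof -
  have "two_sided {x. character_of \<phi> x = 0}"
    by (auto simp: two_sided_def character_of_add character_of_mult)
  from ideal_of_minimal[OF this, of S] assms show ?thesis by auto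
qed

text \<open>The kernel of a functional is not an ideal, but the elements whose translates by words
  on both sides all lie in the kernel form one.\<close>

lemma lin_ideal_of:
  assumes "\<And>v w r. r \<in> S \<Longrightarrow> lin f (mon v * r * mon w) = 0" and "x \<in> ideal_of S"
  shows "lin f x = 0"
proof -
  define J where "J = {x. \<forall>v w. lin f (mon v * x * mon w) = 0}"
  have left: "a * x \<in> J" if "x \<in> J" for a x
  proof (induction a rule: free_alg_induct)
    case (scal_mon c u)
    have "lin f (mon v * (scal c * mon u * x) * mon w) = c * lin f (mon (v @ u) * x * mon w)" for v w
      by (simp add: mon_append mult.assoc scal_left_commute lin_scal)
    then show ?case using that by (simp add: J_def)
  qed (auto simp: J_def distrib_left distrib_right lin_add)
  have right: "x * a \<in> J" if "x \<in> J" for a x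
  proof (induction a rule: free_alg_induct)
    case (scal_mon c u)
    have "lin f (mon v * (x * (scal c * mon u)) * mon w) = c * lin f (mon v * x * mon (u @ w))" for v w
      by (simp add: mon_append mult.assoc scal_left_commute lin_scal)
    then show ?case using that by (simp add: J_def)
  qed (auto simp: J_def distrib_left distrib_right lin_add)
  have "two_sided J"
    unfolding two_sided_def using left right
    by (auto simp: J_def distrib_left distrib_right lin_add)
  from ideal_of_minimal[OF this, of S] assms have "x \<in> J" by (auto simp: J_def)
  then have "lin f (mon [] * x * mon []) = 0" unfolding J_def by blast
  then show ?thesis by simp
qed

text \<open>Adjoin x to a basis of S and prescribe 1 at x and 0 on the basis. This is what allows
  exactness to be tested by functionals.\<close>

lemma separating_functional:
  fixes scale :: "'k::field \<Rightarrow> 'b::ab_group_add \<Rightarrow> 'b"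
  assumes "vector_space scale" and "module.subspace scale S" and "x \<notin> S"
  shows "\<exists>g. (\<forall>u v. g (u + v) = g u + g v) \<and> (\<forall>c v. g (scale c v) = c * g v) \<and> (\<forall>v\<in>S. g v = 0) \<and> g x \<noteq> (0::'k)"
proof -
  interpret V: vector_space scale by fact
  interpret VP: vector_space_pair scale "(*) :: 'k \<Rightarrow> 'k \<Rightarrow> 'k" ..
  obtain B where B: "B \<subseteq> S" "V.independent B" "S \<subseteq> V.span B"
    using V.maximal_independent_subset by blast
  have "V.span B = S"
    using B assms(2) V.span_minimal by blast
  then have ind: "V.independent (insert x B)"
    using B(2) assms(3) by (simp add: V.independent_insert)
  obtain g where g: "Vector_Spaces.linear scale (*) g"
    and gB: "\<And>b. b \<in> insert x B \<Longrightarrow> g b = (if b = x then 1 else 0)"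
    using VP.linear_independent_extend[OF ind, of "\<lambda>b. if b = x then 1 else 0"] by blast
  interpret g: Vector_Spaces.linear scale "(*)" g by fact
  have "x \<notin> B" using B assms(3) by blast
  then have "g v = 0" if "v \<in> S" for v
    using VP.linear_eq_0_on_span[OF g, of B v] gB that \<open>V.span B = S\<close> by force
  then show ?thesis using gB g.add g.scale by (intro exI[of _ g]) auto
qed

section \<open>From matrices over a ring to free resolutions over its quotient\<close>

section \<open>Free right modules and matrices over a quotient ring\<close>

text \<open>Coordinates are natural numbers because resolutions are required to live in
  \<open>nat \<Rightarrow> 'r\<close>; \<open>mult\<close> and \<open>one\<close> merely fill the
  record.\<close>

definition free_rmod :: "('r, 'x) ring_scheme \<Rightarrow> nat set \<Rightarrow> (nat \<Rightarrow> 'r, 'r) rmodule"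
  where "free_rmod R S =
    \<lparr>carrier = S \<rightarrow>\<^sub>E carrier R, mult = (\<lambda>f g. f), one = (\<lambda>i. undefined),
     zero = (\<lambda>i\<in>S. \<zero>\<^bsub>R\<^esub>), add = (\<lambda>f g. \<lambda>i\<in>S. f i \<oplus>\<^bsub>R\<^esub> g i),
     ract = (\<lambda>f a. \<lambda>i\<in>S. f i \<otimes>\<^bsub>R\<^esub> a)\<rparr>"

lemma free_rmod_simps:
  "carrier (free_rmod R S) = S \<rightarrow>\<^sub>E carrier R"
  "\<zero>\<^bsub>free_rmod R S\<^esub> = (\<lambda>i\<in>S. \<zero>\<^bsub>R\<^esub>)"
  "f \<oplus>\<^bsub>free_rmod R S\<^esub> g = (\<lambda>i\<in>S. f i \<oplus>\<^bsub>R\<^esub> g i)"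
  "ract (free_rmod R S) f a = (\<lambda>i\<in>S. f i \<otimes>\<^bsub>R\<^esub> a)"
  by (simp_all add: free_rmod_def)

context ring
begin

lemma abelian_group_free_rmod: "abelian_group (free_rmod R S)"
proof (rule abelian_groupI, unfold free_rmod_simps)
  fix f assume f: "f \<in> S \<rightarrow>\<^sub>E carrier R"
  have "(\<lambda>i\<in>S. \<ominus> f i) \<in> S \<rightarrow>\<^sub>E carrier R" using f by auto
  moreover have "(\<lambda>i\<in>S. (\<lambda>i\<in>S. \<ominus> f i) i \<oplus> f i) = (\<lambda>i\<in>S. \<zero>)"
    using f by (intro restrict_ext) (simp add: l_neg[OF PiE_mem[OF f]])
  ultimately show "\<exists>g\<in>S \<rightarrow>\<^sub>E carrier R. (\<lambda>i\<in>S. g i \<oplus> f i) = (\<lambda>i\<in>S. \<zero>)" by blast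
qed (auto simp: PiE_iff extensional_def fun_eq_iff a_ac)

lemma right_module_free_rmod: "right_module R (free_rmod R S)"
proof (rule right_module.intro[OF ring_axioms abelian_group_free_rmod], unfold_locales, unfold free_rmod_simps)
qed (auto simp: PiE_iff extensional_def fun_eq_iff l_distr r_distr m_assoc)

lemma finsum_free_rmod:
  assumes "finite B" and "g \<in> B \<rightarrow> (S \<rightarrow>\<^sub>E carrier R)"
  shows "finsum (free_rmod R S) g B = (\<lambda>i\<in>S. \<Oplus>b\<in>B. g b i)"
  using assms
proof (induction B rule: finite_induct)
  case empty
  interpret M: abelian_group "free_rmod R S" by (rule abelian_group_free_rmod)
  show ?case by (simp add: free_rmod_simps)
next
  case (insert b B)
  interpret M: abelian_group "free_rmod R S" by (rule abelian_group_free_rmod)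
  have g: "g \<in> B \<rightarrow> carrier (free_rmod R S)" "g b \<in> carrier (free_rmod R S)"
    using insert(4) by (auto simp: free_rmod_simps)
  have *: "(\<lambda>b. g b i) \<in> B \<rightarrow> carrier R" "g b i \<in> carrier R" if "i \<in> S" for i
    using insert(4) that by (auto simp: PiE_mem Pi_iff)
  show ?case
    using insert M.finsum_insert[OF insert(1,2) g] finsum_insert[OF insert(1,2) *]
    by (auto simp: free_rmod_simps intro!: restrict_ext)
qed

text \<open>The unit vectors form a basis. In a nontrivial ring they are pairwise distinct, so that
  coefficients may be indexed by the vectors themselves, as \<open>rmodule_basis\<close>
  demands.\<close>

lemma finite_free_rmodule_free_rmod:
  assumes "finite S" and "\<one> \<noteq> \<zero>"
  shows "finite_free_rmodule R (free_rmod R S)"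
proof -
  define b where "b = (\<lambda>s. \<lambda>i\<in>S. if i = s then \<one> else \<zero>)"
  define B where "B = b ` S"
  have b_carrier: "b s \<in> S \<rightarrow>\<^sub>E carrier R" for s
    by (auto simp: b_def)
  have inj: "inj_on b S"
  proof (rule inj_onI)
    fix s t assume "s \<in> S" "t \<in> S" "b s = b t"
    then have "b s s = b t s" by simp
    then show "s = t" using \<open>s \<in> S\<close> assms(2) by (auto simp: b_def split: if_splits)
  qed
  have finB: "finite B" using assms by (simp add: B_def)
  have eval: "(\<Oplus>\<^bsub>free_rmod R S\<^esub>v\<in>B. ract (free_rmod R S) v (c v)) = (\<lambda>i\<in>S. c (b i))"
    if c: "c \<in> B \<rightarrow>\<^sub>E carrier R" for c
  proof -
    have "(\<Oplus>\<^bsub>free_rmod R S\<^esub>v\<in>B. ract (free_rmod R S) v (c v)) =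
        (\<lambda>i\<in>S. \<Oplus>v\<in>B. ract (free_rmod R S) v (c v) i)"
      using c b_carrier
      by (intro finsum_free_rmod finB)
         (auto simp: free_rmod_simps B_def intro!: m_closed PiE_mem[OF b_carrier] PiE_mem[OF c[unfolded B_def]])
    also have "\<dots> = (\<lambda>i\<in>S. c (b i))"
    proof (rule restrict_ext)
      fix i assume i: "i \<in> S"
      have "(\<Oplus>v\<in>B. ract (free_rmod R S) v (c v) i) = (\<Oplus>v\<in>B. if b i = v then c v else \<zero>)"
      proof (rule finsum_cong')
        show "(\<lambda>v. if b i = v then c v else \<zero>) \<in> B \<rightarrow> carrier R" using c by auto
        fix v assume v: "v \<in> B"
        then obtain s where s: "s \<in> S" "v = b s" by (auto simp: B_def)
        have "b i = b s \<longleftrightarrow> i = s" using inj i s by (auto simp: inj_on_def)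
        moreover have "c (b s) \<in> carrier R" using c v s by auto
        ultimately show "ract (free_rmod R S) v (c v) i = (if b i = v then c v else \<zero>)"
          using i s by (simp add: free_rmod_simps) (auto simp: b_def)
      qed simp
      also have "\<dots> = c (b i)"
        using c i finB by (intro finsum_singleton) (auto simp: B_def)
      finally show "(\<Oplus>v\<in>B. ract (free_rmod R S) v (c v) i) = c (b i)" .
    qed
    finally show ?thesis .
  qed
  have "rmodule_basis R (free_rmod R S) B"
    unfolding rmodule_basis_def
  proof (intro conjI ballI)
    fix x assume x: "x \<in> carrier (free_rmod R S)"
    define c where "c = (\<lambda>v\<in>B. x (the_inv_into S b v))"
    have cb: "c (b i) = x i" if "i \<in> S" for i
      using that by (simp add: c_def B_def the_inv_into_f_f[OF inj])
    have c: "c \<in> B \<rightarrow>\<^sub>E carrier R"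
      using x cb by (auto simp: c_def free_rmod_simps B_def the_inv_into_f_f[OF inj])
    show "\<exists>!c. c \<in> B \<rightarrow>\<^sub>E carrier R \<and> x = (\<Oplus>\<^bsub>free_rmod R S\<^esub>v\<in>B. ract (free_rmod R S) v (c v))"
    proof (rule ex1I)
      show "c \<in> B \<rightarrow>\<^sub>E carrier R \<and> x = (\<Oplus>\<^bsub>free_rmod R S\<^esub>v\<in>B. ract (free_rmod R S) v (c v))"
        using c x unfolding eval[OF c] by (auto simp: cb free_rmod_simps PiE_iff extensional_def fun_eq_iff)
      fix d assume d: "d \<in> B \<rightarrow>\<^sub>E carrier R \<and> x = (\<Oplus>\<^bsub>free_rmod R S\<^esub>v\<in>B. ract (free_rmod R S) v (d v))"
      then have "x = (\<lambda>i\<in>S. d (b i))" by (simp add: eval)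
      then show "d = c" using d c cb by (intro PiE_ext[of d B _ c]) (auto simp: B_def)
    qed
  qed (use finB b_carrier in \<open>auto simp: B_def free_rmod_simps\<close>)
  then show ?thesis using right_module_free_rmod by (auto simp: finite_free_rmodule_def)
qed

end

text \<open>A surjection with kernel I onto a ring with carrier. It abstracts from cosets, so that
  one resolution theorem serves both the cosovereign algebra and the polynomial subalgebra of a
  C*-completion.\<close>

locale quotient_map = ring R
  for R :: "('r, 'x) ring_scheme" (structure) +
  fixes \<pi> :: "'a::ring_1 \<Rightarrow> 'r" and I :: "'a set"
  assumes map_carrier: "range \<pi> = carrier R"
    and map_add: "\<pi> (x + y) = \<pi> x \<oplus> \<pi> y"
    and map_mult: "\<pi> (x * y) = \<pi> x \<otimes> \<pi> y"
    and map_one: "\<pi> 1 = \<one>"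
    and map_zero_iff: "\<pi> x = \<zero> \<longleftrightarrow> x \<in> I"
begin

lemma map_closed [simp]: "\<pi> x \<in> carrier R"
  using map_carrier by auto

lemma map_zero: "\<pi> 0 = \<zero>"
  using map_add[of 0 0] by (simp add: add.l_cancel_one')

lemma map_eq_iff: "\<pi> x = \<pi> y \<longleftrightarrow> x - y \<in> I"
proof -
  have "\<pi> x = \<pi> (x - y) \<oplus> \<pi> y" by (simp flip: map_add)
  then show ?thesis
    by (metis map_closed map_zero_iff l_zero add.r_cancel zero_closed)
qed

lemma map_diff: "\<pi> (x - y) = \<pi> x \<ominus> \<pi> y"
proof -
  have "\<pi> x = \<pi> (x - y) \<oplus> \<pi> y" by (simp flip: map_add)
  then show ?thesis by (simp add: minus_eq a_assoc r_neg)
qed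

text \<open>A column over R given by representatives, its finite index type being coded into the
  natural numbers.\<close>

definition vec :: "('i::finite \<Rightarrow> 'a) \<Rightarrow> nat \<Rightarrow> 'r"
  where "vec c = (\<lambda>m\<in>range (to_nat :: 'i \<Rightarrow> nat). \<pi> (c (from_nat m)))"

abbreviation free_mod :: "'i::finite itself \<Rightarrow> (nat \<Rightarrow> 'r, 'r) rmodule"
  where "free_mod _ \<equiv> free_rmod R (range (to_nat :: 'i \<Rightarrow> nat))"

lemma vec_closed [simp]: "vec (c :: 'i::finite \<Rightarrow> 'a) \<in> carrier (free_mod TYPE('i::finite))"
  by (auto simp: vec_def free_rmod_simps)

lemma vec_surj:
  assumes "f \<in> carrier (free_mod TYPE('i::finite))"
  obtains c :: "'i::finite \<Rightarrow> 'a" where "f = vec c"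
proof -
  have "\<exists>a. \<pi> a = f (to_nat i)" for i :: 'i
  proof -
    have "f (to_nat i) \<in> range \<pi>"
      using assms map_carrier by (auto simp: free_rmod_simps)
    then show ?thesis by (metis rangeE)
  qed
  then obtain c where c: "\<And>i::'i. \<pi> (c i) = f (to_nat i)" by metis
  have "f = vec c"
  proof (rule PiE_ext)
    show "f \<in> range (to_nat :: 'i \<Rightarrow> nat) \<rightarrow>\<^sub>E carrier R" "vec c \<in> range (to_nat :: 'i \<Rightarrow> nat) \<rightarrow>\<^sub>E carrier R"
      using assms by (auto simp: free_rmod_simps vec_def)
  qed (auto simp: vec_def c)
  then show thesis by (rule that)
qed

lemma carrier_free_mod: "carrier (free_mod TYPE('i::finite)) = range (vec :: ('i \<Rightarrow> 'a) \<Rightarrow> _)"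
  using vec_surj vec_closed by (auto elim: vec_surj)

lemma vec_apply: "vec c (to_nat i) = \<pi> (c i)"
  by (simp add: vec_def)

lemma vec_eqI: "(\<And>i. \<pi> (c i) = \<pi> (d i)) \<Longrightarrow> vec c = vec d"
  by (simp add: vec_def)

lemma vec_eq_iff: "vec c = vec d \<longleftrightarrow> (\<forall>i. c i - d i \<in> I)"
  using vec_eqI[of c d] vec_apply[of c] vec_apply[of d] by (auto simp: map_eq_iff) (metis map_eq_iff)

lemma vec_zero: "\<zero>\<^bsub>free_mod TYPE('i::finite)\<^esub> = vec (\<lambda>i::'i. 0)"
  by (auto simp: vec_def free_rmod_simps map_zero)

lemma vec_add: "vec (c :: 'i::finite \<Rightarrow> 'a) \<oplus>\<^bsub>free_mod TYPE('i)\<^esub> vec d = vec (\<lambda>i. c i + d i)"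
  by (auto simp: vec_def free_rmod_simps map_add intro!: restrict_ext)

lemma vec_ract: "ract (free_mod TYPE('i)) (vec (c :: 'i::finite \<Rightarrow> 'a)) (\<pi> a) = vec (\<lambda>i. c i * a)"
  by (auto simp: vec_def free_rmod_simps map_mult intro!: restrict_ext)

lemma bex_range: "(\<exists>x\<in>range f. P x) \<longleftrightarrow> (\<exists>y. P (f y))"
  by blast

definition lift :: "'r \<Rightarrow> 'a" where "lift r = (SOME a. \<pi> a = r)"

lemma map_lift: "\<pi> (lift (\<pi> a)) = \<pi> a"
  unfolding lift_def by (rule someI) simp

text \<open>Left multiplication by a matrix over the covering ring, computed on chosen
  representatives; \<open>matmap_vec\<close> shows that the choice is harmless.\<close>

definition matmap :: "('i::finite \<Rightarrow> 'j::finite \<Rightarrow> 'a) \<Rightarrow> (nat \<Rightarrow> 'r) \<Rightarrow> nat \<Rightarrow> 'r"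
  where "matmap D f = vec (\<lambda>i. \<Sum>j\<in>UNIV. D i j * lift (f (to_nat j)))"

lemma map_sum_cong:
  assumes "\<And>j. j \<in> A \<Longrightarrow> \<pi> (f j) = \<pi> (g j)"
  shows "\<pi> (sum f A) = \<pi> (sum g A)"
  using assms by (induction A rule: infinite_finite_induct) (auto simp: map_add)

lemma matmap_vec: "matmap D (vec c) = vec (\<lambda>i. \<Sum>j\<in>UNIV. D i j * c j)"
  unfolding matmap_def by (intro vec_eqI map_sum_cong) (simp add: map_mult vec_apply map_lift)

lemma matmap_hom:
  "matmap (D :: 'i::finite \<Rightarrow> 'j::finite \<Rightarrow> 'a) \<in> rmodule_hom R (free_mod TYPE('j)) (free_mod TYPE('i))"
  unfolding rmodule_hom_def
proof (intro CollectI conjI ballI funcsetI)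
  fix x y assume "x \<in> carrier (free_mod TYPE('j))" "y \<in> carrier (free_mod TYPE('j))"
  then obtain c d :: "'j \<Rightarrow> 'a" where cd: "x = vec c" "y = vec d" by (auto simp: carrier_free_mod)
  show "matmap D (x \<oplus>\<^bsub>free_mod TYPE('j)\<^esub> y) = matmap D x \<oplus>\<^bsub>free_mod TYPE('i)\<^esub> matmap D y"
    by (simp add: cd vec_add matmap_vec distrib_left sum.distrib)
next
  fix x a assume "x \<in> carrier (free_mod TYPE('j))" "a \<in> carrier R"
  then obtain b and c :: "'j \<Rightarrow> 'a" where "x = vec c" "a = \<pi> b"
    by (auto simp: carrier_free_mod simp flip: map_carrier)
  then show "matmap D (ract (free_mod TYPE('j)) x a) = ract (free_mod TYPE('i)) (matmap D x) a"
    by (simp add: vec_ract matmap_vec sum_distrib_right mult.assoc)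
qed (simp add: matmap_def)

lemma exact_atI:
  assumes "\<And>c :: 'j::finite \<Rightarrow> 'a. vec c \<in> f ` carrier L \<longleftrightarrow> g (vec c) = \<zero>\<^bsub>N\<^esub>"
    and "f ` carrier L \<subseteq> carrier (free_mod TYPE('j))"
  shows "exact_at f g L (free_mod TYPE('j)) N"
  unfolding exact_at_def
proof (intro equalityI subsetI)
  fix y assume y: "y \<in> f ` carrier L"
  then have "y \<in> carrier (free_mod TYPE('j))" using assms(2) by auto
  moreover from this obtain c :: "'j \<Rightarrow> 'a" where "y = vec c" by (rule vec_surj)
  ultimately show "y \<in> {x \<in> carrier (free_mod TYPE('j)). g x = \<zero>\<^bsub>N\<^esub>}" using y assms(1)[of c] by simp
next
  fix y assume y: "y \<in> {x \<in> carrier (free_mod TYPE('j)). g x = \<zero>\<^bsub>N\<^esub>}"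
  then have "y \<in> carrier (free_mod TYPE('j))" by simp
  then obtain c :: "'j \<Rightarrow> 'a" where "y = vec c" by (rule vec_surj)
  then show "y \<in> f ` carrier L" using y assms(1)[of c] by simp
qed

lemma exact_at_matmap:
  fixes D :: "'i::finite \<Rightarrow> 'j::finite \<Rightarrow> 'a" and E :: "'j \<Rightarrow> 'k::finite \<Rightarrow> 'a"
  assumes "\<And>c. (\<forall>i. (\<Sum>j\<in>UNIV. D i j * c j) \<in> I) \<longleftrightarrow> (\<exists>e. \<forall>j. c j - (\<Sum>k\<in>UNIV. E j k * e k) \<in> I)"
  shows "exact_at (matmap E) (matmap D) (free_mod TYPE('k)) (free_mod TYPE('j)) (free_mod TYPE('i))"
proof -
  have "vec c \<in> matmap E ` carrier (free_mod TYPE('k)) \<longleftrightarrow>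
      matmap D (vec c) = \<zero>\<^bsub>free_mod TYPE('i)\<^esub>" for c :: "'j \<Rightarrow> 'a"
  proof -
    have "vec c \<in> matmap E ` carrier (free_mod TYPE('k)) \<longleftrightarrow> (\<exists>e :: 'k \<Rightarrow> 'a. vec c = matmap E (vec e))"
      unfolding carrier_free_mod image_iff by (rule bex_range)
    also have "\<dots> \<longleftrightarrow> (\<forall>i. (\<Sum>j\<in>UNIV. D i j * c j) \<in> I)"
      using assms[of c, symmetric] by (simp only: matmap_vec vec_eq_iff)
    also have "\<dots> \<longleftrightarrow> matmap D (vec c) = \<zero>\<^bsub>free_mod TYPE('i)\<^esub>"
      by (simp only: matmap_vec vec_zero vec_eq_iff diff_0_right)
    finally show ?thesis .
  qed
  moreover have "matmap E ` carrier (free_mod TYPE('k)) \<subseteq> carrier (free_mod TYPE('j))"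
    by (auto simp: matmap_def)
  ultimately show ?thesis
    by (rule exact_atI)
qed

text \<open>Images and kernels over R are translated into congruences modulo I through
  \<open>vec_eq_iff\<close>, which leaves only conditions on the covering ring.\<close>

theorem resolution_from_matrices:
  fixes D\<^sub>1 :: "unit \<Rightarrow> 'i::finite \<Rightarrow> 'a" and D\<^sub>2 :: "'i \<Rightarrow> 'j::finite \<Rightarrow> 'a" and D\<^sub>3 :: "'j \<Rightarrow> 'k::finite \<Rightarrow> 'a"
    and \<epsilon> :: "'r \<Rightarrow> complex" and e :: "'a \<Rightarrow> complex"
  assumes e: "\<And>x y. e (x + y) = e x + e y" "\<And>x y. e (x * y) = e x * e y" "e 1 = 1" "range e = UNIV"
    and \<epsilon>: "\<And>x. \<epsilon> (\<pi> x) = e x"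
    and exact0: "\<And>a. e a = 0 \<longleftrightarrow> (\<exists>c. a - (\<Sum>i\<in>UNIV. D\<^sub>1 () i * c i) \<in> I)"
    and exact1: "\<And>c. (\<Sum>i\<in>UNIV. D\<^sub>1 () i * c i) \<in> I \<longleftrightarrow>
      (\<exists>d. \<forall>i. c i - (\<Sum>j\<in>UNIV. D\<^sub>2 i j * d j) \<in> I)"
    and exact2: "\<And>c. (\<forall>i. (\<Sum>j\<in>UNIV. D\<^sub>2 i j * c j) \<in> I) \<longleftrightarrow>
      (\<exists>d. \<forall>j. c j - (\<Sum>k\<in>UNIV. D\<^sub>3 j k * d k) \<in> I)"
    and inj3: "\<And>c k. (\<And>j. (\<Sum>k\<in>UNIV. D\<^sub>3 j k * c k) \<in> I) \<Longrightarrow> c k \<in> I"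
  shows "has_finite_free_resolution_of_length_3 R (char_module \<epsilon>)"
proof -
  define d\<^sub>0 where "d\<^sub>0 = (\<lambda>f :: nat \<Rightarrow> 'r. \<epsilon> (f (to_nat ())))"
  have d0: "d\<^sub>0 (vec c) = e (c ())" for c
    by (simp add: d\<^sub>0_def vec_apply \<epsilon>)
  have e0: "e 0 = 0" using e(1)[of 0 0] by simp
  have nontrivial: "\<one> \<noteq> \<zero>"
    using \<epsilon>[of 1] \<epsilon>[of 0] e(3) e0 by (auto simp: map_one map_zero)
  have fin: "finite_free_rmodule R (free_mod TYPE('z::finite))"
    by (rule finite_free_rmodule_free_rmod[OF _ nontrivial]) simp
  have C: "abelian_group (char_module \<epsilon>)"
  proof (rule abelian_groupI)
    fix x assume "x \<in> carrier (char_module \<epsilon>)"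
    show "\<exists>y\<in>carrier (char_module \<epsilon>). y \<oplus>\<^bsub>char_module \<epsilon>\<^esub> x = \<zero>\<^bsub>char_module \<epsilon>\<^esub>"
      by (intro bexI[of _ "- x"]) (simp_all add: char_module_def)
  qed (simp_all add: char_module_def)
  have rep: "\<exists>b. a = \<pi> b" if "a \<in> carrier R" for a
    using that map_carrier by auto
  have mod: "right_module R (char_module \<epsilon>)"
  proof (rule right_module.intro[OF ring_axioms C], unfold_locales)
    fix x a b assume "a \<in> carrier R" "b \<in> carrier R"
    then obtain a' b' where "a = \<pi> a'" "b = \<pi> b'" using rep by blast
    then show "ract (char_module \<epsilon>) x (a \<oplus> b) = ract (char_module \<epsilon>) x a \<oplus>\<^bsub>char_module \<epsilon>\<^esub> ract (char_module \<epsilon>) x b"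
      "ract (char_module \<epsilon>) x (a \<otimes> b) = ract (char_module \<epsilon>) (ract (char_module \<epsilon>) x a) b"
      by (simp_all add: char_module_def \<epsilon> e distrib_left flip: map_add map_mult)
  next
    fix x show "ract (char_module \<epsilon>) x \<one> = x"
      by (simp add: char_module_def \<epsilon> e flip: map_one)
  qed (auto simp: char_module_def distrib_right)
  have hom0: "d\<^sub>0 \<in> rmodule_hom R (free_mod TYPE(unit)) (char_module \<epsilon>)"
    unfolding rmodule_hom_def
  proof (intro CollectI conjI ballI funcsetI)
    fix x y assume "x \<in> carrier (free_mod TYPE(unit))" "y \<in> carrier (free_mod TYPE(unit))"
    then obtain c d :: "unit \<Rightarrow> 'a" where "x = vec c" "y = vec d" by (auto simp: carrier_free_mod)
    then show "d\<^sub>0 (x \<oplus>\<^bsub>free_mod TYPE(unit)\<^esub> y) = d\<^sub>0 x \<oplus>\<^bsub>char_module \<epsilon>\<^esub> d\<^sub>0 y"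
      by (simp add: vec_add d0 e char_module_def)
  next
    fix x a assume "x \<in> carrier (free_mod TYPE(unit))" "a \<in> carrier R"
    then obtain b and c :: "unit \<Rightarrow> 'a" where "x = vec c" "a = \<pi> b" by (auto simp: carrier_free_mod simp flip: map_carrier)
    then show "d\<^sub>0 (ract (free_mod TYPE(unit)) x a) = ract (char_module \<epsilon>) (d\<^sub>0 x) a"
      by (simp add: vec_ract d0 e \<epsilon> char_module_def)
  qed (simp add: char_module_def)
  have inj: "inj_on (matmap D\<^sub>3) (carrier (free_mod TYPE('k)))"
  proof (rule inj_onI)
    fix x y assume "x \<in> carrier (free_mod TYPE('k))" "y \<in> carrier (free_mod TYPE('k))" and eq: "matmap D\<^sub>3 x = matmap D\<^sub>3 y"
    then obtain c d :: "'k \<Rightarrow> 'a" where cd: "x = vec c" "y = vec d" by (auto simp: carrier_free_mod)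
    have "(\<Sum>k\<in>UNIV. D\<^sub>3 j k * (c k - d k)) \<in> I" for j
      using eq by (simp add: cd matmap_vec vec_eq_iff right_diff_distrib sum_subtractf)
    then have "c k - d k \<in> I" for k using inj3[of "\<lambda>k. c k - d k" k] by simp
    then show "x = y" by (simp add: cd vec_eq_iff)
  qed
  have "vec c \<in> matmap D\<^sub>1 ` carrier (free_mod TYPE('i)) \<longleftrightarrow> d\<^sub>0 (vec c) = \<zero>\<^bsub>char_module \<epsilon>\<^esub>" for c :: "unit \<Rightarrow> 'a"
  proof -
    have all_unit: "(\<forall>i::unit. P i) \<longleftrightarrow> P ()" for P by (metis (full_types) old.unit.exhaust)
    have "vec c \<in> matmap D\<^sub>1 ` carrier (free_mod TYPE('i)) \<longleftrightarrow> (\<exists>e :: 'i \<Rightarrow> 'a. vec c = matmap D\<^sub>1 (vec e))"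
      unfolding carrier_free_mod image_iff by (rule bex_range)
    also have "\<dots> \<longleftrightarrow> e (c ()) = 0"
      using exact0[of "c ()"] by (simp only: matmap_vec vec_eq_iff all_unit)
    finally show ?thesis by (simp add: d0 char_module_def)
  qed
  moreover have "matmap D\<^sub>1 ` carrier (free_mod TYPE('i)) \<subseteq> carrier (free_mod TYPE(unit))"
    by (auto simp: matmap_def)
  ultimately have ex0: "exact_at (matmap D\<^sub>1) d\<^sub>0 (free_mod TYPE('i)) (free_mod TYPE(unit)) (char_module \<epsilon>)"
    by (rule exact_atI)
  have surj: "d\<^sub>0 ` carrier (free_mod TYPE(unit)) = carrier (char_module \<epsilon>)"
  proof -
    have "\<exists>c :: unit \<Rightarrow> 'a. z = d\<^sub>0 (vec c)" for z
    proof -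
      obtain a where "z = e a" using e(4) by (metis surjD)
      then show ?thesis by (intro exI[of _ "\<lambda>_. a"]) (simp add: d0)
    qed
    then have "range (\<lambda>c :: unit \<Rightarrow> 'a. d\<^sub>0 (vec c)) = UNIV" by (metis surj_def)
    then show ?thesis by (simp add: carrier_free_mod image_image char_module_def)
  qed
  have ex1: "exact_at (matmap D\<^sub>2) (matmap D\<^sub>1) (free_mod TYPE('j)) (free_mod TYPE('i)) (free_mod TYPE(unit))"
    using exact1 by (intro exact_at_matmap) auto
  have ex2: "exact_at (matmap D\<^sub>3) (matmap D\<^sub>2) (free_mod TYPE('k)) (free_mod TYPE('j)) (free_mod TYPE('i))"
    using exact2 by (rule exact_at_matmap)
  show ?thesis
    unfolding has_finite_free_resolution_of_length_3_def
    apply (rule conjI[OF mod])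
    apply (rule exI[of _ "free_mod TYPE(unit)"], rule exI[of _ "free_mod TYPE('i)"],
        rule exI[of _ "free_mod TYPE('j)"], rule exI[of _ "free_mod TYPE('k)"], rule exI[of _ d\<^sub>0],
        rule exI[of _ "matmap D\<^sub>1"], rule exI[of _ "matmap D\<^sub>2"], rule exI[of _ "matmap D\<^sub>3"])
    by (intro conjI fin matmap_hom hom0 inj ex0 ex1 ex2 surj)
qed

end

section \<open>A diamond lemma for functionals on words in the entries of u and v\<close>

section \<open>Rewriting systems with commuting rules\<close>

text \<open>The diamond lemma for functionals: a rule prescribes the value at a word in terms of the values
  at smaller words, and two rules for the same word only have to agree for functionals that obey all
  rules below that word.\<close>

lemma confluent_rules_solvable:
  fixes R :: "('w \<times> (('w \<Rightarrow> 'c) \<Rightarrow> 'c)) set"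
  assumes wf: "wf r"
    and loc: "\<And>w L f g. (w, L) \<in> R \<Longrightarrow> (\<And>v. (v, w) \<in> r \<Longrightarrow> f v = g v) \<Longrightarrow> L f = L g"
    and confl: "\<And>w L L' f. (w, L) \<in> R \<Longrightarrow> (w, L') \<in> R \<Longrightarrow>
      (\<And>v K. (v, w) \<in> r \<Longrightarrow> (v, K) \<in> R \<Longrightarrow> f v = K f) \<Longrightarrow> L f = L' f"
  shows "\<exists>f. \<forall>w L. (w, L) \<in> R \<longrightarrow> f w = L f"
proof -
  \<comment> \<open>One rule per word is selected arbitrarily; confluence then gives the other rules
    for that word.\<close>
  define H where "H f w = (if \<exists>L. (w, L) \<in> R then (SOME L. (w, L) \<in> R) f else undefined)" for f w
  define f where "f = wfrec r H"
  have f: "f w = H (cut f r w) w" for w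
    unfolding f_def by (rule wfrec[OF wf])
  have "f w = L f" if "(w, L) \<in> R" for w L
    using wf that
  proof (induction w arbitrary: L rule: wf_induct_rule)
    case (less w)
    define L0 where "L0 = (SOME L. (w, L) \<in> R)"
    have L0: "(w, L0) \<in> R" unfolding L0_def by (rule someI[of "\<lambda>L. (w, L) \<in> R", OF less.prems])
    have "f w = L0 (cut f r w)" using f[of w] less.prems by (auto simp: H_def L0_def)
    also have "\<dots> = L0 f" by (rule loc[OF L0]) (simp add: cut_apply)
    also have "\<dots> = L f" by (rule confl[OF L0 less.prems]) (rule less.IH)
    finally show ?case .
  qed
  then show ?thesis by blast
qed

type_synonym 'n letter = "bool \<times> (bool \<Rightarrow> 'n)"

text \<open>A letter \<open>(s, g)\<close> stands for the matrix entry in row \<open>g True\<close> and column \<open>g False\<close> of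
  \<open>u\<close> (if \<open>s\<close>) or \<open>v\<close> (otherwise), so that rows and columns can be treated alike.\<close>

definition setx :: "bool \<Rightarrow> 'n \<Rightarrow> 'n letter \<Rightarrow> 'n letter"
  where "setx \<kappa> k x = (fst x, (snd x)(\<kappa> := k))"

definition mk :: "bool \<Rightarrow> bool \<Rightarrow> 'n \<Rightarrow> 'n \<Rightarrow> 'n letter"
  where "mk s \<kappa> k i = (s, (\<lambda>_. i)(\<kappa> := k))"

definition del :: "nat \<Rightarrow> 'a list \<Rightarrow> 'a list"
  where "del i w = take i w @ drop (i + 2) w"

definition up :: "bool \<Rightarrow> nat \<Rightarrow> 'n \<Rightarrow> 'n \<Rightarrow> 'n letter list \<Rightarrow> 'n letter list"
  where "up \<kappa> i k l w = w[i := setx \<kappa> k (w ! i), Suc i := setx \<kappa> l (w ! Suc i)]"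

text \<open>All relations concern one entry of u next to one entry of v, in either order.\<close>

definition opp :: "nat \<Rightarrow> 'n letter list \<Rightarrow> bool"
  where "opp i w \<longleftrightarrow> Suc i < length w \<and> fst (w ! i) \<noteq> fst (w ! Suc i)"

lemma fst_setx [simp]: "fst (setx \<kappa> k x) = fst x"
  by (simp add: setx_def)

lemma snd_setx: "snd (setx \<kappa> k x) \<kappa>' = (if \<kappa>' = \<kappa> then k else snd x \<kappa>')"
  by (simp add: setx_def)

lemma setx_setx [simp]: "setx \<kappa> k (setx \<kappa> l x) = setx \<kappa> k x"
  by (simp add: setx_def)

lemma setx_id: "setx \<kappa> (snd x \<kappa>) x = x"
  by (simp add: setx_def)

lemma setx_commute: "\<kappa> \<noteq> \<kappa>' \<Longrightarrow> setx \<kappa> k (setx \<kappa>' l x) = setx \<kappa>' l (setx \<kappa> k x)"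
  by (simp add: setx_def fun_upd_twist)

lemma setx_eq_mk: "setx \<kappa> k x = mk (fst x) \<kappa> k (snd x (\<not> \<kappa>))"
  by (auto simp: setx_def mk_def fun_eq_iff)

lemma mk_swap: "mk s (\<not> \<kappa>) k i = mk s \<kappa> i k"
  by (auto simp: mk_def fun_eq_iff)

lemma mk_sel [simp]: "fst (mk s \<kappa> k i) = s" "snd (mk s \<kappa> k i) \<kappa> = k" "snd (mk s \<kappa> k i) (\<not> \<kappa>) = i"
  by (simp_all add: mk_def)

lemma setx_mk [simp]: "setx \<kappa> l (mk s \<kappa> k i) = mk s \<kappa> l i"
  by (simp add: setx_def mk_def)

lemma mk_surj: "x = mk (fst x) \<kappa> (snd x \<kappa>) (snd x (\<not> \<kappa>))"
  by (metis setx_eq_mk setx_id)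

lemma length_up [simp]: "length (up \<kappa> i k l w) = length w"
  by (simp add: up_def)

lemma nth_up: "Suc i < length w \<Longrightarrow> up \<kappa> i k l w ! j =
    (if j = i then setx \<kappa> k (w ! i) else if j = Suc i then setx \<kappa> l (w ! Suc i) else w ! j)"
  by (auto simp: up_def nth_list_update)

lemma fst_nth_up [simp]: "Suc i < length w \<Longrightarrow> fst (up \<kappa> i k l w ! j) = fst (w ! j)"
  by (auto simp: nth_up)

lemma opp_length: "opp i w \<Longrightarrow> Suc i < length w"
  by (simp add: opp_def)

lemma opp_up [simp]: "Suc i < length w \<Longrightarrow> opp j (up \<kappa> i k l w) = opp j w"
  by (simp add: opp_def)

lemma up_up [simp]: "Suc i < length w \<Longrightarrow> up \<kappa> i k l (up \<kappa> i k' l' w) = up \<kappa> i k l w"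
  by (rule nth_equalityI) (auto simp: nth_up)

lemma up_id: "Suc i < length w \<Longrightarrow> snd (w ! i) \<kappa> = k \<Longrightarrow> snd (w ! Suc i) \<kappa> = l \<Longrightarrow> up \<kappa> i k l w = w"
  by (rule nth_equalityI) (auto simp: nth_up setx_id)

text \<open>The two replacements touch disjoint index slots: different kinds of index, or disjoint
  pairs of letters.\<close>

definition apart :: "bool \<Rightarrow> nat \<Rightarrow> bool \<Rightarrow> nat \<Rightarrow> bool"
  where "apart \<kappa> i \<kappa>' i' \<longleftrightarrow> \<kappa> \<noteq> \<kappa>' \<or> Suc i < i' \<or> Suc i' < i"

lemma up_commute:
  assumes "apart \<kappa> i \<kappa>' i'" "Suc i < length w" "Suc i' < length w"
  shows "up \<kappa> i k l (up \<kappa>' i' k' l' w) = up \<kappa>' i' k' l' (up \<kappa> i k l w)"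
  by (rule nth_equalityI) (use assms in \<open>auto simp: nth_up apart_def setx_commute\<close>)

lemma snd_nth_up_apart:
  assumes "apart \<kappa> i \<kappa>' i'" "Suc i < length w"
  shows "snd (up \<kappa> i k l w ! i') \<kappa>' = snd (w ! i') \<kappa>'" "snd (up \<kappa> i k l w ! Suc i') \<kappa>' = snd (w ! Suc i') \<kappa>'"
  using assms by (auto simp: nth_up apart_def snd_setx)

lemma sum_swap_pairs:
  "(\<Sum>k\<in>A. \<Sum>l\<in>B. \<Sum>k'\<in>C. \<Sum>l'\<in>D. g k l k' l') = (\<Sum>k'\<in>C. \<Sum>l'\<in>D. \<Sum>k\<in>A. \<Sum>l\<in>B. g k l k' l')"
proof -
  have "(\<Sum>k\<in>A. \<Sum>l\<in>B. \<Sum>k'\<in>C. \<Sum>l'\<in>D. g k l k' l') = (\<Sum>k\<in>A. \<Sum>k'\<in>C. \<Sum>l\<in>B. \<Sum>l'\<in>D. g k l k' l')"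
    by (intro sum.cong refl sum.swap)
  also have "\<dots> = (\<Sum>k'\<in>C. \<Sum>k\<in>A. \<Sum>l\<in>B. \<Sum>l'\<in>D. g k l k' l')"
    by (rule sum.swap)
  also have "\<dots> = (\<Sum>k'\<in>C. \<Sum>k\<in>A. \<Sum>l'\<in>D. \<Sum>l\<in>B. g k l k' l')"
    by (intro sum.cong refl sum.swap)
  also have "\<dots> = (\<Sum>k'\<in>C. \<Sum>l'\<in>D. \<Sum>k\<in>A. \<Sum>l\<in>B. g k l k' l')"
    by (intro sum.cong refl sum.swap)
  finally show ?thesis .
qed

text \<open>The bilinear form \<Phi> \<kappa> s contracts the \<kappa>-indices (rows if \<kappa>,
  columns otherwise) of a letter of sign s followed by one of sign \<not> s.
  \<open>\<Phi>_inverse\<close> pairs row forms with inverse column forms. The index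
  \<open>tp\<close> marks the leading term: its row has a single nonzero entry, on the diagonal, and
  different \<open>tp\<close> for the two signs keep leading words of equal kind from
  overlapping.\<close>

locale forms =
  fixes \<Phi> :: "bool \<Rightarrow> bool \<Rightarrow> 'n::finite \<Rightarrow> 'n \<Rightarrow> complex"
    and tp :: "bool \<Rightarrow> bool \<Rightarrow> 'n"
  assumes \<Phi>_inverse: "(\<Sum>l\<in>UNIV. \<Phi> \<kappa> s k l * \<Phi> (\<not> \<kappa>) (\<not> s) l m) = (if k = m then 1 else 0)"
    and lead: "\<Phi> \<kappa> s (tp \<kappa> s) (tp \<kappa> s) \<noteq> 0"
    and lead_row: "l \<noteq> tp \<kappa> s \<Longrightarrow> \<Phi> \<kappa> s (tp \<kappa> s) l = 0"
    and tp_neq: "s \<noteq> t \<Longrightarrow> tp \<kappa> s \<noteq> tp \<kappa> t"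
begin

text \<open>The quadratic part of a relation at letters i and i+1, evaluated on f; the
  \<kappa>-indices that w has there do not matter.\<close>

definition contr :: "bool \<Rightarrow> nat \<Rightarrow> 'n letter list \<Rightarrow> ('n letter list \<Rightarrow> complex) \<Rightarrow> complex"
  where "contr \<kappa> i w f = (\<Sum>k\<in>UNIV. \<Sum>l\<in>UNIV. \<Phi> \<kappa> (fst (w ! i)) k l * f (up \<kappa> i k l w))"

definition top_at :: "bool \<Rightarrow> nat \<Rightarrow> 'n letter list \<Rightarrow> bool"
  where "top_at \<kappa> i w \<longleftrightarrow>
    snd (w ! i) \<kappa> = tp \<kappa> (fst (w ! i)) \<and> snd (w ! Suc i) \<kappa> = tp \<kappa> (fst (w ! i))"

text \<open>Leading indices further left count more, with powers of two: losing one at position i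
  outweighs gaining one at position i+1 (\<open>mu_up\<close>).\<close>

definition weight :: "bool \<Rightarrow> nat \<Rightarrow> 'n letter list \<Rightarrow> nat"
  where "weight \<kappa> j w = (if snd (w ! j) \<kappa> = tp \<kappa> (fst (w ! j)) then 2 ^ (length w - j) else 0)"

definition mu :: "'n letter list \<Rightarrow> nat"
  where "mu w = (\<Sum>\<kappa>\<in>UNIV. \<Sum>j<length w. weight \<kappa> j w)"

definition prec :: "('n letter list \<times> 'n letter list) set"
  where "prec = inv_image (less_than <*lex*> less_than) (\<lambda>w. (length w, mu w))"

lemma prec_iff: "(v, w) \<in> prec \<longleftrightarrow> length v < length w \<or> length v = length w \<and> mu v < mu w"
  by (auto simp: prec_def)

lemma mu_up:
  assumes i: "Suc i < length w" and top: "snd (w ! i) \<kappa> = tp \<kappa> (fst (w ! i))" and k: "k \<noteq> tp \<kappa> (fst (w ! i))"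
  shows "mu (up \<kappa> i k l w) < mu w"
proof -
  let ?w = "up \<kappa> i k l w" and ?A = "{..<length w} - {i, Suc i}"
  have split: "(\<Sum>j<length w. g j) = g i + g (Suc i) + (\<Sum>j\<in>?A. g j)" for g :: "nat \<Rightarrow> nat"
  proof -
    have "{..<length w} = insert i (insert (Suc i) ?A)" using i by auto
    then have "(\<Sum>j<length w. g j) = (\<Sum>j\<in>insert i (insert (Suc i) ?A). g j)" by simp
    then show ?thesis by simp
  qed
  have rest: "(\<Sum>j\<in>?A. weight \<kappa> j ?w) = (\<Sum>j\<in>?A. weight \<kappa> j w)"
    by (rule sum.cong) (auto simp: weight_def nth_up i)
  have "weight \<kappa> i ?w = 0" using i k by (simp add: weight_def nth_up snd_setx)
  moreover have "weight \<kappa> (Suc i) ?w \<le> 2 ^ (length w - Suc i)" by (simp add: weight_def)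
  moreover have "weight \<kappa> i w = 2 ^ (length w - i)" using top by (simp add: weight_def)
  moreover have "(2::nat) ^ (length w - Suc i) < 2 ^ (length w - i)"
    using i by (intro power_strict_increasing) auto
  ultimately have "(\<Sum>j<length w. weight \<kappa> j ?w) < (\<Sum>j<length w. weight \<kappa> j w)"
    unfolding split using rest by linarith
  moreover have "weight (\<not> \<kappa>) j ?w = weight (\<not> \<kappa>) j w" for j
    using i by (simp add: weight_def nth_up snd_setx)
  ultimately show ?thesis
    unfolding mu_def by (cases \<kappa>) (simp_all add: UNIV_bool)
qed

lemma contr_up: "Suc i < length w \<Longrightarrow> contr \<kappa> i (up \<kappa> i k l w) f = contr \<kappa> i w f"
  by (simp add: contr_def)

text \<open>Isolates the leading word. By \<open>lead_row\<close> all other terms have a non-leading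
  index at position i, hence are smaller by \<open>mu_up\<close>.\<close>

lemma contr_top:
  assumes "Suc i < length w" "top_at \<kappa> i w"
  shows "contr \<kappa> i w f = \<Phi> \<kappa> (fst (w ! i)) (tp \<kappa> (fst (w ! i))) (tp \<kappa> (fst (w ! i))) * f w
    + (\<Sum>k\<in>UNIV - {tp \<kappa> (fst (w ! i))}. \<Sum>l\<in>UNIV. \<Phi> \<kappa> (fst (w ! i)) k l * f (up \<kappa> i k l w))"
proof -
  let ?t = "tp \<kappa> (fst (w ! i))"
  have "(\<Sum>l\<in>UNIV. \<Phi> \<kappa> (fst (w ! i)) ?t l * f (up \<kappa> i ?t l w)) =
      (\<Sum>l\<in>UNIV. if l = ?t then \<Phi> \<kappa> (fst (w ! i)) ?t ?t * f (up \<kappa> i ?t ?t w) else 0)"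
    by (rule sum.cong) (auto simp: lead_row)
  also have "\<dots> = \<Phi> \<kappa> (fst (w ! i)) ?t ?t * f w"
    using assms by (simp add: top_at_def up_id)
  finally show ?thesis
    unfolding contr_def by (subst sum.remove[of UNIV ?t]) simp_all
qed

lemma contr_commute:
  assumes "apart \<kappa> i \<kappa>' i'" "Suc i < length w" "Suc i' < length w"
  shows "contr \<kappa> i w (\<lambda>v. contr \<kappa>' i' v f) = contr \<kappa>' i' w (\<lambda>v. contr \<kappa> i v f)"
proof -
  have apart': "apart \<kappa>' i' \<kappa> i" using assms(1) by (auto simp: apart_def)
  have "contr \<kappa> i w (\<lambda>v. contr \<kappa>' i' v f) =
      (\<Sum>k\<in>UNIV. \<Sum>l\<in>UNIV. \<Sum>k'\<in>UNIV. \<Sum>l'\<in>UNIV.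
        \<Phi> \<kappa> (fst (w ! i)) k l * (\<Phi> \<kappa>' (fst (w ! i')) k' l' * f (up \<kappa>' i' k' l' (up \<kappa> i k l w))))"
    using assms by (simp add: contr_def sum_distrib_left)
  also have "\<dots> = (\<Sum>k'\<in>UNIV. \<Sum>l'\<in>UNIV. \<Sum>k\<in>UNIV. \<Sum>l\<in>UNIV.
        \<Phi> \<kappa> (fst (w ! i)) k l * (\<Phi> \<kappa>' (fst (w ! i')) k' l' * f (up \<kappa>' i' k' l' (up \<kappa> i k l w))))"
    by (rule sum_swap_pairs)
  also have "\<dots> = contr \<kappa>' i' w (\<lambda>v. contr \<kappa> i v f)"
    using assms by (simp add: contr_def sum_distrib_left up_commute[OF assms] mult.left_commute)
  finally show ?thesis .
qed

lemma contr_cong: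
  assumes "\<And>k l. \<Phi> \<kappa> (fst (w ! i)) k l \<noteq> 0 \<Longrightarrow> f (up \<kappa> i k l w) = g (up \<kappa> i k l w)"
  shows "contr \<kappa> i w f = contr \<kappa> i w g"
  unfolding contr_def by (intro sum.cong refl) (use assms in force)

text \<open>An equation \<open>contr = \<rho>\<close> is solved for the value at the word with
  leading indices. Confluence reduces to \<open>cons\<close>: the second equation, contracted by the
  first, agrees with the first contracted by the second. The set E carries prescribed values
  \<theta> that already obey the rules.\<close>

lemma functional_extension:
  fixes \<rho> :: "bool \<Rightarrow> nat \<Rightarrow> 'n letter list \<Rightarrow> ('n letter list \<Rightarrow> complex) \<Rightarrow> complex"
  assumes loc: "\<And>\<kappa> i w f g. opp i w \<Longrightarrow> (\<And>v. length v < length w \<Longrightarrow> f v = g v) \<Longrightarrow> \<rho> \<kappa> i w f = \<rho> \<kappa> i w g"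
    and inv: "\<And>\<kappa> i w k l f. opp i w \<Longrightarrow> \<rho> \<kappa> i (up \<kappa> i k l w) f = \<rho> \<kappa> i w f"
    and cons: "\<And>\<kappa> i \<kappa>' i' w f. opp i w \<Longrightarrow> opp i' w \<Longrightarrow> apart \<kappa> i \<kappa>' i' \<Longrightarrow>
        (\<And>\<kappa> i v. length v < length w \<Longrightarrow> opp i v \<Longrightarrow> contr \<kappa> i v f = \<rho> \<kappa> i v f) \<Longrightarrow>
        contr \<kappa> i w (\<lambda>v. \<rho> \<kappa>' i' v f) = contr \<kappa>' i' w (\<lambda>v. \<rho> \<kappa> i v f)"
    and X_up: "\<And>w \<kappa> i k l. w \<in> E \<Longrightarrow> opp i w \<Longrightarrow> top_at \<kappa> i w \<Longrightarrow> up \<kappa> i k l w \<in> E"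
    and X_contr: "\<And>w \<kappa> i f. w \<in> E \<Longrightarrow> opp i w \<Longrightarrow> top_at \<kappa> i w \<Longrightarrow>
        (\<And>v. v \<in> E \<Longrightarrow> length v < length w \<Longrightarrow> f v = \<theta> v) \<Longrightarrow> contr \<kappa> i w \<theta> = \<rho> \<kappa> i w f"
  shows "\<exists>f. (\<forall>\<kappa> i w. opp i w \<longrightarrow> contr \<kappa> i w f = \<rho> \<kappa> i w f) \<and> (\<forall>w\<in>E. f w = \<theta> w)"
proof -
  define t where "t \<kappa> i w = tp \<kappa> (fst (w ! i))" for \<kappa> i and w :: "'n letter list"
  define c where "c \<kappa> i w = \<Phi> \<kappa> (fst (w ! i)) (t \<kappa> i w) (t \<kappa> i w)" for \<kappa> i w
  \<comment> \<open>The equation solved for its leading word; the remaining terms are words below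
    w.\<close>
  define L where "L \<kappa> i w f = (\<rho> \<kappa> i w f -
      (\<Sum>k\<in>UNIV - {t \<kappa> i w}. \<Sum>l\<in>UNIV. \<Phi> \<kappa> (fst (w ! i)) k l * f (up \<kappa> i k l w))) / c \<kappa> i w" for \<kappa> i w f
  define R where "R = {(w, L \<kappa> i w) | w \<kappa> i. opp i w \<and> top_at \<kappa> i w} \<union> {(w, \<lambda>f. \<theta> w) | w. w \<in> E}"
  have c0: "c \<kappa> i w \<noteq> 0" for \<kappa> i w by (simp add: c_def t_def lead)
  have L_iff: "f w = L \<kappa> i w f \<longleftrightarrow> contr \<kappa> i w f = \<rho> \<kappa> i w f" if "opp i w" "top_at \<kappa> i w" for \<kappa> i w f
    using contr_top[OF opp_length[OF that(1)] that(2), of f] c0[of \<kappa> i w]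
    by (auto simp: L_def c_def t_def field_simps)
  have smaller: "(up \<kappa> i k l w, w) \<in> prec" if "opp i w" "top_at \<kappa> i w" "k \<noteq> t \<kappa> i w" for \<kappa> i k l w
    using that mu_up[of i w \<kappa> k l] by (auto simp: prec_iff opp_def top_at_def t_def)
  have L_loc: "L \<kappa> i w f = L \<kappa> i w g"
    if "opp i w" "top_at \<kappa> i w" "\<And>v. (v, w) \<in> prec \<Longrightarrow> f v = g v" for \<kappa> i w f g
  proof -
    have "\<rho> \<kappa> i w f = \<rho> \<kappa> i w g" using that by (intro loc) (auto simp: prec_iff)
    moreover have "f (up \<kappa> i k l w) = g (up \<kappa> i k l w)" if "k \<in> UNIV - {t \<kappa> i w}" for k l
      using that smaller[of i w \<kappa> k l] \<open>opp i w\<close> \<open>top_at \<kappa> i w\<close> \<open>\<And>v. (v, w) \<in> prec \<Longrightarrow> f v = g v\<close> by auto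
    ultimately show ?thesis unfolding L_def by simp
  qed
  \<comment> \<open>The equation does not depend on the \<kappa>-indices of the pair, so it suffices
    to have it at the word with leading indices.\<close>
  have solved: "contr \<kappa> i v f = \<rho> \<kappa> i v f"
    if "opp i v" "\<And>K. (up \<kappa> i (t \<kappa> i v) (t \<kappa> i v) v, K) \<in> R \<Longrightarrow> f (up \<kappa> i (t \<kappa> i v) (t \<kappa> i v) v) = K f" for \<kappa> i v f
  proof -
    let ?v = "up \<kappa> i (t \<kappa> i v) (t \<kappa> i v) v"
    have l: "Suc i < length v" using that(1) by (rule opp_length)
    have "opp i ?v" "top_at \<kappa> i ?v" using that(1) l by (simp_all add: top_at_def t_def nth_up snd_setx)
    moreover from this have "f ?v = L \<kappa> i ?v f" by (intro that(2)) (auto simp: R_def)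
    ultimately have "contr \<kappa> i ?v f = \<rho> \<kappa> i ?v f" by (simp add: L_iff)
    then show ?thesis using l that(1) by (simp add: contr_up inv)
  qed
  have confl: "L \<kappa> i w f = L \<kappa>' i' w f"
    if w: "opp i w" "top_at \<kappa> i w" "opp i' w" "top_at \<kappa>' i' w"
      and f: "\<And>v K. (v, w) \<in> prec \<Longrightarrow> (v, K) \<in> R \<Longrightarrow> f v = K f" for \<kappa> i \<kappa>' i' w f
  proof (cases "apart \<kappa> i \<kappa>' i'")
    case False
    then have "\<kappa> = \<kappa>'" "i = i' \<or> i' = Suc i \<or> i = Suc i'" by (auto simp: apart_def)
    \<comment> \<open>The middle letter would need the leading \<kappa>-indices of both signs, which
      \<open>tp_neq\<close> excludes.\<close>
    moreover have False if "top_at \<kappa> j w" "top_at \<kappa> (Suc j) w" "opp j w" for j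
      using that tp_neq[of "fst (w ! j)" "fst (w ! Suc j)" \<kappa>] by (simp add: top_at_def opp_def)
    ultimately have "i = i'" using w by auto
    then show ?thesis using \<open>\<kappa> = \<kappa>'\<close> by simp
  next
    case True
    have len: "Suc i < length w" "Suc i' < length w" using w by (auto simp: opp_def)
    \<comment> \<open>The value at w is adjusted so that the first equation holds there; the aim is
      that the second then holds as well.\<close>
    define g where "g = f(w := L \<kappa> i w f)"
    have g_eq: "g v = f v" if "(v, w) \<in> prec" for v
      using that by (auto simp: g_def prec_iff)
    have g: "g v = K g" if "(v, w) \<in> prec" "(v, K) \<in> R" for v K
    proof -
      have "K f = K g"
        using that(2) unfolding R_def
      proof (elim UnE CollectE exE conjE)
        fix v' \<kappa> i assume "(v, K) = (v', L \<kappa> i v')" "opp i v'" "top_at \<kappa> i v'"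
        moreover have "g z = f z" if "(z, v) \<in> prec" for z
          using that \<open>(v, w) \<in> prec\<close> by (intro g_eq) (auto simp: prec_iff)
        ultimately show ?thesis by (auto intro!: L_loc)
      qed simp
      then show ?thesis using f[OF that] g_eq[OF that(1)] by simp
    qed
    have gw: "contr \<kappa> i w g = \<rho> \<kappa> i w g"
      using L_iff[OF w(1,2), of g] L_loc[OF w(1,2), of g f] g_eq by (simp add: g_def)
    have below: "contr \<kappa>'' i'' v g = \<rho> \<kappa>'' i'' v g"
      if "opp i'' v" "(up \<kappa>'' i'' (t \<kappa>'' i'' v) (t \<kappa>'' i'' v) v, w) \<in> prec" for \<kappa>'' i'' v
      using that g by (intro solved) auto
    have shorter: "contr \<kappa> i v g = \<rho> \<kappa> i v g" if "length v < length w" "opp i v" for \<kappa> i v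
      using that by (intro below) (auto simp: prec_iff)
    have step: "contr \<kappa>2 i2 (up \<kappa>1 i1 k l w) g = \<rho> \<kappa>2 i2 (up \<kappa>1 i1 k l w) g"
      if "apart \<kappa>1 i1 \<kappa>2 i2" "opp i1 w" "top_at \<kappa>1 i1 w" "opp i2 w" "top_at \<kappa>2 i2 w" "k \<noteq> t \<kappa>1 i1 w"
      for \<kappa>1 i1 \<kappa>2 i2 k l
    proof (rule below)
      let ?v = "up \<kappa>1 i1 k l w"
      have l: "Suc i1 < length w" "Suc i2 < length w" using that by (auto simp: opp_def)
      show "opp i2 ?v" using that l by simp
      have "up \<kappa>2 i2 (t \<kappa>2 i2 ?v) (t \<kappa>2 i2 ?v) ?v = ?v"
        using that l snd_nth_up_apart[OF that(1) l(1), of k l]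
        by (intro up_id) (auto simp: top_at_def t_def)
      then show "(up \<kappa>2 i2 (t \<kappa>2 i2 ?v) (t \<kappa>2 i2 ?v) ?v, w) \<in> prec"
        using smaller[OF that(2,3,6)] by simp
    qed
    have apart': "apart \<kappa>' i' \<kappa> i" using True by (auto simp: apart_def)
    \<comment> \<open>The only term of the outer contraction that is not below w is w itself, where
      the first equation holds by construction.\<close>
    have "contr \<kappa>' i' w (\<lambda>v. contr \<kappa> i v g) = contr \<kappa>' i' w (\<lambda>v. \<rho> \<kappa> i v g)"
    proof (rule contr_cong)
      fix k l assume nz: "\<Phi> \<kappa>' (fst (w ! i')) k l \<noteq> 0"
      show "contr \<kappa> i (up \<kappa>' i' k l w) g = \<rho> \<kappa> i (up \<kappa>' i' k l w) g"
      proof (cases "k = t \<kappa>' i' w")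
        case True
        then have "l = k" using nz lead_row by (auto simp: t_def)
        then have "up \<kappa>' i' k l w = w" using True w(4) len by (intro up_id) (auto simp: t_def top_at_def)
        then show ?thesis using gw by simp
      qed (use step[OF apart' w(3,4,1,2)] in simp)
    qed
    also have "\<dots> = contr \<kappa> i w (\<lambda>v. \<rho> \<kappa>' i' v g)"
      using cons[OF w(1,3) True, of g] shorter by simp
    finally have "contr \<kappa> i w (\<lambda>v. contr \<kappa>' i' v g) = contr \<kappa> i w (\<lambda>v. \<rho> \<kappa>' i' v g)"
      by (simp add: contr_commute[OF True len])
    \<comment> \<open>In the two equal double contractions all terms except the one at w agree, so
      dividing by the leading coefficient gives the second equation at w.\<close>
    moreover have "(\<Sum>k\<in>UNIV - {tp \<kappa> (fst (w ! i))}. \<Sum>l\<in>UNIV. \<Phi> \<kappa> (fst (w ! i)) k l * contr \<kappa>' i' (up \<kappa> i k l w) g) =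
        (\<Sum>k\<in>UNIV - {tp \<kappa> (fst (w ! i))}. \<Sum>l\<in>UNIV. \<Phi> \<kappa> (fst (w ! i)) k l * \<rho> \<kappa>' i' (up \<kappa> i k l w) g)"
      using step[OF True w] by (intro sum.cong refl) (simp add: t_def)
    ultimately have "contr \<kappa>' i' w g = \<rho> \<kappa>' i' w g"
      using lead by (simp add: contr_top[OF len(1) w(2)])
    then have "g w = L \<kappa>' i' w g" using L_iff[OF w(3,4)] by simp
    also have "\<dots> = L \<kappa>' i' w f" using L_loc[OF w(3,4), of g f] g_eq by simp
    finally show ?thesis by (simp add: g_def)
  qed
  have conflX: "L \<kappa> i w f = \<theta> w"
    if w: "opp i w" "top_at \<kappa> i w" "w \<in> E"
      and f: "\<And>v K. (v, w) \<in> prec \<Longrightarrow> (v, K) \<in> R \<Longrightarrow> f v = K f" for \<kappa> i w f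
  proof -
    have fX: "f v = \<theta> v" if "v \<in> E" "(v, w) \<in> prec" for v
      using f[OF that(2), of "\<lambda>f. \<theta> v"] that(1) by (auto simp: R_def)
    have "contr \<kappa> i w \<theta> = \<rho> \<kappa> i w f"
      using w fX by (intro X_contr) (auto simp: prec_iff)
    \<comment> \<open>The right-hand side sees only shorter words and the contraction only words of
      the length of w, so f below and \<theta> from there on may be spliced.\<close>
    also have "\<dots> = \<rho> \<kappa> i w (\<lambda>v. if length v < length w then f v else \<theta> v)"
      using w by (intro loc) auto
    finally have *: "contr \<kappa> i w (\<lambda>v. if length v < length w then f v else \<theta> v) =
        \<rho> \<kappa> i w (\<lambda>v. if length v < length w then f v else \<theta> v)"
      by (simp add: contr_def)
    have "L \<kappa> i w f = L \<kappa> i w (\<lambda>v. if length v < length w then f v else \<theta> v)"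
    proof -
      have "\<rho> \<kappa> i w f = \<rho> \<kappa> i w (\<lambda>v. if length v < length w then f v else \<theta> v)"
        using w by (intro loc) auto
      moreover have "f (up \<kappa> i k l w) = \<theta> (up \<kappa> i k l w)" if "k \<in> UNIV - {t \<kappa> i w}" for k l
        using that smaller[OF w(1,2)] X_up[OF w(3,1,2)] by (intro fX) auto
      ultimately show ?thesis unfolding L_def by simp
    qed
    also have "\<dots> = \<theta> w" using * by (simp flip: L_iff[OF w(1,2)])
    finally show ?thesis .
  qed
  have "\<exists>f. \<forall>w K. (w, K) \<in> R \<longrightarrow> f w = K f"
  proof (rule confluent_rules_solvable[of prec])
    show "wf prec" unfolding prec_def by (intro wf_inv_image wf_lex_prod wf_less_than)
    show "K f = K g" if "(w, K) \<in> R" "\<And>v. (v, w) \<in> prec \<Longrightarrow> f v = g v" for w K f g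
      using that by (auto simp: R_def intro!: L_loc)
    show "K f = K' f" if R1: "(w, K) \<in> R" and R2: "(w, K') \<in> R"
        and R3: "\<And>v K. (v, w) \<in> prec \<Longrightarrow> (v, K) \<in> R \<Longrightarrow> f v = K f" for w K K' f
    proof -
      have cases: "(\<exists>\<kappa> i. K = L \<kappa> i w \<and> opp i w \<and> top_at \<kappa> i w) \<or> (K = (\<lambda>f. \<theta> w) \<and> w \<in> E)"
        if "(w, K) \<in> R" for K
        using that unfolding R_def by blast
      have LL: "L \<kappa> i w f = L \<kappa>' i' w f"
        if "opp i w" "top_at \<kappa> i w" "opp i' w" "top_at \<kappa>' i' w" for \<kappa> i \<kappa>' i'
        by (rule confl[OF that]) (rule R3)
      have LE: "L \<kappa> i w f = \<theta> w" if "opp i w" "top_at \<kappa> i w" "w \<in> E" for \<kappa> i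
        by (rule conflX[OF that]) (rule R3)
      from cases[OF R1] show ?thesis
      proof (elim disjE exE conjE)
        fix \<kappa> i assume K: "K = L \<kappa> i w" "opp i w" "top_at \<kappa> i w"
        from cases[OF R2] show ?thesis
          by (elim disjE exE conjE) (simp_all add: K LL[of i \<kappa>] LE)
      next
        assume K: "K = (\<lambda>f. \<theta> w)" "w \<in> E"
        from cases[OF R2] show ?thesis
          by (elim disjE exE conjE) (simp_all add: K LE)
      qed
    qed
  qed
  then obtain f where f: "\<And>w K. (w, K) \<in> R \<Longrightarrow> f w = K f" by blast
  have "contr \<kappa> i w f = \<rho> \<kappa> i w f" if "opp i w" for \<kappa> i w
    using that f by (intro solved) auto
  moreover have "f w = \<theta> w" if "w \<in> E" for w
    using f[of w "\<lambda>f. \<theta> w"] that by (auto simp: R_def)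
  ultimately show ?thesis by blast
qed

end

section \<open>Functionals on words with a marked first letter\<close>

lemma length_del: "Suc i < length w \<Longrightarrow> length (del i w) = length w - 2"
  by (simp add: del_def)

lemma nth_del: "Suc i < length w \<Longrightarrow> j < length w - 2 \<Longrightarrow> del i w ! j = (if j < i then w ! j else w ! (j + 2))"
  by (auto simp: del_def nth_append min_def)

lemma del_up_same: "Suc i < length w \<Longrightarrow> del i (up \<kappa> i k l w) = del i w"
  by (rule nth_equalityI) (auto simp: length_del nth_del nth_up)

lemma del_up_right: "i + 2 \<le> i' \<Longrightarrow> Suc i' < length w \<Longrightarrow> del i' (up \<kappa> i k l w) = up \<kappa> i k l (del i' w)"
  by (rule nth_equalityI) (auto simp: length_del nth_del nth_up)

lemma del_up_left: "i + 2 \<le> i' \<Longrightarrow> Suc i' < length w \<Longrightarrow> del i (up \<kappa> i' k l w) = up \<kappa> (i' - 2) k l (del i w)"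
  by (rule nth_equalityI) (auto simp: length_del nth_del nth_up Suc_diff_le)

lemma del_del: "i + 2 \<le> i' \<Longrightarrow> Suc i' < length w \<Longrightarrow> del i (del i' w) = del (i' - 2) (del i w)"
  by (rule nth_equalityI) (auto simp: length_del nth_del)

lemma del_up_Suc: "Suc (Suc i) < length w \<Longrightarrow> del (Suc i) (up \<kappa> i k l w) = (del (Suc i) w)[i := setx \<kappa> k (w ! i)]"
  by (rule nth_equalityI) (auto simp: length_del nth_del nth_up nth_list_update)

lemma del_up_pred: "Suc (Suc i) < length w \<Longrightarrow> del i (up \<kappa> (Suc i) k l w) = (del i w)[i := setx \<kappa> l (w ! Suc (Suc i))]"
  by (rule nth_equalityI) (auto simp: length_del nth_del nth_up nth_list_update)

lemma del_Suc_update: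
  "Suc (Suc i) < length w \<Longrightarrow> (del (Suc i) w)[i := x] = (del i w)[i := x]"
  by (rule nth_equalityI) (auto simp: length_del nth_del nth_list_update)

text \<open>In an overlap x y z, contracting x y or y z along different indices leaves the same
  letter: the \<kappa>-index of z together with the other index of x.\<close>

lemma setx_exchange: "fst x = fst z \<Longrightarrow> setx \<kappa> (snd z \<kappa>) x = setx (\<not> \<kappa>) (snd x (\<not> \<kappa>)) z"
  unfolding setx_eq_mk by (simp add: mk_swap)

lemma up_0 [simp]: "up \<kappa> 0 k l (x # y # q) = setx \<kappa> k x # setx \<kappa> l y # q"
  by (simp add: up_def)

lemma up_Suc [simp]: "up \<kappa> (Suc i) k l (x # q) = x # up \<kappa> i k l q"
  by (simp add: up_def)

lemma del_Suc [simp]: "del (Suc i) (x # q) = x # del i q"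
  by (simp add: del_def)

lemma opp_Suc [simp]: "opp (Suc i) (x # q) \<longleftrightarrow> opp i q"
  by (simp add: opp_def)

lemma opp_0: "opp 0 w \<Longrightarrow> \<exists>x y q. w = x # y # q \<and> fst y = (\<not> fst x)"
  by (cases w; cases "tl w") (auto simp: opp_def)

context forms
begin

text \<open>The functionals that vanish on the ideal of relations
  (\<open>natural_iff_lin\<close>).\<close>

definition natural :: "('n letter list \<Rightarrow> complex) \<Rightarrow> bool"
  where "natural f \<longleftrightarrow> (\<forall>\<kappa> i w. opp i w \<longrightarrow>
    contr \<kappa> i w f = \<Phi> \<kappa> (fst (w ! i)) (snd (w ! i) (\<not> \<kappa>)) (snd (w ! Suc i) (\<not> \<kappa>)) * f (del i w))"

lemma contr_append:
  "contr \<kappa> (length v) (v @ mk s \<kappa> a i # mk t \<kappa> b j # w) f =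
    (\<Sum>k\<in>UNIV. \<Sum>l\<in>UNIV. \<Phi> \<kappa> s k l * f (v @ mk s \<kappa> k i # mk t \<kappa> l j # w))"
  by (simp add: contr_def up_def nth_append list_update_append)

lemma natural_iff:
  "natural f \<longleftrightarrow> (\<forall>\<kappa> s i j v w.
    (\<Sum>k\<in>UNIV. \<Sum>l\<in>UNIV. \<Phi> \<kappa> s k l * f (v @ mk s \<kappa> k i # mk (\<not> s) \<kappa> l j # w)) = \<Phi> \<kappa> s i j * f (v @ w))"
proof safe
  fix \<kappa> s v w and i j :: 'n assume f: "natural f"
  let ?W = "v @ mk s \<kappa> i i # mk (\<not> s) \<kappa> j j # w"
  have "opp (length v) ?W" by (simp add: opp_def nth_append)
  from f[unfolded natural_def, rule_format, OF this, of \<kappa>]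
  have "contr \<kappa> (length v) ?W f = \<Phi> \<kappa> s i j * f (v @ w)"
    by (simp add: nth_append del_def)
  then show "(\<Sum>k\<in>UNIV. \<Sum>l\<in>UNIV. \<Phi> \<kappa> s k l * f (v @ mk s \<kappa> k i # mk (\<not> s) \<kappa> l j # w)) = \<Phi> \<kappa> s i j * f (v @ w)"
    by (simp only: contr_append)
next
  assume *: "\<forall>\<kappa> s i j v w.
    (\<Sum>k\<in>UNIV. \<Sum>l\<in>UNIV. \<Phi> \<kappa> s k l * f (v @ mk s \<kappa> k i # mk (\<not> s) \<kappa> l j # w)) = \<Phi> \<kappa> s i j * f (v @ w)"
  show "natural f"
    unfolding natural_def
  proof safe
    fix \<kappa> i and W :: "'n letter list" assume opp: "opp i W"
    define v where "v = take i W"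
    define w where "w = drop (i + 2) W"
    let ?x = "W ! i" and ?y = "W ! Suc i"
    have len: "Suc i < length W" using opp by (rule opp_length)
    have lv: "length v = i" using len by (simp add: v_def)
    have "W = v @ ?x # ?y # w"
      unfolding v_def w_def using len by (metis Cons_nth_drop_Suc Suc_lessD add_2_eq_Suc' id_take_nth_drop)
    moreover have "?x = mk (fst ?x) \<kappa> (snd ?x \<kappa>) (snd ?x (\<not> \<kappa>))" by (rule mk_surj)
    moreover have "?y = mk (\<not> fst ?x) \<kappa> (snd ?y \<kappa>) (snd ?y (\<not> \<kappa>))"
      using opp mk_surj[of ?y \<kappa>] by (simp add: opp_def)
    ultimately have W: "W = v @ mk (fst ?x) \<kappa> (snd ?x \<kappa>) (snd ?x (\<not> \<kappa>)) #
        mk (\<not> fst ?x) \<kappa> (snd ?y \<kappa>) (snd ?y (\<not> \<kappa>)) # w" by metis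
    have "contr \<kappa> (length v) W f = \<Phi> \<kappa> (fst ?x) (snd ?x (\<not> \<kappa>)) (snd ?y (\<not> \<kappa>)) * f (v @ w)"
      by (subst W, subst contr_append) (rule *[rule_format])
    then show "contr \<kappa> i W f = \<Phi> \<kappa> (fst ?x) (snd ?x (\<not> \<kappa>)) (snd ?y (\<not> \<kappa>)) * f (del i W)"
      unfolding lv by (simp only: del_def v_def[symmetric] w_def[symmetric])
  qed
qed

lemma natural_Cons: "natural f \<Longrightarrow> natural (\<lambda>q. f (x # q))"
proof -
  assume "natural f"
  note f = this[unfolded natural_iff, rule_format]
  show ?thesis unfolding natural_iff using f[where v = "x # v" for v] by simp
qed

lemma natural_scale: "natural f \<Longrightarrow> natural (\<lambda>q. c * f q)"
proof -
  assume "natural f"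
  note f = this[unfolded natural_iff, rule_format]
  have "(\<Sum>k\<in>UNIV. \<Sum>l\<in>UNIV. \<Phi> \<kappa> s k l * (c * g k l)) = c * (\<Sum>k\<in>UNIV. \<Sum>l\<in>UNIV. \<Phi> \<kappa> s k l * g k l)" for \<kappa> s g
    by (simp add: sum_distrib_left mult.left_commute)
  then show ?thesis unfolding natural_iff by (simp add: f mult.left_commute)
qed

lemma natural_sum: "(\<And>i. i \<in> A \<Longrightarrow> natural (f i)) \<Longrightarrow> natural (\<lambda>q. \<Sum>i\<in>A. f i q)"
proof -
  assume f: "\<And>i. i \<in> A \<Longrightarrow> natural (f i)"
  have swap: "(\<Sum>k\<in>UNIV. \<Sum>l\<in>UNIV. c k l * (\<Sum>i\<in>A. g i k l)) = (\<Sum>i\<in>A. \<Sum>k\<in>UNIV. \<Sum>l\<in>UNIV. c k l * g i k l)"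
    for c :: "'n \<Rightarrow> 'n \<Rightarrow> complex" and g
    by (simp add: sum_distrib_left sum.swap[of _ A])
  show ?thesis unfolding natural_iff swap
    using f[unfolded natural_iff] by (simp add: sum_distrib_left)
qed

text \<open>A word x # q stands for the free generator belonging to x, multiplied by q. For i > 0
  the equation says that each \<phi>(x # _) is natural; for i = 0 it says that \<phi> takes the
  value \<psi> on the Fox derivative of the relator (\<open>tot_relator_mon\<close>).\<close>

definition rho :: "(bool \<Rightarrow> bool \<Rightarrow> 'n \<Rightarrow> 'n \<Rightarrow> 'n letter list \<Rightarrow> complex) \<Rightarrow>
    bool \<Rightarrow> nat \<Rightarrow> 'n letter list \<Rightarrow> ('n letter list \<Rightarrow> complex) \<Rightarrow> complex"
  where "rho \<psi> \<kappa> i w f =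
    (if i = 0 then \<psi> \<kappa> (fst (w ! 0)) (snd (w ! 0) (\<not> \<kappa>)) (snd (w ! Suc 0) (\<not> \<kappa>)) (drop 2 w)
       - (\<Sum>l\<in>UNIV. \<Phi> \<kappa> (fst (w ! 0)) (snd (w ! 0) (\<not> \<kappa>)) l * f (setx \<kappa> l (w ! Suc 0) # drop 2 w))
     else \<Phi> \<kappa> (fst (w ! i)) (snd (w ! i) (\<not> \<kappa>)) (snd (w ! Suc i) (\<not> \<kappa>)) * f (del i w))"

lemma collapse_left: "(\<Sum>k\<in>UNIV. \<Sum>l\<in>UNIV. \<Phi> \<kappa> s k l * (\<Phi> (\<not> \<kappa>) (\<not> s) l m * h k)) = h m"
proof -
  have "(\<Sum>k\<in>UNIV. \<Sum>l\<in>UNIV. \<Phi> \<kappa> s k l * (\<Phi> (\<not> \<kappa>) (\<not> s) l m * h k)) =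
      (\<Sum>k\<in>UNIV. (\<Sum>l\<in>UNIV. \<Phi> \<kappa> s k l * \<Phi> (\<not> \<kappa>) (\<not> s) l m) * h k)"
    by (simp add: sum_distrib_right mult.assoc)
  also have "\<dots> = h m" unfolding \<Phi>_inverse by (simp add: if_distrib[of "\<lambda>c. c * _"] cong: if_cong)
  finally show ?thesis .
qed

lemma collapse_right: "(\<Sum>k\<in>UNIV. \<Sum>l\<in>UNIV. \<Phi> (\<not> \<kappa>) (\<not> s) k l * (\<Phi> \<kappa> s a k * h l)) = h a"
proof -
  have "(\<Sum>k\<in>UNIV. \<Sum>l\<in>UNIV. \<Phi> (\<not> \<kappa>) (\<not> s) k l * (\<Phi> \<kappa> s a k * h l)) =
      (\<Sum>l\<in>UNIV. \<Sum>k\<in>UNIV. \<Phi> \<kappa> s a k * \<Phi> (\<not> \<kappa>) (\<not> s) k l * h l)"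
    by (subst sum.swap) (simp add: mult_ac)
  also have "\<dots> = (\<Sum>l\<in>UNIV. (\<Sum>k\<in>UNIV. \<Phi> \<kappa> s a k * \<Phi> (\<not> \<kappa>) (\<not> s) k l) * h l)"
    by (simp only: sum_distrib_right)
  also have "\<dots> = h a" unfolding \<Phi>_inverse by (simp add: if_distrib[of "\<lambda>c. c * _"] cong: if_cong)
  finally show ?thesis .
qed

lemma contr_mult: "contr \<kappa> i w (\<lambda>v. c * f v) = c * contr \<kappa> i w f"
  by (simp add: contr_def sum_distrib_left mult.left_commute)

lemma contr_diff: "contr \<kappa> i w (\<lambda>v. f v - g v) = contr \<kappa> i w f - contr \<kappa> i w g"
  by (simp add: contr_def right_diff_distrib sum_subtractf)

lemma contr_sum: "contr \<kappa> i w (\<lambda>v. \<Sum>j\<in>A. f j v) = (\<Sum>j\<in>A. contr \<kappa> i w (f j))"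
  by (simp add: contr_def sum_distrib_left sum.swap[of _ A])

lemma contr_Suc: "contr \<kappa> (Suc i) (x # q) f = contr \<kappa> i q (\<lambda>q. f (x # q))"
  by (simp add: contr_def)

text \<open>Necessary compatibilities of the values \<psi> on relators: \<open>\<psi>_shift\<close>
  is dual to the cubic identity \<open>relator_syzygy_cubic\<close>, \<open>\<psi>_sym\<close> to
  \<open>relator_syzygy_quadratic\<close>.\<close>

context
  fixes \<psi> :: "bool \<Rightarrow> bool \<Rightarrow> 'n \<Rightarrow> 'n \<Rightarrow> 'n letter list \<Rightarrow> complex"
  assumes \<psi>_natural: "natural (\<psi> \<kappa> s a b)"
    and \<psi>_shift: "(\<Sum>k\<in>UNIV. \<Sum>l\<in>UNIV. \<Phi> (\<not> \<kappa>) (\<not> s) k l * \<psi> \<kappa> s a k (mk s \<kappa> c l # q)) =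
      (\<Sum>l\<in>UNIV. \<Phi> \<kappa> s a l * \<psi> (\<not> \<kappa>) (\<not> s) l c q)"
    and \<psi>_sym: "(\<Sum>k\<in>UNIV. \<Sum>l\<in>UNIV. \<Phi> (\<not> \<kappa>) s k l * \<psi> \<kappa> s k l q) =
      (\<Sum>k\<in>UNIV. \<Sum>l\<in>UNIV. \<Phi> \<kappa> s k l * \<psi> (\<not> \<kappa>) s k l q)"
begin

text \<open>Row and column equation for the same pair. Away from the marked letter both double
  contractions are multiples of the same value; at the marked letter the terms in f cancel and
  \<open>\<psi>_sym\<close> remains.\<close>

lemma rho_consistent_same:
  assumes "opp i w"
  shows "contr \<kappa> i w (\<lambda>v. rho \<psi> (\<not> \<kappa>) i v f) = contr (\<not> \<kappa>) i w (\<lambda>v. rho \<psi> \<kappa> i v f)"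
proof (cases "i = 0")
  case False
  then show ?thesis using opp_length[OF assms]
    by (simp add: contr_def rho_def nth_up snd_setx del_up_same mult_ac)
next
  case True
  with assms obtain x y q where w: "w = x # y # q" "fst y = (\<not> fst x)" by (metis opp_0)
  let ?s = "fst x"
  have expand: "contr \<kappa> 0 w (\<lambda>v. rho \<psi> (\<not> \<kappa>) 0 v f) =
      (\<Sum>k\<in>UNIV. \<Sum>l\<in>UNIV. \<Phi> \<kappa> ?s k l * \<psi> (\<not> \<kappa>) ?s k l q)
      - (\<Sum>k\<in>UNIV. \<Sum>l\<in>UNIV. \<Sum>l'\<in>UNIV. \<Phi> \<kappa> ?s k l * (\<Phi> (\<not> \<kappa>) ?s k l' * f (setx (\<not> \<kappa>) l' (setx \<kappa> l y) # q)))" for \<kappa>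
    by (simp add: contr_def rho_def w snd_setx right_diff_distrib sum_subtractf sum_distrib_left)
  have "(\<Sum>k\<in>UNIV. \<Sum>l\<in>UNIV. \<Sum>l'\<in>UNIV. \<Phi> \<kappa> ?s k l * (\<Phi> (\<not> \<kappa>) ?s k l' * f (setx (\<not> \<kappa>) l' (setx \<kappa> l y) # q))) =
     (\<Sum>k\<in>UNIV. \<Sum>l'\<in>UNIV. \<Sum>l\<in>UNIV. \<Phi> (\<not> \<kappa>) ?s k l' * (\<Phi> \<kappa> ?s k l * f (setx \<kappa> l (setx (\<not> \<kappa>) l' y) # q)))"
    by (rule sum.cong[OF refl], subst sum.swap, intro sum.cong refl) (simp add: setx_commute[of "\<not> \<kappa>" \<kappa>] mult_ac)
  then show ?thesis
    using expand[of \<kappa>] expand[of "\<not> \<kappa>"] \<psi>_sym[of "\<kappa>" ?s q] True by simp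
qed

text \<open>Row and column equation for overlapping pairs x y and y z. Mutually inverse forms
  collapse, and both sides leave one letter by \<open>setx_exchange\<close>; if x is the marked
  letter, \<open>\<psi>_shift\<close> accounts for the extra terms.\<close>

lemma rho_consistent_adjacent:
  assumes "opp i w" "opp (Suc i) w"
    and IH: "\<And>\<kappa> i v. length v < length w \<Longrightarrow> opp i v \<Longrightarrow> contr \<kappa> i v f = rho \<psi> \<kappa> i v f"
  shows "contr \<kappa> i w (\<lambda>v. rho \<psi> (\<not> \<kappa>) (Suc i) v f) = contr (\<not> \<kappa>) (Suc i) w (\<lambda>v. rho \<psi> \<kappa> i v f)"
proof -
  have len: "Suc (Suc i) < length w" using assms(2) by (rule opp_length)
  let ?x = "w ! i" and ?y = "w ! Suc i" and ?z = "w ! Suc (Suc i)"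
  let ?s = "fst ?x"
  have sg: "fst ?y = (\<not> ?s)" "fst ?z = ?s" using assms by (auto simp: opp_def)
  have "contr \<kappa> i w (\<lambda>v. rho \<psi> (\<not> \<kappa>) (Suc i) v f) =
      (\<Sum>k\<in>UNIV. \<Sum>l\<in>UNIV. \<Phi> \<kappa> ?s k l * (\<Phi> (\<not> \<kappa>) (\<not> ?s) l (snd ?z \<kappa>) * f ((del (Suc i) w)[i := setx \<kappa> k ?x])))"
    using len by (simp add: contr_def rho_def nth_up snd_setx sg del_up_Suc)
  also have "\<dots> = f ((del (Suc i) w)[i := setx \<kappa> (snd ?z \<kappa>) ?x])"
    by (rule collapse_left)
  also have "\<dots> = f ((del i w)[i := setx (\<not> \<kappa>) (snd ?x (\<not> \<kappa>)) ?z])"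
    using len setx_exchange[of ?x ?z \<kappa>] sg by (simp only: del_Suc_update)
  finally have lhs: "contr \<kappa> i w (\<lambda>v. rho \<psi> (\<not> \<kappa>) (Suc i) v f) =
    f ((del i w)[i := setx (\<not> \<kappa>) (snd ?x (\<not> \<kappa>)) ?z])" .
  show ?thesis
  proof (cases "i = 0")
    case False
    then have "contr (\<not> \<kappa>) (Suc i) w (\<lambda>v. rho \<psi> \<kappa> i v f) =
       (\<Sum>k\<in>UNIV. \<Sum>l\<in>UNIV. \<Phi> (\<not> \<kappa>) (\<not> ?s) k l * (\<Phi> \<kappa> ?s (snd ?x (\<not> \<kappa>)) k * f ((del i w)[i := setx (\<not> \<kappa>) l ?z])))"
      using len by (simp add: contr_def rho_def nth_up snd_setx sg del_up_pred)
    also have "\<dots> = f ((del i w)[i := setx (\<not> \<kappa>) (snd ?x (\<not> \<kappa>)) ?z])"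
      by (rule collapse_right)
    finally show ?thesis using lhs by simp
  next
    case True
    obtain x y z q where w: "w = x # y # z # q"
      using len True by (cases w; cases "tl w"; cases "tl (tl w)") auto
    let ?a = "snd x (\<not> \<kappa>)"
    have sg': "fst y = (\<not> fst x)" "fst z = fst x" using sg True w by auto
    have z: "setx (\<not> \<kappa>) l z = mk (fst x) \<kappa> (snd z \<kappa>) l" for l
      by (simp add: setx_eq_mk mk_swap sg')
    \<comment> \<open>The equation for the marked pair y z of the word without x, which is shorter
      than w.\<close>
    have inner: "(\<Sum>k\<in>UNIV. \<Sum>l\<in>UNIV. \<Phi> (\<not> \<kappa>) (\<not> fst x) k l * f (setx \<kappa> l' (setx (\<not> \<kappa>) k y) # setx (\<not> \<kappa>) l z # q)) =
        \<psi> (\<not> \<kappa>) (\<not> fst x) l' (snd z \<kappa>) q - (\<Sum>m\<in>UNIV. \<Phi> (\<not> \<kappa>) (\<not> fst x) l' m * f (setx (\<not> \<kappa>) m z # q))" for l'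
      using IH[of "setx \<kappa> l' y # z # q" 0 "\<not> \<kappa>"] sg' w
      by (simp add: contr_def rho_def opp_def snd_setx setx_commute[of "\<not> \<kappa>" \<kappa>])
    have "contr (\<not> \<kappa>) (Suc 0) w (\<lambda>v. rho \<psi> \<kappa> 0 v f) =
       (\<Sum>k\<in>UNIV. \<Sum>l\<in>UNIV. \<Phi> (\<not> \<kappa>) (\<not> fst x) k l * \<psi> \<kappa> (fst x) ?a k (mk (fst x) \<kappa> (snd z \<kappa>) l # q))
       - (\<Sum>k\<in>UNIV. \<Sum>l\<in>UNIV. \<Sum>l'\<in>UNIV. \<Phi> \<kappa> (fst x) ?a l' *
          (\<Phi> (\<not> \<kappa>) (\<not> fst x) k l * f (setx \<kappa> l' (setx (\<not> \<kappa>) k y) # setx (\<not> \<kappa>) l z # q)))"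
      by (simp add: contr_def rho_def w snd_setx right_diff_distrib sum_subtractf sum_distrib_left sg' mult.left_commute flip: z)
    also have "(\<Sum>k\<in>UNIV. \<Sum>l\<in>UNIV. \<Sum>l'\<in>UNIV. \<Phi> \<kappa> (fst x) ?a l' *
          (\<Phi> (\<not> \<kappa>) (\<not> fst x) k l * f (setx \<kappa> l' (setx (\<not> \<kappa>) k y) # setx (\<not> \<kappa>) l z # q))) =
       (\<Sum>l'\<in>UNIV. \<Phi> \<kappa> (fst x) ?a l' *
          (\<Sum>k\<in>UNIV. \<Sum>l\<in>UNIV. \<Phi> (\<not> \<kappa>) (\<not> fst x) k l * f (setx \<kappa> l' (setx (\<not> \<kappa>) k y) # setx (\<not> \<kappa>) l z # q)))"
      unfolding sum_distrib_left by (subst (2) sum.swap, subst sum.swap) (rule refl)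
    also have "\<dots> = (\<Sum>l'\<in>UNIV. \<Phi> \<kappa> (fst x) ?a l' * \<psi> (\<not> \<kappa>) (\<not> fst x) l' (snd z \<kappa>) q)
        - (\<Sum>l'\<in>UNIV. \<Sum>m\<in>UNIV. \<Phi> (\<not> \<kappa>) (\<not> fst x) l' m * (\<Phi> \<kappa> (fst x) ?a l' * f (setx (\<not> \<kappa>) m z # q)))"
      unfolding inner by (simp add: right_diff_distrib sum_subtractf sum_distrib_left mult.left_commute)
    also have "(\<Sum>l'\<in>UNIV. \<Sum>m\<in>UNIV. \<Phi> (\<not> \<kappa>) (\<not> fst x) l' m * (\<Phi> \<kappa> (fst x) ?a l' * f (setx (\<not> \<kappa>) m z # q))) =
        f (setx (\<not> \<kappa>) ?a z # q)"
      by (rule collapse_right)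
    finally show ?thesis using lhs True by (simp add: \<psi>_shift w del_def)
  qed
qed

text \<open>Disjoint pairs: apply the equations already known for the shorter words. If the first
  pair contains the marked letter, naturality of \<psi> is used.\<close>

lemma rho_consistent_far:
  assumes "opp i w" "opp i' w" "i + 2 \<le> i'"
    and IH: "\<And>\<kappa> i v. length v < length w \<Longrightarrow> opp i v \<Longrightarrow> contr \<kappa> i v f = rho \<psi> \<kappa> i v f"
  shows "contr \<kappa> i w (\<lambda>v. rho \<psi> \<kappa>' i' v f) = contr \<kappa>' i' w (\<lambda>v. rho \<psi> \<kappa> i v f)"
proof -
  have len: "Suc i' < length w" "Suc i < length w" using assms by (auto simp: opp_def)
  let ?c = "\<Phi> \<kappa> (fst (w ! i)) (snd (w ! i) (\<not> \<kappa>)) (snd (w ! Suc i) (\<not> \<kappa>))"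
    and ?c' = "\<Phi> \<kappa>' (fst (w ! i')) (snd (w ! i') (\<not> \<kappa>')) (snd (w ! Suc i') (\<not> \<kappa>'))"
  have nth': "del i' w ! i = w ! i" "del i' w ! Suc i = w ! Suc i"
    using len assms(3) by (auto simp: nth_del)
  obtain d where d: "i' = i + 2 + d" using assms(3) le_Suc_ex by blast
  then have nth: "del i w ! (i' - 2) = w ! i'" "del i w ! Suc (i' - 2) = w ! Suc i'"
    using len by (simp_all add: nth_del)
  have opp': "opp i (del i' w)" "opp (i' - 2) (del i w)"
    using assms len by (auto simp: opp_def nth' nth length_del)
  have "contr \<kappa> i w (\<lambda>v. rho \<psi> \<kappa>' i' v f) = ?c' * contr \<kappa> i (del i' w) f"
    using len assms(3)
    by (simp add: contr_def rho_def nth_up del_up_right nth' sum_distrib_left mult.left_commute)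
  also have "\<dots> = ?c' * rho \<psi> \<kappa> i (del i' w) f"
    using len opp' by (subst IH) (auto simp: length_del)
  finally have lhs: "contr \<kappa> i w (\<lambda>v. rho \<psi> \<kappa>' i' v f) = ?c' * rho \<psi> \<kappa> i (del i' w) f" .
  show ?thesis
  proof (cases "i = 0")
    case False
    have "contr \<kappa>' i' w (\<lambda>v. rho \<psi> \<kappa> i v f) = ?c * contr \<kappa>' (i' - 2) (del i w) f"
      using len assms(3) False
      by (simp add: contr_def rho_def nth_up del_up_left nth sum_distrib_left mult.left_commute)
    also have "\<dots> = ?c * rho \<psi> \<kappa>' (i' - 2) (del i w) f"
      using len opp' by (subst IH) (auto simp: length_del)
    finally show ?thesis using lhs False assms(3) len
      by (simp add: rho_def nth nth' del_del mult.left_commute)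
  next
    case True
    obtain x y q where w: "w = x # y # q" using assms(1) True by (metis opp_0)
    obtain j where j: "i' = Suc (Suc j)" using d True by simp
    have oppj: "opp j q" using assms(2) by (simp add: w j)
    have \<psi>: "contr \<kappa>' j q (\<psi> \<kappa> s a b) = ?c' * \<psi> \<kappa> s a b (del j q)" for s a b
      using \<psi>_natural[of \<kappa> s a b] oppj by (simp add: natural_def w j)
    have f: "contr \<kappa>' j q (\<lambda>q. f (x' # q)) = ?c' * f (x' # del j q)" for x'
      using IH[of "x' # q" "Suc j" \<kappa>'] oppj by (simp add: w j contr_Suc rho_def)
    have "contr \<kappa>' i' w (\<lambda>v. rho \<psi> \<kappa> i v f) =
        contr \<kappa>' j q (\<lambda>q. \<psi> \<kappa> (fst x) (snd x (\<not> \<kappa>)) (snd y (\<not> \<kappa>)) q -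
          (\<Sum>l\<in>UNIV. \<Phi> \<kappa> (fst x) (snd x (\<not> \<kappa>)) l * f (setx \<kappa> l y # q)))"
      by (simp add: w j contr_Suc rho_def True)
    also have "\<dots> = ?c' * rho \<psi> \<kappa> i (del i' w) f"
      by (simp add: contr_diff contr_sum contr_mult \<psi> f) (simp add: w j rho_def True sum_distrib_left right_diff_distrib mult.left_commute)
    finally show ?thesis using lhs by simp
  qed
qed

text \<open>The three consistency lemmas cover all pairs of rules. Values on words that begin with
  \<open>x0\<close> may be prescribed, since \<open>x0\<close> has no leading index and so no rule
  rewrites the first letter of such a word.\<close>

lemma marked_extension:
  assumes \<theta>: "natural \<theta>" and x0: "\<And>\<kappa>. snd x0 \<kappa> \<noteq> tp \<kappa> (fst x0)"
  shows "\<exists>\<phi>. (\<forall>\<kappa> i w. opp i w \<longrightarrow> contr \<kappa> i w \<phi> = rho \<psi> \<kappa> i w \<phi>) \<and> (pre \<longrightarrow> (\<forall>q. \<phi> (x0 # q) = \<theta> q))"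
proof -
  \<comment> \<open>The flag \<open>pre\<close> makes E empty when nothing is to be
    prescribed.\<close>
  define E where "E = {w. pre \<and> w \<noteq> [] \<and> hd w = x0}"
  have "\<exists>f. (\<forall>\<kappa> i w. opp i w \<longrightarrow> contr \<kappa> i w f = rho \<psi> \<kappa> i w f) \<and> (\<forall>w\<in>E. f w = \<theta> (tl w))"
  proof (rule functional_extension)
    show "rho \<psi> \<kappa> i w f = rho \<psi> \<kappa> i w g"
      if "opp i w" "\<And>v. length v < length w \<Longrightarrow> f v = g v" for \<kappa> i w f g
      using opp_length[OF that(1)] that(2) by (simp add: rho_def length_del)
    show "rho \<psi> \<kappa> i (up \<kappa> i k l w) f = rho \<psi> \<kappa> i w f" if "opp i w" for \<kappa> i w k l f
      using opp_length[OF that]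
    proof (cases "i = 0")
      case True
      with that obtain x y q where "w = x # y # q" by (metis opp_0)
      then show ?thesis using True by (simp add: rho_def snd_setx)
    qed (simp add: rho_def nth_up snd_setx del_up_same)
  next
    fix \<kappa> i \<kappa>' i' f and w :: "'n letter list"
    assume opp: "opp i w" "opp i' w" and ap: "apart \<kappa> i \<kappa>' i'"
      and IH: "\<And>\<kappa> i v. length v < length w \<Longrightarrow> opp i v \<Longrightarrow> contr \<kappa> i v f = rho \<psi> \<kappa> i v f"
    have le: "contr \<kappa> i w (\<lambda>v. rho \<psi> \<kappa>' i' v f) = contr \<kappa>' i' w (\<lambda>v. rho \<psi> \<kappa> i v f)"
      if le: "opp i w" "opp i' w" "apart \<kappa> i \<kappa>' i'" "i \<le> i'" for \<kappa> i \<kappa>' i'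
    proof -
      consider "i' = i" | "i' = Suc i" | "i + 2 \<le> i'" using le(4) by linarith
      then show ?thesis
      proof cases
        case 1
        then have "\<kappa>' = (\<not> \<kappa>)" using le(3) by (auto simp: apart_def)
        then show ?thesis using rho_consistent_same[OF le(1)] 1 by simp
      next
        case 2
        then have "\<kappa>' = (\<not> \<kappa>)" using le(3) by (auto simp: apart_def)
        then show ?thesis using rho_consistent_adjacent[of i w f \<kappa>] le IH 2 by simp
      next
        case 3
        then show ?thesis using rho_consistent_far[of i w i' f] 3 le IH by simp
      qed
    qed
    show "contr \<kappa> i w (\<lambda>v. rho \<psi> \<kappa>' i' v f) = contr \<kappa>' i' w (\<lambda>v. rho \<psi> \<kappa> i v f)"
    proof (cases "i \<le> i'")
      case True
      then show ?thesis by (rule le[OF opp ap])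
    next
      case False
      have "apart \<kappa>' i' \<kappa> i" using ap by (auto simp: apart_def)
      from le[OF opp(2,1) this] False show ?thesis by simp
    qed
  next
    have notop: "\<exists>j q. i = Suc j \<and> w = x0 # q" if "w \<in> E" "top_at \<kappa> i w" for w \<kappa> i
      using that x0[of \<kappa>] by (cases i; cases w) (auto simp: E_def top_at_def)
    show "up \<kappa> i k l w \<in> E" if "w \<in> E" "opp i w" "top_at \<kappa> i w" for w \<kappa> i k l
      using notop[OF that(1,3)] that(1) by (auto simp: E_def)
    show "contr \<kappa> i w (\<lambda>w. \<theta> (tl w)) = rho \<psi> \<kappa> i w f"
      if wi: "w \<in> E" "opp i w" "top_at \<kappa> i w" "\<And>v. v \<in> E \<Longrightarrow> length v < length w \<Longrightarrow> f v = \<theta> (tl v)" for w \<kappa> i f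
    proof -
      obtain j q where jq: "i = Suc j" "w = x0 # q" using notop[OF wi(1,3)] by blast
      have opp: "opp j q" using wi(2) jq by simp
      have "f (x0 # del j q) = \<theta> (del j q)"
        using wi(1) wi(4)[of "x0 # del j q"] opp_length[OF opp] by (simp add: E_def jq length_del)
      then show ?thesis using \<theta> opp by (simp add: jq contr_Suc natural_def rho_def)
    qed
  qed
  then obtain f where "\<forall>\<kappa> i w. opp i w \<longrightarrow> contr \<kappa> i w f = rho \<psi> \<kappa> i w f" "\<forall>w\<in>E. f w = \<theta> (tl w)"
    by blast
  then show ?thesis by (intro exI[of _ f]) (auto simp: E_def)
qed

end

end

section \<open>Fox derivatives relative to a character\<close>

section \<open>Fox calculus\<close>

text \<open>Letters left of the marked one are evaluated by the character and those right of it are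
  kept, so the derivatives suit right modules.\<close>

fun fox_word :: "('g \<Rightarrow> complex) \<Rightarrow> 'g \<Rightarrow> 'g list \<Rightarrow> 'g free_alg" where
  "fox_word \<phi> x [] = 0"
| "fox_word \<phi> x (y # w) = (if y = x then mon w else 0) + scal (\<phi> y) * fox_word \<phi> x w"

definition fox :: "('g \<Rightarrow> complex) \<Rightarrow> 'g \<Rightarrow> 'g free_alg \<Rightarrow> 'g free_alg"
  where "fox \<phi> x = ext (fox_word \<phi> x)"

lemmas fox_add = ext_add[of "fox_word \<phi> x" for \<phi> x, folded fox_def]
  and fox_diff = ext_diff[of "fox_word \<phi> x" for \<phi> x, folded fox_def]
  and fox_sum = ext_sum[of "fox_word \<phi> x" for \<phi> x, folded fox_def]
  and fox_scal_mult = ext_scal_mult[of "fox_word \<phi> x" for \<phi> x, folded fox_def]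
  and fox_mon = ext_mon[of "fox_word \<phi> x" for \<phi> x, folded fox_def]

lemma fox_0 [simp]: "fox \<phi> x 0 = 0"
  by (simp add: fox_def)

lemma fox_scal [simp]: "fox \<phi> x (scal c) = 0"
  using fox_scal_mult[of \<phi> x c 1] fox_mon[of \<phi> x "[]"] by simp

lemma fox_gen: "fox \<phi> x (gen y) = (if y = x then 1 else 0)"
  by (simp add: gen_eq_mon fox_mon)

lemma fox_word_append:
  "fox_word \<phi> x (v @ w) = fox_word \<phi> x v * mon w + scal (prod_list (map \<phi> v)) * fox_word \<phi> x w"
  by (induction v) (simp_all add: mon_append distrib_left distrib_right scal_mult mult.assoc)

lemma fox_mult: "fox \<phi> x (a * b) = fox \<phi> x a * b + scal (character_of \<phi> a) * fox \<phi> x b"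
proof (induction a rule: free_alg_induct)
  case (scal_mon c v)
  have "fox \<phi> x (mon v * b) = fox \<phi> x (mon v) * b + scal (prod_list (map \<phi> v)) * fox \<phi> x b"
  proof (induction b rule: free_alg_induct)
    case (scal_mon d w)
    have "mon v * (scal d * mon w) = scal d * mon (v @ w)"
      by (simp add: scal_left_commute mon_append)
    then show ?case
      by (simp add: fox_scal_mult fox_mon fox_word_append distrib_left
          scal_left_commute[of "fox_word \<phi> x v"] scal_left_commute[of "scal (prod_list (map \<phi> v))" d])
  qed (simp_all add: distrib_left fox_add)
  then show ?case
    by (simp add: mult.assoc fox_scal_mult character_of_mult character_of_eq_lin[of \<phi>, THEN fun_cong, of "mon v"]
        scal_mult distrib_left)
qed (simp_all add: distrib_right fox_add scal_add character_of_add)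

text \<open>Telescoping along a word, replacing letters by scalars from the left. The derivatives
  are thus the coordinates of a - \<phi>(a) in the augmentation ideal.\<close>

lemma fox_fundamental:
  fixes a :: "'g::finite free_alg"
  shows "(\<Sum>x\<in>UNIV. (gen x - scal (\<phi> x)) * fox \<phi> x a) = a - scal (character_of \<phi> a)"
proof (induction a rule: free_alg_induct)
  case (scal_mon c v)
  have "(\<Sum>x\<in>UNIV. (gen x - scal (\<phi> x)) * fox_word \<phi> x v) = mon v - scal (prod_list (map \<phi> v))"
  proof (induction v)
    case (Cons y v)
    have "(\<Sum>x\<in>UNIV. (gen x - scal (\<phi> x)) * fox_word \<phi> x (y # v)) =
        (\<Sum>x\<in>UNIV. if y = x then (gen x - scal (\<phi> x)) * mon v else 0)
        + (\<Sum>x\<in>UNIV. scal (\<phi> y) * ((gen x - scal (\<phi> x)) * fox_word \<phi> x v))"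
      by (subst sum.distrib[symmetric], rule sum.cong)
         (simp_all add: distrib_left scal_left_commute[of _ "\<phi> y"])
    also have "\<dots> = (gen y - scal (\<phi> y)) * mon v + scal (\<phi> y) * (mon v - scal (prod_list (map \<phi> v)))"
      by (simp add: Cons flip: sum_distrib_left)
    finally show ?case by (simp add: mon_Cons algebra_simps scal_mult)
  qed simp
  then have "scal c * (\<Sum>x\<in>UNIV. (gen x - scal (\<phi> x)) * fox_word \<phi> x v) = scal c * mon v - scal (c * prod_list (map \<phi> v))"
    by (simp add: right_diff_distrib scal_mult)
  then show ?case
    by (simp add: fox_scal_mult fox_mon scal_left_commute[of _ c] sum_distrib_left character_of_mult
        character_of_eq_lin[of \<phi>, THEN fun_cong, of "mon v"])
qed (simp_all add: fox_add distrib_left sum.distrib character_of_add scal_add)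

lemma free_alg_eqI:
  fixes x y :: "'g free_alg"
  shows "(\<And>f. lin f x = lin f y) \<Longrightarrow> x = y"
proof (rule poly_mapping_eqI)
  fix w :: "'g fword" assume *: "\<And>f. lin f x = lin f y"
  have "lin (\<lambda>v. if v = letters w then 1 else 0) z = Poly_Mapping.lookup z w" for z :: "'g free_alg"
  proof (induction z rule: free_alg_induct)
    case (scal_mon c v)
    have "Poly_Mapping.lookup (scal c * mon v) w = (if v = letters w then c else 0)"
      by (cases w) (simp add: scal_mult_mon lookup_single when_def)
    then show ?case by (simp add: lin_scal_mon)
  qed (simp add: lin_add lookup_add)
  with * show "Poly_Mapping.lookup x w = Poly_Mapping.lookup y w" by metis
qed

section \<open>The matrices of the resolution, and exactness\<close>

section \<open>The resolution\<close>

definition ep :: "'n letter \<Rightarrow> complex"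
  where "ep x = (if snd x True = snd x False then 1 else 0)"

lemma ep_mk: "ep (mk s \<kappa> k i) = (if k = i then 1 else 0)"
  by (auto simp: ep_def mk_def)

context forms
begin

text \<open>The four families u v^t = 1, v^t u = 1, v F u^t = F and u^t G v = G with G inverse to F,
  for suitable \<Phi>: rows are contracted if \<kappa> holds, columns otherwise.\<close>

definition relator :: "bool \<Rightarrow> bool \<Rightarrow> 'n \<Rightarrow> 'n \<Rightarrow> 'n letter free_alg"
  where "relator \<kappa> s i j =
    (\<Sum>k\<in>UNIV. \<Sum>l\<in>UNIV. scal (\<Phi> \<kappa> s k l) * (gen (mk s \<kappa> k i) * gen (mk (\<not> s) \<kappa> l j))) - scal (\<Phi> \<kappa> s i j)"

definition rel_ideal :: "'n letter free_alg set"
  where "rel_ideal = ideal_of {relator \<kappa> s i j | \<kappa> s i j. True}"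

lemma two_sided_rel_ideal: "two_sided rel_ideal"
  unfolding rel_ideal_def by (rule two_sided_ideal_of)

lemma relator_in_ideal: "relator \<kappa> s i j \<in> rel_ideal"
  unfolding rel_ideal_def by (rule ideal_of_base) blast

lemmas ideal_closed = two_sided_0[OF two_sided_rel_ideal] two_sided_add[OF two_sided_rel_ideal]
  two_sided_diff[OF two_sided_rel_ideal] two_sided_uminus[OF two_sided_rel_ideal]
  two_sided_mult_left[OF two_sided_rel_ideal] two_sided_mult_right[OF two_sided_rel_ideal]
  two_sided_sum[OF two_sided_rel_ideal]

lemma lin_relator: "lin f (mon v * relator \<kappa> s i j * mon w) =
  (\<Sum>k\<in>UNIV. \<Sum>l\<in>UNIV. \<Phi> \<kappa> s k l * f (v @ mk s \<kappa> k i # mk (\<not> s) \<kappa> l j # w)) - \<Phi> \<kappa> s i j * f (v @ w)"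
proof -
  have 1: "mon v * (scal c * (gen x * gen y)) * mon w = scal c * mon (v @ x # y # w)" for c x y
    by (simp add: scal_left_commute mult.assoc mon_append mon_Cons)
  have 2: "mon v * scal c * mon w = scal c * mon (v @ w)" for c
    by (simp add: scal_commute mult.assoc mon_append)
  show ?thesis
    by (simp add: relator_def right_diff_distrib left_diff_distrib sum_distrib_left sum_distrib_right
        1 2 lin_diff lin_sum lin_scal_mon)
qed

lemma natural_iff_lin: "natural f \<longleftrightarrow> (\<forall>a\<in>rel_ideal. lin f a = 0)"
proof
  assume f: "natural f"
  show "\<forall>a\<in>rel_ideal. lin f a = 0"
    unfolding rel_ideal_def
  proof
    fix a assume a: "a \<in> ideal_of {relator \<kappa> s i j | \<kappa> s i j. True}"
    show "lin f a = 0"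
      by (rule lin_ideal_of[OF _ a]) (use f[unfolded natural_iff] in \<open>auto simp: lin_relator\<close>)
  qed
next
  assume f: "\<forall>a\<in>rel_ideal. lin f a = 0"
  have "lin f (mon v * relator \<kappa> s i j * mon w) = 0" for \<kappa> s i j v w
    using f by (simp add: ideal_closed relator_in_ideal)
  then show "natural f" unfolding natural_iff by (simp add: lin_relator)
qed

lemma character_relator: "character_of ep (relator \<kappa> s i j) = 0"
proof -
  have "character_of ep (relator \<kappa> s i j) =
      (\<Sum>k\<in>UNIV. \<Sum>l\<in>UNIV. \<Phi> \<kappa> s k l * ((if k = i then 1 else 0) * (if l = j then 1 else 0))) - \<Phi> \<kappa> s i j"
    by (simp add: relator_def character_of_diff character_of_sum character_of_mult ep_mk)
  also have "(\<Sum>k\<in>UNIV. \<Sum>l\<in>UNIV. \<Phi> \<kappa> s k l * ((if k = i then 1 else 0) * (if l = j then 1 else 0))) =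
      (\<Sum>k\<in>UNIV. if k = i then (\<Sum>l\<in>UNIV. if l = j then \<Phi> \<kappa> s k l else 0) else 0)"
    by (intro sum.cong refl) (simp add: if_distrib cong: if_cong)
  finally show ?thesis by simp
qed

lemma character_ideal: "a \<in> rel_ideal \<Longrightarrow> character_of ep a = 0"
  unfolding rel_ideal_def by (rule character_of_ideal_of) (auto simp: character_relator)

text \<open>A function on words with marked first letter, read as a functional on the free module
  whose basis is the set of letters.\<close>

definition tot :: "('n letter list \<Rightarrow> complex) \<Rightarrow> ('n letter \<Rightarrow> 'n letter free_alg) \<Rightarrow> complex"
  where "tot \<phi> c = (\<Sum>x\<in>UNIV. lin (\<lambda>q. \<phi> (x # q)) (c x))"

lemma tot_add: "tot \<phi> (\<lambda>x. c x + d x) = tot \<phi> c + tot \<phi> d"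
  by (simp add: tot_def lin_add sum.distrib)

lemma tot_diff: "tot \<phi> (\<lambda>x. c x - d x) = tot \<phi> c - tot \<phi> d"
  by (simp add: tot_def lin_diff sum_subtractf)

lemma tot_scal: "tot \<phi> (\<lambda>x. scal a * c x) = a * tot \<phi> c"
  by (simp add: tot_def lin_scal sum_distrib_left)

lemma tot_sum: "tot \<phi> (\<lambda>x. \<Sum>i\<in>A. c i x) = (\<Sum>i\<in>A. tot \<phi> (c i))"
  by (simp add: tot_def lin_sum sum.swap[of _ A])

lemma tot_single: "tot \<phi> (\<lambda>x. if y = x then a else 0) = lin (\<lambda>q. \<phi> (y # q)) a"
proof -
  have "tot \<phi> (\<lambda>x. if y = x then a else 0) = (\<Sum>x\<in>UNIV. if y = x then lin (\<lambda>q. \<phi> (x # q)) a else 0)"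
    unfolding tot_def by (intro sum.cong refl) simp
  then show ?thesis by simp
qed

lemma fox_relator_mult: "fox ep x (relator \<kappa> s i j) * h =
    (\<Sum>k\<in>UNIV. \<Sum>l\<in>UNIV. scal (\<Phi> \<kappa> s k l) * (if mk s \<kappa> k i = x then gen (mk (\<not> s) \<kappa> l j) * h else 0))
    + (\<Sum>l\<in>UNIV. scal (\<Phi> \<kappa> s i l) * (if mk (\<not> s) \<kappa> l j = x then h else 0))"
proof -
  have "fox ep x (relator \<kappa> s i j) =
    (\<Sum>k\<in>UNIV. \<Sum>l\<in>UNIV. scal (\<Phi> \<kappa> s k l) * (if mk s \<kappa> k i = x then gen (mk (\<not> s) \<kappa> l j) else 0))
    + (\<Sum>k\<in>UNIV. if k = i then (\<Sum>l\<in>UNIV. scal (\<Phi> \<kappa> s i l) * (if mk (\<not> s) \<kappa> l j = x then 1 else 0)) else 0)"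
    unfolding sum.distrib[symmetric]
    by (simp add: relator_def fox_diff fox_sum fox_scal_mult fox_mult fox_gen ep_mk sum.distrib[symmetric] distrib_left)
       (intro sum.cong refl; auto simp: sum.distrib)
  then show ?thesis
    by (simp add: distrib_right sum_distrib_right mult.assoc if_distrib[of "\<lambda>a. a * h"] cong: if_cong)
qed

text \<open>The two terms are the contraction and the correction in \<open>rho\<close> at position
  0: either the first letter of the relator is marked, or it is evaluated and the second one is
  marked.\<close>

lemma tot_relator_mon:
  "tot \<phi> (\<lambda>x. fox ep x (relator \<kappa> s i j) * mon q) =
    (\<Sum>k\<in>UNIV. \<Sum>l\<in>UNIV. \<Phi> \<kappa> s k l * \<phi> (mk s \<kappa> k i # mk (\<not> s) \<kappa> l j # q))
    + (\<Sum>l\<in>UNIV. \<Phi> \<kappa> s i l * \<phi> (mk (\<not> s) \<kappa> l j # q))"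
  by (simp add: fox_relator_mult tot_add tot_sum tot_scal tot_single flip: mon_Cons)

definition D\<^sub>1 :: "unit \<Rightarrow> 'n letter \<Rightarrow> 'n letter free_alg"
  where "D\<^sub>1 _ x = gen x - scal (ep x)"

text \<open>Column relators suffice, since the derivatives of the row relators are combinations of
  theirs by \<open>fox_row_relator\<close>.\<close>

definition D\<^sub>2 :: "'n letter \<Rightarrow> bool \<times> 'n \<times> 'n \<Rightarrow> 'n letter free_alg"
  where "D\<^sub>2 x = (\<lambda>(s, i, j). fox ep x (relator False s i j))"

text \<open>The quadratic identity \<open>relator_syzygy_quadratic\<close>, with its row relators
  rewritten in terms of column relators as in \<open>fox_row_relator\<close>.\<close>

definition D\<^sub>3 :: "bool \<times> 'n \<times> 'n \<Rightarrow> bool \<Rightarrow> 'n letter free_alg"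
  where "D\<^sub>3 = (\<lambda>(s', i, j) s. if s' = s then scal (\<Phi> True s i j)
    else - (\<Sum>m\<in>UNIV. \<Sum>c\<in>UNIV. \<Sum>l\<in>UNIV.
      scal (\<Phi> False s m c * \<Phi> True s m i * \<Phi> True s j l) * gen (mk (\<not> s) False c l)))"

lemma sum_pair: "(\<Sum>p\<in>UNIV. f p) = (\<Sum>x\<in>UNIV. \<Sum>y\<in>UNIV. f (x, y))"
  for f :: "'a::finite \<times> 'b::finite \<Rightarrow> 'd::comm_monoid_add"
  using sum.cartesian_product[of "\<lambda>x y. f (x, y)" UNIV UNIV] by simp

lemma sum_triple: "(\<Sum>p\<in>UNIV. f p) = (\<Sum>s\<in>UNIV. \<Sum>i\<in>UNIV. \<Sum>j\<in>UNIV. f (s, i, j))"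
  for f :: "'a::finite \<times> 'b::finite \<times> 'c::finite \<Rightarrow> 'd::comm_monoid_add"
  by (simp add: sum_pair)

lemma sum_bool: "(\<Sum>t\<in>UNIV. f t) = f s + f (\<not> s)" for f :: "bool \<Rightarrow> 'd::comm_monoid_add"
  by (cases s) (simp_all add: UNIV_bool add.commute)

lemma exact0: "character_of ep a = 0 \<longleftrightarrow> (\<exists>c. a - (\<Sum>x\<in>UNIV. D\<^sub>1 () x * c x) \<in> rel_ideal)"
proof
  assume "character_of ep a = 0"
  then have "a - (\<Sum>x\<in>UNIV. D\<^sub>1 () x * fox ep x a) = 0"
    using fox_fundamental[of ep a] by (simp add: D\<^sub>1_def)
  then show "\<exists>c. a - (\<Sum>x\<in>UNIV. D\<^sub>1 () x * c x) \<in> rel_ideal"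
    by (intro exI[of _ "\<lambda>x. fox ep x a"]) (simp add: ideal_closed)
next
  assume "\<exists>c. a - (\<Sum>x\<in>UNIV. D\<^sub>1 () x * c x) \<in> rel_ideal"
  then obtain c where "character_of ep (a - (\<Sum>x\<in>UNIV. D\<^sub>1 () x * c x)) = 0"
    using character_ideal by blast
  then show "character_of ep a = 0"
    by (simp add: character_of_diff character_of_sum character_of_mult D\<^sub>1_def)
qed

text \<open>Comparing the two ways of applying a column relation to the first and a row relation to the
  last two letters of a word of length three, and vice versa, shows that the row relators are
  redundant modulo the column relators in the presentation of the augmentation ideal.\<close>

lemma scal_\<Phi>_inverse:
  "(\<Sum>l\<in>UNIV. scal (\<Phi> \<kappa> s k l) * scal (\<Phi> (\<not> \<kappa>) (\<not> s) l m)) = (if k = m then 1 else 0)"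
  using \<Phi>_inverse[of \<kappa> s k m] by (simp flip: scal_mult scal_sum)

lemma mk_True: "mk s True k i = mk s False i k"
  using mk_swap[of s False k i] by simp

lemma relator_syzygy_cubic:
  "(\<Sum>k\<in>UNIV. \<Sum>l\<in>UNIV. scal (\<Phi> True (\<not> t) k l) * (relator False t i k * gen (mk t False c l))) =
   (\<Sum>a\<in>UNIV. \<Sum>b\<in>UNIV. scal (\<Phi> False t a b) * (gen (mk t False a i) * relator True (\<not> t) b c))"
proof (rule free_alg_eqI)
  fix f :: "'n letter list \<Rightarrow> complex"
  have right: "lin f (relator \<kappa> s i j * gen z) = (\<Sum>k\<in>UNIV. \<Sum>l\<in>UNIV. \<Phi> \<kappa> s k l * f [mk s \<kappa> k i, mk (\<not> s) \<kappa> l j, z])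
      - \<Phi> \<kappa> s i j * f [z]" for \<kappa> s i j z
    using lin_relator[of f "[]" \<kappa> s i j "[z]"] by (simp add: gen_eq_mon)
  have left: "lin f (gen z * relator \<kappa> s i j) = (\<Sum>k\<in>UNIV. \<Sum>l\<in>UNIV. \<Phi> \<kappa> s k l * f [z, mk s \<kappa> k i, mk (\<not> s) \<kappa> l j])
      - \<Phi> \<kappa> s i j * f [z]" for \<kappa> s i j z
    using lin_relator[of f "[z]" \<kappa> s i j "[]"] by (simp add: gen_eq_mon)
  let ?w = "\<lambda>a b k l. f [mk t False a i, mk (\<not> t) False b k, mk t False c l]"
  have "lin f (\<Sum>k\<in>UNIV. \<Sum>l\<in>UNIV. scal (\<Phi> True (\<not> t) k l) * (relator False t i k * gen (mk t False c l))) =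
      (\<Sum>k\<in>UNIV. \<Sum>l\<in>UNIV. \<Sum>a\<in>UNIV. \<Sum>b\<in>UNIV. \<Phi> True (\<not> t) k l * (\<Phi> False t a b * ?w a b k l))
      - (\<Sum>k\<in>UNIV. \<Sum>l\<in>UNIV. \<Phi> True (\<not> t) k l * (\<Phi> False t i k * f [mk t False c l]))"
    by (simp add: lin_sum lin_scal right right_diff_distrib sum_subtractf sum_distrib_left)
  also have "(\<Sum>k\<in>UNIV. \<Sum>l\<in>UNIV. \<Phi> True (\<not> t) k l * (\<Phi> False t i k * f [mk t False c l])) = f [mk t False c i]"
    using collapse_right[of False t i] by simp
  also have "(\<Sum>k\<in>UNIV. \<Sum>l\<in>UNIV. \<Sum>a\<in>UNIV. \<Sum>b\<in>UNIV. \<Phi> True (\<not> t) k l * (\<Phi> False t a b * ?w a b k l)) =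
      (\<Sum>a\<in>UNIV. \<Sum>b\<in>UNIV. \<Sum>k\<in>UNIV. \<Sum>l\<in>UNIV. \<Phi> False t a b * (\<Phi> True (\<not> t) k l * ?w a b k l))"
    by (subst sum_swap_pairs) (simp only: mult.left_commute)
  also have "f [mk t False c i] = (\<Sum>a\<in>UNIV. \<Sum>b\<in>UNIV. \<Phi> False t a b * (\<Phi> True (\<not> t) b c * f [mk t False a i]))"
    using collapse_left[of False t c "\<lambda>a. f [mk t False a i]"] by simp
  finally show "lin f (\<Sum>k\<in>UNIV. \<Sum>l\<in>UNIV. scal (\<Phi> True (\<not> t) k l) * (relator False t i k * gen (mk t False c l))) =
      lin f (\<Sum>a\<in>UNIV. \<Sum>b\<in>UNIV. scal (\<Phi> False t a b) * (gen (mk t False a i) * relator True (\<not> t) b c))"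
    by (simp add: lin_sum lin_scal left right_diff_distrib sum_subtractf sum_distrib_left mk_True)
qed

text \<open>Both sides contract a pair of letters along rows and along columns; the order of the two
  contractions does not matter.\<close>

lemma relator_syzygy_quadratic:
  "(\<Sum>k\<in>UNIV. \<Sum>l\<in>UNIV. scal (\<Phi> True s k l) * relator False s k l) =
   (\<Sum>k\<in>UNIV. \<Sum>l\<in>UNIV. scal (\<Phi> False s k l) * relator True s k l)"
proof (rule free_alg_eqI)
  fix f :: "'n letter list \<Rightarrow> complex"
  have r: "lin f (relator \<kappa> s i j) = (\<Sum>k\<in>UNIV. \<Sum>l\<in>UNIV. \<Phi> \<kappa> s k l * f [mk s \<kappa> k i, mk (\<not> s) \<kappa> l j])
      - \<Phi> \<kappa> s i j * f []" for \<kappa> s i j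
    using lin_relator[of f "[]" \<kappa> s i j "[]"] by simp
  have "(\<Sum>k\<in>UNIV. \<Sum>l\<in>UNIV. \<Sum>a\<in>UNIV. \<Sum>b\<in>UNIV. \<Phi> True s k l * (\<Phi> False s a b * f [mk s False a k, mk (\<not> s) False b l])) =
    (\<Sum>a\<in>UNIV. \<Sum>b\<in>UNIV. \<Sum>k\<in>UNIV. \<Sum>l\<in>UNIV. \<Phi> False s a b * (\<Phi> True s k l * f [mk s False a k, mk (\<not> s) False b l]))"
    by (subst sum_swap_pairs) (simp only: mult.left_commute)
  then show "lin f (\<Sum>k\<in>UNIV. \<Sum>l\<in>UNIV. scal (\<Phi> True s k l) * relator False s k l) =
      lin f (\<Sum>k\<in>UNIV. \<Sum>l\<in>UNIV. scal (\<Phi> False s k l) * relator True s k l)"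
    by (simp add: lin_sum lin_scal r right_diff_distrib sum_subtractf sum_distrib_left mk_True mult_ac)
qed

text \<open>Differentiate the cubic identity. The terms with an underived relator lie in the ideal,
  and inverting the form \<Phi> False (\<not> s) isolates the row relator.\<close>

lemma fox_row_relator:
  "fox ep x (relator True s m c) - (\<Sum>i\<in>UNIV. \<Sum>k\<in>UNIV. \<Sum>l\<in>UNIV. scal (\<Phi> True s m i * \<Phi> True s k l) *
    (fox ep x (relator False (\<not> s) i k) * gen (mk (\<not> s) False c l))) \<in> rel_ideal"
proof -
  let ?L = "\<lambda>i. \<Sum>k\<in>UNIV. \<Sum>l\<in>UNIV. scal (\<Phi> True s k l) * (fox ep x (relator False (\<not> s) i k) * gen (mk (\<not> s) False c l))"
  let ?E = "\<lambda>i. \<Sum>a\<in>UNIV. \<Sum>b\<in>UNIV. scal (\<Phi> False (\<not> s) a b) * ((if mk (\<not> s) False a i = x then 1 else 0) * relator True s b c)"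
  have E: "?E i \<in> rel_ideal" for i
    by (intro ideal_closed relator_in_ideal)
  have eq: "?L i = ?E i + (\<Sum>b\<in>UNIV. scal (\<Phi> False (\<not> s) i b) * fox ep x (relator True s b c))" for i
  proof -
    have "?L i = fox ep x (\<Sum>k\<in>UNIV. \<Sum>l\<in>UNIV. scal (\<Phi> True s k l) * (relator False (\<not> s) i k * gen (mk (\<not> s) False c l)))"
      by (simp only: fox_sum fox_scal_mult) (simp add: fox_mult character_relator)
    also have "\<dots> = fox ep x (\<Sum>a\<in>UNIV. \<Sum>b\<in>UNIV. scal (\<Phi> False (\<not> s) a b) * (gen (mk (\<not> s) False a i) * relator True s b c))"
      using relator_syzygy_cubic[of "\<not> s" i c] by simp
    also have "\<dots> = (\<Sum>a\<in>UNIV. \<Sum>b\<in>UNIV. scal (\<Phi> False (\<not> s) a b) * ((if mk (\<not> s) False a i = x then 1 else 0) * relator True s b c)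
        + scal (\<Phi> False (\<not> s) a b) * (scal (if a = i then 1 else 0) * fox ep x (relator True s b c)))"
      by (simp only: fox_sum fox_scal_mult) (simp only: fox_mult fox_gen character_of_gen ep_mk distrib_left)
    also have "\<dots> = ?E i + (\<Sum>a\<in>UNIV. \<Sum>b\<in>UNIV. scal (\<Phi> False (\<not> s) a b) * (scal (if a = i then 1 else 0) * fox ep x (relator True s b c)))"
      by (simp only: sum.distrib)
    also have "(\<Sum>a\<in>UNIV. \<Sum>b\<in>UNIV. scal (\<Phi> False (\<not> s) a b) * (scal (if a = i then 1 else 0) * fox ep x (relator True s b c))) =
        (\<Sum>a\<in>UNIV. if a = i then (\<Sum>b\<in>UNIV. scal (\<Phi> False (\<not> s) a b) * fox ep x (relator True s b c)) else 0)"
      by (rule sum.cong[OF refl]) simp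
    finally show ?thesis by simp
  qed
  have "(\<Sum>i\<in>UNIV. scal (\<Phi> True s m i) * (\<Sum>b\<in>UNIV. scal (\<Phi> False (\<not> s) i b) * fox ep x (relator True s b c))) =
      (\<Sum>b\<in>UNIV. (\<Sum>i\<in>UNIV. scal (\<Phi> True s m i) * scal (\<Phi> False (\<not> s) i b)) * fox ep x (relator True s b c))"
    unfolding sum_distrib_left sum_distrib_right by (subst sum.swap) (simp add: mult.assoc)
  also have "\<dots> = (\<Sum>b\<in>UNIV. if m = b then fox ep x (relator True s b c) else 0)"
    by (rule sum.cong[OF refl]) (simp add: scal_\<Phi>_inverse[of True s, simplified])
  also have "\<dots> = fox ep x (relator True s m c)" by simp
  finally have "fox ep x (relator True s m c) = (\<Sum>i\<in>UNIV. scal (\<Phi> True s m i) * (?L i - ?E i))"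
    by (simp only: eq add_diff_cancel_left')
  also have "\<dots> = (\<Sum>i\<in>UNIV. scal (\<Phi> True s m i) * ?L i) - (\<Sum>i\<in>UNIV. scal (\<Phi> True s m i) * ?E i)"
    by (simp only: right_diff_distrib sum_subtractf)
  finally have *: "fox ep x (relator True s m c) =
      (\<Sum>i\<in>UNIV. scal (\<Phi> True s m i) * ?L i) - (\<Sum>i\<in>UNIV. scal (\<Phi> True s m i) * ?E i)" .
  have group: "a = b - c \<Longrightarrow> a - b = - c" for a b c :: "'n letter free_alg" by simp
  from * have 1: "fox ep x (relator True s m c) - (\<Sum>i\<in>UNIV. scal (\<Phi> True s m i) * ?L i) =
      - (\<Sum>i\<in>UNIV. scal (\<Phi> True s m i) * ?E i)"
    by (rule group)
  have 2: "(\<Sum>i\<in>UNIV. scal (\<Phi> True s m i) * ?E i) \<in> rel_ideal"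
    by (rule ideal_closed(7)) (rule ideal_closed(5), rule E)
  have 3: "(\<Sum>i\<in>UNIV. \<Sum>k\<in>UNIV. \<Sum>l\<in>UNIV. scal (\<Phi> True s m i * \<Phi> True s k l) *
        (fox ep x (relator False (\<not> s) i k) * gen (mk (\<not> s) False c l))) = (\<Sum>i\<in>UNIV. scal (\<Phi> True s m i) * ?L i)"
    by (simp add: sum_distrib_left scal_mult mult.assoc)
  show ?thesis unfolding 3 1 by (rule ideal_closed(4)[OF 2])
qed

end

context forms
begin

lemma mk_sel': "snd (mk s False k i) True = i" "snd (mk s True k i) False = i"
  by (simp_all add: mk_def)

definition boundary2 :: "('n letter \<Rightarrow> 'n letter free_alg) \<Rightarrow> bool"
  where "boundary2 c \<longleftrightarrow> (\<exists>d. \<forall>x. c x - (\<Sum>p\<in>UNIV. D\<^sub>2 x p * d p) \<in> rel_ideal)"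

lemma boundary2_add: "boundary2 c \<Longrightarrow> boundary2 d \<Longrightarrow> boundary2 (\<lambda>x. c x + d x)"
  unfolding boundary2_def
proof (elim exE)
  fix c' d' assume *: "\<forall>x. c x - (\<Sum>p\<in>UNIV. D\<^sub>2 x p * c' p) \<in> rel_ideal" "\<forall>x. d x - (\<Sum>p\<in>UNIV. D\<^sub>2 x p * d' p) \<in> rel_ideal"
  have eq: "c x + d x - (\<Sum>p\<in>UNIV. D\<^sub>2 x p * (c' p + d' p)) =
      (c x - (\<Sum>p\<in>UNIV. D\<^sub>2 x p * c' p)) + (d x - (\<Sum>p\<in>UNIV. D\<^sub>2 x p * d' p))" for x
    by (simp add: distrib_left sum.distrib)
  then show "\<exists>e. \<forall>x. c x + d x - (\<Sum>p\<in>UNIV. D\<^sub>2 x p * e p) \<in> rel_ideal"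
  proof (intro exI[of _ "\<lambda>p. c' p + d' p"] allI)
    fix x
    show "c x + d x - (\<Sum>p\<in>UNIV. D\<^sub>2 x p * (c' p + d' p)) \<in> rel_ideal"
      unfolding eq by (rule ideal_closed(2)) (rule *[rule_format])+
  qed
qed

lemma boundary2_mult: "boundary2 c \<Longrightarrow> boundary2 (\<lambda>x. c x * a)"
  unfolding boundary2_def
proof (elim exE)
  fix d assume *: "\<forall>x. c x - (\<Sum>p\<in>UNIV. D\<^sub>2 x p * d p) \<in> rel_ideal"
  have eq: "c x * a - (\<Sum>p\<in>UNIV. D\<^sub>2 x p * (d p * a)) = (c x - (\<Sum>p\<in>UNIV. D\<^sub>2 x p * d p)) * a" for x
    by (simp add: left_diff_distrib sum_distrib_right mult.assoc)
  then show "\<exists>e. \<forall>x. c x * a - (\<Sum>p\<in>UNIV. D\<^sub>2 x p * e p) \<in> rel_ideal"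
  proof (intro exI[of _ "\<lambda>p. d p * a"] allI)
    fix x
    show "c x * a - (\<Sum>p\<in>UNIV. D\<^sub>2 x p * (d p * a)) \<in> rel_ideal"
      unfolding eq by (rule ideal_closed(6)) (rule *[rule_format])
  qed
qed

lemma boundary2_ideal: "(\<And>x. c x \<in> rel_ideal) \<Longrightarrow> boundary2 c"
  unfolding boundary2_def by (intro exI[of _ "\<lambda>p. 0"]) simp

lemma boundary2_scal: "boundary2 c \<Longrightarrow> boundary2 (\<lambda>x. scal a * c x)"
  using boundary2_mult[of c "scal a"] by (simp add: scal_commute)

lemma boundary2_sum: "(\<And>i. i \<in> A \<Longrightarrow> boundary2 (c i)) \<Longrightarrow> boundary2 (\<lambda>x. \<Sum>i\<in>A. c i x)"
  by (induction A rule: infinite_finite_induct)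
     (auto intro: boundary2_ideal boundary2_add simp: ideal_closed)

lemma boundary2_col: "boundary2 (\<lambda>x. fox ep x (relator False s i j))"
  unfolding boundary2_def
proof (intro exI allI)
  fix x
  have "(\<Sum>p\<in>UNIV. D\<^sub>2 x p * (if p = (s, i, j) then 1 else 0)) = (\<Sum>p\<in>UNIV. if p = (s, i, j) then D\<^sub>2 x p else 0)"
    by (rule sum.cong[OF refl]) simp
  then show "fox ep x (relator False s i j) - (\<Sum>p\<in>UNIV. D\<^sub>2 x p * (if p = (s, i, j) then 1 else 0)) \<in> rel_ideal"
    by (simp add: D\<^sub>2_def ideal_closed)
qed

lemma boundary2_relator: "boundary2 (\<lambda>x. fox ep x (relator \<kappa> s i j))"
proof (cases \<kappa>)
  case True
  let ?L = "\<lambda>x. \<Sum>a\<in>UNIV. \<Sum>k\<in>UNIV. \<Sum>l\<in>UNIV. scal (\<Phi> True s i a * \<Phi> True s k l) *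
    (fox ep x (relator False (\<not> s) a k) * gen (mk (\<not> s) False j l))"
  have "boundary2 (\<lambda>x. (fox ep x (relator True s i j) - ?L x) + ?L x)"
    by (intro boundary2_add boundary2_ideal fox_row_relator boundary2_sum boundary2_scal boundary2_mult boundary2_col)
  then show ?thesis using True by simp
qed (simp add: boundary2_col)

text \<open>The elements of the ideal whose derivatives are boundaries form a two-sided ideal: in
  the product rule the underived factor is evaluated to a scalar, vanishes under the character, or
  gives an element of the ideal.\<close>

lemma boundary2_fox: "a \<in> rel_ideal \<Longrightarrow> boundary2 (\<lambda>x. fox ep x a)"
proof -
  assume a: "a \<in> rel_ideal"
  define J where "J = {a \<in> rel_ideal. boundary2 (\<lambda>x. fox ep x a)}"
  have "two_sided J"
    unfolding two_sided_def
  proof (intro conjI ballI allI)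
    show "0 \<in> J" by (simp add: J_def ideal_closed boundary2_ideal)
    fix a b assume "a \<in> J" "b \<in> J"
    then show "a + b \<in> J" by (simp add: J_def ideal_closed fox_add boundary2_add)
  next
    fix a b assume "a \<in> J"
    then have a: "a \<in> rel_ideal" "boundary2 (\<lambda>x. fox ep x a)" by (simp_all add: J_def)
    show "b * a \<in> J"
      using boundary2_add[OF boundary2_ideal[OF ideal_closed(5)[OF a(1)]] boundary2_scal[OF a(2)], of "\<lambda>x. fox ep x b"]
      by (simp add: J_def ideal_closed a(1) fox_mult)
    show "a * b \<in> J" using a character_ideal[OF a(1)]
      by (auto simp: J_def ideal_closed fox_mult intro!: boundary2_mult)
  qed
  moreover have "{relator \<kappa> s i j | \<kappa> s i j. True} \<subseteq> J"
    by (auto simp: J_def relator_in_ideal boundary2_relator)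
  ultimately have "rel_ideal \<subseteq> J" unfolding rel_ideal_def by (rule ideal_of_minimal)
  then show ?thesis using a by (auto simp: J_def)
qed

lemma D\<^sub>1_D\<^sub>2: "(\<Sum>x\<in>UNIV. D\<^sub>1 () x * D\<^sub>2 x p) \<in> rel_ideal"
proof (cases p)
  case (fields s i j)
  then show ?thesis using fox_fundamental[of ep "relator False s i j"]
    by (simp add: D\<^sub>1_def D\<^sub>2_def character_relator relator_in_ideal)
qed

lemma fox_D\<^sub>1: "fox ep x (\<Sum>y\<in>UNIV. D\<^sub>1 () y * c y) = c x"
proof -
  have "fox ep x (\<Sum>y\<in>UNIV. D\<^sub>1 () y * c y) = (\<Sum>y\<in>UNIV. if y = x then c y else 0)"
    unfolding fox_sum by (rule sum.cong[OF refl]) (simp add: D\<^sub>1_def fox_mult fox_diff fox_gen character_of_diff)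
  then show ?thesis by simp
qed

text \<open>The coefficients c are the Fox derivatives of the sum of
  \<open>D\<^sub>1 () x * c x\<close> (\<open>fox_D\<^sub>1\<close>), so membership of that sum in
  the ideal makes c a boundary by \<open>boundary2_fox\<close>.\<close>

lemma exact1: "(\<Sum>x\<in>UNIV. D\<^sub>1 () x * c x) \<in> rel_ideal \<longleftrightarrow> boundary2 c"
proof
  assume "(\<Sum>x\<in>UNIV. D\<^sub>1 () x * c x) \<in> rel_ideal"
  from boundary2_fox[OF this] show "boundary2 c" by (simp add: fox_D\<^sub>1)
next
  assume "boundary2 c"
  then obtain d where d: "\<And>x. c x - (\<Sum>p\<in>UNIV. D\<^sub>2 x p * d p) \<in> rel_ideal" by (auto simp: boundary2_def)
  have "(\<Sum>x\<in>UNIV. D\<^sub>1 () x * c x) = (\<Sum>x\<in>UNIV. D\<^sub>1 () x * (c x - (\<Sum>p\<in>UNIV. D\<^sub>2 x p * d p)))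
      + (\<Sum>p\<in>UNIV. (\<Sum>x\<in>UNIV. D\<^sub>1 () x * D\<^sub>2 x p) * d p)"
    by (simp add: right_diff_distrib sum_subtractf sum_distrib_left sum_distrib_right mult.assoc) (rule sum.swap)
  also have "\<dots> \<in> rel_ideal"
    by (intro ideal_closed d D\<^sub>1_D\<^sub>2)
  finally show "(\<Sum>x\<in>UNIV. D\<^sub>1 () x * c x) \<in> rel_ideal" .
qed

text \<open>Differentiate the quadratic identity and replace the row relators by means of
  \<open>fox_row_relator\<close>.\<close>

lemma D\<^sub>2_D\<^sub>3: "(\<Sum>p\<in>UNIV. D\<^sub>2 x p * D\<^sub>3 p s) \<in> rel_ideal"
proof -
  let ?f = "\<lambda>\<kappa> s i j. fox ep x (relator \<kappa> s i j)"
  let ?L = "\<lambda>m c. \<Sum>i\<in>UNIV. \<Sum>k\<in>UNIV. \<Sum>l\<in>UNIV. scal (\<Phi> True s m i * \<Phi> True s k l) *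
    (?f False (\<not> s) i k * gen (mk (\<not> s) False c l))"
  have "(\<Sum>p\<in>UNIV. D\<^sub>2 x p * D\<^sub>3 p s) =
      (\<Sum>i\<in>UNIV. \<Sum>j\<in>UNIV. ?f False s i j * scal (\<Phi> True s i j))
      - (\<Sum>i\<in>UNIV. \<Sum>k\<in>UNIV. \<Sum>m\<in>UNIV. \<Sum>c\<in>UNIV. \<Sum>l\<in>UNIV.
          scal (\<Phi> False s m c) * (scal (\<Phi> True s m i * \<Phi> True s k l) * (?f False (\<not> s) i k * gen (mk (\<not> s) False c l))))"
    by (simp add: sum_triple sum_bool[of _ s] D\<^sub>2_def D\<^sub>3_def sum_negf sum_distrib_left scal_left_commute[of "?f _ _ _ _"] scal_mult mult.assoc)
  also have "(\<Sum>i\<in>UNIV. \<Sum>k\<in>UNIV. \<Sum>m\<in>UNIV. \<Sum>c\<in>UNIV. \<Sum>l\<in>UNIV.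
          scal (\<Phi> False s m c) * (scal (\<Phi> True s m i * \<Phi> True s k l) * (?f False (\<not> s) i k * gen (mk (\<not> s) False c l)))) =
      (\<Sum>m\<in>UNIV. \<Sum>c\<in>UNIV. scal (\<Phi> False s m c) * ?L m c)"
    by (subst sum_swap_pairs) (simp add: sum_distrib_left)
  also have "(\<Sum>i\<in>UNIV. \<Sum>j\<in>UNIV. ?f False s i j * scal (\<Phi> True s i j)) =
      fox ep x (\<Sum>i\<in>UNIV. \<Sum>j\<in>UNIV. scal (\<Phi> True s i j) * relator False s i j)"
    by (simp add: fox_sum fox_scal_mult scal_commute)
  also have "\<dots> = (\<Sum>m\<in>UNIV. \<Sum>c\<in>UNIV. scal (\<Phi> False s m c) * ?f True s m c)"
    unfolding relator_syzygy_quadratic by (simp only: fox_sum fox_scal_mult)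
  finally have "(\<Sum>p\<in>UNIV. D\<^sub>2 x p * D\<^sub>3 p s) =
      (\<Sum>m\<in>UNIV. \<Sum>c\<in>UNIV. scal (\<Phi> False s m c) * (?f True s m c - ?L m c))"
    by (simp only: right_diff_distrib sum_subtractf)
  also have "\<dots> \<in> rel_ideal"
    by (intro ideal_closed fox_row_relator)
  finally show ?thesis .
qed

text \<open>Exactness in degree two and three is proved dually: a functional on the module of relators that
  vanishes on the image of \<open>D\<^sub>3\<close> extends along \<open>D\<^sub>2\<close> to a functional on the module of differentials.\<close>

definition row_part :: "(bool \<Rightarrow> 'n \<Rightarrow> 'n \<Rightarrow> 'n letter list \<Rightarrow> complex) \<Rightarrow>
    bool \<Rightarrow> bool \<Rightarrow> 'n \<Rightarrow> 'n \<Rightarrow> 'n letter list \<Rightarrow> complex"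
  where "row_part \<psi> \<kappa> s m c q = (if \<kappa> then (\<Sum>i\<in>UNIV. \<Sum>k\<in>UNIV. \<Sum>l\<in>UNIV.
      \<Phi> True s m i * (\<Phi> True s k l * \<psi> (\<not> s) i k (mk (\<not> s) False c l # q))) else \<psi> s m c q)"

lemma row_part_natural:
  assumes "\<And>s i j. natural (\<psi> s i j)"
  shows "natural (row_part \<psi> \<kappa> s a b)"
proof (cases \<kappa>)
  case True
  then have "row_part \<psi> \<kappa> s a b = (\<lambda>q. \<Sum>i\<in>UNIV. \<Sum>k\<in>UNIV. \<Sum>l\<in>UNIV.
      \<Phi> True s a i * (\<Phi> True s k l * \<psi> (\<not> s) i k (mk (\<not> s) False b l # q)))"
    by (simp add: row_part_def fun_eq_iff)
  then show ?thesis by (simp only:) (intro natural_sum natural_scale natural_Cons[of "\<psi> _ _ _"] assms)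
next
  case False
  then have "row_part \<psi> \<kappa> s a b = \<psi> s a b" by (simp add: row_part_def fun_eq_iff)
  then show ?thesis using assms by simp
qed

lemma sum_rotate: "(\<Sum>k\<in>A. \<Sum>l\<in>B. \<Sum>m\<in>C. g k l m) = (\<Sum>m\<in>C. \<Sum>k\<in>A. \<Sum>l\<in>B. g k l m)"
proof -
  have "(\<Sum>k\<in>A. \<Sum>l\<in>B. \<Sum>m\<in>C. g k l m) = (\<Sum>k\<in>A. \<Sum>m\<in>C. \<Sum>l\<in>B. g k l m)"
    by (rule sum.cong[OF refl], rule sum.swap)
  also have "\<dots> = (\<Sum>m\<in>C. \<Sum>k\<in>A. \<Sum>l\<in>B. g k l m)" by (rule sum.swap)
  finally show ?thesis .
qed

text \<open>\<open>row_part\<close> extends \<psi> to row relators by the formula of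
  \<open>fox_row_relator\<close>. Starting from a column relator, the shift condition is the
  inversion of a form; starting from a row relator, it needs naturality of \<psi>.\<close>

lemma row_part_shift:
  assumes nat: "\<And>s i j. natural (\<psi> s i j)"
  shows "(\<Sum>k\<in>UNIV. \<Sum>l\<in>UNIV. \<Phi> (\<not> \<kappa>) (\<not> s) k l * row_part \<psi> \<kappa> s a k (mk s \<kappa> c l # q)) =
      (\<Sum>l\<in>UNIV. \<Phi> \<kappa> s a l * row_part \<psi> (\<not> \<kappa>) (\<not> s) l c q)"
proof (cases \<kappa>)
  case False
  let ?h = "\<lambda>i. \<Sum>k\<in>UNIV. \<Sum>l\<in>UNIV. \<Phi> True (\<not> s) k l * \<psi> s i k (mk s False c l # q)"
  have "(\<Sum>l\<in>UNIV. \<Phi> False s a l * row_part \<psi> True (\<not> s) l c q) =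
     (\<Sum>l\<in>UNIV. \<Sum>i\<in>UNIV. \<Phi> True (\<not> s) l i * (\<Phi> False s a l * ?h i))"
    by (simp add: row_part_def sum_distrib_left mult.left_commute[of "\<Phi> False s a _"])
  also have "\<dots> = ?h a"
    using collapse_right[of False s a ?h] by simp
  finally show ?thesis using False by (simp add: row_part_def)
next
  case True
  have inner: "(\<Sum>k\<in>UNIV. \<Sum>l\<in>UNIV. \<Phi> False (\<not> s) k l * \<psi> (\<not> s) i k' (mk (\<not> s) False k l' # mk s False l c # q)) =
      \<Phi> False (\<not> s) l' c * \<psi> (\<not> s) i k' q" for i k' l'
    using nat[of "\<not> s" i k', unfolded natural_iff, rule_format,
        where \<kappa> = False and s = "\<not> s" and i = l' and j = c and v = "[]" and w = q] by simp
  have "(\<Sum>k\<in>UNIV. \<Sum>l\<in>UNIV. \<Phi> False (\<not> s) k l * row_part \<psi> True s a k (mk s True c l # q)) =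
     (\<Sum>k\<in>UNIV. \<Sum>l\<in>UNIV. \<Sum>i\<in>UNIV. \<Sum>k'\<in>UNIV. \<Sum>l'\<in>UNIV. \<Phi> True s a i * (\<Phi> True s k' l' *
        (\<Phi> False (\<not> s) k l * \<psi> (\<not> s) i k' (mk (\<not> s) False k l' # mk s False l c # q))))"
    by (simp add: row_part_def mk_True sum_distrib_left mult.left_commute[of "\<Phi> False _ _ _"])
  also have "\<dots> = (\<Sum>i\<in>UNIV. \<Sum>k'\<in>UNIV. \<Sum>k\<in>UNIV. \<Sum>l\<in>UNIV. \<Sum>l'\<in>UNIV. \<Phi> True s a i * (\<Phi> True s k' l' *
        (\<Phi> False (\<not> s) k l * \<psi> (\<not> s) i k' (mk (\<not> s) False k l' # mk s False l c # q))))"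
    by (rule sum_swap_pairs)
  also have "\<dots> = (\<Sum>i\<in>UNIV. \<Sum>k'\<in>UNIV. \<Sum>l'\<in>UNIV. \<Sum>k\<in>UNIV. \<Sum>l\<in>UNIV. \<Phi> True s a i * (\<Phi> True s k' l' *
        (\<Phi> False (\<not> s) k l * \<psi> (\<not> s) i k' (mk (\<not> s) False k l' # mk s False l c # q))))"
    by (rule sum.cong[OF refl], rule sum.cong[OF refl], rule sum_rotate)
  also have "\<dots> = (\<Sum>i\<in>UNIV. \<Sum>k'\<in>UNIV. \<Sum>l'\<in>UNIV. \<Phi> True s a i * (\<Phi> True s k' l' * (\<Phi> False (\<not> s) l' c * \<psi> (\<not> s) i k' q)))"
    by (simp only: sum_distrib_left[symmetric] inner)
  also have "\<dots> = (\<Sum>i\<in>UNIV. \<Phi> True s a i * (\<Sum>k'\<in>UNIV. \<Sum>l'\<in>UNIV. \<Phi> True s k' l' * (\<Phi> False (\<not> s) l' c * \<psi> (\<not> s) i k' q)))"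
    by (simp only: sum_distrib_left)
  also have "\<dots> = (\<Sum>i\<in>UNIV. \<Phi> True s a i * \<psi> (\<not> s) i c q)"
    using collapse_left[of True s c] by simp
  finally show ?thesis using True by (simp add: row_part_def)
qed

text \<open>Dual form of exactness: a natural \<psi> that kills the columns of
  \<open>D\<^sub>3\<close> factors through \<open>D\<^sub>2\<close>. The hypothesis
  \<open>cycle\<close> is the symmetry condition of \<open>marked_extension\<close>.\<close>

lemma differential_functional:
  assumes nat: "\<And>s i j. natural (\<psi> s i j)"
    and cycle: "\<And>s q. (\<Sum>k\<in>UNIV. \<Sum>l\<in>UNIV. \<Phi> True s k l * \<psi> s k l q) =
      (\<Sum>k\<in>UNIV. \<Sum>l\<in>UNIV. \<Phi> False s k l * row_part \<psi> True s k l q)"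
    and \<theta>: "natural \<theta>" and x0: "\<And>\<kappa>. snd x0 \<kappa> \<noteq> tp \<kappa> (fst x0)"
  shows "\<exists>\<phi>. (\<forall>x. natural (\<lambda>q. \<phi> (x # q))) \<and>
    (\<forall>s i j h. tot \<phi> (\<lambda>x. fox ep x (relator False s i j) * h) = lin (\<psi> s i j) h) \<and>
    (pre \<longrightarrow> (\<forall>q. \<phi> (x0 # q) = \<theta> q))"
proof -
  have sym: "(\<Sum>k\<in>UNIV. \<Sum>l\<in>UNIV. \<Phi> (\<not> \<kappa>) s k l * row_part \<psi> \<kappa> s k l q) =
      (\<Sum>k\<in>UNIV. \<Sum>l\<in>UNIV. \<Phi> \<kappa> s k l * row_part \<psi> (\<not> \<kappa>) s k l q)" for \<kappa> s q
    using cycle[of s q] by (cases \<kappa>) (simp_all add: row_part_def[of _ False])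
  obtain \<phi> where \<phi>: "\<And>\<kappa> i w. opp i w \<Longrightarrow> contr \<kappa> i w \<phi> = rho (row_part \<psi>) \<kappa> i w \<phi>"
      and pre: "pre \<longrightarrow> (\<forall>q. \<phi> (x0 # q) = \<theta> q)"
    using marked_extension[of "row_part \<psi>" \<theta> x0 pre, OF row_part_natural[OF nat] row_part_shift[OF nat] sym \<theta> x0]
    by blast
  have "natural (\<lambda>q. \<phi> (x # q))" for x
    unfolding natural_def
  proof (intro allI impI)
    fix \<kappa> i and w :: "'n letter list" assume "opp i w"
    then show "contr \<kappa> i w (\<lambda>q. \<phi> (x # q)) =
        \<Phi> \<kappa> (fst (w ! i)) (snd (w ! i) (\<not> \<kappa>)) (snd (w ! Suc i) (\<not> \<kappa>)) * \<phi> (x # del i w)"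
      using \<phi>[of "Suc i" "x # w" \<kappa>] by (simp add: contr_Suc rho_def)
  qed
  moreover have "tot \<phi> (\<lambda>x. fox ep x (relator False s i j) * h) = lin (\<psi> s i j) h" for s i j h
  proof (induction h rule: free_alg_induct)
    case (scal_mon c q)
    have "opp 0 (mk s False i i # mk (\<not> s) False j j # q)" by (simp add: opp_def)
    from \<phi>[OF this, of False]
    have "tot \<phi> (\<lambda>x. fox ep x (relator False s i j) * mon q) = \<psi> s i j q"
      by (simp add: tot_relator_mon contr_def rho_def row_part_def mk_sel')
    then show ?case by (simp add: scal_left_commute tot_scal lin_scal)
  qed (simp add: distrib_left tot_add lin_add)
  ultimately show ?thesis using pre by blast
qed

end

context forms
begin

lemma sum_conj_delta: "(\<Sum>l\<in>UNIV. if P \<and> l = b then K else 0) = (if P then K else (0 :: 'a::comm_monoid_add))"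
  for b :: "'t::finite"
  by (cases P) simp_all

lemma sum_delta3:
  "(\<Sum>m\<in>UNIV. \<Sum>c\<in>UNIV. \<Sum>l\<in>UNIV. if (m = a \<and> c = a') \<and> l = b then K else 0) = (K :: 'a::comm_monoid_add)"
  for a :: "'x::finite" and a' :: "'y::finite" and b :: "'z::finite"
  by (simp only: sum_conj_delta) simp

lemma natural_zero: "natural (\<lambda>_. 0)"
  by (simp add: natural_iff)

text \<open>An entry of u whose indices are the leading ones for the sign of v, hence not leading
  for its own sign.\<close>

definition x\<^sub>0 :: "'n letter" where "x\<^sub>0 = (True, \<lambda>\<kappa>. tp \<kappa> False)"

lemma x\<^sub>0: "snd x\<^sub>0 \<kappa> \<noteq> tp \<kappa> (fst x\<^sub>0)"
  using tp_neq[of False True \<kappa>] by (simp add: x\<^sub>0_def)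

lemma tot_ideal:
  assumes "\<And>x. natural (\<lambda>q. \<phi> (x # q))" and "\<And>x. c x \<in> rel_ideal"
  shows "tot \<phi> c = 0"
  unfolding tot_def using assms natural_iff_lin by (intro sum.neutral) blast

text \<open>If c were outside the image of \<open>D\<^sub>3\<close>, a functional would vanish on
  that image but not at c. It factors through \<open>D\<^sub>2\<close> by
  \<open>differential_functional\<close>, yet \<open>D\<^sub>2\<close> maps c into the
  ideal.\<close>

lemma exact2: "(\<forall>x. (\<Sum>p\<in>UNIV. D\<^sub>2 x p * c p) \<in> rel_ideal) \<longleftrightarrow>
  (\<exists>d. \<forall>p. c p - (\<Sum>s\<in>UNIV. D\<^sub>3 p s * d s) \<in> rel_ideal)"
proof
  assume "\<exists>d. \<forall>p. c p - (\<Sum>s\<in>UNIV. D\<^sub>3 p s * d s) \<in> rel_ideal"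
  then obtain d where d: "\<And>p. c p - (\<Sum>s\<in>UNIV. D\<^sub>3 p s * d s) \<in> rel_ideal" by blast
  show "\<forall>x. (\<Sum>p\<in>UNIV. D\<^sub>2 x p * c p) \<in> rel_ideal"
  proof
    fix x
    have "(\<Sum>p\<in>UNIV. D\<^sub>2 x p * c p) = (\<Sum>p\<in>UNIV. D\<^sub>2 x p * (c p - (\<Sum>s\<in>UNIV. D\<^sub>3 p s * d s)))
        + (\<Sum>s\<in>UNIV. (\<Sum>p\<in>UNIV. D\<^sub>2 x p * D\<^sub>3 p s) * d s)"
      by (simp only: right_diff_distrib sum_subtractf sum_distrib_left sum_distrib_right mult.assoc
          sum.swap[of "\<lambda>s p. D\<^sub>2 x p * (D\<^sub>3 p s * d s)"] diff_add_cancel)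
    also have "\<dots> \<in> rel_ideal"
      by (intro ideal_closed d D\<^sub>2_D\<^sub>3)
    finally show "(\<Sum>p\<in>UNIV. D\<^sub>2 x p * c p) \<in> rel_ideal" .
  qed
next
  assume c: "\<forall>x. (\<Sum>p\<in>UNIV. D\<^sub>2 x p * c p) \<in> rel_ideal"
  define scale where "scale a z = (\<chi> p. scal a * z $ p)" for a and z :: "('n letter free_alg)^(bool \<times> 'n \<times> 'n)"
  \<comment> \<open>The image of \<open>D\<^sub>3\<close>, enlarged by all vectors with entries in
    the ideal, so that functionals vanishing on S are natural.\<close>
  define S where "S = {z :: ('n letter free_alg)^(bool \<times> 'n \<times> 'n). \<exists>d. \<forall>p. z $ p - (\<Sum>s\<in>UNIV. D\<^sub>3 p s * d s) \<in> rel_ideal}"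
  have vs: "vector_space scale"
    by unfold_locales (simp_all add: scale_def vec_eq_iff distrib_left distrib_right scal_add scal_mult mult.assoc)
  interpret V: vector_space scale by (rule vs)
  have sub: "V.subspace S"
    unfolding V.subspace_def
  proof (intro conjI ballI allI)
    show "0 \<in> S" unfolding S_def by (intro CollectI exI[of _ "\<lambda>_. 0"]) (simp add: ideal_closed)
  next
    fix y z assume "y \<in> S" "z \<in> S"
    then obtain d e where "\<And>p. y $ p - (\<Sum>s\<in>UNIV. D\<^sub>3 p s * d s) \<in> rel_ideal" "\<And>p. z $ p - (\<Sum>s\<in>UNIV. D\<^sub>3 p s * e s) \<in> rel_ideal"
      unfolding S_def by blast
    then have "(y $ p - (\<Sum>s\<in>UNIV. D\<^sub>3 p s * d s)) + (z $ p - (\<Sum>s\<in>UNIV. D\<^sub>3 p s * e s)) \<in> rel_ideal" for p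
      by (intro ideal_closed(2))
    moreover have "(y $ p - (\<Sum>s\<in>UNIV. D\<^sub>3 p s * d s)) + (z $ p - (\<Sum>s\<in>UNIV. D\<^sub>3 p s * e s)) =
        (y + z) $ p - (\<Sum>s\<in>UNIV. D\<^sub>3 p s * (d s + e s))" for p
      by (simp add: distrib_left sum.distrib)
    ultimately show "y + z \<in> S" unfolding S_def by (intro CollectI exI[of _ "\<lambda>s. d s + e s"]) simp
  next
    fix a z assume "z \<in> S"
    then obtain d where "\<And>p. z $ p - (\<Sum>s\<in>UNIV. D\<^sub>3 p s * d s) \<in> rel_ideal" unfolding S_def by blast
    then have "scal a * (z $ p - (\<Sum>s\<in>UNIV. D\<^sub>3 p s * d s)) \<in> rel_ideal" for p
      by (rule ideal_closed(5))
    moreover have "scal a * (z $ p - (\<Sum>s\<in>UNIV. D\<^sub>3 p s * d s)) =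
        scale a z $ p - (\<Sum>s\<in>UNIV. D\<^sub>3 p s * (scal a * d s))" for p
      by (simp add: scale_def right_diff_distrib sum_distrib_left scal_left_commute[of "D\<^sub>3 _ _"])
    ultimately show "scale a z \<in> S" unfolding S_def by (intro CollectI exI[of _ "\<lambda>s. scal a * d s"]) simp
  qed
  show "\<exists>d. \<forall>p. c p - (\<Sum>s\<in>UNIV. D\<^sub>3 p s * d s) \<in> rel_ideal"
  proof (rule ccontr)
    assume "\<not> ?thesis"
    then have "(\<chi> p. c p) \<notin> S" by (simp add: S_def)
    from separating_functional[OF vs sub this]
    obtain g where g: "\<And>u v. g (u + v) = g u + g v" "\<And>a v. g (scale a v) = a * g v"
      "\<And>v. v \<in> S \<Longrightarrow> g v = 0" and gc: "g (\<chi> p. c p) \<noteq> 0" by blast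
    define single where "single p h = (\<chi> r. if r = p then h else 0)" for p :: "bool \<times> 'n \<times> 'n" and h :: "'n letter free_alg"
    \<comment> \<open>The components of g as functions on words.\<close>
    define \<psi> where "\<psi> s i j q = g (single (s, i, j) (mon q))" for s i j q
    have g0: "g 0 = 0" using g(1)[of 0 0] by simp
    have lin_\<psi>: "lin (\<psi> s i j) h = g (single (s, i, j) h)" for s i j h
    proof -
      have "g (single (s, i, j) (x + y)) = g (single (s, i, j) x) + g (single (s, i, j) y)" for x y
        unfolding g(1)[symmetric] by (rule arg_cong[of _ _ g]) (simp add: single_def vec_eq_iff)
      moreover have "g (single (s, i, j) (scal a * x)) = a * g (single (s, i, j) x)" for a x
        unfolding g(2)[symmetric] by (rule arg_cong[of _ _ g]) (simp add: single_def scale_def vec_eq_iff)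
      ultimately show ?thesis
        using linear_eq_lin[of "\<lambda>h. g (single (s, i, j) h)" h] by (simp add: \<psi>_def[abs_def])
    qed
    have g_sum: "g (\<Sum>i\<in>A. f i) = (\<Sum>i\<in>A. g (f i))" for A :: "(bool \<times> 'n \<times> 'n) set" and f
      by (induction A rule: infinite_finite_induct) (simp_all add: g0 g(1))
    have g_eq: "g z = (\<Sum>(s, i, j)\<in>UNIV. lin (\<psi> s i j) (z $ (s, i, j)))" for z
    proof -
      have "z = (\<Sum>p\<in>UNIV. single p (z $ p))"
        by (simp add: vec_eq_iff single_def sum_component)
      then have "g z = (\<Sum>p\<in>UNIV. g (single p (z $ p)))" using g_sum by metis
      then show ?thesis by (simp add: lin_\<psi> split_def)
    qed
    have nat: "natural (\<psi> s i j)" for s i j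
      unfolding natural_iff_lin
    proof
      fix a assume a: "a \<in> rel_ideal"
      have "single (s, i, j) a \<in> S"
        unfolding S_def by (intro CollectI exI[of _ "\<lambda>_. 0"]) (simp add: single_def a ideal_closed)
      then show "lin (\<psi> s i j) a = 0" by (simp add: lin_\<psi> g(3))
    qed
    \<comment> \<open>Evaluate g on column s of \<open>D\<^sub>3\<close> times a word q; this vector
      lies in S.\<close>
    have cycle: "(\<Sum>k\<in>UNIV. \<Sum>l\<in>UNIV. \<Phi> True s k l * \<psi> s k l q) =
      (\<Sum>k\<in>UNIV. \<Sum>l\<in>UNIV. \<Phi> False s k l * row_part \<psi> True s k l q)" for s q
    proof -
      have "(\<chi> p. D\<^sub>3 p s * mon q) \<in> S"
        unfolding S_def
      proof (intro CollectI exI allI)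
        fix p
        have "(\<Sum>t\<in>UNIV. D\<^sub>3 p t * (if t = s then mon q else 0)) = (\<Sum>t\<in>UNIV. if t = s then D\<^sub>3 p t * mon q else 0)"
          by (rule sum.cong[OF refl]) simp
        then show "(\<chi> p. D\<^sub>3 p s * mon q) $ p - (\<Sum>t\<in>UNIV. D\<^sub>3 p t * (if t = s then mon q else 0)) \<in> rel_ideal"
          by (simp add: ideal_closed)
      qed
      then have "0 = (\<Sum>t\<in>UNIV. \<Sum>i\<in>UNIV. \<Sum>j\<in>UNIV. lin (\<psi> t i j) (D\<^sub>3 (t, i, j) s * mon q))"
        using g(3)[of "\<chi> p. D\<^sub>3 p s * mon q"] by (simp add: g_eq sum_triple)
      also have "\<dots> = (\<Sum>i\<in>UNIV. \<Sum>j\<in>UNIV. \<Phi> True s i j * \<psi> s i j q)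
          - (\<Sum>i\<in>UNIV. \<Sum>j\<in>UNIV. \<Sum>m\<in>UNIV. \<Sum>c\<in>UNIV. \<Sum>l\<in>UNIV.
            \<Phi> False s m c * (\<Phi> True s m i * (\<Phi> True s j l * \<psi> (\<not> s) i j (mk (\<not> s) False c l # q))))"
        by (simp add: sum_bool[of _ s] D\<^sub>3_def lin_scal lin_uminus lin_sum sum_distrib_right mult.assoc sum_negf flip: mon_Cons)
      also have "(\<Sum>i\<in>UNIV. \<Sum>j\<in>UNIV. \<Sum>m\<in>UNIV. \<Sum>c\<in>UNIV. \<Sum>l\<in>UNIV.
            \<Phi> False s m c * (\<Phi> True s m i * (\<Phi> True s j l * \<psi> (\<not> s) i j (mk (\<not> s) False c l # q)))) =
          (\<Sum>m\<in>UNIV. \<Sum>c\<in>UNIV. \<Phi> False s m c * row_part \<psi> True s m c q)"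
        by (subst sum_swap_pairs) (simp add: row_part_def sum_distrib_left)
      finally show ?thesis by simp
    qed
    from differential_functional[OF nat cycle natural_zero x\<^sub>0, of False]
    obtain \<phi> where \<phi>: "\<And>x. natural (\<lambda>q. \<phi> (x # q))"
      "\<And>s i j h. tot \<phi> (\<lambda>x. fox ep x (relator False s i j) * h) = lin (\<psi> s i j) h" by blast
    have "g (\<chi> p. c p) = (\<Sum>p\<in>UNIV. tot \<phi> (\<lambda>x. D\<^sub>2 x p * c p))"
      by (simp add: g_eq D\<^sub>2_def split_def \<phi>(2))
    also have "\<dots> = tot \<phi> (\<lambda>x. \<Sum>p\<in>UNIV. D\<^sub>2 x p * c p)" by (simp add: tot_sum)
    also have "\<dots> = 0" using c by (intro tot_ideal \<phi>(1)) blast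
    finally show False using gc by simp
  qed
qed

text \<open>Take a natural functional g not vanishing at h, and extend it by \<phi>(x0 # q) = g(q)
  so that \<phi> kills all relator derivatives. If \<open>gen x\<^sub>0 * h\<close> is in the ideal,
  its derivatives are a boundary, so \<phi> kills them; but \<phi> sends them to g(h), because
  \<open>ep x\<^sub>0 = 0\<close>.\<close>

lemma left_mult_injective:
  assumes "gen x\<^sub>0 * h \<in> rel_ideal" and "ep x\<^sub>0 = 0"
  shows "h \<in> rel_ideal"
proof (rule ccontr)
  assume h: "h \<notin> rel_ideal"
  define scale where "scale a z = scal a * z" for a and z :: "'n letter free_alg"
  have vs: "vector_space scale"
    by unfold_locales (simp_all add: scale_def distrib_left distrib_right scal_add scal_mult mult.assoc)
  interpret V: vector_space scale by (rule vs)
  have "V.subspace rel_ideal"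
    unfolding V.subspace_def scale_def by (auto intro: ideal_closed)
  from separating_functional[OF vs this h]
  obtain g where g: "\<And>u v. g (u + v) = g u + g v" "\<And>a v. g (scal a * v) = a * g v"
      "\<And>v. v \<in> rel_ideal \<Longrightarrow> g v = 0" and gh: "g h \<noteq> 0" unfolding scale_def by blast
  have g_lin: "g a = lin (\<lambda>q. g (mon q)) a" for a
    by (rule linear_eq_lin) (simp_all add: g)
  have nat: "natural (\<lambda>q. g (mon q))"
    unfolding natural_iff_lin using g(3) by (simp flip: g_lin)
  have "\<exists>\<phi>. (\<forall>x. natural (\<lambda>q. \<phi> (x # q))) \<and>
    (\<forall>s i j h. tot \<phi> (\<lambda>x. fox ep x (relator False s i j) * h) = lin (\<lambda>_. 0) h) \<and>
    (True \<longrightarrow> (\<forall>q. \<phi> (x\<^sub>0 # q) = g (mon q)))"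
    by (rule differential_functional[of "\<lambda>_ _ _ _. 0", OF natural_zero _ nat x\<^sub>0]) (simp add: row_part_def)
  then obtain \<phi> where \<phi>: "\<And>x. natural (\<lambda>q. \<phi> (x # q))"
      "\<And>s i j h. tot \<phi> (\<lambda>x. fox ep x (relator False s i j) * h) = 0" "\<And>q. \<phi> (x\<^sub>0 # q) = g (mon q)"
    by (auto simp: lin_def)
  obtain d where d: "\<And>x. fox ep x (gen x\<^sub>0 * h) - (\<Sum>p\<in>UNIV. D\<^sub>2 x p * d p) \<in> rel_ideal"
    using boundary2_fox[OF assms(1)] by (auto simp: boundary2_def)
  have "0 = tot \<phi> (\<lambda>x. fox ep x (gen x\<^sub>0 * h) - (\<Sum>p\<in>UNIV. D\<^sub>2 x p * d p))"
    using tot_ideal[OF \<phi>(1) d] by simp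
  also have "\<dots> = tot \<phi> (\<lambda>x. if x\<^sub>0 = x then h else 0) - (\<Sum>p\<in>UNIV. tot \<phi> (\<lambda>x. D\<^sub>2 x p * d p))"
    by (simp add: tot_diff tot_sum fox_mult fox_gen assms(2) if_distrib[of "\<lambda>a. a * h"] cong: if_cong)
  also have "\<dots> = g h"
    by (simp add: tot_single \<phi> D\<^sub>2_def split_def flip: g_lin)
  finally show False using gh by simp
qed

text \<open>Only injectivity of \<open>D\<^sub>3\<close> remains. Two of its rows suffice: one
  contains a multiple of \<open>gen x\<^sub>0\<close> and a zero, the other a nonzero scalar in the
  other column.\<close>

theorem resolution:
  assumes delta: "\<And>k l. \<Phi> True False k l = (if k = l then 1 else 0)"
    and tp: "\<And>s. tp False s = tp True (\<not> s)"
    and R: "quotient_map R \<pi> rel_ideal" and \<epsilon>: "\<And>a. \<epsilon> (\<pi> a) = character_of ep a"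
  shows "has_finite_free_resolution_of_length_3 R (char_module \<epsilon>)"
proof (rule quotient_map.resolution_from_matrices[OF R, where e = "character_of ep" and D\<^sub>1 = D\<^sub>1 and D\<^sub>2 = D\<^sub>2 and D\<^sub>3 = D\<^sub>3])
  show "range (character_of (ep :: 'n letter \<Rightarrow> complex)) = UNIV"
    by (rule surjI[of _ scal]) simp
  fix c :: "bool \<Rightarrow> 'n letter free_alg" and s
  assume c: "\<And>p. (\<Sum>s\<in>UNIV. D\<^sub>3 p s * c s) \<in> rel_ideal"
  let ?a = "tp True True" and ?b = "tp True False"
  have ab: "?a \<noteq> ?b" by (rule tp_neq) simp
  have x0: "x\<^sub>0 = mk True False ?a ?b"
  proof -
    have "(\<lambda>\<kappa>. tp \<kappa> False) = (\<lambda>_. ?b)(False := ?a)"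
    proof
      fix \<kappa>
      show "tp \<kappa> False = ((\<lambda>_. ?b)(False := ?a)) \<kappa>"
        using tp[of False] by (cases \<kappa>) simp_all
    qed
    then show ?thesis by (simp only: x\<^sub>0_def mk_def)
  qed
  have ep0: "ep x\<^sub>0 = 0" using ab by (simp add: x0 ep_mk)
  \<comment> \<open>The form for rows and sign False is the identity and row a of \<Phi> False False
    is concentrated at a, so a single summand is left.\<close>
  have D: "D\<^sub>3 (True, ?a, ?b) False = - (scal (\<Phi> False False ?a ?a) * gen x\<^sub>0)"
  proof -
    have "(\<Sum>m\<in>UNIV. \<Sum>c\<in>UNIV. \<Sum>l\<in>UNIV.
      scal (\<Phi> False False m c * \<Phi> True False m ?a * \<Phi> True False ?b l) * gen (mk True False c l)) =
      (\<Sum>m\<in>UNIV. \<Sum>c\<in>UNIV. \<Sum>l\<in>UNIV. if (m = ?a \<and> c = ?a) \<and> l = ?b then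
        scal (\<Phi> False False ?a ?a) * gen (mk True False ?a ?b) else 0)"
      using lead_row[where \<kappa> = False and s = False] by (intro sum.cong refl) (auto simp: delta tp)
    also have "\<dots> = scal (\<Phi> False False ?a ?a) * gen (mk True False ?a ?b)"
      by (rule sum_delta3)
    finally show ?thesis by (simp add: D\<^sub>3_def x0)
  qed
  have "- (scal (\<Phi> False False ?a ?a) * gen x\<^sub>0) * c False \<in> rel_ideal"
    using c[of "(True, ?a, ?b)"] lead_row[where \<kappa> = True and s = True and l = ?b] ab D by (simp add: sum_bool[of _ True] D\<^sub>3_def)
  then have "scal (- 1 / \<Phi> False False ?a ?a) * (- (scal (\<Phi> False False ?a ?a) * gen x\<^sub>0) * c False) \<in> rel_ideal"
    by (rule ideal_closed(5))
  moreover have "\<Phi> False False ?a ?a \<noteq> 0" using lead[of False False] by (simp add: tp)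
  then have "scal (- 1 / \<Phi> False False ?a ?a) * (- (scal (\<Phi> False False ?a ?a) * gen x\<^sub>0) * c False) = gen x\<^sub>0 * c False"
    by (simp add: mult.assoc[symmetric] scal_mult[symmetric] scal_uminus)
  ultimately have F: "c False \<in> rel_ideal" using left_mult_injective ep0 by simp
  \<comment> \<open>Row (True, a, a) now yields the other coordinate, whose coefficient is the
    leading scalar.\<close>
  have "scal (\<Phi> True True ?a ?a) * c True + D\<^sub>3 (True, ?a, ?a) False * c False \<in> rel_ideal"
    using c[of "(True, ?a, ?a)"] by (simp add: sum_bool[of _ True] D\<^sub>3_def)
  then have "scal (\<Phi> True True ?a ?a) * c True \<in> rel_ideal"
    using two_sided_diff_mem_iff[OF two_sided_rel_ideal, of "scal (\<Phi> True True ?a ?a) * c True + D\<^sub>3 (True, ?a, ?a) False * c False" "scal (\<Phi> True True ?a ?a) * c True"]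
      ideal_closed(5)[OF F] by simp
  then have "scal (1 / \<Phi> True True ?a ?a) * (scal (\<Phi> True True ?a ?a) * c True) \<in> rel_ideal"
    by (rule ideal_closed(5))
  then have "c True \<in> rel_ideal" using lead[of True True]
    by (simp add: mult.assoc[symmetric] scal_mult[symmetric])
  with F show "c s \<in> rel_ideal" by (cases s) auto
qed (use exact0 exact1 exact2 \<epsilon> in \<open>simp_all add: character_of_add character_of_mult boundary2_def\<close>)

end

section \<open>Eigenvectors inside an invariant subspace\<close>

section \<open>Eigenvectors in invariant subspaces\<close>

text \<open>The vector p(M) x. The cut-off n can be any bound for the degree of p.\<close>

definition poly_apply :: "complex^'n^'n \<Rightarrow> complex^'n \<Rightarrow> nat \<Rightarrow> complex poly \<Rightarrow> complex^'n"
  where "poly_apply M x n p = (\<Sum>i\<le>n. poly.coeff p i *s (((*v) M ^^ i) x))"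

lemma poly_apply_Suc: "Polynomial.degree p \<le> n \<Longrightarrow> poly_apply M x (Suc n) p = poly_apply M x n p"
  by (simp add: poly_apply_def coeff_eq_0)

lemma poly_apply_add: "poly_apply M x n (p + q) = poly_apply M x n p + poly_apply M x n q"
  by (simp add: poly_apply_def sum.distrib vec.scale_left_distrib)

lemma poly_apply_smult: "poly_apply M x n (Polynomial.smult c p) = c *s poly_apply M x n p"
  by (simp add: poly_apply_def vec.scale_sum_right)

lemma poly_apply_pCons_0: "poly_apply M x (Suc n) (pCons 0 p) = M *v poly_apply M x n p"
proof -
  have "poly_apply M x (Suc n) (pCons 0 p) = (\<Sum>i\<le>n. poly.coeff p i *s (M *v (((*v) M ^^ i) x)))"
    unfolding poly_apply_def by (subst sum.atMost_Suc_shift) simp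
  also have "\<dots> = M *v poly_apply M x n p"
    unfolding poly_apply_def matrix_vector_mult_def
    by (simp add: vec_eq_iff sum_distrib_left sum_component mult.left_commute sum.swap[of _ "{..n}"])
  finally show ?thesis .
qed

lemma annihilating_poly:
  fixes M :: "complex^'n^'n"
  shows "\<exists>p n. p \<noteq> 0 \<and> Polynomial.degree p \<le> n \<and> poly_apply M x n p = 0"
proof -
  let ?N = "CARD('n)" and ?f = "\<lambda>i. ((*v) M ^^ i) x"
  have "\<exists>u. (\<exists>i\<le>?N. u i \<noteq> 0) \<and> (\<Sum>i\<le>?N. u i *s ?f i) = 0"
  proof (cases "inj_on ?f {..?N}")
    case False
    then obtain i j where ij: "i \<le> ?N" "j \<le> ?N" "i \<noteq> j" "?f i = ?f j" by (auto simp: inj_on_def)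
    let ?u = "\<lambda>k. if k = i then 1 else if k = j then - 1 else (0::complex)"
    have "(\<Sum>k\<le>?N. ?u k *s ?f k) = (\<Sum>k\<le>?N. (if k = i then ?f k else 0) - (if k = j then ?f k else 0))"
      using ij by (intro sum.cong) auto
    also have "\<dots> = 0" using ij by (simp add: sum_subtractf)
    finally show ?thesis using ij by (intro exI[of _ ?u]) auto
  next
    case True
    let ?S = "?f ` {..?N}"
    have "card ?S = Suc ?N" using True by (simp add: card_image)
    then have "vec.dependent ?S"
      using vec.independent_card_le_dim[of ?S UNIV] by (auto simp: card_cart_basis)
    then obtain u where u: "\<exists>v\<in>?S. u v \<noteq> 0" "(\<Sum>v\<in>?S. u v *s v) = 0"
      by (subst (asm) vec.dependent_finite) auto
    then show ?thesis
      by (intro exI[of _ "\<lambda>i. u (?f i)"]) (auto simp: sum.reindex[OF True])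
  qed
  then obtain u where u: "\<exists>i\<le>?N. u i \<noteq> 0" "(\<Sum>i\<le>?N. u i *s ?f i) = 0" by blast
  define p where "p = (\<Sum>i\<le>?N. Polynomial.monom (u i) i)"
  have co: "poly.coeff p i = (if i \<le> ?N then u i else 0)" for i
    by (simp add: p_def coeff_sum)
  then have "p \<noteq> 0" using u(1) by (metis coeff_0)
  moreover have "Polynomial.degree p \<le> ?N" by (rule degree_le) (simp add: co)
  moreover have "poly_apply M x ?N p = 0" using u(2) by (simp add: poly_apply_def co)
  ultimately show ?thesis by blast
qed

text \<open>Take p of least degree with p(M) x = 0 and split off a root z. The cofactor q gives q(M)
  x, which is nonzero by minimality, an eigenvector for z, and in S since S is invariant.\<close>

lemma eigenvector_exists:
  fixes M :: "complex^'n^'n"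
  assumes x: "x \<in> S" "x \<noteq> 0" and sub: "vec.subspace S" and inv: "\<And>y. y \<in> S \<Longrightarrow> M *v y \<in> S"
  shows "\<exists>y c. y \<in> S \<and> y \<noteq> 0 \<and> M *v y = c *s y"
proof -
  have mem: "poly_apply M x n p \<in> S" for n p
  proof -
    have "((*v) M ^^ i) x \<in> S" for i by (induction i) (simp_all add: x inv)
    then show ?thesis unfolding poly_apply_def
      by (intro vec.subspace_sum[OF sub] vec.subspace_scale[OF sub])
  qed
  let ?P = "\<lambda>d. \<exists>p n. p \<noteq> 0 \<and> Polynomial.degree p = d \<and> Polynomial.degree p \<le> n \<and> poly_apply M x n p = 0"
  have "\<exists>d. ?P d" using annihilating_poly[of M x] by blast
  then obtain d where d: "?P d" and least: "\<And>d'. d' < d \<Longrightarrow> \<not> ?P d'"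
    using exists_least_iff[of ?P] by blast
  then obtain p n where p: "p \<noteq> 0" "Polynomial.degree p = d" "d \<le> n" "poly_apply M x n p = 0" by blast
  have const: "poly_apply M x n [:c:] = c *s x" for c n
    by (induction n) (simp_all add: poly_apply_def)
  have "\<not> constant (poly p)"
  proof
    assume "constant (poly p)"
    then have "Polynomial.degree p = 0" by (simp add: constant_degree)
    then obtain c where "p = [:c:]" by (metis degree_eq_zeroE)
    then show False using p const[of n c] x(2) by simp
  qed
  then obtain z where "poly p z = 0" using fundamental_theorem_of_algebra by blast
  then obtain q where q: "p = [:- z, 1:] * q" by (metis poly_eq_0_iff_dvd dvdE)
  then have "q \<noteq> 0" using p by auto
  then have dq: "Polynomial.degree p = Suc (Polynomial.degree q)" unfolding q by (subst degree_mult_eq) auto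
  then obtain m where n: "n = Suc m" using p by (cases n) auto
  have pq: "p = pCons 0 q + Polynomial.smult (- z) q" by (simp add: q)
  have dm: "Polynomial.degree q \<le> m" using p dq n by simp
  have "poly_apply M x n p = M *v poly_apply M x m q + (- z) *s poly_apply M x m q"
    unfolding n pq by (simp only: poly_apply_add poly_apply_smult poly_apply_pCons_0 poly_apply_Suc[OF dm])
  then have "0 = M *v poly_apply M x m q + (- z) *s poly_apply M x m q"
    using p(4) by simp
  then have "M *v poly_apply M x m q = z *s poly_apply M x m q"
    by (simp add: vec.scale_minus_left eq_neg_iff_add_eq_0)
  moreover have "poly_apply M x m q \<noteq> 0"
    using least[of "Polynomial.degree q"] \<open>q \<noteq> 0\<close> dq p n by auto
  ultimately show ?thesis using mem by blast
qed

section \<open>Change of basis in the matrix relations, and the resolution for cosovereign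
  algebras\<close>

section \<open>Matrices over free algebras\<close>

definition mcong :: "'a::ring_1 set \<Rightarrow> 'a^'n^'n \<Rightarrow> 'a^'n^'n \<Rightarrow> bool"
  where "mcong J A B \<longleftrightarrow> (\<forall>i j. A $ i $ j - B $ i $ j \<in> J)"

lemma mcong_mult_left:
  assumes J: "two_sided J" and AB: "mcong J A B"
  shows "mcong J (C ** A) (C ** B)"
  unfolding mcong_def
proof (intro allI)
  fix i j
  have "(C ** A) $ i $ j - (C ** B) $ i $ j = (\<Sum>k\<in>UNIV. C $ i $ k * (A $ k $ j - B $ k $ j))"
    by (simp add: matrix_matrix_mult_def sum_subtractf right_diff_distrib)
  also have "\<dots> \<in> J"
    using AB by (intro two_sided_sum[OF J] two_sided_mult_left[OF J]) (simp add: mcong_def)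
  finally show "(C ** A) $ i $ j - (C ** B) $ i $ j \<in> J" .
qed

lemma mcong_mult_right:
  assumes J: "two_sided J" and AB: "mcong J A B"
  shows "mcong J (A ** C) (B ** C)"
  unfolding mcong_def
proof (intro allI)
  fix i j
  have "(A ** C) $ i $ j - (B ** C) $ i $ j = (\<Sum>k\<in>UNIV. (A $ i $ k - B $ i $ k) * C $ k $ j)"
    by (simp add: matrix_matrix_mult_def sum_subtractf left_diff_distrib)
  also have "\<dots> \<in> J"
    using AB by (intro two_sided_sum[OF J] two_sided_mult_right[OF J]) (simp add: mcong_def)
  finally show "(A ** C) $ i $ j - (B ** C) $ i $ j \<in> J" .
qed

lemma scal_mat_mult: "scal_mat (A ** B) = scal_mat A ** scal_mat B"
  by (simp add: scal_mat_def matrix_matrix_mult_def vec_eq_iff scal_sum scal_mult)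

lemma scal_mat_1 [simp]: "scal_mat (mat 1) = mat 1"
  by (simp add: scal_mat_def mat_def vec_eq_iff)

lemma transpose_scal_mat: "transpose (scal_mat A) = scal_mat (transpose A)"
  by (simp add: scal_mat_def transpose_def)

lemma sandwich_nth:
  fixes W :: "('g free_alg)^'n^'n"
  shows "(scal_mat A ** W ** scal_mat B) $ i $ j = (\<Sum>k\<in>UNIV. \<Sum>l\<in>UNIV. scal (A $ i $ k * B $ l $ j) * W $ k $ l)"
proof -
  have *: "scal a * w * scal b = scal (a * b) * w" for a b and w :: "'g free_alg"
    by (metis scal_mult mult.assoc scal_commute)
  have "(scal_mat A ** W ** scal_mat B) $ i $ j = (\<Sum>l\<in>UNIV. \<Sum>k\<in>UNIV. scal (A $ i $ k) * W $ k $ l * scal (B $ l $ j))"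
    by (simp add: matrix_matrix_mult_def scal_mat_def sum_distrib_right)
  then show ?thesis unfolding * by (subst sum.swap)
qed

lemma transpose_conj: "transpose (scal_mat A ** W ** scal_mat B) =
  scal_mat (transpose B) ** transpose W ** scal_mat (transpose A)" for W :: "('g free_alg)^'n^'n"
proof -
  have "transpose (scal_mat A ** W ** scal_mat B) $ i $ j =
      (scal_mat (transpose B) ** transpose W ** scal_mat (transpose A)) $ i $ j" for i j
  proof -
    have "transpose (scal_mat A ** W ** scal_mat B) $ i $ j = (\<Sum>k\<in>UNIV. \<Sum>l\<in>UNIV. scal (A $ j $ k * B $ l $ i) * W $ k $ l)"
      unfolding sandwich_nth[symmetric] by (simp add: transpose_def)
    also have "\<dots> = (\<Sum>l\<in>UNIV. \<Sum>k\<in>UNIV. scal (B $ l $ i * A $ j $ k) * W $ k $ l)"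
      by (subst sum.swap) (simp add: mult.commute)
    also have "\<dots> = (scal_mat (transpose B) ** transpose W ** scal_mat (transpose A)) $ i $ j"
      unfolding sandwich_nth by (simp add: transpose_def)
    finally show ?thesis .
  qed
  then show ?thesis by (simp add: vec_eq_iff)
qed

text \<open>The defining relations modulo J with G in the role of the inverse of F. The last two are
  freed of inverses on the left, to match \<open>relator\<close> and to behave well under
  conjugation.\<close>

definition rels :: "'g free_alg set \<Rightarrow> complex^'n^'n \<Rightarrow> complex^'n^'n \<Rightarrow>
    ('g free_alg)^'n^'n \<Rightarrow> ('g free_alg)^'n^'n \<Rightarrow> bool"
  where "rels J F G u v \<longleftrightarrow> mcong J (u ** transpose v) (mat 1) \<and> mcong J (transpose v ** u) (mat 1) \<and>
    mcong J (v ** scal_mat F ** transpose u) (scal_mat F) \<and> mcong J (transpose u ** scal_mat G ** v) (scal_mat G)"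

text \<open>Replacing v by P v Q and u by the contragredient transform conjugates F and G; all inner
  factors P Q cancel.\<close>

lemma rels_conjugate:
  fixes F G P Q :: "complex^'n^'n" and u v :: "('g free_alg)^'n^'n"
  assumes J: "two_sided J" and r: "rels J F G u v" and P: "P ** Q = mat 1" "Q ** P = mat 1"
  shows "rels J (P ** F ** Q) (P ** G ** Q)
    (scal_mat (transpose Q) ** u ** scal_mat (transpose P)) (scal_mat P ** v ** scal_mat Q)"
proof -
  have PQ: "scal_mat P ** scal_mat Q = mat 1" "scal_mat Q ** scal_mat P = mat 1"
    "scal_mat (transpose P) ** scal_mat (transpose Q) = mat 1" "scal_mat (transpose Q) ** scal_mat (transpose P) = mat 1"
    using P by (simp_all flip: scal_mat_mult matrix_transpose_mul)
  have cancel: "A ** scal_mat P ** scal_mat Q = A" "A ** scal_mat Q ** scal_mat P = A"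
    "A ** scal_mat (transpose P) ** scal_mat (transpose Q) = A" "A ** scal_mat (transpose Q) ** scal_mat (transpose P) = A"
    for A :: "('g free_alg)^'n^'n"
    by (simp_all add: PQ flip: matrix_mul_assoc)
  let ?u = "scal_mat (transpose Q) ** u ** scal_mat (transpose P)" and ?v = "scal_mat P ** v ** scal_mat Q"
  have t: "transpose ?u = scal_mat P ** transpose u ** scal_mat Q"
    "transpose ?v = scal_mat (transpose Q) ** transpose v ** scal_mat (transpose P)"
    by (simp_all add: transpose_conj)
  have c: "mcong J (scal_mat A ** W ** scal_mat B) (scal_mat A ** Z ** scal_mat B)" if "mcong J W Z"
    for A B :: "complex^'n^'n" and W Z :: "('g free_alg)^'n^'n"
    using that by (intro mcong_mult_left mcong_mult_right J)
  show ?thesis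
    unfolding rels_def t
    using r[unfolded rels_def] c[of "u ** transpose v" "mat 1" "transpose Q" "transpose P"]
      c[of "transpose v ** u" "mat 1" "transpose Q" "transpose P"]
      c[of "v ** scal_mat F ** transpose u" "scal_mat F" P Q]
      c[of "transpose u ** scal_mat G ** v" "scal_mat G" P Q]
    by (simp add: scal_mat_mult matrix_mul_assoc cancel PQ)
qed

definition map_mat :: "('a \<Rightarrow> 'b) \<Rightarrow> 'a^'n^'m \<Rightarrow> 'b^'n^'m"
  where "map_mat h A = (\<chi> i j. h (A $ i $ j))"

lemma map_mat_mult: "map_mat (subst \<sigma>) (A ** B) = map_mat (subst \<sigma>) A ** map_mat (subst \<sigma>) B"
  by (simp add: map_mat_def matrix_matrix_mult_def vec_eq_iff subst_sum subst_mult)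

lemma map_mat_subst_simps [simp]:
  "map_mat (subst \<sigma>) (scal_mat C) = scal_mat C" "map_mat (subst \<sigma>) (mat 1) = mat 1"
  "map_mat (subst \<sigma>) (transpose A) = transpose (map_mat (subst \<sigma>) A)"
  by (simp_all add: map_mat_def scal_mat_def mat_def transpose_def vec_eq_iff)

lemma map_mat_char_mult: "map_mat (character_of \<phi>) (A ** B) = map_mat (character_of \<phi>) A ** map_mat (character_of \<phi>) B"
  by (simp add: map_mat_def matrix_matrix_mult_def vec_eq_iff character_of_sum character_of_mult)

lemma map_mat_char_scal [simp]: "map_mat (character_of \<phi>) (scal_mat C) = C"
  by (simp add: map_mat_def scal_mat_def vec_eq_iff)

lemma entries_subset_iff: "entries A \<subseteq> S \<longleftrightarrow> (\<forall>i j. A $ i $ j \<in> S)"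
  by (auto simp: entries_def)

lemma matrix_inv_mult:
  assumes "invertible A"
  shows "A ** matrix_inv A = mat 1" "matrix_inv A ** A = mat 1"
  using someI_ex[OF assms[unfolded invertible_def]] by (simp_all add: matrix_inv_def)

lemma cosov_rels_iff:
  fixes F :: "complex^'n^'n" and u v :: "('g free_alg)^'n^'n"
  assumes J: "two_sided J" and F: "invertible F"
  shows "(entries (u ** transpose v - mat 1) \<union> entries (transpose v ** u - mat 1) \<union>
      entries (v ** scal_mat F ** transpose u ** scal_mat (matrix_inv F) - mat 1) \<union>
      entries (scal_mat F ** transpose u ** scal_mat (matrix_inv F) ** v - mat 1) \<subseteq> J) \<longleftrightarrow>
    rels J F (matrix_inv F) u v"
proof -
  have inv: "scal_mat F ** scal_mat (matrix_inv F) = mat 1" "scal_mat (matrix_inv F) ** scal_mat F = mat 1"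
    using F by (simp_all add: matrix_inv_mult flip: scal_mat_mult)
  have ent: "entries (A - B) \<subseteq> J \<longleftrightarrow> mcong J A B" for A B :: "('g free_alg)^'n^'n"
    by (simp add: entries_subset_iff mcong_def)
  have "mcong J (v ** scal_mat F ** transpose u ** scal_mat (matrix_inv F)) (mat 1) \<longleftrightarrow>
      mcong J (v ** scal_mat F ** transpose u) (scal_mat F)"
    using mcong_mult_right[OF J, of "v ** scal_mat F ** transpose u ** scal_mat (matrix_inv F)" "mat 1" "scal_mat F"]
      mcong_mult_right[OF J, of "v ** scal_mat F ** transpose u" "scal_mat F" "scal_mat (matrix_inv F)"]
    by (auto simp: inv simp flip: matrix_mul_assoc)
  moreover have "mcong J (scal_mat F ** transpose u ** scal_mat (matrix_inv F) ** v) (mat 1) \<longleftrightarrow>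
      mcong J (transpose u ** scal_mat (matrix_inv F) ** v) (scal_mat (matrix_inv F))"
    using mcong_mult_left[OF J, of "scal_mat F ** transpose u ** scal_mat (matrix_inv F) ** v" "mat 1" "scal_mat (matrix_inv F)"]
      mcong_mult_left[OF J, of "transpose u ** scal_mat (matrix_inv F) ** v" "scal_mat (matrix_inv F)" "scal_mat F"]
    by (auto simp: inv matrix_mul_assoc)
  ultimately show ?thesis by (auto simp: ent rels_def)
qed

text \<open>If row a of P is a left eigenvector of F, then row a of the conjugate of F is the
  eigenvalue times the unit row. This provides \<open>lead_row\<close>.\<close>

lemma matrix_mult_row:
  fixes P F :: "complex^'n^'n"
  assumes "\<And>l. P $ a $ l = y $ l" and "transpose F *v y = c *s y" and "P ** Q = mat 1"
  shows "(P ** F ** Q) $ a $ l = (if l = a then c else 0)"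
proof -
  have row: "(P ** F) $ a $ m = c * P $ a $ m" for m
    using arg_cong[OF assms(2), of "\<lambda>v. v $ m"]
    by (simp add: matrix_matrix_mult_def vector_matrix_mult_def assms(1) mult.commute)
  have "(P ** F ** Q) $ a $ l = (\<Sum>m\<in>UNIV. (P ** F) $ a $ m * Q $ m $ l)"
    by (simp add: matrix_matrix_mult_def[of "P ** F"])
  also have "\<dots> = c * (P ** Q) $ a $ l"
    unfolding row by (simp add: matrix_matrix_mult_def sum_distrib_left mult.assoc)
  also have "\<dots> = (if l = a then c else 0)" by (simp add: assms(3) mat_def)
  finally show ?thesis .
qed

lemma row_replacement_inverse:
  fixes y :: "complex^'n"
  assumes "y $ a \<noteq> 0"
  defines "P \<equiv> \<chi> i j. if i = a then y $ j else if i = j then 1 else 0"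
  obtains Q where "P ** Q = mat 1" "Q ** P = mat 1"
proof -
  define Q :: "complex^'n^'n" where "Q = (\<chi> i j. if i = a then if j = a then 1 / y $ a else - y $ j / y $ a else if i = j then 1 else 0)"
  have prod: "(Q ** P) $ i $ l = (\<Sum>j\<in>UNIV. Q $ i $ j * P $ j $ l)" for i l
    by (simp add: matrix_matrix_mult_def)
  have "(Q ** P) $ i $ l = mat 1 $ i $ l" for i l
  proof (cases "i = a")
    case False
    then have "(Q ** P) $ i $ l = (\<Sum>j\<in>UNIV. if i = j then P $ j $ l else 0)"
      unfolding prod by (intro sum.cong) (auto simp: Q_def)
    then show ?thesis using False by (simp add: P_def mat_def)
  next
    case True
    have "(Q ** P) $ i $ l = (\<Sum>j\<in>UNIV. (if j = a then y $ l / y $ a else 0) + (if j = l then if l = a then 0 else - y $ l / y $ a else 0))"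
      unfolding prod using True assms(1) by (intro sum.cong) (auto simp: Q_def P_def)
    also have "\<dots> = mat 1 $ i $ l"
      using assms(1) True by (auto simp: sum.distrib mat_def)
    finally show ?thesis .
  qed
  then have "Q ** P = mat 1" by (simp add: vec_eq_iff)
  moreover from this have "P ** Q = mat 1" by (simp add: matrix_left_right_inverse)
  ultimately show thesis using that by blast
qed

definition letter_u :: "('n letter free_alg)^'n^'n"
  where "letter_u = (\<chi> i j. gen (mk True True i j))"

definition letter_v :: "('n letter free_alg)^'n^'n"
  where "letter_v = (\<chi> i j. gen (mk False True i j))"

text \<open>For \<kappa> = s the relations involve F or G; for \<kappa> \<noteq> s they are u v^t =
  1 and v^t u = 1, with identity form.\<close>

definition cosov_forms :: "complex^'n^'n \<Rightarrow> complex^'n^'n \<Rightarrow> bool \<Rightarrow> bool \<Rightarrow> 'n \<Rightarrow> 'n \<Rightarrow> complex"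
  where "cosov_forms F G \<kappa> s k l = (if \<kappa> = s then if \<kappa> then G $ k $ l else F $ k $ l else if k = l then 1 else 0)"

lemma cosov_forms_inverse:
  assumes "F ** G = mat 1" "G ** F = mat 1"
  shows "(\<Sum>l\<in>UNIV. cosov_forms F G \<kappa> s k l * cosov_forms F G (\<not> \<kappa>) (\<not> s) l m) = (if k = m then 1 else 0)"
proof (cases "\<kappa> = s")
  case True
  then show ?thesis
    using arg_cong[OF assms(1), of "\<lambda>A. A $ k $ m"] arg_cong[OF assms(2), of "\<lambda>A. A $ k $ m"]
    by (cases s) (simp_all add: cosov_forms_def matrix_matrix_mult_def mat_def)
next
  case False
  then have "(\<Sum>l\<in>UNIV. cosov_forms F G \<kappa> s k l * cosov_forms F G (\<not> \<kappa>) (\<not> s) l m) =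
      (\<Sum>l\<in>UNIV. if l = k then (if l = m then 1 else 0) else 0)"
    by (intro sum.cong) (auto simp: cosov_forms_def)
  then show ?thesis by simp
qed

text \<open>A left eigenvector of F, placed as row a of a base change, makes the conjugate F'
  satisfy \<open>forms\<close>. The substitutions \<sigma> and \<tau> are inverse to each other and
  exchange the two ideals, so R is also the quotient by \<open>rel_ideal\<close>, with matching
  counits.\<close>

theorem cosov_resolution:
  fixes F :: "complex^'n^'n" and R :: "('r, 'x) ring_scheme"
  assumes n: "CARD('n) \<ge> 2" and F: "invertible F"
    and Q: "quotient_map R \<pi> (cosov_ideal F)"
    and \<epsilon>: "\<And>a. \<epsilon> (\<pi> a) = character_of cosov_counit_gen a"
  shows "has_finite_free_resolution_of_length_3 R (char_module \<epsilon>)"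
proof -
  interpret Q: quotient_map R \<pi> "cosov_ideal F" by (rule Q)
  define G where "G = matrix_inv F"
  have FG: "F ** G = mat 1" "G ** F = mat 1" using F by (simp_all add: G_def matrix_inv_mult)
  have "(\<chi> i. 1) \<noteq> (0 :: complex^'n)" by (simp add: vec_eq_iff)
  then obtain y c where y: "y \<noteq> 0" "transpose F *v y = c *s y"
    using eigenvector_exists[of "\<chi> i. 1" UNIV "transpose F"] by auto
  have yG: "y = c *s (transpose G *v y)"
  proof -
    have "y = transpose G *v (transpose F *v y)"
      using FG by (simp only: matrix_vector_mul_assoc flip: matrix_transpose_mul) (simp add: transpose_mat)
    also have "\<dots> = c *s (transpose G *v y)" unfolding y(2) by (rule vec.linear_scale[OF matrix_vector_mul_linear_gen])
    finally show ?thesis .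
  qed
  then have c: "c \<noteq> 0" using y(1) by auto
  have yG': "transpose G *v y = (1 / c) *s y"
    by (subst (2) yG) (simp add: c)
  obtain a where a: "y $ a \<noteq> 0" using y(1) by (auto simp: vec_eq_iff)
  \<comment> \<open>The second index serves as the leading one for the identity forms; it has to
    differ from a.\<close>
  obtain b where b: "b \<noteq> a"
  proof -
    have "(UNIV :: 'n set) \<noteq> {a}" using n by (metis card.empty card.insert empty_iff finite.emptyI numeral_le_one_iff One_nat_def semiring_norm(69))
    then show thesis using that by auto
  qed
  define P :: "complex^'n^'n" where "P = (\<chi> i j. if i = a then y $ j else if i = j then 1 else 0)"
  obtain P' where P': "P ** P' = mat 1" "P' ** P = mat 1"
    using row_replacement_inverse[OF a] unfolding P_def by blast
  define F' where "F' = P ** F ** P'"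
  define G' where "G' = P ** G ** P'"
  have rowP: "P $ a $ l = y $ l" for l by (simp add: P_def)
  have F'a: "F' $ a $ l = (if l = a then c else 0)" for l
    unfolding F'_def by (rule matrix_mult_row[OF rowP y(2) P'(1)])
  have G'a: "G' $ a $ l = (if l = a then 1 / c else 0)" for l
    unfolding G'_def by (rule matrix_mult_row[OF rowP yG' P'(1)])
  have FG': "F' ** G' = mat 1" "G' ** F' = mat 1"
  proof -
    have "F' ** G' = P ** (F ** (P' ** P) ** G) ** P'" by (simp only: F'_def G'_def matrix_mul_assoc)
    also have "\<dots> = mat 1" using FG P' by simp
    finally show "F' ** G' = mat 1" .
    then show "G' ** F' = mat 1" by (simp add: matrix_left_right_inverse)
  qed
  \<comment> \<open>Index a leads for F' and G', whose rows at a are multiples of unit rows; for the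
    identity forms any index would do, and b is taken.\<close>
  let ?\<Phi> = "cosov_forms F' G'" and ?tp = "\<lambda>\<kappa> s :: bool. if \<kappa> = s then a else b"
  interpret forms ?\<Phi> ?tp
  proof
    show "(\<Sum>l\<in>UNIV. ?\<Phi> \<kappa> s k l * ?\<Phi> (\<not> \<kappa>) (\<not> s) l m) = (if k = m then 1 else 0)" for \<kappa> s k m
      by (rule cosov_forms_inverse[OF FG'])
    show "?\<Phi> \<kappa> s (?tp \<kappa> s) (?tp \<kappa> s) \<noteq> 0" for \<kappa> s
      using c by (simp add: cosov_forms_def F'a G'a)
    show "?\<Phi> \<kappa> s (?tp \<kappa> s) l = 0" if "l \<noteq> ?tp \<kappa> s" for l \<kappa> s
      using that by (auto simp: cosov_forms_def F'a G'a split: if_splits)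
    show "?tp \<kappa> s \<noteq> ?tp \<kappa> t" if "s \<noteq> t" for s t \<kappa>
      using that b by (cases \<kappa>; cases s; cases t) auto
  qed
  have rel: "relator False True i j = (letter_u ** transpose letter_v - mat 1) $ i $ j"
    "relator True False i j = (transpose letter_v ** letter_u - mat 1) $ i $ j"
    "relator False False i j = (letter_v ** scal_mat F' ** transpose letter_u - scal_mat F') $ i $ j"
    "relator True True i j = (transpose letter_u ** scal_mat G' ** letter_v - scal_mat G') $ i $ j" for i j
  proof -
    have delta: "(\<Sum>k\<in>UNIV. \<Sum>l\<in>UNIV. scal (if k = l then 1 else 0) * g k l) = (\<Sum>k\<in>UNIV. g k k)"
      for g :: "'n \<Rightarrow> 'n \<Rightarrow> 'n letter free_alg"
      by (rule sum.cong[OF refl]) (simp add: scal_if if_distrib[of "\<lambda>z. z * _"] cong: if_cong)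
    have triple: "(A ** scal_mat C ** B) $ i $ j = (\<Sum>k\<in>UNIV. \<Sum>l\<in>UNIV. scal (C $ k $ l) * (A $ i $ k * B $ l $ j))"
      for A B :: "('n letter free_alg)^'n^'n" and C :: "complex^'n^'n"
      by (simp add: matrix_matrix_mult_def scal_mat_def sum_distrib_right mult.assoc scal_left_commute[of "A $ _ $ _"])
         (rule sum.swap)
    show "relator False True i j = (letter_u ** transpose letter_v - mat 1) $ i $ j"
      "relator True False i j = (transpose letter_v ** letter_u - mat 1) $ i $ j"
      by (simp_all add: relator_def cosov_forms_def delta)
         (simp_all add: matrix_matrix_mult_def transpose_def letter_u_def letter_v_def mat_def mk_True)
    show "relator False False i j = (letter_v ** scal_mat F' ** transpose letter_u - scal_mat F') $ i $ j"
      "relator True True i j = (transpose letter_u ** scal_mat G' ** letter_v - scal_mat G') $ i $ j"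
      by (simp_all add: relator_def cosov_forms_def triple)
         (simp_all add: transpose_def letter_u_def letter_v_def scal_mat_def mk_True)
  qed
  have rels_core: "rels rel_ideal F' G' letter_u letter_v"
    unfolding rels_def mcong_def
    by (simp only: vector_minus_component[symmetric] rel[symmetric] relator_in_ideal simp_thms)
  have J: "two_sided (cosov_ideal F)" unfolding cosov_ideal_def by (rule two_sided_ideal_of)
  have rels_cosov: "rels (cosov_ideal F) F G cosov_u cosov_v"
    unfolding G_def by (subst cosov_rels_iff[OF J F, symmetric])
      (auto simp: cosov_ideal_def cosov_relators_def Let_def intro: ideal_of_base)
  \<comment> \<open>The base change of \<open>rels_conjugate\<close>; TU and TV undo SU and
    SV.\<close>
  define SU where "SU = scal_mat (transpose P') ** cosov_u ** scal_mat (transpose P)"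
  define SV where "SV = scal_mat P ** cosov_v ** scal_mat P'"
  define TU where "TU = scal_mat (transpose P) ** letter_u ** scal_mat (transpose P')"
  define TV where "TV = scal_mat P' ** letter_v ** scal_mat P"
  define \<sigma> where "\<sigma> x = (if fst x then SU else SV) $ (snd x True) $ (snd x False)" for x
  define \<tau> where "\<tau> g = (case g of U i j \<Rightarrow> TU $ i $ j | V i j \<Rightarrow> TV $ i $ j)" for g
  have \<sigma>_mat: "map_mat (subst \<sigma>) letter_u = SU" "map_mat (subst \<sigma>) letter_v = SV"
    by (simp_all add: map_mat_def letter_u_def letter_v_def \<sigma>_def mk_sel' vec_eq_iff)
  have \<tau>_mat: "map_mat (subst \<tau>) cosov_u = TU" "map_mat (subst \<tau>) cosov_v = TV"
    by (simp_all add: map_mat_def cosov_u_def cosov_v_def \<tau>_def vec_eq_iff)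
  have rels_S: "rels (cosov_ideal F) F' G' SU SV"
    unfolding F'_def G'_def SU_def SV_def by (rule rels_conjugate[OF J rels_cosov P'])
  have "P' ** F' ** P = F" "P' ** G' ** P = G"
    unfolding F'_def G'_def by (metis P' matrix_mul_assoc matrix_mul_lid matrix_mul_rid)+
  then have rels_T: "rels rel_ideal F G TU TV"
    using rels_conjugate[OF two_sided_rel_ideal rels_core P'(2,1)] by (simp add: TU_def TV_def)
  have SP: "scal_mat P ** scal_mat P' = mat 1" "scal_mat P' ** scal_mat P = mat 1"
    "scal_mat (transpose P) ** scal_mat (transpose P') = mat 1" "scal_mat (transpose P') ** scal_mat (transpose P) = mat 1"
    using P' by (simp_all flip: scal_mat_mult matrix_transpose_mul)
  have \<tau>\<sigma>: "subst \<tau> (subst \<sigma> x) = x" for x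
  proof -
    have "map_mat (subst \<tau>) SU = scal_mat (transpose P') ** scal_mat (transpose P) ** letter_u ** (scal_mat (transpose P') ** scal_mat (transpose P))"
      by (simp add: SU_def map_mat_mult \<tau>_mat TU_def matrix_mul_assoc)
    then have U: "map_mat (subst \<tau>) SU = letter_u" by (simp add: SP)
    have "map_mat (subst \<tau>) SV = scal_mat P ** scal_mat P' ** letter_v ** (scal_mat P ** scal_mat P')"
      by (simp add: SV_def map_mat_mult \<tau>_mat TV_def matrix_mul_assoc)
    then have V: "map_mat (subst \<tau>) SV = letter_v" by (simp add: SP)
    have "subst \<tau> (\<sigma> g) = gen g" for g
      using arg_cong[OF U, of "\<lambda>A. A $ snd g True $ snd g False"] arg_cong[OF V, of "\<lambda>A. A $ snd g True $ snd g False"]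
        mk_surj[of g True]
      by (auto simp: \<sigma>_def map_mat_def letter_u_def letter_v_def)
    then show ?thesis by (simp add: subst_subst subst_gen_id)
  qed
  have \<sigma>\<tau>: "subst \<sigma> (subst \<tau> x) = x" for x
  proof -
    have "map_mat (subst \<sigma>) TU = scal_mat (transpose P) ** scal_mat (transpose P') ** cosov_u ** (scal_mat (transpose P) ** scal_mat (transpose P'))"
      by (simp add: TU_def map_mat_mult \<sigma>_mat SU_def matrix_mul_assoc)
    then have U: "map_mat (subst \<sigma>) TU = cosov_u" by (simp add: SP)
    have "map_mat (subst \<sigma>) TV = scal_mat P' ** scal_mat P ** cosov_v ** (scal_mat P' ** scal_mat P)"
      by (simp add: TV_def map_mat_mult \<sigma>_mat SV_def matrix_mul_assoc)
    then have V: "map_mat (subst \<sigma>) TV = cosov_v" by (simp add: SP)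
    have "subst \<sigma> (\<tau> g) = gen g" for g
      using U V by (cases g) (simp_all add: \<tau>_def map_mat_def cosov_u_def cosov_v_def vec_eq_iff)
    then show ?thesis by (simp add: subst_subst subst_gen_id)
  qed
  have \<sigma>_rel: "subst \<sigma> (relator \<kappa> s i j) \<in> cosov_ideal F" for \<kappa> s i j
  proof -
    have m: "subst \<sigma> ((A - B) $ i $ j) = map_mat (subst \<sigma>) A $ i $ j - map_mat (subst \<sigma>) B $ i $ j"
      for A B :: "('n letter free_alg)^'n^'n"
      by (simp add: map_mat_def subst_diff)
    show ?thesis
      using rels_S unfolding rels_def mcong_def
      by (cases \<kappa>; cases s) (simp_all only: rel m map_mat_mult map_mat_subst_simps \<sigma>_mat)
  qed
  have \<sigma>_ideal: "subst \<sigma> x \<in> cosov_ideal F" if "x \<in> rel_ideal" for x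
    by (rule subst_ideal_of[OF J _ that[unfolded rel_ideal_def]]) (auto intro: \<sigma>_rel)
  have \<tau>_ideal: "subst \<tau> x \<in> rel_ideal" if "x \<in> cosov_ideal F" for x
  proof (rule subst_ideal_of[OF two_sided_rel_ideal _ that[unfolded cosov_ideal_def]])
    fix r assume r: "r \<in> cosov_relators F"
    have E: "subst \<tau> ` entries (A - B) = entries (map_mat (subst \<tau>) A - map_mat (subst \<tau>) B)"
      for A B :: "('n cosov_gen free_alg)^'n^'n"
    proof -
      have "subst \<tau> ` entries C = {subst \<tau> (C $ i $ j) |i j. True}" for C :: "('n cosov_gen free_alg)^'n^'n"
        by (auto simp: entries_def)
      from this[of "A - B"] show ?thesis by (simp add: map_mat_def subst_diff) (simp add: entries_def)
    qed
    have "entries (TU ** transpose TV - mat 1) \<union> entries (transpose TV ** TU - mat 1) \<union>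
      entries (TV ** scal_mat F ** transpose TU ** scal_mat (matrix_inv F) - mat 1) \<union>
      entries (scal_mat F ** transpose TU ** scal_mat (matrix_inv F) ** TV - mat 1) \<subseteq> rel_ideal"
      using rels_T cosov_rels_iff[OF two_sided_rel_ideal F] unfolding G_def by blast
    then have "subst \<tau> ` cosov_relators F \<subseteq> rel_ideal"
      unfolding cosov_relators_def Let_def image_Un E map_mat_mult map_mat_subst_simps \<tau>_mat .
    then show "subst \<tau> r \<in> rel_ideal" using r by blast
  qed
  have "quotient_map R (\<lambda>x. \<pi> (subst \<sigma> x)) rel_ideal"
  proof unfold_locales
    have "range (\<lambda>x. \<pi> (subst \<sigma> x)) = range \<pi>"
      using surjI[of "subst \<sigma>" "subst \<tau>", OF \<sigma>\<tau>] by (metis image_image)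
    then show "range (\<lambda>x. \<pi> (subst \<sigma> x)) = carrier R" by (simp add: Q.map_carrier)
    show "\<pi> (subst \<sigma> x) = \<zero>\<^bsub>R\<^esub> \<longleftrightarrow> x \<in> rel_ideal" for x
      using \<sigma>_ideal[of x] \<tau>_ideal[of "subst \<sigma> x"] \<tau>\<sigma>[of x] by (auto simp: Q.map_zero_iff)
  qed (simp_all add: subst_add subst_mult Q.map_add Q.map_mult Q.map_one)
  moreover have "\<epsilon> (\<pi> (subst \<sigma> x)) = character_of ep x" for x
  proof -
    have cu: "map_mat (character_of cosov_counit_gen) cosov_u = mat 1" "map_mat (character_of cosov_counit_gen) cosov_v = mat 1"
      by (simp_all add: map_mat_def cosov_u_def cosov_v_def mat_def vec_eq_iff)
    have "map_mat (character_of cosov_counit_gen) SU = mat 1" "map_mat (character_of cosov_counit_gen) SV = mat 1"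
      using P' by (simp_all add: SU_def SV_def map_mat_char_mult cu flip: matrix_transpose_mul)
    then have "character_of cosov_counit_gen (\<sigma> g) = ep g" for g
      by (cases g) (auto simp: \<sigma>_def ep_def map_mat_def vec_eq_iff mat_def)
    then show ?thesis by (simp add: \<epsilon> character_of_subst)
  qed
  ultimately show ?thesis
    by (intro resolution) (auto simp: cosov_forms_def)
qed

section \<open>Positivity of star x x for C*-seminorms, without completeness or spectral
  theory\<close>

section \<open>Positive elements for a C*-seminorm\<close>

lemma star_add: "star (x + y) = star x + star y"
  unfolding star_def
  by (rule setsum_keys_plus_distrib[where f = "\<lambda>w c. Poly_Mapping.single (Word (rev (map flip (letters w)))) (cnj c)"])
     (auto simp: single_add)

lemma star_scal_mon: "star (scal c * mon w) = scal (cnj c) * mon (rev (map flip w))"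
  by (cases "c = 0") (auto simp: scal_mult_mon star_def)

lemma flip_flip [simp]: "flip (flip g) = g"
  by (cases g) auto

lemma star_star [simp]: "star (star x) = x"
proof (induction x rule: free_alg_induct)
  case (scal_mon c w)
  have "map (\<lambda>g. flip (flip g)) w = w" by (induction w) auto
  then show ?case by (simp add: star_scal_mon rev_map o_def)
qed (simp add: star_add)

lemma star_mult: "star (x * y) = star y * star x"
proof (induction x rule: free_alg_induct)
  case (scal_mon c v)
  show ?case
  proof (induction y rule: free_alg_induct)
    case (scal_mon d w)
    have swap: "scal a * mon v * (scal b * mon w) = scal (a * b) * mon (v @ w)" for a b and v w :: "'a starred list"
      by (simp add: mult.assoc scal_left_commute[of "mon v"] scal_mult mon_append)
    show ?case by (simp add: swap star_scal_mon mult.commute)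
  qed (simp add: distrib_left distrib_right star_add)
qed (simp add: distrib_left distrib_right star_add)

lemma star_scal [simp]: "star (scal c) = scal (cnj c)"
  using star_scal_mon[of c "[]"] by simp

lemma star_0 [simp]: "star 0 = 0"
  using star_scal[of 0] by simp

lemma star_1 [simp]: "star 1 = 1"
  using star_scal[of 1] by simp

lemma star_gen [simp]: "star (gen g) = gen (flip g)"
  using star_scal_mon[of 1 "[g]"] by (simp add: gen_eq_mon)

lemma star_uminus: "star (- x) = - star x"
  using star_add[of x "- x"] by (simp add: eq_neg_iff_add_eq_0 add.commute)

lemma star_diff: "star (x - y) = star x - star y"
  using star_add[of x "- y"] by (simp add: star_uminus)

lemma star_sum: "star (sum f A) = (\<Sum>i\<in>A. star (f i))"
  by (induction A rule: infinite_finite_induct) (auto simp: star_add)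

lemma star_power: "star (x ^ n) = star x ^ n"
  by (induction n) (simp_all add: star_mult power_commutes)

lemma scal_scal: "scal c * (scal d * x) = scal (c * d) * x"
  by (simp add: scal_mult mult.assoc)

lemma scal_move: "NO_MATCH (scal d) x \<Longrightarrow> x * scal c = scal c * x"
  by (rule scal_commute)

lemma scal_left_move: "NO_MATCH (scal d) x \<Longrightarrow> x * (scal c * y) = scal c * (x * y)"
  by (rule scal_left_commute)

lemmas scal_norm = scal_scal scal_mult[symmetric] scal_move scal_left_move mult.assoc
  distrib_left distrib_right left_diff_distrib right_diff_distrib

lemma lin_eqI: "(\<And>f. lin f x = lin f y) \<Longrightarrow> x = y"
  by (rule free_alg_eqI)

lemma lin_scal_const: "lin f (scal c) = c * f []"
  using lin_scal_mon[of f c "[]"] by simp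

lemma commute_square: "a * g = g * a \<Longrightarrow> a * (g * g) = g * g * a" for a g :: "'a::ring_1"
  by (metis mult.assoc)

text \<open>The classical iteration for square roots: 1 minus the iterate for c = 1 - a tends to the
  root of a, the defect being twice the increment (\<open>sqrt_iter_square\<close>). Iterates
  commute with everything that commutes with c.\<close>

primrec sqrt_iter :: "'g free_alg \<Rightarrow> nat \<Rightarrow> 'g free_alg"
  where "sqrt_iter c 0 = 0"
  | "sqrt_iter c (Suc m) = scal (1 / 2) * (c + sqrt_iter c m * sqrt_iter c m)"

text \<open>The scalar iteration for c = 1. It dominates the algebra iterates and their increments
  when the seminorm of c is at most 1, and it converges, being increasing and bounded.\<close>

primrec sqrt_bound :: "nat \<Rightarrow> real"
  where "sqrt_bound 0 = 0"
  | "sqrt_bound (Suc m) = (1 + (sqrt_bound m)\<^sup>2) / 2"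

lemma sqrt_bound_range: "0 \<le> sqrt_bound m \<and> sqrt_bound m \<le> 1"
  by (induction m) (auto simp: power_le_one)

lemma sqrt_bound_mono: "sqrt_bound m \<le> sqrt_bound (Suc m)"
proof -
  have "2 * sqrt_bound m \<le> 1 + (sqrt_bound m)\<^sup>2"
    using zero_le_power2[of "1 - sqrt_bound m"] by (simp add: power2_eq_square algebra_simps)
  then show ?thesis by simp
qed

lemma sqrt_bound_diff: "(\<lambda>m. sqrt_bound (Suc m) - sqrt_bound m) \<longlonglongrightarrow> 0"
proof -
  have "incseq sqrt_bound" by (rule incseq_SucI) (rule sqrt_bound_mono)
  then have "convergent sqrt_bound"
    using sqrt_bound_range by (intro Bseq_monoseq_convergent BseqI'[of _ 1] incseq_imp_monoseq) auto
  then obtain l where l: "sqrt_bound \<longlonglongrightarrow> l" by (auto simp: convergent_def)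
  from tendsto_diff[OF LIMSEQ_Suc[OF this] this] show ?thesis by simp
qed

lemma sqrt_iter_commute:
  assumes "c * z = z * c"
  shows "sqrt_iter c m * z = z * sqrt_iter c m"
proof (induction m)
  case (Suc m)
  have "sqrt_iter c m * sqrt_iter c m * z = z * (sqrt_iter c m * sqrt_iter c m)"
    by (metis Suc mult.assoc)
  then show ?case
    by (simp add: assms distrib_left distrib_right scal_left_commute[of z] mult.assoc)
qed simp

lemma star_sqrt_iter: "star c = c \<Longrightarrow> star (sqrt_iter c m) = sqrt_iter c m"
  by (induction m) (simp_all add: star_add star_mult flip: scal_commute)

lemma sqrt_iter_square: "(1 - sqrt_iter c m) * (1 - sqrt_iter c m) =
    (1 - c) + scal 2 * (sqrt_iter c (Suc m) - sqrt_iter c m)"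
  by (rule lin_eqI) (simp add: scal_norm lin_add lin_diff lin_scal)

text \<open>The usual spectral radius argument: otherwise (A / B)^(2^k) would be unbounded.\<close>

lemma real_power_bound:
  fixes A B C :: real
  assumes "0 \<le> A" "0 \<le> B" and b: "\<And>k. A ^ (2 ^ k) \<le> C * B ^ (2 ^ k - 1)"
  shows "A \<le> B"
proof (rule ccontr)
  assume "\<not> A \<le> B"
  then have AB: "B < A" "0 < A" using assms by auto
  show False
  proof (cases "B = 0")
    case True
    then show False using b[of 1] AB by simp
  next
    case False
    then have B: "0 < B" using assms by simp
    define r where "r = A / B"
    have r: "1 < r" using AB B by (simp add: r_def)
    have le: "r ^ (2 ^ k) \<le> C / B" for k
    proof -
      have "A ^ (2 ^ k) \<le> C * (B ^ (2 ^ k) / B)"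
        using b[of k] B by (simp add: power_diff)
      then show ?thesis using B by (simp add: r_def power_divide field_simps)
    qed
    obtain n where n: "C / B < r ^ n" using real_arch_pow[OF r] by blast
    have "r ^ n \<le> r ^ (2 ^ n)" using r by (intro power_increasing) (auto intro: less_imp_le less_exp)
    then show False using le[of n] n by simp
  qed
qed

locale cstar =
  fixes p :: "'g starred free_alg \<Rightarrow> real"
  assumes cstar_seminorm: "cstar_seminorm p"
begin

lemma p_nonneg [simp]: "0 \<le> p x"
  and p_triangle: "p (x + y) \<le> p x + p y"
  and p_scal_mult [simp]: "p (scal c * x) = cmod c * p x"
  and p_mult: "p (x * y) \<le> p x * p y"
  and p_star_mult: "p (star x * x) = (p x)\<^sup>2"
  using cstar_seminorm unfolding cstar_seminorm_def by blast+

lemma p_0 [simp]: "p 0 = 0"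
  using p_scal_mult[of 0 0] by simp

lemma p_uminus [simp]: "p (- x) = p x"
  using p_scal_mult[of "-1" x] by (simp add: scal_uminus)

lemma p_diff: "p (x - y) \<le> p x + p y"
  using p_triangle[of x "- y"] by simp

lemma p_minus_commute: "p (x - y) = p (y - x)"
  using p_uminus[of "x - y"] by simp

lemma p_star [simp]: "p (star x) = p x"
proof -
  have le: "p (star x) \<le> p x" for x
  proof -
    have "(p (star x))\<^sup>2 \<le> p x * p (star x)"
      using p_star_mult[of "star x"] p_mult[of x "star x"] by simp
    then show ?thesis
      by (cases "p (star x) = 0") (auto simp: power2_eq_square p_nonneg less_le)
  qed
  show ?thesis using le[of x] le[of "star x"] by simp
qed

lemma p_1: "p 1 \<le> 1"
  using p_star_mult[of 1] by (auto simp: power2_eq_square)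

lemma p_scal_le: "p (scal c) \<le> cmod c"
  using p_scal_mult[of c 1] p_1 mult_left_mono[of "p 1" 1 "cmod c"] by simp

lemma p_power: "p (x ^ n) \<le> p x ^ n" if "0 < n"
  using that
proof (induction n rule: nat_induct_non_zero)
  case (Suc n)
  have "p (x ^ Suc n) \<le> p x * p (x ^ n)" using p_mult[of x "x ^ n"] by simp
  also have "\<dots> \<le> p x * p x ^ n" using Suc by (intro mult_left_mono) auto
  finally show ?case by simp
qed simp

lemma p_square: "star h = h \<Longrightarrow> p (h * h) = (p h)\<^sup>2"
  using p_star_mult[of h] by simp

lemma p_power2: "star h = h \<Longrightarrow> p (h ^ (2 ^ k)) = p h ^ (2 ^ k)"
proof (induction k)
  case (Suc k)
  have "h ^ (2 ^ Suc k) = h ^ (2 ^ k) * h ^ (2 ^ k)" by (simp add: mult_2 power_add)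
  moreover have "p h ^ (2 ^ Suc k) = (p h ^ (2 ^ k))\<^sup>2"
    by (simp add: mult.commute flip: power_mult)
  ultimately show ?case using Suc p_square[of "h ^ (2 ^ k)"] by (simp add: star_power)
qed simp

text \<open>For the normal element n = a + i b one has star n n = a^2 + b^2, and a is the real part
  of n.\<close>

lemma p_commuting_squares:
  assumes "star a = a" "star b = b" "a * b = b * a"
  shows "(p a)\<^sup>2 \<le> p (a * a + b * b)"
proof -
  let ?n = "a + scal \<i> * b"
  have st: "star ?n = a - scal \<i> * b"
    using scal_commute[of b] assms by (simp add: star_add star_mult scal_uminus)
  have "star ?n * ?n = a * a + b * b"
    unfolding st by (rule lin_eqI) (simp add: scal_norm lin_add lin_diff lin_scal assms(3))
  then have n: "p (a * a + b * b) = (p ?n)\<^sup>2" by (simp flip: p_star_mult)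
  have "scal 2 * a = ?n + star ?n"
    unfolding st by (rule lin_eqI) (simp add: scal_norm lin_add lin_diff lin_scal)
  then have "2 * p a \<le> p ?n + p (star ?n)" using p_triangle[of ?n "star ?n"] p_scal_mult[of 2 a] by simp
  then have "p a \<le> p ?n" by simp
  then show ?thesis unfolding n by (intro power_mono) auto
qed

text \<open>Stands for nonnegative spectrum: a self-adjoint element within distance t of the scalar
  t.\<close>

definition pos :: "'g starred free_alg \<Rightarrow> bool"
  where "pos a \<longleftrightarrow> star a = a \<and> (\<exists>t>0. p (scal (of_real t) - a) \<le> t)"

lemma sqrt_iter_p:
  assumes "p c \<le> 1"
  shows "p (sqrt_iter c m) \<le> sqrt_bound m"
    and "p (sqrt_iter c (Suc m) - sqrt_iter c m) \<le> sqrt_bound (Suc m) - sqrt_bound m"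
proof -
  show b: "p (sqrt_iter c m) \<le> sqrt_bound m" for m
  proof (induction m)
    case (Suc m)
    have "p (c + sqrt_iter c m * sqrt_iter c m) \<le> p c + p (sqrt_iter c m) * p (sqrt_iter c m)"
      using p_triangle[of c "sqrt_iter c m * sqrt_iter c m"] p_mult[of "sqrt_iter c m" "sqrt_iter c m"] by linarith
    also have "\<dots> \<le> 1 + sqrt_bound m * sqrt_bound m"
      using assms Suc sqrt_bound_range[of m] by (intro add_mono mult_mono) auto
    finally show ?case by (simp add: power2_eq_square)
  qed simp
  show "p (sqrt_iter c (Suc m) - sqrt_iter c m) \<le> sqrt_bound (Suc m) - sqrt_bound m"
  proof (induction m)
    case 0
    then show ?case using assms by simp
  next
    case (Suc m)
    let ?y = "sqrt_iter c (Suc m)" and ?z = "sqrt_iter c m"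
    have "sqrt_iter c (Suc (Suc m)) - ?y = scal (1/2) * (c + ?y * ?y) - scal (1/2) * (c + ?z * ?z)" by simp
    also have "\<dots> = scal (1/2) * ((?y - ?z) * (?y + ?z))"
    proof -
      have "?y * ?z = ?z * ?y"
        by (rule sqrt_iter_commute) (rule sqrt_iter_commute[symmetric], rule refl)
      then have "(?y - ?z) * (?y + ?z) = ?y * ?y - ?z * ?z" by (simp only: distrib_left left_diff_distrib) simp
      then show ?thesis by (simp only: right_diff_distrib[symmetric]) simp
    qed
    finally have eq: "sqrt_iter c (Suc (Suc m)) - ?y = scal (1/2) * ((?y - ?z) * (?y + ?z))" .
    have "p ((?y - ?z) * (?y + ?z)) \<le> p (?y - ?z) * p (?y + ?z)" by (rule p_mult)
    also have "\<dots> \<le> (sqrt_bound (Suc m) - sqrt_bound m) * (sqrt_bound (Suc m) + sqrt_bound m)"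
      using Suc b[of "Suc m"] b[of m] p_triangle[of ?y ?z] sqrt_bound_mono[of m]
      by (intro mult_mono) (auto intro: order_trans simp del: sqrt_iter.simps sqrt_bound.simps)
    finally have "p (sqrt_iter c (Suc (Suc m)) - ?y) \<le> (sqrt_bound (Suc m) - sqrt_bound m) * (sqrt_bound (Suc m) + sqrt_bound m) / 2"
      unfolding eq p_scal_mult by simp
    also have "\<dots> = sqrt_bound (Suc (Suc m)) - sqrt_bound (Suc m)"
      unfolding sqrt_bound.simps(2)[of "Suc m"] by (subst (4) sqrt_bound.simps(2)) (simp add: power2_eq_square algebra_simps diff_divide_distrib add_divide_distrib del: sqrt_bound.simps)
    finally show ?case .
  qed
qed

lemma sqrt_approx_1:
  assumes "star a = a" "p (1 - a) \<le> 1" "0 < e"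
  shows "\<exists>k. star k = k \<and> (\<forall>z. a * z = z * a \<longrightarrow> k * z = z * k) \<and> p (a - k * k) < e"
proof -
  let ?c = "1 - a"
  obtain m where m: "\<bar>sqrt_bound (Suc m) - sqrt_bound m\<bar> < e / 2"
    using LIMSEQ_D[OF sqrt_bound_diff, of "e / 2"] assms(3) by auto
  let ?k = "1 - sqrt_iter ?c m"
  have "p (a - ?k * ?k) = 2 * p (sqrt_iter ?c (Suc m) - sqrt_iter ?c m)"
    unfolding sqrt_iter_square using p_scal_mult[of 2 "sqrt_iter ?c (Suc m) - sqrt_iter ?c m"]
    by (simp add: p_uminus del: sqrt_iter.simps p_scal_mult)
  also have "\<dots> < e" using sqrt_iter_p(2)[OF assms(2), of m] m by linarith
  finally have "p (a - ?k * ?k) < e" .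
  moreover have "?k * z = z * ?k" if "a * z = z * a" for z
    using sqrt_iter_commute[of ?c z m] that by (simp add: left_diff_distrib right_diff_distrib)
  moreover have "star ?k = ?k" using assms(1) by (simp add: star_diff star_sqrt_iter)
  ultimately show ?thesis by blast
qed

lemma sqrt_approx:
  assumes "pos a" "0 < e"
  shows "\<exists>k. star k = k \<and> (\<forall>z. a * z = z * a \<longrightarrow> k * z = z * k) \<and> p (a - k * k) < e"
proof -
  obtain t where t: "star a = a" "0 < t" "p (scal (of_real t) - a) \<le> t"
    using assms by (auto simp: pos_def)
  let ?a = "scal (of_real (1 / t)) * a"
  have inv_t: "scal (of_real (1 / t)) * scal (of_real t) = 1"
    using t by (simp flip: scal_mult)
  have eq: "1 - ?a = scal (of_real (1 / t)) * (scal (of_real t) - a)"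
    unfolding right_diff_distrib inv_t ..
  have "p (1 - ?a) \<le> 1" unfolding eq p_scal_mult using t by (simp add: norm_divide field_simps)
  moreover have "star ?a = ?a" using t by (simp add: star_mult scal_commute)
  moreover have "0 < e / t" using assms t by simp
  ultimately obtain k where k: "star k = k" "\<And>z. ?a * z = z * ?a \<Longrightarrow> k * z = z * k" "p (?a - k * k) < e / t"
    using sqrt_approx_1[of ?a "e / t"] by blast
  let ?k = "scal (of_real (sqrt t)) * k"
  have eq: "a - ?k * ?k = scal (of_real t) * (?a - k * k)"
    using t by (intro lin_eqI) (simp add: scal_norm lin_add lin_diff lin_scal flip: of_real_mult)
  have "p (a - ?k * ?k) < e" unfolding eq p_scal_mult using k(3) t by (simp add: field_simps)
  moreover have "star ?k = ?k" by (simp add: star_mult scal_commute k(1))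
  moreover have "?k * z = z * ?k" if "a * z = z * a" for z
  proof -
    have "?a * z = z * ?a" using that by (simp only: mult.assoc scal_left_commute[of z])
    from k(2)[OF this] show ?thesis by (simp only: mult.assoc scal_left_commute[of z])
  qed
  ultimately show ?thesis by blast
qed

lemma pos_herm: "pos a \<Longrightarrow> star a = a"
  by (simp add: pos_def)

text \<open>Approximate square roots of commuting elements commute, so
  \<open>p_commuting_squares\<close> applies to them.\<close>

lemma p_pos_mono:
  assumes "pos a" "pos b" "a * b = b * a"
  shows "p a \<le> p (a + b)"
proof (rule field_le_epsilon)
  fix e :: real assume e: "0 < e"
  then have e3: "0 < e / 3" by simp
  obtain k where k: "star k = k" "\<And>z. a * z = z * a \<Longrightarrow> k * z = z * k" "p (a - k * k) < e / 3"
    using sqrt_approx[OF assms(1) e3] by blast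
  obtain l where l: "star l = l" "\<And>z. b * z = z * b \<Longrightarrow> l * z = z * l" "p (b - l * l) < e / 3"
    using sqrt_approx[OF assms(2) e3] by blast
  have kl: "k * l = l * k" using k(2) l(2) assms(3) by metis
  have "p a \<le> p (k * k) + e / 3" using p_triangle[of "k * k" "a - k * k"] k(3) by simp
  moreover have "p (k * k) \<le> p (k * k + l * l)"
    using p_commuting_squares[OF k(1) l(1) kl] p_square[OF k(1)] by simp
  moreover have "p (k * k + l * l) \<le> p (a + b) + p ((a - k * k) + (b - l * l))"
    using p_diff[of "a + b" "(a - k * k) + (b - l * l)"] by (simp add: algebra_simps)
  moreover have "p ((a - k * k) + (b - l * l)) \<le> p (a - k * k) + p (b - l * l)" by (rule p_triangle)
  ultimately show "p a \<le> p (a + b) + e" using k(3) l(3) by linarith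
qed

lemma pos_add: "pos a \<Longrightarrow> pos b \<Longrightarrow> pos (a + b)"
proof -
  assume "pos a" "pos b"
  then obtain s t where *: "star a = a" "star b = b" "0 < s" "p (scal (of_real s) - a) \<le> s" "0 < t" "p (scal (of_real t) - b) \<le> t"
    by (auto simp: pos_def)
  have eq: "scal (of_real (s + t)) - (a + b) = (scal (of_real s) - a) + (scal (of_real t) - b)"
    by (simp add: scal_add)
  have "p (scal (of_real (s + t)) - (a + b)) \<le> s + t"
    unfolding eq using p_triangle[of "scal (of_real s) - a" "scal (of_real t) - b"] * by linarith
  then show ?thesis using * unfolding pos_def star_add by (metis add_pos_pos)
qed

lemma pos_scal_mult: "pos a \<Longrightarrow> 0 < c \<Longrightarrow> pos (scal (of_real c) * a)"
proof -
  assume a: "pos a" and c: "0 < c"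
  then obtain t where t: "star a = a" "0 < t" "p (scal (of_real t) - a) \<le> t" by (auto simp: pos_def)
  have "scal (of_real (c * t)) - scal (of_real c) * a = scal (of_real c) * (scal (of_real t) - a)"
    by (simp add: scal_mult right_diff_distrib)
  then have "p (scal (of_real (c * t)) - scal (of_real c) * a) \<le> c * t" using c t by simp
  then show ?thesis using c t unfolding pos_def
    by (intro conjI exI[of _ "c * t"]) (auto simp: star_mult scal_commute)
qed

lemma pos_diff_scal: "star a = a \<Longrightarrow> p a \<le> r \<Longrightarrow> 0 < r \<Longrightarrow> pos (scal (of_real r) - a)"
  unfolding pos_def by (intro conjI exI[of _ r]) (auto simp: star_diff)

lemma pos_0 [simp]: "pos 0" and pos_1 [simp]: "pos 1"
  unfolding pos_def using p_1 by (auto intro!: exI[of _ 1])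

lemma pos_sum: "(\<And>i. i \<in> A \<Longrightarrow> pos (f i)) \<Longrightarrow> pos (sum f A)"
  by (induction A rule: infinite_finite_induct) (auto intro: pos_add)

text \<open>With k an approximate root of 1 - h^2, the seminorm of k^2 is at most that of k^2 + h^2,
  which is close to 1.\<close>

lemma p_one_minus_square:
  assumes h: "star h = h" "p h \<le> 1"
  shows "p (1 - h * h) \<le> 1"
proof (rule field_le_epsilon)
  fix e :: real assume e: "0 < e"
  let ?a = "1 - h * h"
  have "p (1 - ?a) \<le> 1" using p_square[OF h(1)] h(2) by (simp add: power_le_one)
  moreover have "star ?a = ?a" "0 < e / 2" using e h by (simp_all add: star_diff star_mult)
  ultimately obtain k where k: "star k = k" "\<And>z. ?a * z = z * ?a \<Longrightarrow> k * z = z * k" "p (?a - k * k) < e / 2"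
    using sqrt_approx_1[of ?a "e / 2"] by blast
  have kh: "k * h = h * k" by (rule k(2)) (simp add: algebra_simps mult.assoc)
  have "p ?a \<le> p (k * k) + e / 2" using p_triangle[of "k * k" "?a - k * k"] k(3) by simp
  moreover have "p (k * k) \<le> p (k * k + h * h)"
    using p_commuting_squares[OF k(1) h(1) kh] p_square[OF k(1)] by simp
  moreover have "p (k * k + h * h) \<le> p 1 + p (?a - k * k)"
    using p_diff[of 1 "?a - k * k"] by (simp add: algebra_simps)
  ultimately show "p ?a \<le> 1 + e" using k(3) p_1 by linarith
qed

lemma p_scal_minus_square:
  assumes h: "star h = h" "(p h)\<^sup>2 \<le> t" "0 < t"
  shows "p (scal (of_real t) - h * h) \<le> t"
proof -
  let ?g = "scal (of_real (1 / sqrt t)) * h"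
  have "star ?g = ?g" using h by (simp add: star_mult scal_commute)
  moreover have "p ?g \<le> 1"
    using h real_le_rsqrt[of "p h" t] by (simp add: norm_divide field_simps)
  ultimately have "p (1 - ?g * ?g) \<le> 1" by (rule p_one_minus_square)
  moreover have "scal (of_real t) - h * h = scal (of_real t) * (1 - ?g * ?g)"
    using h by (intro lin_eqI)
      (simp add: scal_norm lin_add lin_diff lin_scal flip: of_real_mult of_real_divide)
  ultimately show ?thesis using h by (simp add: mult_left_le)
qed

lemma pos_square: "star h = h \<Longrightarrow> pos (h * h)"
  using p_scal_minus_square[of h "(p h)\<^sup>2 + 1"]
  unfolding pos_def by (intro conjI exI[of _ "(p h)\<^sup>2 + 1"]) (auto simp: star_mult add_nonneg_pos)

text \<open>The product is approximated by the square of the self-adjoint product of commuting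
  approximate roots, and \<open>p_scal_minus_square\<close> applies with a t that does not depend on
  the approximation.\<close>

lemma pos_mult:
  assumes "pos a" "pos b" "a * b = b * a"
  shows "pos (a * b)"
proof -
  define t where "t = p (a * b) + 1"
  have t: "0 < t" by (simp add: t_def add_nonneg_pos)
  have "p (scal (of_real t) - a * b) \<le> t"
  proof (rule field_le_epsilon)
    fix e0 :: real assume e0: "0 < e0"
    define e where "e = min e0 1"
    have e: "0 < e" "e \<le> 1" "e \<le> e0" using e0 by (auto simp: e_def)
    have pb: "0 < p b + 1" by (simp add: add_nonneg_pos)
    then have e1: "0 < e / (2 * (p b + 1))" using e by simp
    obtain k where k: "star k = k" "\<And>z. a * z = z * a \<Longrightarrow> k * z = z * k" "p (a - k * k) < e / (2 * (p b + 1))"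
      using sqrt_approx[OF assms(1) e1] by blast
    have pk: "0 < p (k * k) + 1" by (simp add: add_nonneg_pos)
    then have e2: "0 < e / (2 * (p (k * k) + 1))" using e by simp
    obtain l where l: "star l = l" "\<And>z. b * z = z * b \<Longrightarrow> l * z = z * l" "p (b - l * l) < e / (2 * (p (k * k) + 1))"
      using sqrt_approx[OF assms(2) e2] by blast
    have kl: "k * l = l * k" using k(2) l(2) assms(3) by metis
    have h: "star (k * l) = k * l" by (simp only: star_mult k(1) l(1) kl)
    have sq: "(k * l) * (k * l) = (k * k) * (l * l)" using kl by (metis mult.assoc)
    have "p (a * b - (k * l) * (k * l)) = p ((a - k * k) * b + (k * k) * (b - l * l))"
      unfolding sq by (simp add: algebra_simps)
    also have "\<dots> \<le> p (a - k * k) * p b + p (k * k) * p (b - l * l)"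
      by (rule order_trans[OF p_triangle add_mono[OF p_mult p_mult]])
    also have "\<dots> \<le> e / (2 * (p b + 1)) * (p b + 1) + (p (k * k) + 1) * (e / (2 * (p (k * k) + 1)))"
      using k(3) l(3) e pb pk by (intro add_mono mult_mono) auto
    also have "\<dots> = e / 2 + e / 2"
      using pb pk by (intro arg_cong2[where f = "(+)"]) (simp_all add: divide_simps)
    also have "\<dots> = e" by simp
    finally have ab: "p (a * b - (k * l) * (k * l)) \<le> e" .
    have "p ((k * l) * (k * l)) \<le> t"
      using p_diff[of "a * b" "a * b - (k * l) * (k * l)"] ab e by (simp add: t_def)
    then have "(p (k * l))\<^sup>2 \<le> t" using p_square[OF h] by simp
    from p_scal_minus_square[OF h this t]
    have "p (scal (of_real t) - (k * l) * (k * l)) \<le> t" .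
    then show "p (scal (of_real t) - a * b) \<le> t + e0"
      using p_diff[of "scal (of_real t) - (k * l) * (k * l)" "a * b - (k * l) * (k * l)"] ab e by simp
  qed
  then show ?thesis
    using t assms by (auto simp: pos_def star_mult)
qed


text \<open>The polynomial has no constant term, so powers of q(star z z) can be written as star z
  (z star z - r) q(z star z)^m z. Comparing the powers 2^k, where the seminorm is multiplicative,
  gives the bound.\<close>

lemma p_quadratic_swap:
  fixes r :: real
  defines "q \<equiv> \<lambda>t. t * t - scal (of_real r) * t"
  shows "p (q (star z * z)) \<le> p (q (z * star z))"
proof (rule real_power_bound)
  let ?c = "star z * z" and ?d = "z * star z" and ?r = "scal (of_real r)"
  have herm: "star (q ?c) = q ?c" by (simp add: q_def star_diff star_mult scal_commute)
  have q: "q ?c = star z * (?d - ?r) * z"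
    by (simp add: q_def algebra_simps scal_left_commute[of "star z"] mult.assoc)
  have zq: "z * q ?c = q ?d * z"
    by (simp add: q_def algebra_simps scal_left_commute[of z] mult.assoc)
  have pow: "q ?c ^ Suc m = star z * (?d - ?r) * q ?d ^ m * z" for m
  proof (induction m)
    case (Suc m)
    have "q ?c ^ Suc (Suc m) = q ?c ^ Suc m * q ?c" by (rule power_Suc2)
    also have "\<dots> = star z * (?d - ?r) * q ?d ^ m * (z * q ?c)" unfolding Suc by (simp only: mult.assoc)
    also have "\<dots> = star z * (?d - ?r) * q ?d ^ Suc m * z" unfolding zq power_Suc2 by (simp only: mult.assoc)
    finally show ?case .
  qed (simp add: q)
  fix k :: nat
  have "p (q ?c) ^ 2 ^ k = p (q ?c ^ 2 ^ k)" using p_power2[OF herm] by simp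
  also have "\<dots> \<le> ((p z)\<^sup>2 * p (?d - ?r) * max 1 (p 1)) * p (q ?d) ^ (2 ^ k - 1)"
  proof -
    obtain m where m: "(2::nat) ^ k = Suc m" using not0_implies_Suc[of "2 ^ k"] by auto
    have "p (star z * (?d - ?r) * q ?d ^ m * z) \<le> p (star z) * p (?d - ?r) * p (q ?d ^ m) * p z"
      by (intro order_trans[OF p_mult] mult_right_mono p_nonneg order_refl)
    also have "\<dots> \<le> p (star z) * p (?d - ?r) * (max 1 (p 1) * p (q ?d) ^ m) * p z"
    proof (intro mult_right_mono mult_left_mono p_nonneg mult_nonneg_nonneg)
      show "p (q ?d ^ m) \<le> max 1 (p 1) * p (q ?d) ^ m"
        using p_power[of m "q ?d"] p_1 by (cases "m = 0") auto
    qed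
    finally show ?thesis unfolding m pow by (simp add: power2_eq_square mult_ac)
  qed
  finally show "p (q ?c) ^ 2 ^ k \<le> ((p z)\<^sup>2 * p (?d - ?r) * max 1 (p 1)) * p (q ?d) ^ (2 ^ k - 1)" .
qed simp_all

text \<open>Writing c = star z z and d = z star z, a large norm r of c could only come from spectrum
  near -r, since c \<le> 1. But t^2 - r t would be about 2 r^2 there, while its values on the range
  -1 \<le> d \<le> r are much smaller, and \<open>p_quadratic_swap\<close> compares the two.\<close>

lemma p_bounded_above:
  assumes c: "pos (1 - star z * z)" and d: "pos (1 + z * star z)"
  shows "p (star z * z) \<le> 5"
proof (rule ccontr)
  let ?c = "star z * z" and ?d = "z * star z"
  assume "\<not> p ?c \<le> 5"
  define r where "r = p ?c"
  have r: "5 < r" using \<open>\<not> p ?c \<le> 5\<close> by (simp add: r_def)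
  let ?r = "scal (of_real r)"
  have hc: "star ?c = ?c" and hd: "star ?d = ?d" by (simp_all add: star_mult)
  have rd: "p ?d = r" using p_star_mult[of "star z"] p_star_mult[of z] by (simp add: r_def)
  have "r\<^sup>2 = p (?c * ?c)" using p_square[OF hc] by (simp add: r_def)
  \<comment> \<open>Adding the positive element r (1 - c) turns c^2 into q(c) + r.\<close>
  also have "\<dots> \<le> p (?c * ?c + ?r * (1 - ?c))"
    using r c by (intro p_pos_mono pos_square hc pos_scal_mult)
      (simp_all add: algebra_simps mult.assoc scal_commute scal_left_commute)
  also have "?c * ?c + ?r * (1 - ?c) = (?c * ?c - ?r * ?c) + ?r" by (simp add: algebra_simps)
  also have "p \<dots> \<le> p (?c * ?c - ?r * ?c) + r"
    using p_triangle[of "?c * ?c - ?r * ?c" ?r] p_scal_le[of "of_real r"] r by simp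
  also have "p (?c * ?c - ?r * ?c) \<le> p (?d * ?d - ?r * ?d)" by (rule p_quadratic_swap)
  also have "p (?d * ?d - ?r * ?d) \<le> ((1 + r) / 2)\<^sup>2 + 2 * r"
  proof -
    \<comment> \<open>A is at most ((1 + r) / 2)^2 by completing the square with g, and q(d) = (r -
      d) - A.\<close>
    let ?A = "(1 + ?d) * (?r - ?d)" and ?g = "?d - scal (of_real ((r - 1) / 2))"
    have rdp: "pos (?r - ?d)" using rd r by (intro pos_diff_scal hd) auto
    have hg: "star ?g = ?g" using hd by (simp add: star_diff)
    have Ap: "pos ?A"
      by (rule pos_mult[OF d rdp], rule lin_eqI) (simp add: scal_norm lin_add lin_diff lin_scal)
    have eq: "?A + ?g * ?g = scal (of_real (((1 + r) / 2)\<^sup>2))"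
      by (rule lin_eqI) (simp add: scal_norm lin_add lin_diff lin_scal lin_scal_const power2_eq_square field_simps)
    have "p ?A \<le> p (?A + ?g * ?g)"
    proof (rule p_pos_mono[OF Ap pos_square[OF hg]])
      have "?A * ?g = ?g * ?A"
        by (rule lin_eqI) (simp add: scal_norm lin_add lin_diff lin_scal)
      then show "?A * (?g * ?g) = ?g * ?g * ?A" by (rule commute_square)
    qed
    also have "\<dots> \<le> ((1 + r) / 2)\<^sup>2" unfolding eq by (rule order_trans[OF p_scal_le]) (simp only: norm_of_real, simp)
    finally have A: "p ?A \<le> ((1 + r) / 2)\<^sup>2" .
    have eq': "?d * ?d - ?r * ?d = (?r - ?d) - ?A"
      by (rule lin_eqI) (simp add: scal_norm lin_add lin_diff lin_scal)
    have "p (?d * ?d - ?r * ?d) \<le> p ?r + p ?d + p ?A"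
      unfolding eq' using p_diff[of "?r - ?d" ?A] p_diff[of ?r ?d] by linarith
    then show ?thesis using A rd p_scal_le[of "of_real r"] r by simp
  qed
  finally have "r\<^sup>2 \<le> ((1 + r) / 2)\<^sup>2 + 3 * r" by simp
  then have "3 * (r * r) \<le> 1 + 14 * r" by (simp add: power2_eq_square field_simps)
  moreover have "5 * r \<le> r * r" using r by simp
  ultimately show False using r by linarith
qed

text \<open>If \<open>y = 1 - star x * x\<close> had norm above 1, then \<open>z = x * y ^ N\<close> would give
  \<open>star z * z = (1 - y) * y ^ (2 * N) \<le> 1\<close>, hence also \<open>z * star z \<ge> - 1\<close>, while its norm tends to
  infinity.\<close>

lemma pos_star_mult_1:
  assumes "p x \<le> 1"
  shows "pos (star x * x)"
proof -
  define y where "y = 1 - star x * x"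
  have hy: "star y = y" by (simp add: y_def star_diff star_mult)
  have py: "pos y"
    unfolding pos_def using hy assms p_star_mult[of x]
    by (intro conjI exI[of _ 1]) (auto simp: y_def power_le_one)
  have pyn: "pos (y ^ n)" for n
  proof (induction n)
    case (Suc n)
    from pos_mult[OF py this] show ?case by (simp add: power_commutes)
  qed simp
  have h1y: "star (1 - y) = 1 - y" by (simp add: star_diff hy)
  \<comment> \<open>Induction from (1 - y) y^m \<le> 1, adding the positive term (1 - y)^2
    y^m.\<close>
  have pq: "pos (1 - (1 - y) * y ^ m)" for m
  proof (induction m)
    case (Suc m)
    have eq: "1 - (1 - y) * y ^ Suc m = (1 - (1 - y) * y ^ m) + (1 - y) * (1 - y) * y ^ m"
      by (simp add: algebra_simps power_commutes)
    have "pos ((1 - y) * (1 - y) * y ^ m)"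
    proof (rule pos_mult[OF pos_square[OF h1y] pyn])
      have "(1 - y) * y ^ m = y ^ m * (1 - y)" by (simp add: algebra_simps power_commutes)
      from commute_square[OF this[symmetric]] show "(1 - y) * (1 - y) * y ^ m = y ^ m * ((1 - y) * (1 - y))" ..
    qed
    then show ?case unfolding eq by (intro pos_add Suc)
  qed (simp add: py)
  have bound: "p ((1 - y) * y ^ (2 * N)) \<le> 5" for N
  proof -
    let ?z = "x * y ^ N"
    have "star ?z * ?z = star (y ^ N) * (star x * x) * y ^ N"
      by (simp only: star_mult mult.assoc)
    also have "\<dots> = y ^ N * (1 - y) * y ^ N"
      unfolding star_power hy by (simp add: y_def)
    also have "y ^ N * (1 - y) = (1 - y) * y ^ N" by (simp add: algebra_simps power_commutes)
    finally have c: "star ?z * ?z = (1 - y) * y ^ (2 * N)" by (simp add: mult.assoc mult_2 power_add)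
    \<comment> \<open>Twice the real part and, up to sign, twice the imaginary part of z; half the
      sum of their squares is z star z + star z z.\<close>
    let ?g = "?z + star ?z" and ?h = "scal \<i> * (?z - star ?z)"
    have "pos (?g * ?g)" "pos (?h * ?h)"
      by (rule pos_square, simp add: star_add add.commute,
          rule pos_square, simp add: star_mult star_diff star_power scal_uminus algebra_simps scal_commute hy)
    then have "pos ((1 - star ?z * ?z) + scal (of_real (1 / 2)) * (?g * ?g + ?h * ?h))"
      using pq[of "2 * N"] unfolding c by (intro pos_add pos_scal_mult) auto
    also have "(1 - star ?z * ?z) + scal (of_real (1 / 2)) * (?g * ?g + ?h * ?h) = 1 + ?z * star ?z"
      by (rule lin_eqI) (simp add: scal_norm lin_add lin_diff lin_scal)
    finally show ?thesis using p_bounded_above[of ?z] pq[of "2 * N"] unfolding c by simp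
  qed
  have "p y \<le> 1"
  proof (rule ccontr)
    assume "\<not> p y \<le> 1"
    then have r: "1 < p y" by simp
    \<comment> \<open>N is chosen such that 2 N + 2 is a power of two, where the seminorm of a power
      of y is the power of the seminorm.\<close>
    have grow: "(p y - 1) * p y ^ (2 ^ Suc k - 2) \<le> 5" for k
    proof -
      define N where "N = (2::nat) ^ k - 1"
      have N: "2 ^ Suc k = Suc (Suc (2 * N))"
        using one_le_power[of "2::nat" k] unfolding N_def power_Suc by linarith
      have "p y ^ Suc (Suc (2 * N)) = p (y ^ Suc (Suc (2 * N)))"
        using p_power2[OF hy, of "Suc k"] unfolding N by simp
      also have "\<dots> \<le> p (y ^ Suc (2 * N)) + p ((1 - y) * y ^ (2 * N) * y)"
        using p_diff[of "y ^ Suc (2 * N)" "(1 - y) * y ^ (2 * N) * y"] by (simp add: algebra_simps power_commutes)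
      also have "\<dots> \<le> p y ^ Suc (2 * N) + 5 * p y"
        using p_power[of "Suc (2 * N)" y] p_mult[of "(1 - y) * y ^ (2 * N)" y] mult_right_mono[OF bound[of N], of "p y"]
        by simp
      finally have "p y * ((p y - 1) * p y ^ (2 * N)) \<le> p y * 5" by (simp add: algebra_simps)
      then show ?thesis using r unfolding N by simp
    qed
    obtain n where n: "5 / (p y - 1) < p y ^ n" using real_arch_pow[OF r] by blast
    have "n \<le> 2 ^ Suc n - 2"
    proof (cases n)
      case (Suc m)
      have "Suc m \<le> 2 ^ m" by (simp add: Suc_le_eq)
      then show ?thesis using Suc by simp
    qed simp
    then have "p y ^ n \<le> p y ^ (2 ^ Suc n - 2)" using r by (intro power_increasing) auto
    then have "5 / (p y - 1) < p y ^ (2 ^ Suc n - 2)" using n by linarith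
    then show False using grow[of n] r by (simp add: field_simps)
  qed
  then show ?thesis
    unfolding pos_def by (intro conjI exI[of _ 1]) (auto simp: star_mult y_def)
qed

lemma pos_star_mult: "pos (star x * x)"
proof -
  define r where "r = p x + 1"
  have r: "0 < r" by (simp add: r_def add_nonneg_pos)
  let ?x = "scal (of_real (1 / r)) * x"
  have "p ?x \<le> 1" using r by (simp add: norm_divide field_simps) (simp add: r_def)
  then have "pos (scal (of_real (r * r)) * (star ?x * ?x))"
    using r by (intro pos_scal_mult pos_star_mult_1) auto
  also have "scal (of_real (r * r)) * (star ?x * ?x) = star x * x"
    using r by (intro lin_eqI) (simp add: star_mult scal_norm lin_scal)
  finally show ?thesis .
qed

text \<open>If star x x + b = 1 with b positive, then star x x is at most 1. This bounds the entries
  of unitary matrices.\<close>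

lemma p_le_1:
  assumes b: "pos b" and sum: "p (star x * x + b - 1) = 0"
  shows "p x \<le> 1"
proof -
  let ?a = "star x * x"
  obtain t where t: "0 < t" "p (scal (of_real t) - b) \<le> t" using b by (auto simp: pos_def)
  have "p (scal (of_real t) - (1 - ?a)) \<le> t"
    using p_triangle[of "scal (of_real t) - b" "?a + b - 1"] t sum by (simp add: algebra_simps)
  then have "pos (1 - ?a)" using t by (auto simp: pos_def star_diff star_mult)
  then have "p ?a \<le> p (?a + (1 - ?a))"
    by (rule p_pos_mono[OF pos_star_mult]) (simp add: algebra_simps)
  then have "(p x)\<^sup>2 \<le> 1" using p_1 by (simp add: p_star_mult)
  then show ?thesis by (simp add: power2_le_imp_le[of "p x" 1])
qed

end

section \<open>Finite-dimensional weighted inner products and projections\<close>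

section \<open>Orthonormal systems of functions\<close>

definition ip :: "'a set \<Rightarrow> ('a \<Rightarrow> real) \<Rightarrow> ('a \<Rightarrow> complex) \<Rightarrow> ('a \<Rightarrow> complex) \<Rightarrow> complex"
  where "ip D W f g = (\<Sum>x\<in>D. f x * cnj (g x) * of_real (W x))"

lemma ip_add_left: "ip D W (\<lambda>x. f x + g x) h = ip D W f h + ip D W g h"
  by (simp add: ip_def algebra_simps sum.distrib)

lemma ip_diff_left: "ip D W (\<lambda>x. f x - g x) h = ip D W f h - ip D W g h"
  by (simp add: ip_def algebra_simps sum_subtractf)

lemma ip_scale_left: "ip D W (\<lambda>x. c * f x) h = c * ip D W f h"
  by (simp add: ip_def algebra_simps sum_distrib_left)

lemma ip_sum_left: "ip D W (\<lambda>x. \<Sum>a\<in>A. f a x) h = (\<Sum>a\<in>A. ip D W (f a) h)"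
  by (simp add: ip_def sum_distrib_right sum_distrib_left sum.swap[of _ A])

lemma ip_cnj: "cnj (ip D W f g) = ip D W g f"
  by (simp add: ip_def algebra_simps)

lemma ip_sum_right: "ip D W h (\<lambda>x. \<Sum>a\<in>A. f a x) = (\<Sum>a\<in>A. ip D W h (f a))"
  by (subst (1 2) ip_cnj[symmetric]) (simp add: ip_sum_left)

lemma ip_scale_right: "ip D W h (\<lambda>x. c * f x) = cnj c * ip D W h f"
  by (subst (1 2) ip_cnj[symmetric]) (simp add: ip_scale_left)

lemma ip_diff_right: "ip D W h (\<lambda>x. f x - g x) = ip D W h f - ip D W h g"
  by (simp add: ip_def algebra_simps sum_subtractf)

lemma ip_self: "ip D W f f = of_real (\<Sum>x\<in>D. (cmod (f x))\<^sup>2 * W x)"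
  by (simp add: ip_def complex_norm_square del: of_real_power)

definition orthonormal :: "'a set \<Rightarrow> ('a \<Rightarrow> real) \<Rightarrow> nat \<Rightarrow> (nat \<Rightarrow> 'a \<Rightarrow> complex) \<Rightarrow> bool"
  where "orthonormal D W m f \<longleftrightarrow> (\<forall>a<m. \<forall>b<m. ip D W (f a) (f b) = (if a = b then 1 else 0))"

definition projection :: "'a set \<Rightarrow> ('a \<Rightarrow> real) \<Rightarrow> nat \<Rightarrow> (nat \<Rightarrow> 'a \<Rightarrow> complex) \<Rightarrow> ('a \<Rightarrow> complex) \<Rightarrow> 'a \<Rightarrow> complex"
  where "projection D W m f e x = (\<Sum>a<m. ip D W e (f a) * f a x)"

definition function_subspace :: "('a \<Rightarrow> complex) set \<Rightarrow> bool"
  where "function_subspace S \<longleftrightarrow> (\<lambda>x. 0) \<in> S \<and> (\<forall>f\<in>S. \<forall>g\<in>S. \<forall>c d. (\<lambda>x. c * f x + d * g x) \<in> S)"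

lemma function_subspace_combine: "function_subspace S \<Longrightarrow> f \<in> S \<Longrightarrow> g \<in> S \<Longrightarrow> (\<lambda>x. c * f x + d * g x) \<in> S"
  by (simp add: function_subspace_def)

lemma function_subspace_sum:
  assumes S: "function_subspace S" and "finite A" "\<And>a. a \<in> A \<Longrightarrow> f a \<in> S"
  shows "(\<lambda>x. \<Sum>a\<in>A. c a * f a x) \<in> S"
  using assms(2,3)
proof (induction A)
  case (insert a A)
  then show ?case using function_subspace_combine[OF S, of "f a" "\<lambda>x. \<Sum>a\<in>A. c a * f a x" "c a" 1] by simp
qed (use S in \<open>simp add: function_subspace_def\<close>)

context
  fixes D :: "'a set" and W :: "'a \<Rightarrow> real"
  assumes fin: "finite D" and W: "\<And>x. x \<in> D \<Longrightarrow> 0 < W x"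
begin

lemma ip_self_0: "ip D W f f = 0 \<Longrightarrow> x \<in> D \<Longrightarrow> f x = 0"
proof -
  assume "ip D W f f = 0" and x: "x \<in> D"
  then have "(\<Sum>x\<in>D. (cmod (f x))\<^sup>2 * W x) = 0" by (simp only: ip_self of_real_eq_0_iff)
  then have "(cmod (f x))\<^sup>2 * W x = 0"
    using x fin less_imp_le[OF W] by (subst (asm) sum_nonneg_eq_0_iff) auto
  then show "f x = 0" using W[OF x] by simp
qed

lemma projection_orthogonal:
  assumes f: "orthonormal D W m f" and b: "b < m"
  shows "ip D W (\<lambda>x. e x - projection D W m f e x) (f b) = 0"
proof -
  have "ip D W (projection D W m f e) (f b) = (\<Sum>a<m. ip D W e (f a) * ip D W (f a) (f b))"
    unfolding projection_def by (simp add: ip_sum_left ip_scale_left)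
  also have "\<dots> = (\<Sum>a<m. if a = b then ip D W e (f b) else 0)"
    using f b by (intro sum.cong) (auto simp: orthonormal_def)
  finally show ?thesis using b by (simp add: ip_diff_left)
qed

text \<open>Bessel's inequality for the indicator of a point x bounds the contribution of x by 1;
  summing over D counts the family.\<close>

lemma orthonormal_bound:
  assumes f: "orthonormal D W m f"
  shows "m \<le> card D"
proof -
  have bessel: "(\<Sum>a<m. (cmod (f a x))\<^sup>2 * W x) \<le> 1" if x: "x \<in> D" for x
  proof -
    define e :: "'a \<Rightarrow> complex" where "e y = (if y = x then 1 else 0)" for y
    have ef: "ip D W e g = cnj (g x) * W x" for g
    proof -
      have "ip D W e g = (\<Sum>y\<in>D. if y = x then cnj (g x) * W x else 0)"
        unfolding ip_def e_def by (intro sum.cong) auto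
      then show ?thesis using fin x by simp
    qed
    let ?P = "projection D W m f e" and ?r = "\<lambda>y. e y - projection D W m f e y"
    have "ip D W ?r ?r = ip D W ?r e - ip D W ?r ?P" by (rule ip_diff_right)
    also have "ip D W ?r ?P = 0"
      unfolding projection_def[of D W m f e, abs_def] ip_sum_right ip_scale_right
      by (simp add: projection_orthogonal[OF f, unfolded projection_def])
    also have "ip D W ?r e - 0 = W x - ip D W ?P e"
      by (simp add: ip_diff_left ef) (simp add: e_def)
    also have "ip D W ?P e = (\<Sum>a<m. of_real ((cmod (f a x))\<^sup>2 * W x * W x))"
    proof -
      have "ip D W ?P e = (\<Sum>a<m. ip D W e (f a) * cnj (ip D W e (f a)))"
        unfolding projection_def by (simp add: ip_sum_left ip_scale_left ip_cnj)
      then show ?thesis by (simp add: ef complex_norm_square mult_ac del: of_real_power)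
    qed
    finally have "ip D W ?r ?r = of_real (W x - (\<Sum>a<m. (cmod (f a x))\<^sup>2 * W x * W x))" by simp
    then have "(\<Sum>y\<in>D. (cmod (?r y))\<^sup>2 * W y) = W x - (\<Sum>a<m. (cmod (f a x))\<^sup>2 * W x * W x)"
      by (simp only: ip_self of_real_eq_iff)
    moreover have "0 \<le> (\<Sum>y\<in>D. (cmod (?r y))\<^sup>2 * W y)"
      using less_imp_le[OF W] by (intro sum_nonneg) auto
    ultimately have "0 \<le> W x - (\<Sum>a<m. (cmod (f a x))\<^sup>2 * W x * W x)" by simp
    then have "W x * (\<Sum>a<m. (cmod (f a x))\<^sup>2 * W x) \<le> W x * 1"
      by (simp add: sum_distrib_left mult_ac)
    then show ?thesis using W[OF x] by simp
  qed
  have "real m = (\<Sum>a<m. \<Sum>x\<in>D. (cmod (f a x))\<^sup>2 * W x)"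
  proof -
    have "(\<Sum>x\<in>D. (cmod (f a x))\<^sup>2 * W x) = 1" if "a < m" for a
    proof -
      have "complex_of_real (\<Sum>x\<in>D. (cmod (f a x))\<^sup>2 * W x) = 1"
        using f that unfolding ip_self[symmetric] orthonormal_def by simp
      then show ?thesis by (metis of_real_1 of_real_eq_iff)
    qed
    then show ?thesis by simp
  qed
  also have "\<dots> = (\<Sum>x\<in>D. \<Sum>a<m. (cmod (f a x))\<^sup>2 * W x)" by (rule sum.swap)
  also have "\<dots> \<le> (\<Sum>x\<in>D. 1)" using bessel by (intro sum_mono) auto
  finally show ?thesis by simp
qed

text \<open>An orthonormal family in S of maximal size spans S on D: the normalized remainder of a
  function that is not reproduced would enlarge it.\<close>

lemma orthonormal_basis_exists:
  assumes S: "function_subspace S"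
  shows "\<exists>m f. (\<forall>a<m. f a \<in> S) \<and> orthonormal D W m f \<and> (\<forall>g\<in>S. \<forall>x\<in>D. g x = projection D W m f g x)"
proof -
  let ?Q = "\<lambda>m. \<exists>f. (\<forall>a<m. f a \<in> S) \<and> orthonormal D W m f"
  have "?Q 0" by (simp add: orthonormal_def)
  have bd: "\<And>m. ?Q m \<Longrightarrow> m \<le> card D" using orthonormal_bound by blast
  define m where "m = (GREATEST m. ?Q m)"
  have m: "?Q m" unfolding m_def using \<open>?Q 0\<close> bd by (rule GreatestI_nat)
  have max: "k \<le> m" if "?Q k" for k unfolding m_def using that bd by (rule Greatest_le_nat)
  from m obtain f where f: "\<forall>a<m. f a \<in> S" "orthonormal D W m f" by blast
  have "g x = projection D W m f g x" if g: "g \<in> S" and x: "x \<in> D" for g x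
  proof (rule ccontr)
    assume ne: "g x \<noteq> projection D W m f g x"
    define r where "r = (\<lambda>y. g y - projection D W m f g y)"
    have "projection D W m f g \<in> S"
      unfolding projection_def[abs_def] using f by (intro function_subspace_sum[OF S]) auto
    then have rS: "r \<in> S"
      using function_subspace_combine[OF S g, of "projection D W m f g" 1 "-1"] by (simp add: r_def)
    have rf: "ip D W r (f b) = 0" if "b < m" for b
      unfolding r_def by (rule projection_orthogonal[OF f(2) that])
    define s where "s = (\<Sum>x\<in>D. (cmod (r x))\<^sup>2 * W x)"
    have ips: "ip D W r r = of_real s" by (simp add: ip_self s_def)
    have "s \<noteq> 0" using ip_self_0[of r x] x ne ips by (auto simp: r_def)
    moreover have "0 \<le> s" unfolding s_def using less_imp_le[OF W] by (intro sum_nonneg) auto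
    ultimately have s: "0 < s" by simp
    define e where "e = (\<lambda>y. of_real (1 / sqrt s) * r y)"
    have eS: "e \<in> S" using function_subspace_combine[OF S rS rS, of "of_real (1 / sqrt s)" 0] by (simp add: e_def)
    have ee: "ip D W e e = 1"
      unfolding e_def ip_scale_left ip_scale_right ips using s
      by (simp flip: of_real_mult of_real_divide)
    have ef: "ip D W e (f b) = 0" "ip D W (f b) e = 0" if "b < m" for b
    proof -
      show "ip D W e (f b) = 0" unfolding e_def ip_scale_left rf[OF that] by simp
      then show "ip D W (f b) e = 0" by (metis ip_cnj complex_cnj_zero)
    qed
    let ?f = "\<lambda>a. if a = m then e else f a"
    have "?Q (Suc m)"
    proof (intro exI[of _ ?f] conjI)
      show "\<forall>a<Suc m. ?f a \<in> S" using f eS by auto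
      show "orthonormal D W (Suc m) ?f"
        using f(2) ee ef unfolding orthonormal_def by (auto simp: less_Suc_eq)
    qed
    then show False using max[of "Suc m"] by simp
  qed
  then show ?thesis using f by blast
qed

lemma ip_projection:
  assumes f: "orthonormal D W m f" and g: "\<And>x. x \<in> D \<Longrightarrow> g x = projection D W m f g x"
  shows "ip D W (projection D W m f e) g = ip D W e g"
proof -
  have "ip D W (\<lambda>x. e x - projection D W m f e x) g = ip D W (\<lambda>x. e x - projection D W m f e x) (projection D W m f g)"
    unfolding ip_def using g by (intro sum.cong) auto
  also have "\<dots> = 0"
    unfolding projection_def[of D W m f g, abs_def] ip_sum_right ip_scale_right
    by (simp add: projection_orthogonal[OF f])
  finally show ?thesis by (simp add: ip_diff_left)
qed

end


section \<open>The span of the noncrossing pairings, and contractions\<close>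

section \<open>Noncrossing tensors\<close>

lemma pair_overlap_cases:
  assumes "a @ x # y # b = a' @ x' # y' # b'"
  obtains (same) "a = a'" "x = x'" "y = y'" "b = b'"
  | (right) "a = a' @ [x']" "x = y'" "b' = y # b"
  | (left) "a' = a @ [x]" "x' = y" "b = y' # b'"
  | (far_right) m where "a = a' @ x' # y' # m" "b' = m @ x # y # b"
  | (far_left) m where "a' = a @ x # y # m" "b = m @ x' # y' # b'"
proof -
  from assms consider (1) us where "a = a' @ us" "us @ x # y # b = x' # y' # b'"
    | (2) us where "a' = a @ us" "us @ x' # y' # b' = x # y # b"
    by (auto simp: append_eq_append_conv2)
  then show thesis
  proof cases
    case 1
    show thesis
    proof (cases us)
      case Nil
      then show thesis using 1 same by simp
    next
      case (Cons u us')
      then show thesis using 1 right far_right by (cases us') auto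
    qed
  next
    case 2
    show thesis
    proof (cases us)
      case Nil
      then show thesis using 2 same by simp
    next
      case (Cons u us')
      then show thesis using 2 left far_left by (cases us') auto
    qed
  qed
qed

definition tuples :: "nat \<Rightarrow> 'n list set"
  where "tuples n = {i. length i = n}"

lemma finite_tuples [simp]: "finite (tuples n :: 'n::finite list set)"
  using finite_lists_length_eq[of "UNIV :: 'n set" n] by (simp add: tuples_def)

lemma tuples_0 [simp]: "tuples 0 = {[]}"
  by (auto simp: tuples_def)

lemma sum_tuples_Suc:
  fixes g :: "'n::finite list \<Rightarrow> 'b::comm_monoid_add"
  shows "(\<Sum>i\<in>tuples (Suc n). g i) = (\<Sum>k\<in>UNIV. \<Sum>i\<in>tuples n. g (k # i))"
proof -
  have "(\<Sum>i\<in>tuples (Suc n). g i) = (\<Sum>(k, i)\<in>UNIV \<times> tuples n. g (k # i))"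
    by (rule sum.reindex_bij_witness[of _ "\<lambda>(k, i). k # i" "\<lambda>i. (hd i, tl i)"])
       (auto simp: tuples_def length_Suc_conv)
  then show ?thesis by (simp add: sum.cartesian_product)
qed

lemma sum_tuples_append:
  fixes g :: "'n::finite list \<Rightarrow> 'b::comm_monoid_add"
  shows "(\<Sum>i\<in>tuples (m + n). g i) = (\<Sum>i\<in>tuples m. \<Sum>j\<in>tuples n. g (i @ j))"
  by (induction m arbitrary: g) (simp_all add: sum_tuples_Suc)

lemma sum_tuples_pair:
  fixes g :: "'n::finite list \<Rightarrow> 'b::comm_monoid_add"
  shows "(\<Sum>i\<in>tuples (m + Suc (Suc n)). g i) = (\<Sum>i\<in>tuples m. \<Sum>j\<in>tuples n. \<Sum>k\<in>UNIV. \<Sum>l\<in>UNIV. g (i @ k # l # j))"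
  unfolding sum_tuples_append sum_tuples_Suc
  by (intro sum.cong refl) (simp add: sum.swap[of _ "tuples n"])

lemma tuples_split:
  assumes "length i = m + n"
  obtains i\<^sub>1 i\<^sub>2 where "i = i\<^sub>1 @ i\<^sub>2" "length i\<^sub>1 = m" "length i\<^sub>2 = n"
  using assms by (metis append_take_drop_id length_drop length_take diff_add_inverse le_add1 min.absorb2)

lemma tuples_split_pair:
  assumes "length i = m + Suc (Suc n)"
  obtains i\<^sub>1 k l i\<^sub>2 where "i = i\<^sub>1 @ k # l # i\<^sub>2" "length i\<^sub>1 = m" "length i\<^sub>2 = n"
proof -
  obtain i1 j where "i = i1 @ j" "length i1 = m" "length j = Suc (Suc n)" using tuples_split[OF assms] .
  then show thesis using that by (auto simp: length_Suc_conv)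
qed

text \<open>The numbers f are the eigenvalues of the positive matrix F after
  diagonalization.\<close>

locale haar =
  fixes f :: "'n::finite \<Rightarrow> real"
  assumes f_pos: "\<And>k. 0 < f k"
begin

definition cw :: "bool \<Rightarrow> 'n \<Rightarrow> real" where "cw s k = (if s then 1 else f k)"
definition rw :: "bool \<Rightarrow> 'n \<Rightarrow> real" where "rw s k = (if s then 1 / f k else 1)"
text \<open>\<open>cw\<close> and \<open>rw\<close> are the coefficients of the column and row
  relations. The weight \<open>nw\<close> is chosen so that inserting a pair with \<open>cw\<close>
  is adjoint to contracting a pair with \<open>rw\<close> (\<open>weights\<close>).\<close>

definition nw :: "bool \<Rightarrow> 'n \<Rightarrow> real" where "nw s k = (if s then 1 else 1 / f k)"

lemma cw_pos: "0 < cw s k" and rw_pos: "0 < rw s k" and nw_pos: "0 < nw s k"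
  using f_pos by (auto simp: cw_def rw_def nw_def)

lemma weights: "cw s k * (nw s k * nw (\<not> s) k) = rw s k" "rw s k * cw (\<not> s) k = 1" "cw (\<not> s) k * rw s k = 1"
  using f_pos[of k] by (auto simp: cw_def rw_def nw_def)

text \<open>The invariant vectors of the tensor product of the fundamental representation and its conjugate
  indexed by a word of signs: the linear combinations of noncrossing pairings.\<close>

inductive fx :: "bool list \<Rightarrow> ('n list \<Rightarrow> complex) \<Rightarrow> bool"
  where
    nil: "fx [] \<phi>"
  | cup: "\<lbrakk>fx (a @ b) \<xi>; \<And>i\<^sub>1 k l i\<^sub>2. length i\<^sub>1 = length a \<Longrightarrow> length i\<^sub>2 = length b \<Longrightarrow>
        \<phi> (i\<^sub>1 @ k # l # i\<^sub>2) = (if k = l then of_real (cw s k) * \<xi> (i\<^sub>1 @ i\<^sub>2) else 0)\<rbrakk>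
      \<Longrightarrow> fx (a @ s # (\<not> s) # b) \<phi>"
  | zero: "(\<And>i. length i = length t \<Longrightarrow> \<phi> i = 0) \<Longrightarrow> fx t \<phi>"
  | lin: "\<lbrakk>fx t \<xi>; fx t \<eta>; \<And>i. length i = length t \<Longrightarrow> \<phi> i = c * \<xi> i + d * \<eta> i\<rbrakk> \<Longrightarrow> fx t \<phi>"

lemma fx_scale: "fx t \<xi> \<Longrightarrow> (\<And>i. length i = length t \<Longrightarrow> \<phi> i = c * \<xi> i) \<Longrightarrow> fx t \<phi>"
  by (rule fx.lin[of t \<xi> \<xi> \<phi> c 0]) auto

lemma fx_cong: "fx t \<xi> \<Longrightarrow> (\<And>i. length i = length t \<Longrightarrow> \<phi> i = \<xi> i) \<Longrightarrow> fx t \<phi>"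
  by (rule fx_scale[of t \<xi> \<phi> 1]) auto

lemma fx_subspace: "function_subspace {\<phi>. fx t \<phi>}"
  unfolding function_subspace_def
proof (intro conjI ballI allI; unfold mem_Collect_eq)
  show "fx t (\<lambda>i. 0)" by (rule fx.zero) simp
  show "fx t (\<lambda>i. c * \<xi> i + d * \<eta> i)" if "fx t \<xi>" "fx t \<eta>" for \<xi> \<eta> c d
    by (rule fx.lin[OF that]) simp
qed

text \<open>By the position of the contracted pair relative to the last inserted one: the same pair
  gives a scalar loop, an overlap straightens a zigzag because \<open>rw\<close> times
  \<open>cw\<close> is 1, and disjoint pairs commute.\<close>

lemma fx_cap:
  assumes "fx t \<phi>" and "t = a @ s # (\<not> s) # b"
    and "\<And>i\<^sub>1 i\<^sub>2. length i\<^sub>1 = length a \<Longrightarrow> length i\<^sub>2 = length b \<Longrightarrow>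
      \<psi> (i\<^sub>1 @ i\<^sub>2) = (\<Sum>k\<in>UNIV. of_real (rw s k) * \<phi> (i\<^sub>1 @ k # k # i\<^sub>2))"
  shows "fx (a @ b) \<psi>"
  using assms
proof (induction arbitrary: a s b \<psi> rule: fx.induct)
  case (nil \<phi>)
  then show ?case by simp
next
  case (zero t \<phi>)
  show ?case
  proof (rule fx.zero)
    fix i :: "'n list" assume "length i = length (a @ b)"
    then obtain i1 i2 where "i = i1 @ i2" "length i1 = length a" "length i2 = length b"
      using tuples_split[of i "length a" "length b"] by auto
    then show "\<psi> i = 0" using zero by simp
  qed
next
  case (lin t \<xi> \<eta> \<phi> c d)
  let ?cap = "\<lambda>\<phi> i. \<Sum>k\<in>UNIV. of_real (rw s k) * \<phi> (take (length a) i @ k # k # drop (length a) i)"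
  show ?case
  proof (rule fx.lin)
    show "fx (a @ b) (?cap \<xi>)" by (rule lin.IH(1)[OF lin.prems(1)]) simp
    show "fx (a @ b) (?cap \<eta>)" by (rule lin.IH(2)[OF lin.prems(1)]) simp
    fix i :: "'n list" assume "length i = length (a @ b)"
    then obtain i1 i2 where "i = i1 @ i2" "length i1 = length a" "length i2 = length b"
      using tuples_split[of i "length a" "length b"] by auto
    then show "\<psi> i = c * ?cap \<xi> i + d * ?cap \<eta> i"
      using lin by (simp add: sum_distrib_left sum.distrib[symmetric] algebra_simps)
  qed
next
  case (cup a' b' \<xi> \<phi> s')
  note \<psi> = cup.prems(2)
  have delta: "(\<Sum>k\<in>UNIV. of_real (rw s k) * (if x = k then g k else 0)) = of_real (rw s x) * g x"
    "(\<Sum>k\<in>UNIV. of_real (rw s k) * (if k = x then g k else 0)) = of_real (rw s x) * g x"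
    for g :: "'n \<Rightarrow> complex" and x
    by (simp_all add: if_distrib[of "\<lambda>z. _ * z"] cong: if_cong)
  from cup.prems(1)[symmetric] show ?case
  proof (cases rule: pair_overlap_cases)
    case same
    show ?thesis
    proof (rule fx_scale)
      show "fx (a @ b) \<xi>" using cup.hyps same by simp
      fix i :: "'n list" assume "length i = length (a @ b)"
      then obtain i1 i2 where i: "i = i1 @ i2" "length i1 = length a" "length i2 = length b"
        using tuples_split[of i "length a" "length b"] by auto
      then show "\<psi> i = (\<Sum>k\<in>UNIV. of_real (rw s k) * of_real (cw s k)) * \<xi> i"
        using \<psi>[OF i(2,3)] cup.hyps(2) same by (simp add: sum_distrib_right mult.assoc)
    qed
  next
    case right
    show ?thesis
    proof (rule fx_cong)
      show "fx (a @ b) \<xi>" using cup.hyps(1) right by simp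
      fix i :: "'n list" assume "length i = length (a @ b)"
      then obtain i1 i2 where i: "i = i1 @ i2" "length i1 = length a" "length i2 = length b"
        using tuples_split[of i "length a" "length b"] by auto
      obtain j x where j: "i1 = j @ [x]" "length j = length a'" using i right by (auto simp: length_Suc_conv_rev)
      have "\<psi> i = (\<Sum>k\<in>UNIV. of_real (rw s k) * (if x = k then of_real (cw s' x) * \<xi> i else 0))"
        unfolding i(1) \<psi>[OF i(2,3)] using cup.hyps(2)[of j _ ] j i(3) right(3) by (intro sum.cong) auto
      then show "\<psi> i = \<xi> i" unfolding delta using right weights(2)[of s x]
        by (simp flip: of_real_mult mult.assoc)
    qed
  next
    case left
    show ?thesis
    proof (rule fx_cong)
      show "fx (a @ b) \<xi>" using cup.hyps(1) left by simp
      fix i :: "'n list" assume "length i = length (a @ b)"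
      then obtain i1 i2 where i: "i = i1 @ i2" "length i1 = length a" "length i2 = length b"
        using tuples_split[of i "length a" "length b"] by auto
      obtain j x where j: "i2 = x # j" "length j = length b'" using i left by (auto simp: length_Suc_conv)
      have "\<phi> (i1 @ k # k # i2) = (if k = x then of_real (cw s' x) * \<xi> i else 0)" for k
        using cup.hyps(2)[of "i1 @ [k]" j k x] j i left by auto
      then have "\<psi> i = (\<Sum>k\<in>UNIV. of_real (rw s k) * (if k = x then of_real (cw s' x) * \<xi> i else 0))"
        unfolding i(1) \<psi>[OF i(2,3)] by simp
      then show "\<psi> i = \<xi> i" unfolding delta using left weights(2)[of s x]
        by (simp flip: of_real_mult mult.assoc)
    qed
  next
    case (far_right m)
    let ?cap = "\<lambda>i. \<Sum>k\<in>UNIV. of_real (rw s k) * \<xi> (take (length (a' @ m)) i @ k # k # drop (length (a' @ m)) i)"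
    have "fx ((a' @ m) @ b) ?cap" by (rule cup.IH) (use far_right in simp_all)
    then have "fx (a' @ s' # (\<not> s') # m @ b) \<psi>"
    proof (intro fx.cup[of a' "m @ b"])
      fix i1 i2 :: "'n list" and k l assume l: "length i1 = length a'" "length i2 = length (m @ b)"
      then obtain j1 j2 where j: "i2 = j1 @ j2" "length j1 = length m" "length j2 = length b"
        using tuples_split[of i2 "length m" "length b"] by auto
      have "\<psi> (i1 @ k # l # i2) = \<psi> ((i1 @ k # l # j1) @ j2)" using j by simp
      also have "\<dots> = (\<Sum>r\<in>UNIV. of_real (rw s r) * \<phi> (i1 @ k # l # (j1 @ r # r # j2)))"
        using l j far_right by (subst \<psi>) auto
      also have "\<dots> = (if k = l then of_real (cw s' k) * ?cap (i1 @ i2) else 0)"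
        using l j far_right by (subst cup.hyps(2)) (auto simp: sum_distrib_left algebra_simps)
      finally show "\<psi> (i1 @ k # l # i2) = (if k = l then of_real (cw s' k) * ?cap (i1 @ i2) else 0)" .
    qed simp
    then show ?thesis using far_right by simp
  next
    case (far_left m)
    let ?cap = "\<lambda>i. \<Sum>k\<in>UNIV. of_real (rw s k) * \<xi> (take (length a) i @ k # k # drop (length a) i)"
    have "fx (a @ m @ b') ?cap" by (rule cup.IH) (use far_left in simp_all)
    then have "fx ((a @ m) @ s' # (\<not> s') # b') \<psi>"
    proof (intro fx.cup[of "a @ m" b'])
      fix i1 i2 :: "'n list" and k l assume l: "length i1 = length (a @ m)" "length i2 = length b'"
      then obtain j1 j2 where j: "i1 = j1 @ j2" "length j1 = length a" "length j2 = length m"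
        using tuples_split[of i1 "length a" "length m"] by auto
      have "\<psi> (i1 @ k # l # i2) = \<psi> (j1 @ (j2 @ k # l # i2))" using j by simp
      also have "\<dots> = (\<Sum>r\<in>UNIV. of_real (rw s r) * \<phi> ((j1 @ r # r # j2) @ k # l # i2))"
        using l j far_left by (subst \<psi>) auto
      also have "\<dots> = (if k = l then of_real (cw s' k) * ?cap (i1 @ i2) else 0)"
        using l j far_left by (subst cup.hyps(2)) (auto simp: sum_distrib_left algebra_simps)
      finally show "\<psi> (i1 @ k # l # i2) = (if k = l then of_real (cw s' k) * ?cap (i1 @ i2) else 0)" .
    qed simp
    then show ?thesis using far_left by simp
  qed
qed

text \<open>Coefficient tensors that annihilate every inserted pair.\<close>

definition red :: "bool list \<Rightarrow> ('n list \<Rightarrow> complex) \<Rightarrow> bool"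
  where "red t c \<longleftrightarrow> (\<forall>a s b i\<^sub>1 i\<^sub>2. t = a @ s # (\<not> s) # b \<longrightarrow> length i\<^sub>1 = length a \<longrightarrow> length i\<^sub>2 = length b \<longrightarrow>
    (\<Sum>k\<in>UNIV. of_real (cw s k) * c (i\<^sub>1 @ k # k # i\<^sub>2)) = 0)"

text \<open>The index i enters reversed because the word for s comes from the adjoint factor in star
  y y.\<close>

definition pairing :: "bool list \<Rightarrow> bool list \<Rightarrow> ('n list \<Rightarrow> complex) \<Rightarrow> ('n list \<Rightarrow> complex) \<Rightarrow> ('n list \<Rightarrow> complex) \<Rightarrow> complex"
  where "pairing s t c c' \<phi> = (\<Sum>i\<in>tuples (length s). \<Sum>j\<in>tuples (length t). c i * c' j * \<phi> (rev i @ j))"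

fun nest :: "bool list \<Rightarrow> 'n list \<Rightarrow> real"
  where "nest (s # t) (k # i) = cw (\<not> s) k * nest t i" | "nest _ _ = 1"

lemma nest_pos: "0 < nest t i"
  by (induction t i rule: nest.induct) (auto simp: cw_pos)

definition bar :: "bool list \<Rightarrow> bool list"
  where "bar t = rev (map Not t)"

lemma bar_simps [simp]: "length (bar t) = length t" "bar (s @ t) = bar t @ bar s" "bar [] = []" "bar (x # t) = bar t @ [\<not> x]" "bar (bar t) = t"
  by (simp_all add: bar_def rev_map o_def)

lemma red_Cons: "red (x # t) c \<Longrightarrow> red t (\<lambda>i. c (k # i))"
  unfolding red_def
proof (intro allI impI)
  fix a s b and i\<^sub>1 i\<^sub>2 :: "'n list"
  assume r: "\<forall>a s b i\<^sub>1 i\<^sub>2. x # t = a @ s # (\<not> s) # b \<longrightarrow> length i\<^sub>1 = length a \<longrightarrow> length i\<^sub>2 = length b \<longrightarrow>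
      (\<Sum>k\<in>UNIV. of_real (cw s k) * c (i\<^sub>1 @ k # k # i\<^sub>2)) = 0"
    and *: "t = a @ s # (\<not> s) # b" "length i\<^sub>1 = length a" "length i\<^sub>2 = length b"
  show "(\<Sum>r\<in>UNIV. of_real (cw s r) * c (k # i\<^sub>1 @ r # r # i\<^sub>2)) = 0"
    using r[rule_format, of "x # a" s b "k # i\<^sub>1" i\<^sub>2] * by simp
qed

lemma red_pair_sum:
  assumes "red (a @ s # (\<not> s) # b) c" "length i\<^sub>1 = length a" "length i\<^sub>2 = length b"
  shows "(\<Sum>k\<in>UNIV. \<Sum>l\<in>UNIV. c (i\<^sub>1 @ k # l # i\<^sub>2) * (if k = l then of_real (cw s k) * z else 0)) = 0"
proof -
  have "(\<Sum>k\<in>UNIV. \<Sum>l\<in>UNIV. c (i\<^sub>1 @ k # l # i\<^sub>2) * (if k = l then of_real (cw s k) * z else 0)) =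
      (\<Sum>k\<in>UNIV. of_real (cw s k) * c (i\<^sub>1 @ k # k # i\<^sub>2)) * z"
    by (simp add: sum_distrib_right if_distrib[of "\<lambda>z. _ * z"] mult_ac cong: if_cong)
       (simp add: sum_distrib_left)
  then show ?thesis using assms unfolding red_def by simp
qed

text \<open>A noncrossing pairing with a pair inside s or inside t is killed by reducedness.
  Otherwise a pair joins the two heads; removing it leads to shorter words. Only the nested pairing
  with s = t survives, so the value is one universal multiple of a weighted inner product.\<close>

lemma fx_pairing:
  assumes "fx T \<phi>" and "T = bar s @ t"
  shows "\<exists>\<kappa>. \<forall>c c'. red s c \<longrightarrow> red t c' \<longrightarrow>
    pairing s t c c' \<phi> = (if s = t then \<kappa> * (\<Sum>i\<in>tuples (length s). c i * c' i * of_real (nest s i)) else 0)"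
  using assms
proof (induction arbitrary: s t rule: fx.induct)
  case (nil \<phi>)
  then have "s = []" "t = []" by (auto simp: bar_def)
  then show ?case by (intro exI[of _ "\<phi> []"]) (simp add: pairing_def)
next
  case (zero T \<phi>)
  then have "pairing s t c c' \<phi> = 0" for c c'
    unfolding pairing_def by (intro sum.neutral ballI) (simp add: tuples_def)
  then show ?case by (intro exI[of _ 0]) simp
next
  case (lin T \<xi> \<eta> \<phi> \<alpha> \<beta>)
  obtain \<kappa> \<mu> where *: "\<forall>c c'. red s c \<longrightarrow> red t c' \<longrightarrow>
      pairing s t c c' \<xi> = (if s = t then \<kappa> * (\<Sum>i\<in>tuples (length s). c i * c' i * of_real (nest s i)) else 0)"
    "\<forall>c c'. red s c \<longrightarrow> red t c' \<longrightarrow>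
      pairing s t c c' \<eta> = (if s = t then \<mu> * (\<Sum>i\<in>tuples (length s). c i * c' i * of_real (nest s i)) else 0)"
    using lin.IH(1)[OF lin.prems] lin.IH(2)[OF lin.prems] by blast
  have "pairing s t c c' \<phi> = \<alpha> * pairing s t c c' \<xi> + \<beta> * pairing s t c c' \<eta>" for c c'
  proof -
    have "pairing s t c c' \<phi> = (\<Sum>i\<in>tuples (length s). \<Sum>j\<in>tuples (length t). \<alpha> * (c i * c' j * \<xi> (rev i @ j)) + \<beta> * (c i * c' j * \<eta> (rev i @ j)))"
      unfolding pairing_def using lin.hyps(3) lin.prems
      by (intro sum.cong refl) (simp add: tuples_def algebra_simps)
    then show ?thesis by (simp add: pairing_def sum.distrib sum_distrib_left)
  qed
  then show ?case using * by (intro exI[of _ "\<alpha> * \<kappa> + \<beta> * \<mu>"]) (simp add: algebra_simps)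
next
  case (cup a b \<xi> \<phi> x)
  from cup.prems consider (inner) m where "t = m @ x # (\<not> x) # b" "a = bar s @ m"
    | (outer) m where "a @ x # (\<not> x) # m = bar s" "b = m @ t"
    | (mid) "bar s = a @ [x]" "t = (\<not> x) # b"
    by (auto simp: append_eq_append_conv2 append_eq_Cons_conv Cons_eq_append_conv)
  then show ?case
  proof cases
    case inner
    have "pairing s t c c' \<phi> = 0" if "red t c'" for c c'
    proof -
      have "pairing s t c c' \<phi> = (\<Sum>i\<in>tuples (length s). \<Sum>j\<^sub>1\<in>tuples (length m). \<Sum>j\<^sub>2\<in>tuples (length b).
          c i * (\<Sum>k\<in>UNIV. \<Sum>l\<in>UNIV. c' (j\<^sub>1 @ k # l # j\<^sub>2) * (if k = l then of_real (cw x k) * \<xi> (rev i @ j\<^sub>1 @ j\<^sub>2) else 0)))"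
        unfolding pairing_def inner(1) length_append length_Cons sum_tuples_pair
      proof (intro sum.cong refl)
        fix i j1 j2 :: "'n list"
        assume "i \<in> tuples (length s)" "j1 \<in> tuples (length m)" "j2 \<in> tuples (length b)"
        then have "\<phi> (rev i @ j1 @ k # l # j2) = (if k = l then of_real (cw x k) * \<xi> (rev i @ j1 @ j2) else 0)" for k l
          using cup.hyps(2)[of "rev i @ j1" j2 k l] inner by (simp add: tuples_def)
        then show "(\<Sum>k\<in>UNIV. \<Sum>l\<in>UNIV. c i * c' (j1 @ k # l # j2) * \<phi> (rev i @ j1 @ k # l # j2)) =
          c i * (\<Sum>k\<in>UNIV. \<Sum>l\<in>UNIV. c' (j1 @ k # l # j2) * (if k = l then of_real (cw x k) * \<xi> (rev i @ j1 @ j2) else 0))"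
          by (simp only: sum_distrib_left mult.assoc)
      qed
      also have "\<dots> = 0"
        using red_pair_sum[OF that[unfolded inner(1)]] by (intro sum.neutral ballI) (simp add: tuples_def)
      finally show ?thesis .
    qed
    then show ?thesis by (intro exI[of _ 0]) simp
  next
    case outer
    have s: "s = bar m @ x # (\<not> x) # bar a" using arg_cong[OF outer(1), of bar] by simp
    have "pairing s t c c' \<phi> = 0" if "red s c" for c c'
    proof -
      have "pairing s t c c' \<phi> = (\<Sum>i\<^sub>1\<in>tuples (length m). \<Sum>i\<^sub>2\<in>tuples (length a). \<Sum>k\<in>UNIV. \<Sum>l\<in>UNIV. \<Sum>j\<in>tuples (length t).
          c' j * (c (i\<^sub>1 @ k # l # i\<^sub>2) * (if k = l then of_real (cw x k) * \<xi> (rev i\<^sub>2 @ rev i\<^sub>1 @ j) else 0)))"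
        unfolding pairing_def s length_append length_Cons sum_tuples_pair bar_simps
      proof (intro sum.cong refl)
        fix i1 i2 j :: "'n list" and k l
        assume "i1 \<in> tuples (length m)" "i2 \<in> tuples (length a)" "j \<in> tuples (length t)"
        then have "\<phi> (rev i2 @ l # k # rev i1 @ j) = (if l = k then of_real (cw x l) * \<xi> (rev i2 @ rev i1 @ j) else 0)"
          using cup.hyps(2)[of "rev i2" "rev i1 @ j" l k] outer by (simp add: tuples_def)
        then show "c (i1 @ k # l # i2) * c' j * \<phi> (rev (i1 @ k # l # i2) @ j) =
          c' j * (c (i1 @ k # l # i2) * (if k = l then of_real (cw x k) * \<xi> (rev i2 @ rev i1 @ j) else 0))"
          by (simp add: mult_ac)
      qed
      also have "\<dots> = (\<Sum>i\<^sub>1\<in>tuples (length m). \<Sum>i\<^sub>2\<in>tuples (length a). \<Sum>j\<in>tuples (length t).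
          c' j * (\<Sum>k\<in>UNIV. \<Sum>l\<in>UNIV. c (i\<^sub>1 @ k # l # i\<^sub>2) * (if k = l then of_real (cw x k) * \<xi> (rev i\<^sub>2 @ rev i\<^sub>1 @ j) else 0)))"
        by (simp only: sum_distrib_left sum.swap[of _ "tuples (length t)"])
      also have "\<dots> = 0"
        using red_pair_sum[OF that[unfolded s]] by (intro sum.neutral ballI) (simp add: tuples_def)
      finally show ?thesis .
    qed
    then show ?thesis by (intro exI[of _ 0]) simp
  next
    \<comment> \<open>The pair joins the first letters of s and t; tensors with one index fixed stay
      reduced by \<open>red_Cons\<close>.\<close>
    case mid
    define s\<^sub>0 where "s\<^sub>0 = bar a"
    have s: "s = (\<not> x) # s\<^sub>0" using arg_cong[OF mid(1), of bar] by (simp add: s\<^sub>0_def)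
    have a: "a = bar s\<^sub>0" by (simp add: s\<^sub>0_def)
    obtain \<kappa> where \<kappa>: "\<And>c c'. red s\<^sub>0 c \<Longrightarrow> red b c' \<Longrightarrow>
      pairing s\<^sub>0 b c c' \<xi> = (if s\<^sub>0 = b then \<kappa> * (\<Sum>i\<in>tuples (length s\<^sub>0). c i * c' i * of_real (nest s\<^sub>0 i)) else 0)"
      using cup.IH[of s\<^sub>0 b] a by blast
    have "pairing s t c c' \<phi> = (if s = t then \<kappa> * (\<Sum>i\<in>tuples (length s). c i * c' i * of_real (nest s i)) else 0)"
      if "red s c" "red t c'" for c c'
    proof -
      have "pairing s t c c' \<phi> = (\<Sum>k\<in>UNIV. \<Sum>i\<in>tuples (length s\<^sub>0). \<Sum>l\<in>UNIV. \<Sum>j\<in>tuples (length b).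
          if k = l then of_real (cw x k) * (c (k # i) * c' (l # j) * \<xi> (rev i @ j)) else 0)"
        unfolding pairing_def s mid(2) length_Cons sum_tuples_Suc
      proof (intro sum.cong refl)
        fix i j :: "'n list" and k l
        assume "i \<in> tuples (length s\<^sub>0)" "j \<in> tuples (length b)"
        then have "\<phi> (rev i @ k # l # j) = (if k = l then of_real (cw x k) * \<xi> (rev i @ j) else 0)"
          using cup.hyps(2)[of "rev i" j k l] by (simp add: tuples_def s\<^sub>0_def)
        then show "c (k # i) * c' (l # j) * \<phi> (rev (k # i) @ l # j) =
          (if k = l then of_real (cw x k) * (c (k # i) * c' (l # j) * \<xi> (rev i @ j)) else 0)" by simp
      qed
      also have "\<dots> = (\<Sum>k\<in>UNIV. of_real (cw x k) * pairing s\<^sub>0 b (\<lambda>i. c (k # i)) (\<lambda>j. c' (k # j)) \<xi>)"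
      proof (rule sum.cong[OF refl])
        fix k
        have "(\<Sum>l\<in>UNIV. \<Sum>j\<in>tuples (length b). if k = l then g l j else 0) = (\<Sum>j\<in>tuples (length b). g k j)"
          for g :: "'n \<Rightarrow> 'n list \<Rightarrow> complex"
          by (subst sum.swap) simp
        then show "(\<Sum>i\<in>tuples (length s\<^sub>0). \<Sum>l\<in>UNIV. \<Sum>j\<in>tuples (length b).
            if k = l then of_real (cw x k) * (c (k # i) * c' (l # j) * \<xi> (rev i @ j)) else 0) =
          of_real (cw x k) * pairing s\<^sub>0 b (\<lambda>i. c (k # i)) (\<lambda>j. c' (k # j)) \<xi>"
          unfolding pairing_def by (simp add: sum_distrib_left)
      qed
      also have "\<dots> = (\<Sum>k\<in>UNIV. of_real (cw x k) * (if s\<^sub>0 = b then \<kappa> * (\<Sum>i\<in>tuples (length s\<^sub>0). c (k # i) * c' (k # i) * of_real (nest s\<^sub>0 i)) else 0))"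
        using that unfolding s mid(2) by (simp add: \<kappa> red_Cons)
      also have "\<dots> = (if s = t then \<kappa> * (\<Sum>i\<in>tuples (length s). c i * c' i * of_real (nest s i)) else 0)"
        unfolding s mid(2) by (simp add: sum_tuples_Suc sum_distrib_left mult_ac)
      finally show ?thesis .
    qed
    then show ?thesis by blast
  qed
qed

text \<open>The nested pairing itself, which detects a reduced tensor with positive weight.\<close>

definition nested :: "bool list \<Rightarrow> 'n list \<Rightarrow> complex"
  where "nested t i = (if rev (take (length t) i) = drop (length t) i then of_real (nest t (drop (length t) i)) else 0)"

lemma nested_eq: "length i = length t \<Longrightarrow> nested t (rev i @ j) = (if i = j then of_real (nest t i) else 0)"
proof -
  assume "length i = length t"
  then have td: "take (length t) (rev i @ j) = rev i" "drop (length t) (rev i @ j) = j" by simp_all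
  show ?thesis unfolding nested_def td by auto
qed

lemma fx_nested: "fx (bar t @ t) (nested t)"
proof (induction t)
  case Nil
  show ?case using fx.nil by simp
next
  case (Cons x t)
  have "fx (bar t @ (\<not> x) # (\<not> \<not> x) # t) (nested (x # t))"
  proof (rule fx.cup[OF Cons])
    fix i1 i2 :: "'n list" and k l assume "length i1 = length (bar t)" "length i2 = length t"
    then show "nested (x # t) (i1 @ k # l # i2) = (if k = l then of_real (cw (\<not> x) k) * nested t (i1 @ i2) else 0)"
      by (auto simp: nested_def)
  qed
  then show ?case by simp
qed

end

section \<open>The Haar functional: moments, invariance, positivity and faithfulness\<close>

section \<open>The Haar functional\<close>

definition coef :: "'g free_alg \<Rightarrow> 'g list \<Rightarrow> complex"
  where "coef y w = lin (\<lambda>u. if u = w then 1 else 0) y"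

lemma coef_simps [simp]: "coef 0 w = 0" "coef (x + y) w = coef x w + coef y w" "coef (x - y) w = coef x w - coef y w"
  "coef (scal c * x) w = c * coef x w" "coef (mon u) w = (if u = w then 1 else 0)"
  by (simp_all add: coef_def lin_add lin_diff lin_scal)

lemma coef_sum: "coef (sum g A) w = (\<Sum>a\<in>A. coef (g a) w)"
  by (simp add: coef_def lin_sum)

lemma coef_lookup: "coef y w = Poly_Mapping.lookup y (Word w)"
proof -
  have letters: "letters x = w \<longleftrightarrow> x = Word w" for x by (cases x) auto
  have "coef y w = (\<Sum>u\<in>Poly_Mapping.keys y. if u = Word w then Poly_Mapping.lookup y u else 0)"
    unfolding coef_def lin_def by (intro sum.cong refl) (simp add: letters)
  then show ?thesis by (simp add: in_keys_iff)
qed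

definition shorter :: "nat \<Rightarrow> 'g free_alg \<Rightarrow> bool"
  where "shorter N y \<longleftrightarrow> (\<forall>w. N \<le> length w \<longrightarrow> coef y w = 0)"

lemma shorter_exists: "\<exists>N. shorter N y"
proof (induction y rule: free_alg_induct)
  case (scal_mon c w)
  show ?case by (intro exI[of _ "Suc (length w)"]) (auto simp: shorter_def)
next
  case (add x y)
  then obtain M N where "shorter M x" "shorter N y" by blast
  then show ?case by (intro exI[of _ "max M N"]) (auto simp: shorter_def)
qed

lemma finite_short_words: "finite {w :: ('n::finite \<times> 'n) starred list. length w < N}"
proof -
  have "(UNIV :: ('n \<times> 'n) starred set) \<subseteq> range Gen \<union> range Adj"
  proof
    fix g :: "('n \<times> 'n) starred" show "g \<in> range Gen \<union> range Adj" by (cases g) auto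
  qed
  then have "finite (UNIV :: ('n \<times> 'n) starred set)" by (rule finite_subset) simp
  then have "finite {w :: ('n \<times> 'n) starred list. set w \<subseteq> UNIV \<and> length w \<le> N}" by (rule finite_lists_length_le)
  then show ?thesis by (rule finite_subset[rotated]) auto
qed

lemma lin_expand:
  fixes y :: "('n::finite \<times> 'n) starred free_alg"
  assumes "shorter N y"
  shows "lin h y = (\<Sum>w | length w < N. coef y w * h w)"
proof -
  have "lin h y = (\<Sum>u\<in>Word ` {w. length w < N}. Poly_Mapping.lookup y u * h (letters u))"
    unfolding lin_def
  proof (rule sum.mono_neutral_left)
    show "Poly_Mapping.keys y \<subseteq> Word ` {w. length w < N}"
    proof
      fix u assume "u \<in> Poly_Mapping.keys y"
      then have "coef y (letters u) \<noteq> 0" by (simp add: coef_lookup in_keys_iff)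
      then have "length (letters u) < N" using assms unfolding shorter_def by (meson not_le)
      then show "u \<in> Word ` {w. length w < N}" by (metis (mono_tags) fword.collapse image_eqI mem_Collect_eq)
    qed
  qed (auto simp: finite_short_words in_keys_iff)
  also have "\<dots> = (\<Sum>w | length w < N. coef y w * h w)"
    by (subst sum.reindex) (auto simp: inj_on_def coef_lookup)
  finally show ?thesis .
qed

lemma shorter_expand:
  fixes y :: "('n::finite \<times> 'n) starred free_alg"
  assumes "shorter N y"
  shows "y = (\<Sum>w | length w < N. scal (coef y w) * mon w)"
  by (rule lin_eqI) (simp add: lin_expand[OF assms] lin_sum lin_scal_mon)

lemma star_ideal_of:
  assumes "\<And>r. r \<in> S \<Longrightarrow> star r \<in> ideal_of S" and "x \<in> ideal_of S"
  shows "star x \<in> ideal_of S"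
proof -
  have "two_sided {x. star x \<in> ideal_of S}"
    using two_sided_ideal_of[of S] by (auto simp: two_sided_def star_add star_mult)
  from ideal_of_minimal[OF this, of S] assms show ?thesis by blast
qed

lemma sum_shuffle:
  "(\<Sum>i\<in>A. \<Sum>j\<in>B. \<Sum>k\<in>C. \<Sum>l\<in>D. \<Sum>a\<in>M. g i j k l a) =
   (\<Sum>a\<in>M. \<Sum>j\<in>B. \<Sum>l\<in>D. \<Sum>i\<in>A. \<Sum>k\<in>C. g i j k l a)"
  by (simp only: sum.cartesian_product)
     (rule sum.reindex_bij_witness[of _ "\<lambda>(a, j, l, i, k). (i, j, k, l, a)" "\<lambda>(i, j, k, l, a). (a, j, l, i, k)"], auto)

definition lt :: "bool \<Rightarrow> 'n \<Rightarrow> 'n \<Rightarrow> ('n \<times> 'n) starred"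
  where "lt s i j = (if s then Gen (i, j) else Adj (i, j))"

definition sg :: "('n \<times> 'n) starred \<Rightarrow> bool" where "sg g = (case g of Gen _ \<Rightarrow> True | Adj _ \<Rightarrow> False)"
definition rowi :: "('n \<times> 'n) starred \<Rightarrow> 'n" where "rowi g = (case g of Gen x \<Rightarrow> fst x | Adj x \<Rightarrow> fst x)"
definition coli :: "('n \<times> 'n) starred \<Rightarrow> 'n" where "coli g = (case g of Gen x \<Rightarrow> snd x | Adj x \<Rightarrow> snd x)"

lemma lt_simps [simp]: "sg (lt s i j) = s" "rowi (lt s i j) = i" "coli (lt s i j) = j" "lt (sg g) (rowi g) (coli g) = g"
  "flip (lt s i j) = lt (\<not> s) i j" "sg (flip g) = (\<not> sg g)" "rowi (flip g) = rowi g" "coli (flip g) = coli g"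
  by (cases g; simp add: lt_def sg_def rowi_def coli_def)+

fun mk_word :: "bool list \<Rightarrow> 'n list \<Rightarrow> 'n list \<Rightarrow> ('n \<times> 'n) starred list"
  where "mk_word (s # t) (k # i) (l # j) = lt s k l # mk_word t i j" | "mk_word _ _ _ = []"

lemma mk_word_append: "length i\<^sub>1 = length a \<Longrightarrow> length j\<^sub>1 = length a \<Longrightarrow>
    mk_word (a @ b) (i\<^sub>1 @ i\<^sub>2) (j\<^sub>1 @ j\<^sub>2) = mk_word a i\<^sub>1 j\<^sub>1 @ mk_word b i\<^sub>2 j\<^sub>2"
  by (induction a i\<^sub>1 j\<^sub>1 rule: mk_word.induct) auto

lemma mk_word_sel: "length i = length t \<Longrightarrow> length j = length t \<Longrightarrow>
    map sg (mk_word t i j) = t \<and> map rowi (mk_word t i j) = i \<and> map coli (mk_word t i j) = j"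
  by (induction t i j rule: mk_word.induct) auto

lemma mk_word_id: "mk_word (map sg w) (map rowi w) (map coli w) = w"
  by (induction w) auto

lemma sum_words:
  fixes g :: "('n::finite \<times> 'n) starred list \<Rightarrow> complex"
  shows "(\<Sum>w | length w < N. g w) =
    (\<Sum>t | length t < N. \<Sum>i\<in>tuples (length t). \<Sum>j\<in>tuples (length t). g (mk_word t i j))"
proof -
  have fin: "finite {t :: bool list. length t < N}"
    using finite_lists_length_le[of "UNIV :: bool set" N] by (rule finite_subset[rotated]) auto
  have "(\<Sum>w | length w < N. g w) = (\<Sum>(t, p)\<in>(SIGMA t:{t. length t < N}. tuples (length t) \<times> tuples (length t)). g (mk_word t (fst p) (snd p)))"
    by (rule sum.reindex_bij_witness[of _ "\<lambda>(t, p). mk_word t (fst p) (snd p)" "\<lambda>w. (map sg w, map rowi w, map coli w)"])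
       (auto simp: tuples_def mk_word_id mk_word_sel dest: arg_cong[of _ _ length] intro: mk_word_sel[THEN conjunct1, THEN arg_cong[of _ _ length], simplified, THEN ssubst])
  also have "\<dots> = (\<Sum>t | length t < N. \<Sum>p\<in>tuples (length t) \<times> tuples (length t). g (mk_word t (fst p) (snd p)))"
    using fin by (subst sum.Sigma) auto
  finally show ?thesis by (simp add: sum.cartesian_product case_prod_beta)
qed

context haar
begin

fun nws :: "bool list \<Rightarrow> 'n list \<Rightarrow> real"
  where "nws (s # t) (k # j) = nw s k * nws t j" | "nws _ _ = 1"

lemma nws_pos: "0 < nws t j"
  by (induction t j rule: nws.induct) (auto simp: nw_pos)

lemma nws_append: "length j\<^sub>1 = length a \<Longrightarrow> nws (a @ b) (j\<^sub>1 @ j\<^sub>2) = nws a j\<^sub>1 * nws b j\<^sub>2"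
  by (induction a j\<^sub>1 rule: nws.induct) auto

definition is_basis :: "bool list \<Rightarrow> nat \<times> (nat \<Rightarrow> 'n list \<Rightarrow> complex) \<Rightarrow> bool"
  where "is_basis t mf \<longleftrightarrow> (\<forall>a<fst mf. fx t (snd mf a)) \<and> orthonormal (tuples (length t)) (nws t) (fst mf) (snd mf) \<and>
    (\<forall>g. fx t g \<longrightarrow> (\<forall>x\<in>tuples (length t). g x = projection (tuples (length t)) (nws t) (fst mf) (snd mf) g x))"

definition bm :: "bool list \<Rightarrow> nat" where "bm t = fst (SOME mf. is_basis t mf)"
definition bf :: "bool list \<Rightarrow> nat \<Rightarrow> 'n list \<Rightarrow> complex" where "bf t = snd (SOME mf. is_basis t mf)"

abbreviation tip :: "bool list \<Rightarrow> ('n list \<Rightarrow> complex) \<Rightarrow> ('n list \<Rightarrow> complex) \<Rightarrow> complex"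
  where "tip t \<equiv> ip (tuples (length t)) (nws t)"

lemma basis:
  shows "\<And>a. a < bm t \<Longrightarrow> fx t (bf t a)"
    and "orthonormal (tuples (length t)) (nws t) (bm t) (bf t)"
    and "\<And>g x. fx t g \<Longrightarrow> x \<in> tuples (length t) \<Longrightarrow> g x = projection (tuples (length t)) (nws t) (bm t) (bf t) g x"
proof -
  have "\<exists>mf. is_basis t mf"
    using orthonormal_basis_exists[OF finite_tuples[of "length t"] nws_pos[of t] fx_subspace[of t]]
    unfolding is_basis_def by auto
  then have "is_basis t (SOME mf. is_basis t mf)" by (rule someI_ex)
  then show "\<And>a. a < bm t \<Longrightarrow> fx t (bf t a)"
    "orthonormal (tuples (length t)) (nws t) (bm t) (bf t)"
    "\<And>g x. fx t g \<Longrightarrow> x \<in> tuples (length t) \<Longrightarrow> g x = projection (tuples (length t)) (nws t) (bm t) (bf t) g x"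
    unfolding is_basis_def bm_def bf_def by blast+
qed

text \<open>The kernel of the orthogonal projection onto the invariant tensors, as in Weingarten
  calculus: its column j is the projection of the unit vector at j (\<open>hT_ip\<close>).\<close>

definition hT :: "bool list \<Rightarrow> 'n list \<Rightarrow> 'n list \<Rightarrow> complex"
  where "hT t i j = (\<Sum>a<bm t. bf t a i * cnj (bf t a j) * of_real (nws t j))"

lemma fx_hT: "fx t (\<lambda>i. hT t i j)"
proof -
  have "(\<lambda>i. \<Sum>a<bm t. (cnj (bf t a j) * of_real (nws t j)) * bf t a i) \<in> {\<phi>. fx t \<phi>}"
    by (rule function_subspace_sum[OF fx_subspace]) (auto intro: basis(1))
  then show ?thesis by (simp add: hT_def mult_ac)
qed

lemma hT_ip:
  assumes "fx t \<psi>" "length j = length t"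
  shows "tip t (\<lambda>i. hT t i j) \<psi> = cnj (\<psi> j) * of_real (nws t j)"
proof -
  define e :: "'n list \<Rightarrow> complex" where "e x = (if x = j then 1 else 0)" for x
  have ef: "tip t e g = cnj (g j) * of_real (nws t j)" for g
  proof -
    have "tip t e g = (\<Sum>x\<in>tuples (length t). if x = j then cnj (g j) * of_real (nws t j) else 0)"
      unfolding ip_def e_def by (intro sum.cong) auto
    then show ?thesis using assms(2) finite_tuples[of "length t", where 'n = 'n] by (simp add: tuples_def)
  qed
  have "(\<lambda>i. hT t i j) = projection (tuples (length t)) (nws t) (bm t) (bf t) e"
    by (rule HOL.ext) (simp add: hT_def projection_def ef mult_ac)
  then show ?thesis
    using ip_projection[OF finite_tuples nws_pos basis(2)[of t], of \<psi> e] basis(3)[OF assms(1)] ef by simp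
qed

lemma fx_unique:
  assumes "fx t \<xi>" "fx t \<eta>" "\<And>\<psi>. fx t \<psi> \<Longrightarrow> tip t \<xi> \<psi> = tip t \<eta> \<psi>" "length i = length t"
  shows "\<xi> i = \<eta> i"
proof -
  have "fx t (\<lambda>i. \<xi> i - \<eta> i)" using fx.lin[OF assms(1,2), of "\<lambda>i. \<xi> i - \<eta> i" 1 "-1"] by simp
  then have "tip t (\<lambda>i. \<xi> i - \<eta> i) (\<lambda>i. \<xi> i - \<eta> i) = 0" using assms(3) by (simp add: ip_diff_left)
  then have "\<xi> i - \<eta> i = 0"
    using ip_self_0[where D = "tuples (length t)" and W = "nws t" and f = "\<lambda>i. \<xi> i - \<eta> i" and x = i, OF finite_tuples nws_pos] assms(4) by (simp add: tuples_def)
  then show ?thesis by simp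
qed

text \<open>Both sides, as functions of i, are invariant tensors, so it is enough to compare inner
  products with invariant \<psi>. Moving the inserted pair to \<psi> as a contraction, which is
  again invariant by \<open>fx_cap\<close>, makes them equal.\<close>

lemma hT_column:
  assumes "length j\<^sub>1 = length a" "length j\<^sub>2 = length b" "length i\<^sub>1 = length a" "length i\<^sub>2 = length b"
  shows "(\<Sum>k\<in>UNIV. of_real (cw s k) * hT (a @ s # (\<not> s) # b) (i\<^sub>1 @ x # y # i\<^sub>2) (j\<^sub>1 @ k # k # j\<^sub>2)) =
    (if x = y then of_real (cw s x) * hT (a @ b) (i\<^sub>1 @ i\<^sub>2) (j\<^sub>1 @ j\<^sub>2) else 0)"
proof -
  let ?t = "a @ s # (\<not> s) # b" and ?n = "length a"
  define g where "g = (\<lambda>i. hT (a @ b) i (j\<^sub>1 @ j\<^sub>2))"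
  define cg where "cg i = (if i ! ?n = i ! Suc ?n then of_real (cw s (i ! ?n)) * g (take ?n i @ drop (Suc (Suc ?n)) i) else 0)" for i
  define G where "G i = (\<Sum>k\<in>UNIV. of_real (cw s k) * hT ?t i (j\<^sub>1 @ k # k # j\<^sub>2))" for i
  have cg: "cg (i @ k # l # i') = (if k = l then of_real (cw s k) * g (i @ i') else 0)" if "length i = ?n" for i k l i'
    using that by (simp add: cg_def nth_append)
  have fg: "fx (a @ b) g" unfolding g_def by (rule fx_hT)
  have fcg: "fx ?t cg" by (rule fx.cup[OF fg]) (simp add: cg)
  have fG: "fx ?t G"
    using function_subspace_sum[OF fx_subspace[of ?t], of UNIV "\<lambda>k i. hT ?t i (j\<^sub>1 @ k # k # j\<^sub>2)" "\<lambda>k. of_real (cw s k)"]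
    by (simp add: G_def[abs_def] fx_hT)
  have "tip ?t G \<psi> = tip ?t cg \<psi>" if \<psi>: "fx ?t \<psi>" for \<psi>
  proof -
    \<comment> \<open>The contraction of \<psi>, adjoint to inserting a pair.\<close>
    define c\<psi> where "c\<psi> i = (\<Sum>k\<in>UNIV. of_real (rw s k) * \<psi> (take ?n i @ k # k # drop ?n i))" for i
    have fc: "fx (a @ b) c\<psi>" by (rule fx_cap[OF \<psi> refl]) (simp add: c\<psi>_def)
    have nwsp: "nws ?t (i @ k # l # i') = nws (a @ b) (i @ i') * (nw s k * nw (\<not> s) l)" if "length i = ?n" for i k l i'
      using that by (simp add: nws_append)
    have w: "of_real (cw s k) * (z * (of_real (nw s k) * of_real (nw (\<not> s) k))) = of_real (rw s k) * (z :: complex)" for k z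
      by (simp only: weights(1)[of s k, symmetric] of_real_mult mult_ac)
    have "tip ?t G \<psi> = (\<Sum>k\<in>UNIV. of_real (cw s k) * tip ?t (\<lambda>i. hT ?t i (j\<^sub>1 @ k # k # j\<^sub>2)) \<psi>)"
      unfolding G_def[abs_def] ip_sum_left ip_scale_left ..
    also have "\<dots> = (\<Sum>k\<in>UNIV. of_real (cw s k) * ((cnj (\<psi> (j\<^sub>1 @ k # k # j\<^sub>2)) * of_real (nws (a @ b) (j\<^sub>1 @ j\<^sub>2))) * (of_real (nw s k) * of_real (nw (\<not> s) k))))"
      using assms by (intro sum.cong refl, subst hT_ip[OF \<psi>]) (simp_all add: nwsp mult_ac)
    also have "\<dots> = cnj (c\<psi> (j\<^sub>1 @ j\<^sub>2)) * of_real (nws (a @ b) (j\<^sub>1 @ j\<^sub>2))"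
      unfolding w using assms by (simp add: c\<psi>_def sum_distrib_right mult.assoc)
    also have "\<dots> = tip (a @ b) g c\<psi>"
      unfolding g_def using assms by (subst hT_ip[OF fc]) auto
    also have "\<dots> = (\<Sum>i\<in>tuples ?n. \<Sum>i'\<in>tuples (length b). g (i @ i') * cnj (c\<psi> (i @ i')) * of_real (nws (a @ b) (i @ i')))"
      by (simp add: ip_def sum_tuples_append)
    also have "\<dots> = (\<Sum>i\<in>tuples ?n. \<Sum>i'\<in>tuples (length b). \<Sum>k\<in>UNIV. \<Sum>l\<in>UNIV. cg (i @ k # l # i') * cnj (\<psi> (i @ k # l # i')) * of_real (nws ?t (i @ k # l # i')))"
    proof (intro sum.cong refl)
      fix i i' :: "'n list" assume "i \<in> tuples ?n" "i' \<in> tuples (length b)"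
      then have l: "length i = ?n" "length i' = length b" by (simp_all add: tuples_def)
      have "(\<Sum>k\<in>UNIV. \<Sum>l\<in>UNIV. cg (i @ k # l # i') * cnj (\<psi> (i @ k # l # i')) * of_real (nws ?t (i @ k # l # i'))) =
        (\<Sum>k\<in>UNIV. of_real (cw s k) * ((g (i @ i') * cnj (\<psi> (i @ k # k # i')) * of_real (nws (a @ b) (i @ i'))) * (of_real (nw s k) * of_real (nw (\<not> s) k))))"
      proof (rule sum.cong[OF refl])
        fix k
        have "cg (i @ k # l # i') * cnj (\<psi> (i @ k # l # i')) * of_real (nws ?t (i @ k # l # i')) = (if k = l then
            of_real (cw s k) * ((g (i @ i') * cnj (\<psi> (i @ k # k # i')) * of_real (nws (a @ b) (i @ i'))) * (of_real (nw s k) * of_real (nw (\<not> s) k))) else 0)" for l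
          using l by (auto simp: cg nwsp mult_ac)
        then show "(\<Sum>l\<in>UNIV. cg (i @ k # l # i') * cnj (\<psi> (i @ k # l # i')) * of_real (nws ?t (i @ k # l # i'))) =
            of_real (cw s k) * ((g (i @ i') * cnj (\<psi> (i @ k # k # i')) * of_real (nws (a @ b) (i @ i'))) * (of_real (nw s k) * of_real (nw (\<not> s) k)))"
          by simp
      qed
      also have "\<dots> = g (i @ i') * cnj (c\<psi> (i @ i')) * of_real (nws (a @ b) (i @ i'))"
        unfolding w using l by (simp add: c\<psi>_def sum_distrib_right sum_distrib_left mult_ac)
      finally show "g (i @ i') * cnj (c\<psi> (i @ i')) * of_real (nws (a @ b) (i @ i')) =
        (\<Sum>k\<in>UNIV. \<Sum>l\<in>UNIV. cg (i @ k # l # i') * cnj (\<psi> (i @ k # l # i')) * of_real (nws ?t (i @ k # l # i')))" by simp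
    qed
    also have "\<dots> = tip ?t cg \<psi>"
      unfolding ip_def length_append length_Cons sum_tuples_pair ..
    finally show ?thesis .
  qed
  then have "G (i\<^sub>1 @ x # y # i\<^sub>2) = cg (i\<^sub>1 @ x # y # i\<^sub>2)"
    using fx_unique[OF fG fcg] assms by simp
  then show ?thesis using assms by (simp add: G_def cg g_def)
qed

lemma hT_hermitian: "hT t i j * of_real (nws t i) = cnj (hT t j i) * of_real (nws t j)"
  by (simp add: hT_def sum_distrib_right sum_distrib_left mult_ac)

text \<open>The projection is self-adjoint (\<open>hT_hermitian\<close>), so this is
  \<open>hT_column\<close> conjugated; the weights \<open>nw\<close> turn \<open>cw\<close> into
  \<open>rw\<close>.\<close>

lemma hT_row:
  assumes "length j\<^sub>1 = length a" "length j\<^sub>2 = length b" "length i\<^sub>1 = length a" "length i\<^sub>2 = length b"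
  shows "(\<Sum>k\<in>UNIV. of_real (rw s k) * hT (a @ s # (\<not> s) # b) (i\<^sub>1 @ k # k # i\<^sub>2) (j\<^sub>1 @ x # y # j\<^sub>2)) =
    (if x = y then of_real (rw s x) * hT (a @ b) (i\<^sub>1 @ i\<^sub>2) (j\<^sub>1 @ j\<^sub>2) else 0)"
proof -
  let ?t = "a @ s # (\<not> s) # b" and ?j = "j\<^sub>1 @ x # y # j\<^sub>2"
  have nwsp: "nws ?t (i @ k # l # i') = nws (a @ b) (i @ i') * (nw s k * nw (\<not> s) l)" if "length i = length a" for i k l i'
    using that by (simp add: nws_append)
  define N where "N = complex_of_real (nws (a @ b) (i\<^sub>1 @ i\<^sub>2))"
  have N: "N \<noteq> 0" using nws_pos[of "a @ b" "i\<^sub>1 @ i\<^sub>2"] by (simp add: N_def)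
  have term_eq: "(of_real (rw s k) * hT ?t (i\<^sub>1 @ k # k # i\<^sub>2) ?j) * N =
      cnj (of_real (cw s k) * hT ?t ?j (i\<^sub>1 @ k # k # i\<^sub>2)) * of_real (nws ?t ?j)" for k
  proof -
    have "rw s k = cw s k * (nw s k * nw (\<not> s) k)" using weights(1) by simp
    then have "(of_real (rw s k) * hT ?t (i\<^sub>1 @ k # k # i\<^sub>2) ?j) * N =
        of_real (cw s k) * (hT ?t (i\<^sub>1 @ k # k # i\<^sub>2) ?j * of_real (nws ?t (i\<^sub>1 @ k # k # i\<^sub>2)))"
      using assms by (simp add: nwsp N_def mult_ac)
    then show ?thesis unfolding hT_hermitian by (simp add: mult_ac)
  qed
  have "(\<Sum>k\<in>UNIV. of_real (rw s k) * hT ?t (i\<^sub>1 @ k # k # i\<^sub>2) ?j) * N =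
      cnj (\<Sum>k\<in>UNIV. of_real (cw s k) * hT ?t ?j (i\<^sub>1 @ k # k # i\<^sub>2)) * of_real (nws ?t ?j)"
    unfolding sum_distrib_right term_eq by (simp add: sum_distrib_right)
  also have "\<dots> = cnj (if x = y then of_real (cw s x) * hT (a @ b) (j\<^sub>1 @ j\<^sub>2) (i\<^sub>1 @ i\<^sub>2) else 0) * of_real (nws ?t ?j)"
    using assms by (subst hT_column) auto
  also have "\<dots> = (if x = y then of_real (rw s x) * (cnj (hT (a @ b) (j\<^sub>1 @ j\<^sub>2) (i\<^sub>1 @ i\<^sub>2)) * of_real (nws (a @ b) (j\<^sub>1 @ j\<^sub>2))) else 0)"
  proof -
    have "complex_of_real (rw s x) = of_real (cw s x) * (of_real (nw s x) * of_real (nw (\<not> s) x))"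
      by (simp only: weights(1)[of s x, symmetric] of_real_mult)
    then show ?thesis using assms by (auto simp: nwsp mult_ac)
  qed
  also have "\<dots> = (if x = y then of_real (rw s x) * hT (a @ b) (i\<^sub>1 @ i\<^sub>2) (j\<^sub>1 @ j\<^sub>2) else 0) * N"
    unfolding hT_hermitian[symmetric] N_def by simp
  finally show ?thesis using N by simp
qed

definition relC :: "bool \<Rightarrow> 'n \<Rightarrow> 'n \<Rightarrow> ('n \<times> 'n) starred free_alg"
  where "relC s i j = (\<Sum>k\<in>UNIV. scal (of_real (cw s k)) * mon [lt s i k, lt (\<not> s) j k]) - scal (if i = j then of_real (cw s i) else 0)"

definition relR :: "bool \<Rightarrow> 'n \<Rightarrow> 'n \<Rightarrow> ('n \<times> 'n) starred free_alg"
  where "relR s i j = (\<Sum>k\<in>UNIV. scal (of_real (rw s k)) * mon [lt s k i, lt (\<not> s) k j]) - scal (if i = j then of_real (rw s i) else 0)"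

definition diag_rels :: "('n \<times> 'n) starred free_alg set"
  where "diag_rels = {relC s i j |s i j. True} \<union> {relR s i j |s i j. True}"

definition diag_ideal :: "('n \<times> 'n) starred free_alg set"
  where "diag_ideal = ideal_of diag_rels"

lemma two_sided_diag_ideal: "two_sided diag_ideal"
  unfolding diag_ideal_def by (rule two_sided_ideal_of)

lemma rel_in_diag_ideal: "relC s i j \<in> diag_ideal" "relR s i j \<in> diag_ideal"
  unfolding diag_ideal_def by (rule ideal_of_base, force simp: diag_rels_def)+

lemma star_diag_ideal: "x \<in> diag_ideal \<Longrightarrow> star x \<in> diag_ideal"
proof -
  have "star (relC s i j) = relC s j i" "star (relR s i j) = relR s j i" for s i j
    by (simp_all add: relC_def relR_def star_diff star_sum star_scal_mon)
  then have "star r \<in> diag_ideal" if "r \<in> diag_rels" for r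
    using that rel_in_diag_ideal by (auto simp: diag_rels_def)
  then show "x \<in> diag_ideal \<Longrightarrow> star x \<in> diag_ideal"
    unfolding diag_ideal_def by (rule star_ideal_of)
qed

text \<open>The value of the Haar functional on a monomial is a matrix entry of the projection: rows
  and columns of the letters are its two multi-indices.\<close>

definition H :: "('n \<times> 'n) starred list \<Rightarrow> complex"
  where "H w = hT (map sg w) (map rowi w) (map coli w)"

lemma sandwich: "mon v * (scal c * mon l) * mon w = scal c * mon (v @ l @ w)" "mon v * scal c * mon w = scal c * mon (v @ w)"
  by (simp_all add: mult.assoc scal_left_commute[of "mon v"] scal_commute[of "mon v"] mon_append)

lemma haar_natural: "x \<in> diag_ideal \<Longrightarrow> lin H x = 0"
  unfolding diag_ideal_def
proof (rule lin_ideal_of)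
  fix v w r assume "r \<in> diag_rels"
  then consider s i j where "r = relC s i j" | s i j where "r = relR s i j" by (auto simp: diag_rels_def)
  then show "lin H (mon v * r * mon w) = 0"
  proof cases
    case 1
    have "lin H (mon v * r * mon w) =
        (\<Sum>k\<in>UNIV. of_real (cw s k) * H (v @ [lt s i k, lt (\<not> s) j k] @ w)) - (if i = j then of_real (cw s i) else 0) * H (v @ w)"
      unfolding 1 relC_def right_diff_distrib left_diff_distrib sum_distrib_left sum_distrib_right sandwich lin_diff lin_sum lin_scal_mon ..
    then show ?thesis by (simp add: H_def hT_column)
  next
    case 2
    have "lin H (mon v * r * mon w) =
        (\<Sum>k\<in>UNIV. of_real (rw s k) * H (v @ [lt s k i, lt (\<not> s) k j] @ w)) - (if i = j then of_real (rw s i) else 0) * H (v @ w)"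
      unfolding 2 relR_def right_diff_distrib left_diff_distrib sum_distrib_left sum_distrib_right sandwich lin_diff lin_sum lin_scal_mon ..
    then show ?thesis by (simp add: H_def hT_row)
  qed
qed

lemma haar_1: "lin H 1 = 1"
proof -
  have "hT [] [] [] = 1"
    using hT_ip[OF fx.nil[of "\<lambda>_. 1"], of "[]"] by (simp add: ip_def)
  then show ?thesis using lin_mon[of H "[]"] by (simp add: H_def)
qed

end

context haar
begin

text \<open>The coefficients are orthogonal to the quadratic parts of all translated relators, for
  the weight \<open>wt\<close>.\<close>

definition reduced :: "('n \<times> 'n) starred free_alg \<Rightarrow> bool"
  where "reduced y \<longleftrightarrow> (\<forall>v w s a b.
    (\<Sum>k\<in>UNIV. of_real (rw s k) * coef y (v @ [lt s a k, lt (\<not> s) b k] @ w)) = 0 \<and>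
    (\<Sum>k\<in>UNIV. of_real (cw s k) * coef y (v @ [lt s k a, lt (\<not> s) k b] @ w)) = 0)"

lemma reduced_0 [simp]: "reduced 0"
  by (simp add: reduced_def)

lemma reduced_add: "reduced x \<Longrightarrow> reduced y \<Longrightarrow> reduced (x + y)"
  by (simp add: reduced_def distrib_left sum.distrib)

text \<open>This weight turns orthogonality to the quadratic part of \<open>relC\<close> into a
  contraction with \<open>rw\<close>, and that of \<open>relR\<close> into one with
  \<open>cw\<close>.\<close>

definition wt :: "('n \<times> 'n) starred list \<Rightarrow> real"
  where "wt w = prod_list (map (\<lambda>g. nw (sg g) (coli g) / nw (sg g) (rowi g)) w)"

lemma wt_pos: "0 < wt w"
  by (induction w) (auto simp: wt_def nw_pos)

lemma wt_pair: "wt (v @ [lt s a k, lt s' b l] @ w) = wt v * wt w * (nw s k / nw s a * (nw s' l / nw s' b))"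
  by (simp add: wt_def)

lemma diag_ideal_pair:
  "(\<Sum>k\<in>UNIV. scal (of_real (cw s k)) * mon (v @ [lt s a k, lt (\<not> s) b k] @ w)) - scal (if a = b then of_real (cw s a) else 0) * mon (v @ w) \<in> diag_ideal"
  "(\<Sum>k\<in>UNIV. scal (of_real (rw s k)) * mon (v @ [lt s k a, lt (\<not> s) k b] @ w)) - scal (if a = b then of_real (rw s a) else 0) * mon (v @ w) \<in> diag_ideal"
proof -
  note J = two_sided_diag_ideal
  have "mon v * relC s a b * mon w \<in> diag_ideal" "mon v * relR s a b * mon w \<in> diag_ideal"
    by (intro two_sided_mult_left[OF J] two_sided_mult_right[OF J] rel_in_diag_ideal)+
  then show "(\<Sum>k\<in>UNIV. scal (of_real (cw s k)) * mon (v @ [lt s a k, lt (\<not> s) b k] @ w)) - scal (if a = b then of_real (cw s a) else 0) * mon (v @ w) \<in> diag_ideal"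
    "(\<Sum>k\<in>UNIV. scal (of_real (rw s k)) * mon (v @ [lt s k a, lt (\<not> s) k b] @ w)) - scal (if a = b then of_real (rw s a) else 0) * mon (v @ w) \<in> diag_ideal"
    unfolding relC_def relR_def right_diff_distrib left_diff_distrib sum_distrib_left sum_distrib_right sandwich .
qed

text \<open>Project the part of degree N orthogonally onto the homogeneous elements that can be
  shortened modulo the ideal. The projected part may be shortened, and the remainder is orthogonal
  to all quadratic parts of relators, hence reduced.\<close>

lemma reduction_step:
  assumes x: "shorter (Suc N) x"
  shows "\<exists>y x'. reduced y \<and> shorter N x' \<and> x - (y + x') \<in> diag_ideal"
proof -
  let ?D = "{w :: ('n \<times> 'n) starred list. length w = N}"
  have fin: "finite ?D" by (rule finite_subset[OF _ finite_short_words[of "Suc N"]]) auto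
  define Z where "Z = {z. (\<forall>w. length w \<noteq> N \<longrightarrow> coef z w = 0) \<and> (\<exists>z'. shorter N z' \<and> z - z' \<in> diag_ideal)}"
  note J = two_sided_diag_ideal
  have S: "function_subspace (coef ` Z)"
    unfolding function_subspace_def
  proof (intro conjI ballI allI)
    show "(\<lambda>x. 0) \<in> coef ` Z"
      by (rule image_eqI[of _ _ 0]) (auto simp: Z_def shorter_def fun_eq_iff two_sided_0[OF J] intro!: exI[of _ 0])
    fix g h c d assume "g \<in> coef ` Z" "h \<in> coef ` Z"
    then obtain z z' u u' where *: "g = coef z" "\<forall>w. length w \<noteq> N \<longrightarrow> coef z w = 0" "shorter N z'" "z - z' \<in> diag_ideal"
      "h = coef u" "\<forall>w. length w \<noteq> N \<longrightarrow> coef u w = 0" "shorter N u'" "u - u' \<in> diag_ideal"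
      unfolding Z_def by blast
    have "scal c * (z - z') + scal d * (u - u') \<in> diag_ideal"
      by (intro two_sided_add[OF J] two_sided_mult_left[OF J] *)
    moreover have "scal c * (z - z') + scal d * (u - u') = (scal c * z + scal d * u) - (scal c * z' + scal d * u')"
      by (simp add: algebra_simps)
    moreover have "shorter N (scal c * z' + scal d * u')" using * by (simp add: shorter_def)
    ultimately have "scal c * z + scal d * u \<in> Z" using *(2,6) by (auto simp: Z_def)
    then show "(\<lambda>x. c * g x + d * h x) \<in> coef ` Z"
      by (rule image_eqI[rotated]) (simp add: *(1,5) fun_eq_iff)
  qed
  obtain m \<phi> where \<phi>: "\<And>a. a < m \<Longrightarrow> \<phi> a \<in> coef ` Z" "orthonormal ?D wt m \<phi>"
    "\<And>g x. g \<in> coef ` Z \<Longrightarrow> x \<in> ?D \<Longrightarrow> g x = projection ?D wt m \<phi> g x"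
    using orthonormal_basis_exists[where W = wt, OF fin wt_pos S] by blast
  define g where "g = projection ?D wt m \<phi> (coef x)"
  have "g \<in> coef ` Z"
    unfolding g_def projection_def[abs_def] using \<phi>(1) by (intro function_subspace_sum[OF S]) auto
  then obtain z z' where z: "g = coef z" "\<And>w. length w \<noteq> N \<Longrightarrow> coef z w = 0" "shorter N z'" "z - z' \<in> diag_ideal"
    unfolding Z_def by blast
  define y where "y = (\<Sum>w\<in>?D. scal (coef x w - g w) * mon w)"
  have cy: "coef y w = (if length w = N then coef x w - g w else 0)" for w
    using fin by (simp add: y_def coef_sum if_distrib[of "\<lambda>z. _ * z"] cong: if_cong)
  have "shorter N (x - y - z)"
    unfolding shorter_def
  proof (intro allI impI)
    fix w :: "('n \<times> 'n) starred list" assume "N \<le> length w"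
    then show "coef (x - y - z) w = 0"
      using x z(1,2) by (cases "length w = N") (auto simp: shorter_def cy)
  qed
  then have "shorter N (x - y - z + z')" using z(3) by (simp add: shorter_def)
  moreover have "x - (y + (x - y - z + z')) \<in> diag_ideal" using z(4) by simp
  moreover have "reduced y"
  proof -
    \<comment> \<open>Common form of both contractions: u lists the words of the quadratic part of a
      translated relator and l is the word left when the pair is removed.\<close>
    have orth: "(\<Sum>k\<in>UNIV. of_real (d k) * coef y (u k)) = 0"
      if q: "(\<Sum>k\<in>UNIV. scal (of_real (c k)) * mon (u k)) - scal e * mon l \<in> diag_ideal"
        and l: "\<And>k. length (u k) = Suc (Suc (length l))" and d: "\<And>k. c k * wt (u k) = r * d k" and r: "r \<noteq> 0"
      for c d :: "'n \<Rightarrow> real" and u :: "'n \<Rightarrow> ('n \<times> 'n) starred list" and e r l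
    proof (cases "Suc (Suc (length l)) = N")
      case False
      then show ?thesis using l by (simp add: cy)
    next
      case True
      let ?q = "\<Sum>k\<in>UNIV. scal (of_real (c k)) * mon (u k)"
      have "?q \<in> Z"
        unfolding Z_def using q l True
        by (auto simp: coef_sum shorter_def intro!: sum.neutral exI[of _ "scal e * mon l"])
      then have qS: "coef ?q \<in> coef ` Z" by simp
      have "0 = ip ?D wt (\<lambda>w. coef x w - g w) (coef ?q)"
        unfolding g_def
        using ip_projection[where W = wt, OF fin wt_pos \<phi>(2), of "coef ?q" "coef x"] \<phi>(3)[OF qS]
        by (simp add: ip_diff_left)
      also have "coef ?q = (\<lambda>w. \<Sum>k\<in>UNIV. of_real (c k) * coef (mon (u k)) w)"
        by (simp add: fun_eq_iff coef_sum)
      also have "ip ?D wt (\<lambda>w. coef x w - g w) \<dots> = (\<Sum>k\<in>UNIV. of_real (c k) * (coef y (u k) * of_real (wt (u k))))"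
      proof -
        have ck: "ip ?D wt (\<lambda>w. coef x w - g w) (coef (mon (u k))) = coef y (u k) * of_real (wt (u k))" for k
        proof -
          have "ip ?D wt (\<lambda>w. coef x w - g w) (coef (mon (u k))) =
              (\<Sum>w\<in>?D. if u k = w then coef y (u k) * of_real (wt (u k)) else 0)"
            unfolding ip_def by (intro sum.cong refl) (auto simp: cy)
          then show ?thesis using fin l[of k] True by simp
        qed
        show ?thesis by (simp only: ip_sum_right ip_scale_right complex_cnj_complex_of_real ck)
      qed
      also have "\<dots> = (\<Sum>k\<in>UNIV. of_real (c k * wt (u k)) * coef y (u k))" by (simp add: mult_ac)
      also have "\<dots> = of_real r * (\<Sum>k\<in>UNIV. of_real (d k) * coef y (u k))"
        unfolding d by (simp add: sum_distrib_left mult_ac)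
      finally show ?thesis using r by simp
    qed
    have nz: "nw s a \<noteq> 0" "wt v \<noteq> 0" for s a v using nw_pos[of s a] wt_pos[of v] by auto
    have "(\<Sum>k\<in>UNIV. of_real (rw s k) * coef y (v @ [lt s a k, lt (\<not> s) b k] @ w)) = 0" for v w s a b
    proof (rule orth[OF diag_ideal_pair(1)])
      show "cw s k * wt (v @ [lt s a k, lt (\<not> s) b k] @ w) = (wt v * wt w / (nw s a * nw (\<not> s) b)) * rw s k" for k
        unfolding wt_pair weights(1)[of s k, symmetric] by simp
    qed (use nz in auto)
    moreover have "(\<Sum>k\<in>UNIV. of_real (cw s k) * coef y (v @ [lt s k a, lt (\<not> s) k b] @ w)) = 0" for v w s a b
    proof (rule orth[OF diag_ideal_pair(2)])
      show "rw s k * wt (v @ [lt s k a, lt (\<not> s) k b] @ w) = (wt v * wt w * (nw s a * nw (\<not> s) b)) * cw s k" for k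
        unfolding wt_pair weights(1)[of s k, symmetric] using nz by simp
    qed (use nz in auto)
    ultimately show ?thesis unfolding reduced_def by blast
  qed
  ultimately show ?thesis by blast
qed

lemma reduced_representative: "\<exists>y. reduced y \<and> x - y \<in> diag_ideal"
proof -
  have "shorter N x \<Longrightarrow> \<exists>y. reduced y \<and> x - y \<in> diag_ideal" for N
  proof (induction N arbitrary: x)
    case 0
    then have "x = 0" by (intro lin_eqI) (simp add: lin_expand)
    then show ?case using two_sided_0[OF two_sided_diag_ideal] by (intro exI[of _ 0]) simp
  next
    case (Suc N)
    obtain y x' where y: "reduced y" "shorter N x'" "x - (y + x') \<in> diag_ideal"
      using reduction_step[OF Suc.prems] by blast
    obtain y' where y': "reduced y'" "x' - y' \<in> diag_ideal" using Suc.IH[OF y(2)] by blast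
    have "(x - (y + x')) + (x' - y') \<in> diag_ideal"
      using y(3) y'(2) by (rule two_sided_add[OF two_sided_diag_ideal])
    then have "x - (y + y') \<in> diag_ideal" by (simp add: algebra_simps)
    then show ?case using reduced_add[OF y(1) y'(1)] by blast
  qed
  then show ?thesis using shorter_exists[of x] by blast
qed

lemma red_rows:
  assumes y: "reduced y" and j: "length j = length t"
  shows "red t (\<lambda>i. coef y (mk_word t i j))" "red t (\<lambda>i. cnj (coef y (mk_word t i j)))"
proof -
  have *: "(\<Sum>k\<in>UNIV. of_real (cw s k) * coef y (mk_word t (i\<^sub>1 @ k # k # i\<^sub>2) j)) = 0"
    if t: "t = a @ s # (\<not> s) # b" and l: "length i\<^sub>1 = length a" "length i\<^sub>2 = length b" for a s b i\<^sub>1 i\<^sub>2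
  proof -
    obtain j\<^sub>1 k l j\<^sub>2 where "j = j\<^sub>1 @ k # l # j\<^sub>2" "length j\<^sub>1 = length a" "length j\<^sub>2 = length b"
      by (rule tuples_split_pair[of j "length a" "length b"]) (use j t in auto)
    then show ?thesis using y t l unfolding reduced_def by (simp add: mk_word_append)
  qed
  then show "red t (\<lambda>i. coef y (mk_word t i j))" unfolding red_def by blast
  have "(\<Sum>k\<in>UNIV. of_real (cw s k) * cnj (coef y (mk_word t (i\<^sub>1 @ k # k # i\<^sub>2) j))) = 0"
    if "t = a @ s # (\<not> s) # b" "length i\<^sub>1 = length a" "length i\<^sub>2 = length b" for a s b i\<^sub>1 i\<^sub>2
    using arg_cong[OF *[OF that], of cnj] by simp
  then show "red t (\<lambda>i. cnj (coef y (mk_word t i j)))" unfolding red_def by blast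
qed

text \<open>The column condition in \<open>reduced\<close> carries \<open>rw\<close>; multiplication
  by the projection weights, for the adjoint or the plain factor, changes it into the
  \<open>cw\<close> of \<open>red\<close>.\<close>

lemma red_columns:
  assumes y: "reduced y" and i: "length i = length t"
  shows "red t (\<lambda>j. coef y (mk_word t i j) * of_real (nws (bar t) (rev j)))"
    and "red t (\<lambda>j. cnj (coef y (mk_word t i j)) * of_real (nws t j))"
proof -
  have *: "(\<Sum>k\<in>UNIV. of_real (rw s k) * coef y (mk_word t i (j\<^sub>1 @ k # k # j\<^sub>2))) = 0"
    if t: "t = a @ s # (\<not> s) # b" and l: "length j\<^sub>1 = length a" "length j\<^sub>2 = length b" for a s b j\<^sub>1 j\<^sub>2
  proof -
    obtain i\<^sub>1 k l i\<^sub>2 where "i = i\<^sub>1 @ k # l # i\<^sub>2" "length i\<^sub>1 = length a" "length i\<^sub>2 = length b"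
      by (rule tuples_split_pair[of i "length a" "length b"]) (use i t in auto)
    then show ?thesis using y t l unfolding reduced_def by (simp add: mk_word_append)
  qed
  have rwc: "complex_of_real (cw s k) * (z * of_real (A * (B * (nw s k * nw (\<not> s) k)))) = of_real (A * B) * (of_real (rw s k) * z)" for s k z A B
    unfolding weights(1)[of s k, symmetric] by (simp add: mult_ac)
  have "(\<Sum>k\<in>UNIV. of_real (cw s k) * (coef y (mk_word t i (j\<^sub>1 @ k # k # j\<^sub>2)) * of_real (nws (bar t) (rev (j\<^sub>1 @ k # k # j\<^sub>2))))) = 0"
    if t: "t = a @ s # (\<not> s) # b" and l: "length j\<^sub>1 = length a" "length j\<^sub>2 = length b" for a s b j\<^sub>1 j\<^sub>2
  proof -
    have "nws (bar t) (rev (j\<^sub>1 @ k # k # j\<^sub>2)) = nws (bar b) (rev j\<^sub>2) * (nws (bar a) (rev j\<^sub>1) * (nw s k * nw (\<not> s) k))" for k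
      using l unfolding t by (simp add: nws_append)
    then show ?thesis using *[OF t l] by (simp only: rwc flip: sum_distrib_left) simp
  qed
  then show "red t (\<lambda>j. coef y (mk_word t i j) * of_real (nws (bar t) (rev j)))" unfolding red_def by blast
  have "(\<Sum>k\<in>UNIV. of_real (cw s k) * (cnj (coef y (mk_word t i (j\<^sub>1 @ k # k # j\<^sub>2))) * of_real (nws t (j\<^sub>1 @ k # k # j\<^sub>2)))) = 0"
    if t: "t = a @ s # (\<not> s) # b" and l: "length j\<^sub>1 = length a" "length j\<^sub>2 = length b" for a s b j\<^sub>1 j\<^sub>2
  proof -
    have "nws t (j\<^sub>1 @ k # k # j\<^sub>2) = nws a j\<^sub>1 * (nws b j\<^sub>2 * (nw s k * nw (\<not> s) k))" for k
      using l unfolding t by (simp add: nws_append)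
    moreover have "(\<Sum>k\<in>UNIV. of_real (rw s k) * cnj (coef y (mk_word t i (j\<^sub>1 @ k # k # j\<^sub>2)))) = 0"
      using arg_cong[OF *[OF t l], of cnj] by simp
    ultimately show ?thesis by (simp only: rwc flip: sum_distrib_left) simp
  qed
  then show "red t (\<lambda>j. cnj (coef y (mk_word t i j)) * of_real (nws t j))" unfolding red_def by blast
qed

text \<open>The contribution to H(star y y) of monomials of sign pattern s in the first and t in the
  second factor.\<close>

definition block :: "('n \<times> 'n) starred free_alg \<Rightarrow> bool list \<Rightarrow> bool list \<Rightarrow> complex"
  where "block y s t = (\<Sum>i\<in>tuples (length s). \<Sum>j\<in>tuples (length s). \<Sum>i'\<in>tuples (length t). \<Sum>j'\<in>tuples (length t).
    cnj (coef y (mk_word s i j)) * (coef y (mk_word t i' j') * hT (bar s @ t) (rev i @ i') (rev j @ j')))"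

text \<open>Expand the projection in an orthonormal basis. Each basis tensor is paired once with the
  rows and once with the columns of the coefficients, and \<open>fx_pairing\<close> evaluates both
  by the same constant; the product is a squared modulus.\<close>

lemma block_eq:
  assumes y: "reduced y"
  obtains \<kappa> where
    "\<And>a c c'. a < bm (bar s @ t) \<Longrightarrow> red s c \<Longrightarrow> red t c' \<Longrightarrow> pairing s t c c' (bf (bar s @ t) a) =
      (if s = t then \<kappa> a * (\<Sum>i\<in>tuples (length s). c i * c' i * of_real (nest s i)) else 0)"
    and "block y s t = (if s = t then of_real ((\<Sum>a<bm (bar t @ t). (cmod (\<kappa> a))\<^sup>2) *
      (\<Sum>i\<in>tuples (length t). \<Sum>j\<in>tuples (length t).
        (cmod (coef y (mk_word t i j)))\<^sup>2 * (nest t i * nws (bar t) (rev j) * nws t j * nest t j))) else 0)"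
proof -
  let ?T = "bar s @ t"
  let ?P = "\<lambda>a \<kappa>. a < bm ?T \<longrightarrow> (\<forall>c c'. red s c \<longrightarrow> red t c' \<longrightarrow> pairing s t c c' (bf ?T a) =
      (if s = t then \<kappa> * (\<Sum>i\<in>tuples (length s). c i * c' i * of_real (nest s i)) else 0))"
  have "\<forall>a. \<exists>\<kappa>. ?P a \<kappa>" using fx_pairing[OF basis(1) refl] by blast
  then have "\<exists>\<kappa>. \<forall>a. ?P a (\<kappa> a)" by (rule choice)
  then obtain \<kappa> where \<kappa>: "\<And>a c c'. a < bm ?T \<Longrightarrow> red s c \<Longrightarrow> red t c' \<Longrightarrow> pairing s t c c' (bf ?T a) =
      (if s = t then \<kappa> a * (\<Sum>i\<in>tuples (length s). c i * c' i * of_real (nest s i)) else 0)"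
    by blast
  define Y where "Y i j = coef y (mk_word s i j)" for i j
  define Z where "Z i j = coef y (mk_word t i j)" for i j
  let ?nb = "\<lambda>j. complex_of_real (nws (bar s) (rev j))" and ?n = "\<lambda>j. complex_of_real (nws t j)"
  have "block y s t = (\<Sum>i\<in>tuples (length s). \<Sum>j\<in>tuples (length s). \<Sum>i'\<in>tuples (length t). \<Sum>j'\<in>tuples (length t). \<Sum>a<bm ?T.
      (cnj (Y i j) * Z i' j' * bf ?T a (rev i @ i')) * (cnj (bf ?T a (rev j @ j')) * ?nb j * ?n j'))"
    unfolding block_def hT_def Y_def[symmetric] Z_def[symmetric] sum_distrib_left
    by (intro sum.cong refl) (simp add: tuples_def nws_append mult_ac)
  also have "\<dots> = (\<Sum>a<bm ?T. \<Sum>j\<in>tuples (length s). \<Sum>j'\<in>tuples (length t).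
      pairing s t (\<lambda>i. cnj (Y i j)) (\<lambda>i. Z i j') (bf ?T a) * (cnj (bf ?T a (rev j @ j')) * ?nb j * ?n j'))"
    by (subst sum_shuffle) (simp only: pairing_def sum_distrib_right)
  also have "\<dots> = (\<Sum>a<bm ?T. \<Sum>j\<in>tuples (length s). \<Sum>j'\<in>tuples (length t).
      (if s = t then \<kappa> a * (\<Sum>i\<in>tuples (length s). cnj (Y i j) * Z i j' * of_real (nest s i)) else 0) * (cnj (bf ?T a (rev j @ j')) * ?nb j * ?n j'))"
    by (intro sum.cong refl arg_cong2[where f = "(*)"] \<kappa>)
       (simp_all add: Y_def Z_def tuples_def red_rows[OF y])
  finally have B: "block y s t = (\<Sum>a<bm ?T. \<Sum>j\<in>tuples (length s). \<Sum>j'\<in>tuples (length t).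
      (if s = t then \<kappa> a * (\<Sum>i\<in>tuples (length s). cnj (Y i j) * Z i j' * of_real (nest s i)) else 0) * (cnj (bf ?T a (rev j @ j')) * ?nb j * ?n j'))" .
  show thesis
  proof (cases "s = t")
    case False
    then show thesis using that[of \<kappa>] \<kappa> B by simp
  next
    case True
    have ZY: "Z = Y" using True by (simp add: Z_def[abs_def] Y_def[abs_def])
    have "block y s t = (\<Sum>a<bm ?T. \<kappa> a * (\<Sum>j\<in>tuples (length t). \<Sum>j'\<in>tuples (length t). \<Sum>i\<in>tuples (length t).
        of_real (nest t i) * cnj (Y i j * ?nb j * (cnj (Y i j') * ?n j') * bf ?T a (rev j @ j'))))"
      unfolding B using True ZY by (simp add: sum_distrib_left sum_distrib_right mult_ac)
    also have "\<dots> = (\<Sum>a<bm ?T. \<kappa> a * (\<Sum>i\<in>tuples (length t). of_real (nest t i) *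
        cnj (pairing t t (\<lambda>j. Y i j * ?nb j) (\<lambda>j. cnj (Y i j) * ?n j) (bf ?T a))))"
    proof -
      have "(\<Sum>j\<in>tuples (length t). \<Sum>j'\<in>tuples (length t). \<Sum>i\<in>tuples (length t). g i j j') =
        (\<Sum>i\<in>tuples (length t). \<Sum>j\<in>tuples (length t). \<Sum>j'\<in>tuples (length t). g i j j')" for g :: "'n list \<Rightarrow> 'n list \<Rightarrow> 'n list \<Rightarrow> complex"
        by (subst (2) sum.swap, subst sum.swap) (rule refl)
      note sw = this
      show ?thesis
      proof (rule sum.cong[OF refl], rule arg_cong2[where f = "(*)"], rule refl)
        fix a :: nat
        show "(\<Sum>j\<in>tuples (length t). \<Sum>j'\<in>tuples (length t). \<Sum>i\<in>tuples (length t).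
            of_real (nest t i) * cnj (Y i j * ?nb j * (cnj (Y i j') * ?n j') * bf ?T a (rev j @ j'))) =
          (\<Sum>i\<in>tuples (length t). of_real (nest t i) * cnj (pairing t t (\<lambda>j. Y i j * ?nb j) (\<lambda>j. cnj (Y i j) * ?n j) (bf ?T a)))"
          by (subst sw) (simp add: pairing_def sum_distrib_left)
      qed
    qed
    also have "\<dots> = (\<Sum>a<bm ?T. \<kappa> a * (\<Sum>i\<in>tuples (length t). of_real (nest t i) *
        cnj (\<kappa> a * (\<Sum>j\<in>tuples (length t). (Y i j * ?nb j) * (cnj (Y i j) * ?n j) * of_real (nest t j)))))"
    proof (intro sum.cong refl arg_cong2[where f = "(*)"] arg_cong[where f = cnj])
      fix a and i :: "'n list" assume "a \<in> {..<bm ?T}" "i \<in> tuples (length t)"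
      then show "pairing t t (\<lambda>j. Y i j * ?nb j) (\<lambda>j. cnj (Y i j) * ?n j) (bf ?T a) =
          \<kappa> a * (\<Sum>j\<in>tuples (length t). (Y i j * ?nb j) * (cnj (Y i j) * ?n j) * of_real (nest t j))"
        using \<kappa>[of a "\<lambda>j. Y i j * ?nb j" "\<lambda>j. cnj (Y i j) * ?n j"] red_columns[OF y, of i t] True
        by (simp add: Y_def tuples_def)
    qed
    also have "\<dots> = (\<Sum>a<bm ?T. (\<kappa> a * cnj (\<kappa> a)) * (\<Sum>i\<in>tuples (length t). \<Sum>j\<in>tuples (length t).
        (Y i j * cnj (Y i j)) * (of_real (nest t i) * ?nb j * ?n j * of_real (nest t j))))"
      by (simp add: sum_distrib_left mult_ac)
    also have "\<dots> = of_real ((\<Sum>a<bm ?T. (cmod (\<kappa> a))\<^sup>2) *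
      (\<Sum>i\<in>tuples (length t). \<Sum>j\<in>tuples (length t).
        (cmod (Y i j))\<^sup>2 * (nest t i * nws (bar s) (rev j) * nws t j * nest t j)))"
      by (simp add: complex_norm_square[symmetric] sum_distrib_right)
    finally show thesis using that[of \<kappa>] \<kappa> True by (simp add: Y_def)
  qed
qed

text \<open>If all constants \<kappa> were zero, every invariant tensor would pair to zero with the
  coefficients. The nested pairing is invariant and pairs to a positive number with a nonzero column
  of coefficients.\<close>

lemma block_diagonal:
  assumes y: "reduced y"
  shows "\<exists>c \<ge> 0. block y t t = of_real c \<and> (c = 0 \<longrightarrow> (\<forall>i j. length i = length t \<longrightarrow> length j = length t \<longrightarrow> coef y (mk_word t i j) = 0))"
proof -
  let ?T = "bar t @ t"
  define w where "w i j = nest t i * nws (bar t) (rev j) * nws t j * nest t j" for i j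
  have w: "0 < w i j" for i j by (simp add: w_def nest_pos nws_pos)
  obtain \<kappa> where \<kappa>: "\<And>a c c'. a < bm ?T \<Longrightarrow> red t c \<Longrightarrow> red t c' \<Longrightarrow> pairing t t c c' (bf ?T a) =
        \<kappa> a * (\<Sum>i\<in>tuples (length t). c i * c' i * of_real (nest t i))"
    and b: "block y t t = of_real ((\<Sum>a<bm ?T. (cmod (\<kappa> a))\<^sup>2) *
      (\<Sum>i\<in>tuples (length t). \<Sum>j\<in>tuples (length t). (cmod (coef y (mk_word t i j)))\<^sup>2 * w i j))"
    using block_eq[OF y, of t t] unfolding w_def by auto
  let ?c1 = "\<Sum>a<bm ?T. (cmod (\<kappa> a))\<^sup>2"
  let ?c2 = "\<Sum>i\<in>tuples (length t). \<Sum>j\<in>tuples (length t). (cmod (coef y (mk_word t i j)))\<^sup>2 * w i j"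
  have nn: "0 \<le> (cmod z)\<^sup>2 * w i j" for z i j using w[of i j] by simp
  have c2: "0 \<le> ?c2" by (intro sum_nonneg nn)
  have "coef y (mk_word t i0 j0) = 0"
    if l: "length i0 = length t" "length j0 = length t" and zero: "?c1 * ?c2 = 0" for i0 j0
  proof (rule ccontr)
    assume ne: "coef y (mk_word t i0 j0) \<noteq> 0"
    define c where "c i = coef y (mk_word t i j0)" for i
    define q where "q i j = (cmod (coef y (mk_word t i j)))\<^sup>2 * w i j" for i j
    have q0: "0 \<le> q i j" for i j unfolding q_def by (rule nn)
    have mem: "i0 \<in> tuples (length t)" "j0 \<in> tuples (length t)" using l by (simp_all add: tuples_def)
    have "0 < q i0 j0" using ne w by (simp add: q_def)
    also have "\<dots> \<le> (\<Sum>j\<in>tuples (length t). q i0 j)"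
      by (rule member_le_sum[of j0 "tuples (length t)" "q i0"]) (simp_all add: mem q0)
    also have "\<dots> \<le> (\<Sum>i\<in>tuples (length t). \<Sum>j\<in>tuples (length t). q i j)"
      by (rule member_le_sum[of i0 "tuples (length t)" "\<lambda>i. \<Sum>j\<in>tuples (length t). q i j"])
        (simp_all add: mem q0 sum_nonneg)
    finally have "?c2 \<noteq> 0" unfolding q_def by linarith
    then have "?c1 = 0" using zero by simp
    then have k0: "\<kappa> a = 0" if "a < bm ?T" for a
      using sum_nonneg_0[of "{..<bm ?T}" "\<lambda>a. (cmod (\<kappa> a))\<^sup>2" a] that by simp
    have red: "red t c" "red t (\<lambda>i. cnj (c i))" using red_rows[OF y l(2)] by (simp_all add: c_def[abs_def])
    \<comment> \<open>Expansion of the nested pairing in the orthonormal basis.\<close>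
    have "pairing t t (\<lambda>i. cnj (c i)) c (nested t) =
        (\<Sum>a<bm ?T. tip ?T (nested t) (bf ?T a) * pairing t t (\<lambda>i. cnj (c i)) c (bf ?T a))"
    proof -
      have "nested t (rev i @ j) = (\<Sum>a<bm ?T. tip ?T (nested t) (bf ?T a) * bf ?T a (rev i @ j))"
        if "i \<in> tuples (length t)" "j \<in> tuples (length t)" for i j
      proof -
        have "rev i @ j \<in> tuples (length ?T)" using that by (simp add: tuples_def)
        from basis(3)[OF fx_nested this] show ?thesis by (simp only: projection_def)
      qed
      then have "pairing t t (\<lambda>i. cnj (c i)) c (nested t) = (\<Sum>i\<in>tuples (length t). \<Sum>j\<in>tuples (length t). \<Sum>a<bm ?T.
          tip ?T (nested t) (bf ?T a) * (cnj (c i) * c j * bf ?T a (rev i @ j)))"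
        unfolding pairing_def by (intro sum.cong refl) (simp add: sum_distrib_left mult_ac)
      also have "\<dots> = (\<Sum>a<bm ?T. \<Sum>i\<in>tuples (length t). \<Sum>j\<in>tuples (length t).
          tip ?T (nested t) (bf ?T a) * (cnj (c i) * c j * bf ?T a (rev i @ j)))"
        by (subst (2) sum.swap, subst sum.swap) (rule refl)
      finally show ?thesis by (simp add: pairing_def sum_distrib_left)
    qed
    also have "\<dots> = 0" using \<kappa>[OF _ red(2,1)] k0 by simp
    finally have "pairing t t (\<lambda>i. cnj (c i)) c (nested t) = 0" .
    moreover have "pairing t t (\<lambda>i. cnj (c i)) c (nested t) = of_real (\<Sum>i\<in>tuples (length t). (cmod (c i))\<^sup>2 * nest t i)"
    proof -
      have "(\<Sum>j\<in>tuples (length t). cnj (c i) * c j * nested t (rev i @ j)) = of_real ((cmod (c i))\<^sup>2 * nest t i)"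
        if i: "i \<in> tuples (length t)" for i
      proof -
        have "(\<Sum>j\<in>tuples (length t). cnj (c i) * c j * nested t (rev i @ j)) =
            (\<Sum>j\<in>tuples (length t). if i = j then of_real ((cmod (c i))\<^sup>2 * nest t i) else 0)"
          using i by (intro sum.cong refl) (auto simp: nested_eq tuples_def complex_norm_square mult_ac simp del: of_real_power)
        then show ?thesis using i by simp
      qed
      then show ?thesis by (simp add: pairing_def)
    qed
    ultimately have "(\<Sum>i\<in>tuples (length t). (cmod (c i))\<^sup>2 * nest t i) = 0" by (simp only: of_real_eq_0_iff)
    then have "(cmod (c i0))\<^sup>2 * nest t i0 = 0"
      using sum_nonneg_0[of "tuples (length t)" "\<lambda>i. (cmod (c i))\<^sup>2 * nest t i" i0] mem(1) less_imp_le[OF nest_pos[of t]]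
      by simp
    then show False using ne nest_pos[of t i0] by (simp add: c_def)
  qed
  then show ?thesis
    using b c2 by (intro exI[of _ "?c1 * ?c2"]) (auto intro!: mult_nonneg_nonneg sum_nonneg)
qed

text \<open>Sorting monomials by sign patterns gives a sum of blocks. Blocks for different patterns
  vanish, so no cross terms disturb positivity.\<close>

lemma haar_reduced:
  assumes y: "reduced y"
  shows "\<exists>r\<ge>0. lin H (star y * y) = of_real r \<and> (r = 0 \<longrightarrow> y = 0)"
proof -
  obtain N where N: "shorter N y" using shorter_exists by blast
  let ?A = "{w :: ('n \<times> 'n) starred list. length w < N}" and ?T = "{t :: bool list. length t < N}"
  have finT: "finite ?T"
    using finite_lists_length_le[of "UNIV :: bool set" N] by (rule finite_subset[rotated]) auto
  have sy: "star y = (\<Sum>v\<in>?A. scal (cnj (coef y v)) * mon (rev (map flip v)))"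
    by (subst shorter_expand[OF N]) (simp add: star_sum star_scal_mon)
  have "lin H (star y * y) = (\<Sum>v\<in>?A. \<Sum>w\<in>?A. cnj (coef y v) * (coef y w * H (rev (map flip v) @ w)))"
    unfolding sy by (simp add: sum_distrib_right lin_sum mult.assoc lin_scal lin_mon_mult lin_expand[OF N] sum_distrib_left)
  also have "\<dots> = (\<Sum>s\<in>?T. \<Sum>t\<in>?T. block y s t)"
  proof -
    have H: "H (rev (map flip (mk_word s i j)) @ mk_word t i' j') = hT (bar s @ t) (rev i @ i') (rev j @ j')"
      if "length i = length s" "length j = length s" "length i' = length t" "length j' = length t" for s t i j i' j'
    proof -
      have "map sg (rev (map flip w)) = bar (map sg w)" "map rowi (rev (map flip w)) = rev (map rowi w)" "map coli (rev (map flip w)) = rev (map coli w)"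
        for w :: "('n \<times> 'n) starred list" by (induction w) simp_all
      then show ?thesis
        using mk_word_sel[of i s j] mk_word_sel[of i' t j'] that unfolding H_def map_append by simp
    qed
    have "(\<Sum>v\<in>?A. \<Sum>w\<in>?A. cnj (coef y v) * (coef y w * H (rev (map flip v) @ w))) =
      (\<Sum>s\<in>?T. \<Sum>i\<in>tuples (length s). \<Sum>j\<in>tuples (length s). \<Sum>t\<in>?T. \<Sum>i'\<in>tuples (length t). \<Sum>j'\<in>tuples (length t).
        cnj (coef y (mk_word s i j)) * (coef y (mk_word t i' j') * hT (bar s @ t) (rev i @ i') (rev j @ j')))"
      unfolding sum_words by (intro sum.cong refl) (simp add: H tuples_def)
    also have "\<dots> = (\<Sum>s\<in>?T. \<Sum>t\<in>?T. block y s t)"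
    proof (rule sum.cong[OF refl])
      fix s :: "bool list"
      have "(\<Sum>i\<in>tuples (length s). \<Sum>j\<in>tuples (length s). \<Sum>t\<in>?T. g i j t) =
        (\<Sum>t\<in>?T. \<Sum>i\<in>tuples (length s). \<Sum>j\<in>tuples (length s). g i j t)" for g :: "'n list \<Rightarrow> 'n list \<Rightarrow> bool list \<Rightarrow> complex"
        by (subst (2) sum.swap, subst sum.swap) (rule refl)
      then show "(\<Sum>i\<in>tuples (length s). \<Sum>j\<in>tuples (length s). \<Sum>t\<in>?T. \<Sum>i'\<in>tuples (length t). \<Sum>j'\<in>tuples (length t).
        cnj (coef y (mk_word s i j)) * (coef y (mk_word t i' j') * hT (bar s @ t) (rev i @ i') (rev j @ j'))) = (\<Sum>t\<in>?T. block y s t)"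
        unfolding block_def .
    qed
    finally show ?thesis .
  qed
  also have "\<dots> = (\<Sum>s\<in>?T. block y s s)"
  proof (rule sum.cong[OF refl])
    fix s :: "bool list" assume s: "s \<in> ?T"
    have "block y s t = (if s = t then block y s s else 0)" for t
      by (cases "s = t") (simp, rule block_eq[OF y, of s t], simp)
    then have "(\<Sum>t\<in>?T. block y s t) = (\<Sum>t\<in>?T. if s = t then block y s s else 0)"
      by (rule sum.cong[OF refl])
    also have "\<dots> = block y s s" using s finT by simp
    finally show "(\<Sum>t\<in>?T. block y s t) = block y s s" .
  qed
  finally have lH: "lin H (star y * y) = (\<Sum>s\<in>?T. block y s s)" .
  let ?P = "\<lambda>t c. 0 \<le> c \<and> block y t t = of_real c \<and>
    (c = 0 \<longrightarrow> (\<forall>i j. length i = length t \<longrightarrow> length j = length t \<longrightarrow> coef y (mk_word t i j) = 0))"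
  have "\<forall>t. \<exists>c. ?P t c" using block_diagonal[OF y] by blast
  then have "\<exists>c. \<forall>t. ?P t (c t)" by (rule choice)
  then obtain c where c: "\<And>t. 0 \<le> c t" "\<And>t. block y t t = of_real (c t)"
    "\<And>t i j. c t = 0 \<Longrightarrow> length i = length t \<Longrightarrow> length j = length t \<Longrightarrow> coef y (mk_word t i j) = 0"
    by blast
  have "y = 0" if "(\<Sum>t\<in>?T. c t) = 0"
  proof (rule lin_eqI)
    fix h
    have "coef y w = 0" if "w \<in> ?A" for w
    proof -
      have "c (map sg w) = 0" using \<open>(\<Sum>t\<in>?T. c t) = 0\<close> finT c(1) that by (subst (asm) sum_nonneg_eq_0_iff) auto
      from c(3)[OF this, of "map rowi w" "map coli w"] show ?thesis by (simp add: mk_word_id)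
    qed
    then show "lin h y = lin h 0" by (simp add: lin_expand[OF N])
  qed
  then show ?thesis
    using c by (intro exI[of _ "\<Sum>t\<in>?T. c t"]) (auto simp: lH intro: sum_nonneg)
qed

text \<open>Positivity and faithfulness modulo the ideal, transferred from a reduced representative
  of x.\<close>

theorem haar_positive: "\<exists>r\<ge>0. lin H (star x * x) = of_real r \<and> (r = 0 \<longrightarrow> x \<in> diag_ideal)"
proof -
  note J = two_sided_diag_ideal
  obtain y where y: "reduced y" "x - y \<in> diag_ideal" using reduced_representative by blast
  have "star x * (x - y) + star (x - y) * y \<in> diag_ideal"
    using y(2) star_diag_ideal[OF y(2)] by (intro two_sided_add[OF J] two_sided_mult_left[OF J] two_sided_mult_right[OF J])
  then have "star x * x - star y * y \<in> diag_ideal" by (simp add: algebra_simps star_diff)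
  then have "lin H (star x * x) = lin H (star y * y)"
    using haar_natural[of "star x * x - star y * y"] by (simp add: lin_diff)
  moreover have "x \<in> diag_ideal" if "y = 0" using y(2) that by simp
  ultimately show ?thesis using haar_reduced[OF y(1)] by auto
qed

end

section \<open>The GNS construction\<close>

section \<open>C*-seminorms from positive functionals\<close>

text \<open>The condition \<open>h_gen\<close> says that left multiplication by each generator is
  bounded for the seminorm of h, so that all elements act by bounded operators.\<close>

locale positive_functional =
  fixes h :: "'g starred free_alg \<Rightarrow> complex"
  assumes h_add: "h (x + y) = h x + h y" and h_scal: "h (scal c * x) = c * h x"
    and h_pos: "\<exists>r\<ge>0. h (star x * x) = complex_of_real r" and h_1: "h 1 = 1"
    and h_gen: "\<exists>M\<ge>0. \<forall>y. Re (h (star (gen g * y) * (gen g * y))) \<le> M * Re (h (star y * y))"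
begin

definition nrm :: "'g starred free_alg \<Rightarrow> real"
  where "nrm x = sqrt (Re (h (star x * x)))"

lemma h_self: "h (star x * x) = of_real ((nrm x)\<^sup>2)" and nrm_nonneg: "0 \<le> nrm x"
  using h_pos[of x] by (auto simp: nrm_def simp flip: of_real_power)

lemma h_0: "h 0 = 0"
  using h_scal[of 0 0] by simp

lemma h_uminus: "h (- x) = - h x"
  using h_scal[of "- 1" x] by (simp add: scal_uminus)

lemma h_diff: "h (x - y) = h x - h y"
  using h_add[of x "- y"] by (simp add: h_uminus)

lemma nrm_combination:
  "complex_of_real ((nrm (x + scal c * y))\<^sup>2) =
    of_real ((nrm x)\<^sup>2) + c * h (star x * y) + cnj c * h (star y * x) + of_real ((cmod c)\<^sup>2 * (nrm y)\<^sup>2)"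
proof -
  have "star (x + scal c * y) * (x + scal c * y) =
      star x * x + scal c * (star x * y) + scal (cnj c) * (star y * x) + scal (cnj c * c) * (star y * y)"
    by (rule lin_eqI) (simp add: star_add star_mult scal_norm lin_add lin_scal)
  then have "h (star (x + scal c * y) * (x + scal c * y)) =
      h (star x * x) + c * h (star x * y) + cnj c * h (star y * x) + cnj c * c * h (star y * y)"
    by (simp only: h_add h_scal)
  moreover have "cnj c * c = of_real ((cmod c)\<^sup>2)" by (simp only: complex_norm_square mult.commute)
  ultimately show ?thesis unfolding h_self by (simp only: of_real_mult)
qed

lemma h_hermitian: "h (star x * y) = cnj (h (star y * x))"
proof -
  have im: "Im (c * h (star x * y) + cnj c * h (star y * x)) = 0" for c
    using arg_cong[OF nrm_combination[of x c y], of Im] by simp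
  show ?thesis using im[of 1] im[of \<i>] by (simp add: complex_eq_iff)
qed

lemma cauchy_schwarz: "cmod (h (star y * x)) \<le> nrm x * nrm y"
proof -
  let ?b = "h (star y * x)" and ?B = "(cmod (h (star y * x)))\<^sup>2"
  have ineq: "0 \<le> (nrm x)\<^sup>2 - 2 * t * ?B + t\<^sup>2 * ?B * (nrm y)\<^sup>2" for t :: real
  proof -
    let ?c = "- (of_real t * ?b)"
    have E: "?c * h (star x * y) = - of_real (t * ?B)" "cnj ?c * ?b = - of_real (t * ?B)"
      unfolding h_hermitian[of x y] of_real_mult complex_norm_square by (simp_all add: mult_ac)
    have "complex_of_real ((nrm (x + scal ?c * y))\<^sup>2) =
        of_real ((nrm x)\<^sup>2 - t * ?B - t * ?B + (cmod ?c)\<^sup>2 * (nrm y)\<^sup>2)"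
      unfolding nrm_combination E by (simp only: of_real_add of_real_diff) simp
    then have "(nrm (x + scal ?c * y))\<^sup>2 = (nrm x)\<^sup>2 - t * ?B - t * ?B + (cmod ?c)\<^sup>2 * (nrm y)\<^sup>2"
      by (simp only: of_real_eq_iff)
    moreover have "(cmod ?c)\<^sup>2 = t\<^sup>2 * ?B" by (simp add: norm_mult power_mult_distrib)
    ultimately show ?thesis using zero_le_power2[of "nrm (x + scal ?c * y)"] by simp
  qed
  have "?B \<le> (nrm x * nrm y)\<^sup>2"
  proof (cases "nrm y = 0")
    case True
    have "?B = 0"
    proof (rule ccontr)
      assume "?B \<noteq> 0"
      then show False using ineq[of "((nrm x)\<^sup>2 + 1) / (2 * ?B)"] True by (simp add: field_simps)
    qed
    then show ?thesis by simp
  next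
    case False
    then have "0 < (nrm y)\<^sup>2" by simp
    have "B \<le> a * n" if "0 \<le> a - 2 * (1 / n) * B + (1 / n)\<^sup>2 * B * n" "0 < n" for a B n :: real
      using that by (simp add: field_simps power2_eq_square)
    from this[OF ineq \<open>0 < (nrm y)\<^sup>2\<close>] show ?thesis by (simp add: power_mult_distrib)
  qed
  then show ?thesis using nrm_nonneg by (intro power2_le_imp_le[of "cmod ?b"]) auto
qed

lemma nrm_triangle: "nrm (x + y) \<le> nrm x + nrm y"
proof (rule power2_le_imp_le)
  have "(nrm (x + y))\<^sup>2 = (nrm x)\<^sup>2 + 2 * Re (h (star y * x)) + (nrm y)\<^sup>2"
    using arg_cong[OF nrm_combination[of x 1 y], of Re] h_hermitian[of x y] by simp
  moreover have "Re (h (star y * x)) \<le> nrm x * nrm y"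
    using cauchy_schwarz[of y x] complex_Re_le_cmod[of "h (star y * x)"] by linarith
  ultimately show "(nrm (x + y))\<^sup>2 \<le> (nrm x + nrm y)\<^sup>2" by (simp add: power2_sum)
qed (simp add: nrm_nonneg)

lemma nrm_scal: "nrm (scal c * x) = cmod c * nrm x"
proof -
  have "nrm 0 = 0" by (simp add: nrm_def h_0)
  then have "complex_of_real ((nrm (scal c * x))\<^sup>2) = of_real ((cmod c)\<^sup>2 * (nrm x)\<^sup>2)"
    using nrm_combination[of 0 c x] by (simp add: h_0)
  then have "(nrm (scal c * x))\<^sup>2 = (cmod c * nrm x)\<^sup>2" by (simp only: of_real_eq_iff power_mult_distrib)
  then show ?thesis using nrm_nonneg by (simp add: power2_eq_iff_nonneg)
qed

text \<open>L bounds left multiplication by x; the infimum of such L is the operator seminorm of the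
  GNS representation.\<close>

definition bnd :: "'g starred free_alg \<Rightarrow> real \<Rightarrow> bool"
  where "bnd x L \<longleftrightarrow> 0 \<le> L \<and> (\<forall>y. nrm (x * y) \<le> L * nrm y)"

lemma bnd_add: "bnd x L \<Longrightarrow> bnd y M \<Longrightarrow> bnd (x + y) (L + M)"
  unfolding bnd_def distrib_right
proof (intro conjI allI)
  assume x: "0 \<le> L \<and> (\<forall>z. nrm (x * z) \<le> L * nrm z)" and y: "0 \<le> M \<and> (\<forall>z. nrm (y * z) \<le> M * nrm z)"
  show "0 \<le> L + M" using x y by simp
  show "nrm (x * z + y * z) \<le> L * nrm z + M * nrm z" for z
    by (rule order_trans[OF nrm_triangle]) (use x y in \<open>simp add: add_mono\<close>)
qed

lemma bnd_scal_mult: "bnd x L \<Longrightarrow> bnd (scal c * x) (cmod c * L)"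
  unfolding bnd_def mult.assoc nrm_scal by (auto intro: mult_left_mono)

lemma bnd_mult: "bnd x L \<Longrightarrow> bnd y M \<Longrightarrow> bnd (x * y) (L * M)"
  unfolding bnd_def
proof (intro conjI allI)
  assume x: "0 \<le> L \<and> (\<forall>z. nrm (x * z) \<le> L * nrm z)" and y: "0 \<le> M \<and> (\<forall>z. nrm (y * z) \<le> M * nrm z)"
  show "0 \<le> L * M" using x y by simp
  fix z
  have "nrm (x * (y * z)) \<le> L * nrm (y * z)" using x by blast
  also have "\<dots> \<le> L * (M * nrm z)" using x y by (intro mult_left_mono) auto
  finally show "nrm (x * y * z) \<le> L * M * nrm z" by (simp add: mult.assoc)
qed

lemma bnd_exists: "\<exists>L. bnd x L"
proof (induction x rule: free_alg_induct)
  case (scal_mon c w)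
  have "\<exists>L. bnd (mon w) L"
  proof (induction w)
    case Nil
    show ?case by (intro exI[of _ 1]) (simp add: bnd_def)
  next
    case (Cons g w)
    obtain M where M: "0 \<le> M" "\<And>y. Re (h (star (gen g * y) * (gen g * y))) \<le> M * Re (h (star y * y))"
      using h_gen[of g] by blast
    have "bnd (gen g) (sqrt M)"
      unfolding bnd_def nrm_def using M by (simp flip: real_sqrt_mult)
    then show ?case using Cons bnd_mult unfolding mon_Cons by blast
  qed
  then show ?case using bnd_scal_mult by blast
qed (use bnd_add in blast)

definition op_norm :: "'g starred free_alg \<Rightarrow> real"
  where "op_norm x = Inf {L. bnd x L}"

lemma op_norm_le: "bnd x L \<Longrightarrow> op_norm x \<le> L"
  unfolding op_norm_def by (rule cInf_lower) (auto simp: bnd_def intro!: bdd_belowI[of _ 0])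

lemma bnd_op_norm: "bnd x (op_norm x)"
  unfolding bnd_def
proof (intro conjI allI)
  have ne: "{L. bnd x L} \<noteq> {}" using bnd_exists by auto
  show "0 \<le> op_norm x" unfolding op_norm_def by (rule cInf_greatest[OF ne]) (simp add: bnd_def)
  fix y show "nrm (x * y) \<le> op_norm x * nrm y"
  proof (cases "nrm y = 0")
    case True
    then show ?thesis using bnd_exists[of x] by (auto simp: bnd_def) (metis mult_zero_right)
  next
    case False
    then have y: "0 < nrm y" using nrm_nonneg[of y] by simp
    have "nrm (x * y) / nrm y \<le> op_norm x"
      unfolding op_norm_def by (rule cInf_greatest[OF ne]) (use y in \<open>simp add: bnd_def divide_le_eq\<close>)
    then show ?thesis using y by (simp add: divide_le_eq)
  qed
qed

lemma op_norm_apply: "nrm (x * y) \<le> op_norm x * nrm y" and op_norm_nonneg: "0 \<le> op_norm x"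
  using bnd_op_norm[of x] by (auto simp: bnd_def)

text \<open>By Cauchy-Schwarz the square of \<open>nrm (x * y)\<close> is at most
  \<open>nrm (star x * x * y)\<close> times \<open>nrm y\<close>, which gives the nontrivial half of
  the C*-identity.\<close>

lemma cstar_seminorm_op_norm: "cstar_seminorm op_norm"
proof -
  have scal_le: "op_norm (scal c * x) \<le> cmod c * op_norm x" for c x
    by (rule op_norm_le[OF bnd_scal_mult[OF bnd_op_norm]])
  have scal: "op_norm (scal c * x) = cmod c * op_norm x" for c x
  proof (cases "c = 0")
    case True
    then show ?thesis using scal_le[of c x] op_norm_nonneg[of "scal c * x"] by simp
  next
    case False
    have "op_norm x = op_norm (scal (1 / c) * (scal c * x))" using False by (simp add: scal_scal)
    also have "\<dots> \<le> cmod (1 / c) * op_norm (scal c * x)" by (rule scal_le)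
    finally show ?thesis using False scal_le[of c x] by (simp add: norm_divide field_simps)
  qed
  have mult: "op_norm (x * y) \<le> op_norm x * op_norm y" for x y
    by (rule op_norm_le[OF bnd_mult[OF bnd_op_norm bnd_op_norm]])
  have star_le: "op_norm (star x) \<le> op_norm x" for x
  proof (rule op_norm_le, unfold bnd_def, intro conjI allI op_norm_nonneg)
    fix y
    have "(nrm (star x * y))\<^sup>2 = cmod (h (star (star x * y) * (star x * y)))"
      unfolding h_self by (simp add: norm_power nrm_nonneg)
    also have "star (star x * y) * (star x * y) = star y * (x * (star x * y))"
      by (simp add: star_mult mult.assoc)
    also have "cmod (h \<dots>) \<le> nrm (x * (star x * y)) * nrm y" by (rule cauchy_schwarz)
    also have "\<dots> \<le> (op_norm x * nrm (star x * y)) * nrm y"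
      by (intro mult_right_mono op_norm_apply nrm_nonneg)
    finally have "nrm (star x * y) * nrm (star x * y) \<le> nrm (star x * y) * (op_norm x * nrm y)"
      by (simp add: power2_eq_square mult_ac)
    then show "nrm (star x * y) \<le> op_norm x * nrm y"
      using nrm_nonneg[of "star x * y"] op_norm_nonneg[of x] nrm_nonneg[of y]
      by (cases "nrm (star x * y) = 0") auto
  qed
  have "op_norm (star x * x) = (op_norm x)\<^sup>2" for x
  proof (rule antisym)
    have "op_norm (star x) * op_norm x \<le> op_norm x * op_norm x"
      by (intro mult_right_mono star_le op_norm_nonneg)
    then show "op_norm (star x * x) \<le> (op_norm x)\<^sup>2"
      using mult[of "star x" x] by (simp add: power2_eq_square)
    have "bnd x (sqrt (op_norm (star x * x)))"
      unfolding bnd_def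
    proof (intro conjI allI)
      fix y
      have "(nrm (x * y))\<^sup>2 = cmod (h (star (x * y) * (x * y)))"
        unfolding h_self by (simp add: norm_power nrm_nonneg)
      also have "star (x * y) * (x * y) = star y * (star x * x * y)"
        by (simp add: star_mult mult.assoc)
      also have "cmod (h \<dots>) \<le> nrm (star x * x * y) * nrm y" by (rule cauchy_schwarz)
      also have "\<dots> \<le> op_norm (star x * x) * nrm y * nrm y"
        by (intro mult_right_mono op_norm_apply nrm_nonneg)
      finally have "(nrm (x * y))\<^sup>2 \<le> (sqrt (op_norm (star x * x)) * nrm y)\<^sup>2"
        using op_norm_nonneg by (simp add: power2_eq_square power_mult_distrib mult_ac)
      then show "nrm (x * y) \<le> sqrt (op_norm (star x * x)) * nrm y"
        by (rule power2_le_imp_le) (simp add: nrm_nonneg op_norm_nonneg)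
    qed (simp add: op_norm_nonneg)
    then have "op_norm x \<le> sqrt (op_norm (star x * x))" by (rule op_norm_le)
    then have "(op_norm x)\<^sup>2 \<le> (sqrt (op_norm (star x * x)))\<^sup>2"
      by (rule power_mono) (rule op_norm_nonneg)
    then show "(op_norm x)\<^sup>2 \<le> op_norm (star x * x)" using op_norm_nonneg by simp
  qed
  then show ?thesis
    unfolding cstar_seminorm_def using op_norm_nonneg scal mult op_norm_le[OF bnd_add[OF bnd_op_norm bnd_op_norm]]
    by blast
qed

lemma op_norm_eq_0: "(\<And>y. nrm (x * y) = 0) \<Longrightarrow> op_norm x = 0"
  using op_norm_le[of x 0] op_norm_nonneg[of x] by (simp add: bnd_def)

lemma op_norm_0_imp: "op_norm x = 0 \<Longrightarrow> h (star x * x) = 0"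
proof -
  assume "op_norm x = 0"
  then have "nrm x = 0" using op_norm_apply[of x 1] nrm_nonneg[of x] by simp
  then show "h (star x * x) = 0" by (simp add: h_self)
qed

end

context haar
begin

sublocale positive_functional "lin H"
proof
  show "lin H (x + y) = lin H x + lin H y" for x y by (rule lin_add)
  show "lin H (scal c * x) = c * lin H x" for c x by (rule lin_scal)
  show pos: "\<exists>r\<ge>0. lin H (star x * x) = complex_of_real r" for x using haar_positive[of x] by blast
  show "lin H 1 = 1" by (rule haar_1)
  show "\<exists>M\<ge>0. \<forall>y. Re (lin H (star (gen g * y) * (gen g * y))) \<le> M * Re (lin H (star y * y))" for g :: "('n \<times> 'n) starred"
  proof -
    \<comment> \<open>A row relation writes a positive multiple of 1 as a positive combination of
      terms star g' g', with g among the g'; each term is therefore bounded by the whole.\<close>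
    define s i where "s = (\<not> sg g)" and "i = coli g"
    let ?q = "\<lambda>k y. lin H (star (gen (lt (\<not> s) k i) * y) * (gen (lt (\<not> s) k i) * y))"
    have "Re (lin H (star (gen g * y) * (gen g * y))) \<le> (rw s i / rw s (rowi g)) * Re (lin H (star y * y))" for y
    proof -
      have "star y * relR s i i * y \<in> diag_ideal"
        by (intro two_sided_mult_left[OF two_sided_diag_ideal] two_sided_mult_right[OF two_sided_diag_ideal] rel_in_diag_ideal)
      moreover have "star y * relR s i i * y = (\<Sum>k\<in>UNIV. scal (of_real (rw s k)) * (star (gen (lt (\<not> s) k i) * y) * (gen (lt (\<not> s) k i) * y)))
          - scal (of_real (rw s i)) * (star y * y)"
      proof -
        have m: "mon [lt s k i, lt (\<not> s) k i] = gen (lt s k i) * gen (lt (\<not> s) k i)" for k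
          by (simp add: mon_Cons)
        have "star y * (scal c * (a * b)) * y = scal c * (star y * (a * (b * y)))" for c and a b :: "('n \<times> 'n) starred free_alg"
          by (simp only: mult.assoc scal_left_commute[of "star y"])
        moreover have "star y * scal c * y = scal c * (star y * y)" for c
          by (simp only: scal_commute[of "star y"] mult.assoc)
        ultimately show ?thesis
          unfolding relR_def m right_diff_distrib left_diff_distrib sum_distrib_left sum_distrib_right
          by (simp add: star_mult mult.assoc)
      qed
      ultimately have "lin H ((\<Sum>k\<in>UNIV. scal (of_real (rw s k)) * (star (gen (lt (\<not> s) k i) * y) * (gen (lt (\<not> s) k i) * y)))
          - scal (of_real (rw s i)) * (star y * y)) = 0" using haar_natural by simp
      then have "(\<Sum>k\<in>UNIV. of_real (rw s k) * ?q k y) = of_real (rw s i) * lin H (star y * y)"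
        by (simp only: lin_diff lin_sum lin_scal right_minus_eq)
      from arg_cong[OF this, of Re] have "(\<Sum>k\<in>UNIV. rw s k * Re (?q k y)) = rw s i * Re (lin H (star y * y))"
        by simp
      moreover have nn: "0 \<le> rw s k * Re (?q k y)" for k
        using pos[of "gen (lt (\<not> s) k i) * y"] less_imp_le[OF rw_pos[of s k]] by auto
      moreover have "rw s (rowi g) * Re (?q (rowi g) y) \<le> (\<Sum>k\<in>UNIV. rw s k * Re (?q k y))"
        by (rule member_le_sum[of "rowi g" UNIV "\<lambda>k. rw s k * Re (?q k y)"]) (simp_all add: nn)
      moreover have "lt (\<not> s) (rowi g) i = g" by (simp add: s_def i_def)
      ultimately show ?thesis using rw_pos[of s "rowi g"] by (simp add: field_simps)
    qed
    moreover have "0 \<le> rw s i / rw s (rowi g)" using rw_pos less_imp_le by (intro divide_nonneg_nonneg) blast+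
    ultimately show ?thesis by blast
  qed
qed

text \<open>Faithfulness of H: a zero operator sends 1 to a null vector, so x is in the ideal by
  \<open>haar_positive\<close>.\<close>

lemma op_norm_ideal: "op_norm x = 0 \<longleftrightarrow> x \<in> diag_ideal"
proof
  assume "op_norm x = 0"
  then have "lin H (star x * x) = 0" by (rule op_norm_0_imp)
  then show "x \<in> diag_ideal" using haar_positive[of x] by auto
next
  assume x: "x \<in> diag_ideal"
  show "op_norm x = 0"
  proof (rule op_norm_eq_0)
    fix y
    have "star (x * y) * (x * y) \<in> diag_ideal"
      by (intro two_sided_mult_left[OF two_sided_diag_ideal] two_sided_mult_right[OF two_sided_diag_ideal] x)
    from haar_natural[OF this] show "nrm (x * y) = 0" by (simp add: nrm_def)
  qed
qed

end


section \<open>The universal C*-seminorm and its completion by Cauchy sequences\<close>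

section \<open>The universal seminorm and its completion\<close>

lemma coset_quotient_map:
  fixes \<phi> :: "'a::ring_1 \<Rightarrow> 'r" and R :: "('r, 'x) ring_scheme"
  assumes R: "ring R" and I: "ideal I R" and cl: "\<And>x. \<phi> x \<in> carrier R"
    and hom: "\<And>x y. \<phi> (x + y) = \<phi> x \<oplus>\<^bsub>R\<^esub> \<phi> y" "\<And>x y. \<phi> (x * y) = \<phi> x \<otimes>\<^bsub>R\<^esub> \<phi> y" "\<phi> 1 = \<one>\<^bsub>R\<^esub>"
  shows "quotient_map ((R Quot I)\<lparr>carrier := range (\<lambda>x. I +>\<^bsub>R\<^esub> \<phi> x)\<rparr>) (\<lambda>x. I +>\<^bsub>R\<^esub> \<phi> x) {x. \<phi> x \<in> I}"
proof -
  interpret R: ring R by (rule R)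
  interpret I: ideal I R by (rule I)
  interpret Q: ring "R Quot I" by (rule I.quotient_is_ring)
  let ?\<psi> = "\<lambda>x. I +>\<^bsub>R\<^esub> \<phi> x"
  note rh = I.rcos_ring_hom
  have \<psi>: "?\<psi> x \<in> carrier (R Quot I)" "?\<psi> (x + y) = ?\<psi> x \<oplus>\<^bsub>R Quot I\<^esub> ?\<psi> y" "?\<psi> (x * y) = ?\<psi> x \<otimes>\<^bsub>R Quot I\<^esub> ?\<psi> y"
    "?\<psi> 1 = \<one>\<^bsub>R Quot I\<^esub>" for x y
    unfolding hom using ring_hom_memE[OF rh] cl by auto
  have \<psi>0: "?\<psi> 0 = \<zero>\<^bsub>R Quot I\<^esub>"
    using \<psi>(2)[of 0 0] \<psi>(1)[of 0] by (simp add: Q.add.l_cancel_one')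
  have neg: "\<ominus>\<^bsub>R Quot I\<^esub> ?\<psi> x = ?\<psi> (- x)" for x
  proof (rule Q.minus_equality)
    show "?\<psi> (- x) \<oplus>\<^bsub>R Quot I\<^esub> ?\<psi> x = \<zero>\<^bsub>R Quot I\<^esub>" using \<psi>(2)[of "- x" x] \<psi>0 by simp
  qed (rule \<psi>(1))+
  have "subring (range ?\<psi>) (R Quot I)"
  proof (rule Q.subringI)
    show "range ?\<psi> \<subseteq> carrier (R Quot I)" using \<psi>(1) by auto
    show "\<one>\<^bsub>R Quot I\<^esub> \<in> range ?\<psi>" unfolding \<psi>(4)[symmetric] by (rule rangeI)
  next
    fix a assume "a \<in> range ?\<psi>"
    then obtain x where "a = ?\<psi> x" by blast
    then show "\<ominus>\<^bsub>R Quot I\<^esub> a \<in> range ?\<psi>" unfolding neg by (simp only: neg) (rule rangeI)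
  next
    fix a b assume "a \<in> range ?\<psi>" "b \<in> range ?\<psi>"
    then obtain x y where ab: "a = ?\<psi> x" "b = ?\<psi> y" by blast
    show "a \<otimes>\<^bsub>R Quot I\<^esub> b \<in> range ?\<psi>" by (rule range_eqI[of _ _ "x * y"]) (simp only: ab \<psi>(3))
    show "a \<oplus>\<^bsub>R Quot I\<^esub> b \<in> range ?\<psi>" by (rule range_eqI[of _ _ "x + y"]) (simp only: ab \<psi>(2))
  qed
  then interpret S: ring "(R Quot I)\<lparr>carrier := range ?\<psi>\<rparr>" by (rule Q.subring_is_ring)
  show ?thesis
  proof unfold_locales
    show "?\<psi> x = \<zero>\<^bsub>(R Quot I)\<lparr>carrier := range ?\<psi>\<rparr>\<^esub> \<longleftrightarrow> x \<in> {x. \<phi> x \<in> I}" for x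
      using R.a_coset_join1[OF _ cl I.a_subgroup, of x] R.a_coset_join2[OF cl I.a_subgroup, of x]
      by (auto simp: FactRing_def)
  qed (simp_all add: \<psi>(2-4))
qed

text \<open>The C*-identity passes to suprema because squaring is monotone on nonnegative
  reals.\<close>

lemma cstar_seminorm_Sup:
  assumes ne: "P \<noteq> {}" and cs: "\<And>p. p \<in> P \<Longrightarrow> cstar_seminorm p" and bd: "\<And>x. \<exists>B. \<forall>p\<in>P. p x \<le> B"
  shows "cstar_seminorm (\<lambda>x. SUP p\<in>P. p x)"
proof -
  let ?N = "\<lambda>x. SUP p\<in>P. p x"
  have up: "p x \<le> ?N x" if "p \<in> P" for p x
  proof -
    obtain B where "\<forall>p\<in>P. p x \<le> B" using bd by blast
    then have "bdd_above ((\<lambda>p. p x) ` P)" by (intro bdd_aboveI2[of P _ B]) blast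
    then show ?thesis by (rule cSUP_upper[OF that])
  qed
  have least: "(\<And>p. p \<in> P \<Longrightarrow> p x \<le> B) \<Longrightarrow> ?N x \<le> B" for x B
    using ne by (intro cSUP_least) auto
  obtain p0 where p0: "p0 \<in> P" using ne by blast
  have nn: "0 \<le> p x" if "p \<in> P" for p x using cs[OF that] by (simp add: cstar_seminorm_def)
  have N0: "0 \<le> ?N x" for x using up[OF p0, of x] nn[OF p0, of x] by linarith
  have scal_le: "?N (scal c * x) \<le> cmod c * ?N x" for c x
  proof (rule least)
    fix p assume p: "p \<in> P"
    have "p (scal c * x) = cmod c * p x" using cs[OF p] by (simp add: cstar_seminorm_def)
    then show "p (scal c * x) \<le> cmod c * ?N x" using mult_left_mono[OF up[OF p, of x], of "cmod c"] by simp
  qed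
  have scal: "?N (scal c * x) = cmod c * ?N x" for c x
  proof (cases "c = 0")
    case True
    then show ?thesis using scal_le[of c x] N0[of "scal c * x"] by simp
  next
    case False
    have "?N x = ?N (scal (1 / c) * (scal c * x))" using False by (simp add: scal_scal)
    also have "\<dots> \<le> cmod (1 / c) * ?N (scal c * x)" by (rule scal_le)
    finally show ?thesis using False scal_le[of c x] by (simp add: norm_divide field_simps)
  qed
  have add: "?N (x + y) \<le> ?N x + ?N y" for x y
  proof (rule least)
    fix p assume p: "p \<in> P"
    have "p (x + y) \<le> p x + p y" using cs[OF p] by (simp add: cstar_seminorm_def)
    then show "p (x + y) \<le> ?N x + ?N y" using up[OF p, of x] up[OF p, of y] by linarith
  qed
  have mult: "?N (x * y) \<le> ?N x * ?N y" for x y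
  proof (rule least)
    fix p assume p: "p \<in> P"
    have "p (x * y) \<le> p x * p y" using cs[OF p] by (simp add: cstar_seminorm_def)
    also have "\<dots> \<le> ?N x * ?N y" by (intro mult_mono up[OF p] nn[OF p] N0)
    finally show "p (x * y) \<le> ?N x * ?N y" .
  qed
  have "?N (star x * x) = (?N x)\<^sup>2" for x
  proof (rule antisym)
    have sq: "p (star x * x) = (p x)\<^sup>2" if "p \<in> P" for p using cs[OF that] by (simp add: cstar_seminorm_def)
    show "?N (star x * x) \<le> (?N x)\<^sup>2"
      by (rule least) (simp add: sq power_mono up nn)
    have "?N x \<le> sqrt (?N (star x * x))"
    proof (rule least)
      fix p assume p: "p \<in> P"
      show "p x \<le> sqrt (?N (star x * x))" using up[OF p, of "star x * x"] sq[OF p] by (simp add: real_le_rsqrt)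
    qed
    then have "(?N x)\<^sup>2 \<le> (sqrt (?N (star x * x)))\<^sup>2" using N0 by (intro power_mono)
    then show "(?N x)\<^sup>2 \<le> ?N (star x * x)" using N0 by simp
  qed
  then show ?thesis using N0 scal add mult unfolding cstar_seminorm_def by blast
qed

text \<open>Uniform bounds on generators propagate to all elements, so the supremum that defines the
  universal seminorm is finite.\<close>

locale universal_cstar =
  fixes S :: "'g starred free_alg set"
  assumes gens_bounded: "\<exists>B. \<forall>p. cstar_seminorm p \<longrightarrow> (\<forall>r\<in>S. p r = 0) \<longrightarrow> p (gen g) \<le> B"
begin

lemma seminorms_bounded: "\<exists>B. \<forall>p\<in>{p. cstar_seminorm p \<and> (\<forall>r\<in>S. p r = 0)}. p x \<le> B"
proof (induction x rule: free_alg_induct)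
  case (scal_mon c w)
  have "\<exists>B\<ge>0. \<forall>p\<in>{p. cstar_seminorm p \<and> (\<forall>r\<in>S. p r = 0)}. p (mon w) \<le> B"
  proof (induction w)
    case Nil
    have "p 1 \<le> 1" if "cstar_seminorm p" for p :: "'g starred free_alg \<Rightarrow> real"
      by (rule cstar.p_1) (unfold_locales, rule that)
    then show ?case by (intro exI[of _ 1]) auto
  next
    case (Cons g w)
    obtain B where B: "\<And>p. cstar_seminorm p \<Longrightarrow> \<forall>r\<in>S. p r = 0 \<Longrightarrow> p (gen g) \<le> B"
      using gens_bounded[of g] by blast
    obtain C where C: "0 \<le> C" "\<And>p. cstar_seminorm p \<Longrightarrow> \<forall>r\<in>S. p r = 0 \<Longrightarrow> p (mon w) \<le> C"
      using Cons by blast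
    have "p (mon (g # w)) \<le> max 0 B * C" if p: "cstar_seminorm p" "\<forall>r\<in>S. p r = 0" for p
    proof -
      have "p (mon (g # w)) \<le> p (gen g) * p (mon w)" unfolding mon_Cons using p by (simp add: cstar_seminorm_def)
      also have "\<dots> \<le> max 0 B * C"
        using B[OF p] C(2)[OF p] p by (intro mult_mono) (auto simp: cstar_seminorm_def)
      finally show ?thesis .
    qed
    then show ?case using C(1) by (intro exI[of _ "max 0 B * C"]) auto
  qed
  then obtain B where "\<And>p. cstar_seminorm p \<Longrightarrow> \<forall>r\<in>S. p r = 0 \<Longrightarrow> p (mon w) \<le> B" by blast
  then show ?case
    by (intro exI[of _ "cmod c * B"]) (auto simp: cstar_seminorm_def intro: mult_left_mono)
next
  case (add x y)
  then obtain B C where BC: "\<And>p. cstar_seminorm p \<Longrightarrow> \<forall>r\<in>S. p r = 0 \<Longrightarrow> p x \<le> B"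
    "\<And>p. cstar_seminorm p \<Longrightarrow> \<forall>r\<in>S. p r = 0 \<Longrightarrow> p y \<le> C" by blast
  have "p (x + y) \<le> B + C" if p: "cstar_seminorm p" "\<forall>r\<in>S. p r = 0" for p
  proof -
    have "p (x + y) \<le> p x + p y" using p(1) by (simp add: cstar_seminorm_def)
    then show ?thesis using BC[OF p] by linarith
  qed
  then show ?case by blast
qed

abbreviation N :: "'g starred free_alg \<Rightarrow> real" where "N \<equiv> univ_seminorm S"

sublocale cstar N
proof
  have "(\<lambda>_. 0) \<in> {p. cstar_seminorm p \<and> (\<forall>r\<in>S. p r = (0 :: real))}" by (simp add: cstar_seminorm_def)
  then show "cstar_seminorm N"
    unfolding univ_seminorm_def[abs_def] using seminorms_bounded
    by (intro cstar_seminorm_Sup) (simp_all only: mem_Collect_eq, blast+)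
qed

lemma seminorm_le: "cstar_seminorm p \<Longrightarrow> (\<And>r. r \<in> S \<Longrightarrow> p r = 0) \<Longrightarrow> p x \<le> N x"
proof -
  assume p: "cstar_seminorm p" "\<And>r. r \<in> S \<Longrightarrow> p r = 0"
  let ?P = "{p. cstar_seminorm p \<and> (\<forall>r\<in>S. p r = 0)}"
  obtain B where "\<forall>p\<in>?P. p x \<le> B" using seminorms_bounded by blast
  then have "bdd_above ((\<lambda>p. p x) ` ?P)" by (intro bdd_aboveI2[of ?P _ B]) blast
  moreover have "p \<in> ?P" using p by blast
  ultimately show "p x \<le> N x" unfolding univ_seminorm_def by (rule cSUP_upper[rotated])
qed

lemma N_ideal: "x \<in> ideal_of S \<Longrightarrow> N x = 0"
proof -
  assume x: "x \<in> ideal_of S"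
  have zero: "p x = 0" if p: "cstar_seminorm p" "\<forall>r\<in>S. p r = 0" for p
  proof -
    interpret p: cstar p by unfold_locales (rule p)
    have "two_sided {x. p x = 0}"
      unfolding two_sided_def
    proof (intro conjI ballI allI; unfold mem_Collect_eq)
      show "p (a + b) = 0" if "p a = 0" "p b = 0" for a b using p.p_triangle[of a b] that p.p_nonneg[of "a + b"] by linarith
      show "p (b * a) = 0" if "p a = 0" for a b using p.p_mult[of b a] that p.p_nonneg[of "b * a"] by simp
      show "p (a * b) = 0" if "p a = 0" for a b using p.p_mult[of a b] that p.p_nonneg[of "a * b"] by simp
    qed simp
    from ideal_of_minimal[OF this, of S] show ?thesis using p x by blast
  qed
  have ne: "{p. cstar_seminorm p \<and> (\<forall>r\<in>S. p r = (0 :: real))} \<noteq> {}"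
    by (auto simp: cstar_seminorm_def intro!: exI[of _ "\<lambda>_. 0"])
  have "N x \<le> 0"
    unfolding univ_seminorm_def
  proof (rule cSUP_least[OF ne])
    fix p assume "p \<in> {p. cstar_seminorm p \<and> (\<forall>r\<in>S. p r = (0 :: real))}"
    then show "p x \<le> 0" using zero[of p] by simp
  qed
  then show "N x = 0" using p_nonneg[of x] by linarith
qed

abbreviation C :: "(nat \<Rightarrow> 'g starred free_alg) ring" where "C \<equiv> cauchy_ring S"

lemma cauchy_carrier: "s \<in> carrier C \<longleftrightarrow> (\<forall>e>0. \<exists>M. \<forall>k\<ge>M. \<forall>l\<ge>M. N (s k - s l) < e)"
  by (simp add: cauchy_ring_def)

lemma cauchy_ops [simp]: "s \<oplus>\<^bsub>C\<^esub> t = (\<lambda>k. s k + t k)" "s \<otimes>\<^bsub>C\<^esub> t = (\<lambda>k. s k * t k)" "\<one>\<^bsub>C\<^esub> = (\<lambda>_. 1)" "\<zero>\<^bsub>C\<^esub> = (\<lambda>_. 0)"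
  by (simp_all add: cauchy_ring_def)

lemma cauchy_const [simp]: "(\<lambda>_. x) \<in> carrier C"
  by (simp add: cauchy_carrier)

lemma cauchy_add: "s \<in> carrier C \<Longrightarrow> t \<in> carrier C \<Longrightarrow> (\<lambda>k. s k + t k) \<in> carrier C"
  unfolding cauchy_carrier
proof (intro allI impI)
  fix e :: real assume s: "\<forall>e>0. \<exists>M. \<forall>k\<ge>M. \<forall>l\<ge>M. N (s k - s l) < e" and t: "\<forall>e>0. \<exists>M. \<forall>k\<ge>M. \<forall>l\<ge>M. N (t k - t l) < e" and e: "0 < e"
  obtain M M' where M: "\<forall>k\<ge>M. \<forall>l\<ge>M. N (s k - s l) < e / 2" "\<forall>k\<ge>M'. \<forall>l\<ge>M'. N (t k - t l) < e / 2"
    using s[rule_format, of "e / 2"] t[rule_format, of "e / 2"] e by auto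
  show "\<exists>M. \<forall>k\<ge>M. \<forall>l\<ge>M. N (s k + t k - (s l + t l)) < e"
  proof (intro exI[of _ "max M M'"] allI impI)
    fix k l assume "max M M' \<le> k" "max M M' \<le> l"
    then have "N (s k - s l) < e / 2" "N (t k - t l) < e / 2" using M by auto
    moreover have eq: "s k + t k - (s l + t l) = (s k - s l) + (t k - t l)" by simp
    ultimately show "N (s k + t k - (s l + t l)) < e"
      unfolding eq using p_triangle[of "s k - s l" "t k - t l"] by linarith
  qed
qed

lemma cauchy_bounded: "s \<in> carrier C \<Longrightarrow> \<exists>B>0. \<exists>M. \<forall>k\<ge>M. N (s k) \<le> B"
proof -
  assume "s \<in> carrier C"
  then obtain M where M: "\<forall>k\<ge>M. \<forall>l\<ge>M. N (s k - s l) < 1" unfolding cauchy_carrier by (meson zero_less_one)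
  have "N (s k) \<le> N (s M) + 1" if "M \<le> k" for k
  proof -
    have "N (s k - s M) < 1" using M that by blast
    then show ?thesis using p_triangle[of "s M" "s k - s M"] by simp
  qed
  moreover have "0 < N (s M) + 1" by (simp add: add_nonneg_pos)
  ultimately show ?thesis by blast
qed

lemma cauchy_mult:
  assumes s: "s \<in> carrier C" and t: "t \<in> carrier C"
  shows "(\<lambda>k. s k * t k) \<in> carrier C"
  unfolding cauchy_carrier
proof (intro allI impI)
  fix e :: real assume e: "0 < e"
  obtain B M1 where B: "0 < B" "\<forall>k\<ge>M1. N (s k) \<le> B" using cauchy_bounded[OF s] by blast
  obtain B' M2 where B': "0 < B'" "\<forall>k\<ge>M2. N (t k) \<le> B'" using cauchy_bounded[OF t] by blast
  obtain M3 where M3: "\<forall>k\<ge>M3. \<forall>l\<ge>M3. N (s k - s l) < e / (2 * B')"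
    using s[unfolded cauchy_carrier, rule_format, of "e / (2 * B')"] e B' by auto
  obtain M4 where M4: "\<forall>k\<ge>M4. \<forall>l\<ge>M4. N (t k - t l) < e / (2 * B)"
    using t[unfolded cauchy_carrier, rule_format, of "e / (2 * B)"] e B by auto
  show "\<exists>M. \<forall>k\<ge>M. \<forall>l\<ge>M. N (s k * t k - s l * t l) < e"
  proof (intro exI[of _ "M1 + M2 + M3 + M4"] allI impI)
    fix k l assume "M1 + M2 + M3 + M4 \<le> k" "M1 + M2 + M3 + M4 \<le> l"
    then have b: "N (s k) \<le> B" "N (t l) \<le> B'" "N (s k - s l) < e / (2 * B')" "N (t k - t l) < e / (2 * B)"
      using B(2) B'(2) M3 M4 by auto
    have "s k * t k - s l * t l = s k * (t k - t l) + (s k - s l) * t l" by (simp add: algebra_simps)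
    then have "N (s k * t k - s l * t l) \<le> N (s k) * N (t k - t l) + N (s k - s l) * N (t l)"
      using p_triangle[of "s k * (t k - t l)" "(s k - s l) * t l"] p_mult[of "s k" "t k - t l"] p_mult[of "s k - s l" "t l"] by simp
    also have "\<dots> \<le> B * N (t k - t l) + N (s k - s l) * B'"
      using b by (intro add_mono mult_right_mono mult_left_mono) auto
    also have "\<dots> < B * (e / (2 * B)) + e / (2 * B') * B'"
      using b B B' by (intro add_strict_mono mult_strict_left_mono mult_strict_right_mono) auto
    also have "\<dots> = e" using B B' by simp
    finally show "N (s k * t k - s l * t l) < e" .
  qed
qed

lemma cauchy_uminus: "s \<in> carrier C \<Longrightarrow> (\<lambda>k. - s k) \<in> carrier C"
  using cauchy_mult[OF cauchy_const[of "- 1"], of s] by simp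

lemma ring_cauchy: "ring C"
proof (rule ringI)
  show "abelian_group C"
  proof (rule abelian_groupI)
    fix s assume "s \<in> carrier C"
    then show "\<exists>t\<in>carrier C. t \<oplus>\<^bsub>C\<^esub> s = \<zero>\<^bsub>C\<^esub>" by (intro bexI[of _ "\<lambda>k. - s k"]) (auto intro: cauchy_uminus)
  qed (auto intro: cauchy_add simp: algebra_simps)
  show "monoid C" by unfold_locales (auto intro: cauchy_mult simp: mult.assoc)
qed (auto simp: algebra_simps)

lemma null_iff: "s \<in> null_ideal S \<longleftrightarrow> (\<lambda>k. N (s k)) \<longlonglongrightarrow> 0"
  by (simp add: null_ideal_def)

lemma null_0: "(\<lambda>_. 0) \<in> null_ideal S"
  by (simp add: null_iff)

lemma null_mult:
  assumes s: "s \<in> null_ideal S" and t: "t \<in> carrier C"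
  shows "(\<lambda>k. t k * s k) \<in> null_ideal S" "(\<lambda>k. s k * t k) \<in> null_ideal S"
proof -
  obtain B M where B: "0 < B" "\<forall>k\<ge>M. N (t k) \<le> B" using cauchy_bounded[OF t] by blast
  have lim: "(\<lambda>k. B * N (s k)) \<longlonglongrightarrow> 0" using tendsto_mult_left[OF s[unfolded null_iff], of B] by simp
  have le: "N (t k * s k) \<le> B * N (s k)" "N (s k * t k) \<le> B * N (s k)" if "M \<le> k" for k
  proof -
    have "N (t k) * N (s k) \<le> B * N (s k)" using B that by (intro mult_right_mono) auto
    then show "N (t k * s k) \<le> B * N (s k)" "N (s k * t k) \<le> B * N (s k)"
      using p_mult[of "t k" "s k"] p_mult[of "s k" "t k"] by (auto simp: mult.commute)
  qed
  show "(\<lambda>k. t k * s k) \<in> null_ideal S" "(\<lambda>k. s k * t k) \<in> null_ideal S"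
    unfolding null_iff
    by (rule tendsto_sandwich[OF _ _ tendsto_const lim]; auto simp: eventually_sequentially intro!: exI[of _ M] le)+
qed

lemma null_add: "s \<in> null_ideal S \<Longrightarrow> t \<in> null_ideal S \<Longrightarrow> (\<lambda>k. s k + t k) \<in> null_ideal S"
  unfolding null_iff
proof -
  assume "(\<lambda>k. N (s k)) \<longlonglongrightarrow> 0" "(\<lambda>k. N (t k)) \<longlonglongrightarrow> 0"
  from tendsto_add[OF this] have lim: "(\<lambda>k. N (s k) + N (t k)) \<longlonglongrightarrow> 0" by simp
  show "(\<lambda>k. N (s k + t k)) \<longlonglongrightarrow> 0"
    by (rule tendsto_sandwich[OF _ _ tendsto_const lim]) (simp_all add: p_triangle)
qed

lemma null_cauchy: "s \<in> null_ideal S \<Longrightarrow> s \<in> carrier C"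
  unfolding cauchy_carrier
proof (intro allI impI)
  fix e :: real assume s: "s \<in> null_ideal S" and e: "0 < e"
  then obtain M where M: "\<forall>k\<ge>M. N (s k) < e / 2"
    using LIMSEQ_D[of "\<lambda>k. N (s k)" 0 "e / 2"] by (auto simp: null_iff)
  show "\<exists>M. \<forall>k\<ge>M. \<forall>l\<ge>M. N (s k - s l) < e"
  proof (intro exI[of _ M] allI impI)
    fix k l assume "M \<le> k" "M \<le> l"
    then have "N (s k) < e / 2" "N (s l) < e / 2" using M by auto
    then show "N (s k - s l) < e" using p_diff[of "s k" "s l"] by linarith
  qed
qed

lemma ideal_null: "ideal (null_ideal S) C"
proof (rule idealI[OF ring_cauchy])
  interpret C: ring C by (rule ring_cauchy)
  show "subgroup (null_ideal S) (add_monoid C)"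
  proof (rule group.subgroupI[OF C.a_group])
    show "null_ideal S \<subseteq> carrier (add_monoid C)" using null_cauchy by auto
    show "null_ideal S \<noteq> {}" using null_0 by blast
    fix s assume s: "s \<in> null_ideal S"
    have "inv\<^bsub>add_monoid C\<^esub> s = (\<lambda>k. - s k)"
      unfolding a_inv_def[symmetric]
      by (rule C.minus_equality) (use null_cauchy[OF s] in \<open>auto intro: cauchy_uminus\<close>)
    moreover have "(\<lambda>k. - s k) \<in> null_ideal S" using s by (simp add: null_iff)
    ultimately show "inv\<^bsub>add_monoid C\<^esub> s \<in> null_ideal S" by simp
    fix t assume "t \<in> null_ideal S"
    then show "s \<otimes>\<^bsub>add_monoid C\<^esub> t \<in> null_ideal S" using null_add[OF s] by simp
  qed
qed (simp_all add: null_mult)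

lemma const_class_eq: "const_class S x = {\<lambda>k. s k + x |s. s \<in> null_ideal S}"
  by (auto simp: const_class_def a_r_coset_def r_coset_def)

text \<open>Constant sequences embed the free algebra in the Cauchy ring; such a sequence is null
  when its seminorm is zero.\<close>

lemma const_quotient_map:
  "quotient_map ((univ_cstar S)\<lparr>carrier := range (const_class S)\<rparr>) (const_class S) {x. N x = 0}"
proof -
  have "{x. (\<lambda>_. x) \<in> null_ideal S} = {x. N x = 0}" by (auto simp: null_iff LIMSEQ_const_iff)
  moreover have "quotient_map ((C Quot null_ideal S)\<lparr>carrier := range (\<lambda>x. null_ideal S +>\<^bsub>C\<^esub> (\<lambda>_. x))\<rparr>)
      (\<lambda>x. null_ideal S +>\<^bsub>C\<^esub> (\<lambda>_. x)) {x. (\<lambda>_. x) \<in> null_ideal S}"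
    by (rule coset_quotient_map[OF ring_cauchy ideal_null]) simp_all
  ultimately show ?thesis by (simp add: univ_cstar_def const_class_def[abs_def])
qed

lemma class_star_const: "class_star (const_class S x) = const_class S (star x)"
proof -
  have sub: "class_star (const_class S x) \<subseteq> const_class S (star x)" for x
  proof
    fix a assume "a \<in> class_star (const_class S x)"
    then obtain s where s: "s \<in> null_ideal S" "a = (\<lambda>k. star (s k) + star x)"
      by (auto simp: class_star_def const_class_eq star_add)
    have "(\<lambda>k. star (s k)) \<in> null_ideal S" using s(1) by (simp add: null_iff)
    then show "a \<in> const_class S (star x)"
      unfolding const_class_eq s(2) by (intro CollectI exI[of _ "\<lambda>k. star (s k)"] conjI refl)
  qed
  have "const_class S (star x) = class_star (class_star (const_class S (star x)))"
    by (simp add: class_star_def image_image)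
  also have "\<dots> \<subseteq> class_star (const_class S (star (star x)))"
    unfolding class_star_def[of "class_star _"] class_star_def[of "const_class S (star (star x))"]
    by (rule image_mono[OF sub])
  finally show ?thesis using sub[of x] by auto
qed

text \<open>The classes of constant sequences are closed under all operations, including the star,
  and are generated by the classes of the generators.\<close>

lemma star_subalgebra_eq:
  assumes G: "G \<subseteq> range (const_class S)" and gens: "\<And>g. const_class S (gen g) \<in> star_subalgebra_generated S G"
  shows "star_subalgebra_generated S G = range (const_class S)"
proof -
  interpret Q: quotient_map "(univ_cstar S)\<lparr>carrier := range (const_class S)\<rparr>" "const_class S" "{x. N x = 0}"
    by (rule const_quotient_map)
  have hom: "const_class S x \<oplus>\<^bsub>univ_cstar S\<^esub> const_class S y = const_class S (x + y)"
    "const_class S x \<otimes>\<^bsub>univ_cstar S\<^esub> const_class S y = const_class S (x * y)" for x y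
    by (simp_all add: Q.map_add Q.map_mult)
  show ?thesis
  proof
    show "star_subalgebra_generated S G \<subseteq> range (const_class S)"
    proof
      fix a assume "a \<in> star_subalgebra_generated S G"
      then show "a \<in> range (const_class S)"
      proof induction
        case (base a)
        then show ?case using G by blast
      next
        case (add a b)
        then obtain x y where "a = const_class S x" "b = const_class S y" by blast
        then show ?case by (simp only: hom rangeI)
      next
        case (mult a b)
        then obtain x y where "a = const_class S x" "b = const_class S y" by blast
        then show ?case by (simp only: hom rangeI)
      next
        case (star a)
        then obtain x where "a = const_class S x" by blast
        then show ?case by (simp only: class_star_const rangeI)
      qed simp
    qed
    have "const_class S x \<in> star_subalgebra_generated S G" for x
    proof (induction x rule: free_alg_induct)
      case (scal_mon c w)
      have "const_class S (mon w) \<in> star_subalgebra_generated S G"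
      proof (induction w)
        case Nil
        show ?case using star_subalgebra_generated.scalar[of S 1 G] by simp
      next
        case (Cons g w)
        then show ?case unfolding mon_Cons hom(2)[symmetric] by (intro star_subalgebra_generated.mult gens)
      qed
      then show ?case
        unfolding hom(2)[symmetric] by (intro star_subalgebra_generated.mult star_subalgebra_generated.scalar)
    next
      case (add x y)
      then show ?case unfolding hom(1)[symmetric] by (rule star_subalgebra_generated.add)
    qed
    then show "range (const_class S) \<subseteq> star_subalgebra_generated S G" by blast
  qed
qed

text \<open>A character compatible with the star has a modulus that is a C*-seminorm, so it is
  dominated by the universal one and sends null sequences to 0. All representatives of a class thus
  have the same limit.\<close>

lemma character_limit:
  assumes char: "\<And>g. \<phi> (flip g) = cnj (\<phi> g)" and S: "\<And>r. r \<in> S \<Longrightarrow> character_of \<phi> r = 0"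
  shows "the_elem ((\<lambda>s. lim (\<lambda>k. character_of \<phi> (s k))) ` const_class S x) = character_of \<phi> x"
proof -
  have star: "character_of \<phi> (star y) = cnj (character_of \<phi> y)" for y
  proof (induction y rule: free_alg_induct)
    case (scal_mon c w)
    have "character_of \<phi> (mon (rev (map flip w))) = cnj (character_of \<phi> (mon w))"
      by (induction w) (simp_all add: mon_append mon_Cons character_of_mult char)
    then show ?case by (simp add: star_scal_mon character_of_mult)
  qed (simp add: star_add character_of_add)
  have "cstar_seminorm (\<lambda>y. cmod (character_of \<phi> y))"
    unfolding cstar_seminorm_def
    by (simp add: character_of_add character_of_mult norm_triangle_ineq norm_mult star power2_eq_square)
  then have le: "cmod (character_of \<phi> y) \<le> N y" for y
    using seminorm_le[of "\<lambda>y. cmod (character_of \<phi> y)"] S by simp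
  have "lim (\<lambda>k. character_of \<phi> (s k + x)) = character_of \<phi> x" if s: "s \<in> null_ideal S" for s
  proof (rule limI)
    have "(\<lambda>k. character_of \<phi> (s k)) \<longlonglongrightarrow> 0"
      using s unfolding null_iff by (rule Lim_null_comparison[rotated]) (simp add: le)
    from tendsto_add[OF this tendsto_const[of "character_of \<phi> x"]]
    show "(\<lambda>k. character_of \<phi> (s k + x)) \<longlonglongrightarrow> character_of \<phi> x" by (simp add: character_of_add)
  qed
  then have "(\<lambda>s. lim (\<lambda>k. character_of \<phi> (s k + x))) ` null_ideal S = (\<lambda>s. character_of \<phi> x) ` null_ideal S"
    by (rule image_cong[OF refl])
  also have "\<dots> = {character_of \<phi> x}" by (rule image_constant[OF null_0])
  moreover have "const_class S x = (\<lambda>s k. s k + x) ` null_ideal S" unfolding const_class_eq by blast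
  ultimately show ?thesis by (simp add: image_image)
qed

end

section \<open>Unitary diagonalization of positive definite matrices\<close>

section \<open>Unitary diagonalization of positive matrices\<close>

definition adjm :: "complex^'n^'m \<Rightarrow> complex^'m^'n"
  where "adjm A = (\<chi> i j. cnj (A $ j $ i))"

lemma adjm_mult: "adjm (A ** B) = adjm B ** adjm A" for A B :: "complex^'n^'n"
  by (simp add: adjm_def matrix_matrix_mult_def vec_eq_iff mult.commute)

lemma adjm_1 [simp]: "adjm (mat 1) = mat 1"
  by (auto simp: adjm_def mat_def vec_eq_iff)

definition cip :: "complex^'n \<Rightarrow> complex^'n \<Rightarrow> complex"
  where "cip x y = (\<Sum>i\<in>UNIV. x $ i * cnj (y $ i))"

lemma cip_simps: "cip 0 y = 0" "cip (x + z) y = cip x y + cip z y" "cip (c *s x) y = c * cip x y" "cip x (c *s y) = cnj c * cip x y"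
  by (simp_all add: cip_def algebra_simps sum.distrib sum_distrib_left)

lemma cip_cnj: "cnj (cip x y) = cip y x"
  by (simp add: cip_def mult.commute)

lemma cip_self: "x \<noteq> 0 \<Longrightarrow> \<exists>r>0. cip x x = of_real r"
proof -
  assume "x \<noteq> 0"
  then obtain i where i: "x $ i \<noteq> 0" by (auto simp: vec_eq_iff)
  have "0 < (cmod (x $ i))\<^sup>2" using i by simp
  also have "\<dots> \<le> (\<Sum>i\<in>UNIV. (cmod (x $ i))\<^sup>2)" by (rule member_le_sum) auto
  finally have "0 < (\<Sum>i\<in>UNIV. (cmod (x $ i))\<^sup>2)" .
  moreover have "cip x x = of_real (\<Sum>i\<in>UNIV. (cmod (x $ i))\<^sup>2)"
    by (simp add: cip_def complex_norm_square del: of_real_power)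
  ultimately show ?thesis by blast
qed

lemma cip_adjm: "cip (A *v x) y = cip x (adjm A *v y)" for A :: "complex^'n^'n"
  unfolding cip_def matrix_vector_mult_def adjm_def
  by (simp add: sum_distrib_left sum_distrib_right mult_ac) (rule sum.swap)

text \<open>Put the conjugates of the vectors e b into the rows of a square matrix. Row a is zero,
  so the matrix is singular and has a kernel.\<close>

lemma orthogonal_vector_exists:
  fixes e :: "'n::finite \<Rightarrow> complex^'n"
  assumes "a \<notin> A"
  shows "\<exists>x. x \<noteq> 0 \<and> (\<forall>b\<in>A. cip x (e b) = 0)"
proof -
  define M :: "complex^'n^'n" where "M = (\<chi> i j. if i \<in> A then cnj (e i $ j) else 0)"
  have "\<not> (\<forall>x. M *v x = 0 \<longrightarrow> x = 0)"
  proof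
    assume "\<forall>x. M *v x = 0 \<longrightarrow> x = 0"
    then obtain B where "B ** M = mat 1" using matrix_left_invertible_ker[of M] by blast
    then have "M ** B = mat 1" by (simp add: matrix_left_right_inverse)
    then have "(M ** B) $ a $ a = 1" by (simp add: mat_def)
    then show False using assms by (simp add: matrix_matrix_mult_def M_def)
  qed
  then obtain x where x: "M *v x = 0" "x \<noteq> 0" by blast
  have "cip x (e b) = 0" if "b \<in> A" for b
  proof -
    have "(M *v x) $ b = cip x (e b)" using that by (simp add: matrix_vector_mult_def M_def cip_def mult.commute)
    then show ?thesis using x(1) by simp
  qed
  then show ?thesis using x(2) by blast
qed

text \<open>Induction on the index set: the orthogonal complement of the eigenvectors found so far
  is invariant under the self-adjoint F, so it contains another one.\<close>

lemma orthonormal_eigenvectors: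
  fixes L :: "complex^'n^'n" and A :: "'n set"
  assumes L: "invertible L"
  defines "F \<equiv> L ** adjm L"
  shows "\<exists>e l. (\<forall>a\<in>A. \<forall>b\<in>A. cip (e a) (e b) = (if a = b then 1 else 0)) \<and> (\<forall>a\<in>A. F *v e a = complex_of_real (l a) *s e a \<and> 0 < l a)"
proof (induction A rule: finite_induct[OF finite])
  case 1
  show ?case by simp
next
  case (2 a A)
  then obtain e l where e: "\<And>a b. a \<in> A \<Longrightarrow> b \<in> A \<Longrightarrow> cip (e a) (e b) = (if a = b then 1 else 0)"
    "\<And>a. a \<in> A \<Longrightarrow> F *v e a = complex_of_real (l a) *s e a" "\<And>a. a \<in> A \<Longrightarrow> 0 < l a" by blast
  have FL: "cip (F *v y) z = cip (adjm L *v y) (adjm L *v z)" for y z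
    unfolding F_def matrix_vector_mul_assoc[symmetric] by (rule cip_adjm)
  have Fs: "cip (F *v y) z = cip y (F *v z)" for y z
    unfolding FL by (metis FL cip_cnj)
  define S where "S = {y. \<forall>b\<in>A. cip y (e b) = 0}"
  have "vec.subspace S" unfolding vec.subspace_def by (simp add: S_def cip_simps)
  moreover have "F *v y \<in> S" if "y \<in> S" for y
    using that e(2) by (simp add: S_def Fs cip_simps)
  moreover obtain x where "x \<in> S" "x \<noteq> 0" using orthogonal_vector_exists[OF 2(2), of e] by (auto simp: S_def)
  ultimately obtain y c where y: "y \<in> S" "y \<noteq> 0" "F *v y = c *s y" using eigenvector_exists[of x S F] by blast
  obtain r where r: "0 < r" "cip y y = of_real r" using cip_self[OF y(2)] by blast
  \<comment> \<open>The eigenvalue is the quotient of the squared norms of adjm L y and y, hence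
    positive.\<close>
  have "adjm L *v y \<noteq> 0"
  proof
    assume 0: "adjm L *v y = 0"
    obtain L' where "L ** L' = mat 1" using L by (auto simp: invertible_def)
    then have "adjm L' ** adjm L = mat 1" by (simp flip: adjm_mult)
    then have "y = adjm L' *v (adjm L *v y)" by (simp add: matrix_vector_mul_assoc)
    then show False using 0 y(2) by simp
  qed
  then obtain q where q: "0 < q" "cip (adjm L *v y) (adjm L *v y) = of_real q" using cip_self by blast
  have "c * of_real r = of_real q" using FL[of y y] q(2) r(2) by (simp add: y(3) cip_simps)
  then have c: "c = of_real (q / r)" using r(1) by (simp add: field_simps)
  define z where "z = complex_of_real (1 / sqrt r) *s y"
  have zz: "cip z z = 1"
    using r(1) by (simp add: z_def cip_simps r(2) flip: of_real_mult of_real_divide)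
  have ze: "cip z (e b) = 0" "cip (e b) z = 0" if "b \<in> A" for b
  proof -
    show "cip z (e b) = 0" using y(1) that by (simp add: z_def cip_simps S_def)
    then show "cip (e b) z = 0" by (metis cip_cnj complex_cnj_zero)
  qed
  have Fz: "F *v z = complex_of_real (q / r) *s z"
    unfolding z_def vec.linear_scale[OF matrix_vector_mul_linear_gen] y(3) c by (simp add: mult_ac)
  show ?case
    by (intro exI[of _ "e(a := z)"] exI[of _ "l(a := q / r)"])
       (use e zz ze Fz q(1) r(1) 2(2) in \<open>auto simp: fun_upd_def\<close>)
qed

definition diagm :: "('n \<Rightarrow> real) \<Rightarrow> complex^'n^'n"
  where "diagm f = (\<chi> i j. if i = j then of_real (f i) else 0)"

lemma spectral_theorem:
  fixes L :: "complex^'n^'n"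
  assumes L: "invertible L"
  obtains P :: "complex^'n^'n" and f where "P ** adjm P = mat 1" "adjm P ** P = mat 1" "P ** (L ** adjm L) ** adjm P = diagm f" "\<And>i. 0 < f i"
proof -
  obtain e :: "'n \<Rightarrow> complex^'n" and l where e: "\<And>a b. cip (e a) (e b) = (if a = b then 1 else 0)"
    "\<And>a. (L ** adjm L) *v e a = complex_of_real (l a) *s e a" "\<And>a. 0 < l a"
    using orthonormal_eigenvectors[OF L, of UNIV] by blast
  define P :: "complex^'n^'n" where "P = (\<chi> i j. cnj (e i $ j))"
  have "(P ** adjm P) $ i $ k = cip (e k) (e i)" for i k
    by (simp add: matrix_matrix_mult_def P_def adjm_def cip_def mult.commute)
  then have 1: "P ** adjm P = mat 1" by (auto simp: vec_eq_iff e(1) mat_def)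
  then have 2: "adjm P ** P = mat 1" by (simp add: matrix_left_right_inverse)
  have col: "((L ** adjm L) ** adjm P) $ j $ k = of_real (l k) * e k $ j" for j k
  proof -
    have "(M ** adjm P) $ j $ k = (M *v e k) $ j" for M :: "complex^'n^'n"
      by (simp add: matrix_matrix_mult_def matrix_vector_mult_def P_def adjm_def)
    then show ?thesis by (simp add: e(2))
  qed
  have "(P ** ((L ** adjm L) ** adjm P)) $ i $ k = of_real (l k) * cip (e k) (e i)" for i k
    by (simp add: matrix_matrix_mult_def[of P] col) (simp add: P_def cip_def sum_distrib_left mult_ac)
  then have "P ** (L ** adjm L) ** adjm P = diagm l"
    by (auto simp: vec_eq_iff e(1) diagm_def matrix_mul_assoc)
  then show thesis using that 1 2 e(3) by blast
qed


section \<open>The polynomial algebra of the free unitary quantum group as a cosovereign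
  algebra\<close>

section \<open>The relations of the free unitary quantum groups\<close>

abbreviation fu_u :: "(('n::finite \<times> 'n) starred free_alg)^'n^'n" where "fu_u \<equiv> free_unitary_u"

definition fu_v :: "(('n::finite \<times> 'n) starred free_alg)^'n^'n" where "fu_v = conj_mat free_unitary_u"

lemma fu_v_nth: "fu_v $ i $ j = gen (Adj (i, j))"
  by (simp add: fu_v_def conj_mat_def free_unitary_u_def)

lemma adj_mat_mult: "adj_mat (A ** B) = adj_mat B ** adj_mat A"
  for A B :: "('g starred free_alg)^'n^'n"
  by (simp add: adj_mat_def conj_mat_def transpose_def matrix_matrix_mult_def vec_eq_iff star_sum star_mult)

lemma adj_mat_scal: "adj_mat (scal_mat A) = scal_mat (adjm A)"
  by (simp add: adj_mat_def conj_mat_def transpose_def scal_mat_def adjm_def vec_eq_iff)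

lemma adj_mat_fu: "adj_mat fu_u = transpose fu_v" "adj_mat fu_v = transpose fu_u"
  by (simp_all add: adj_mat_def fu_v_def conj_mat_def transpose_def vec_eq_iff)

lemma rels_preimage:
  fixes u v :: "('g free_alg)^'n^'n"
  assumes "rels J F G (map_mat (subst \<sigma>) u) (map_mat (subst \<sigma>) v)"
  shows "rels {x. subst \<sigma> x \<in> J} F G u v"
proof -
  have "mcong {x. subst \<sigma> x \<in> J} A B" if "mcong J (map_mat (subst \<sigma>) A) (map_mat (subst \<sigma>) B)" for A B :: "('g free_alg)^'n^'n"
    using that by (simp add: mcong_def map_mat_def subst_diff)
  then show ?thesis using assms unfolding rels_def by (auto simp: map_mat_mult)
qed

lemma two_sided_preimage: "two_sided J \<Longrightarrow> two_sided {x. subst \<sigma> x \<in> J}"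
  by (auto simp: two_sided_def subst_add subst_mult)

lemma two_sided_character: "two_sided {x. character_of \<phi> x = 0}"
  by (auto simp: two_sided_def character_of_add character_of_mult)

lemma rels_character:
  fixes u v :: "('g free_alg)^'n^'n"
  assumes "map_mat (character_of \<phi>) u = mat 1" "map_mat (character_of \<phi>) v = mat 1"
  shows "rels {x. character_of \<phi> x = 0} F G u v"
proof -
  have c: "mcong {x. character_of \<phi> x = 0} A B" if "map_mat (character_of \<phi>) A = map_mat (character_of \<phi>) B" for A B :: "('g free_alg)^'n^'n"
    using that by (simp add: mcong_def map_mat_def character_of_diff vec_eq_iff)
  have t: "map_mat (character_of \<phi>) (transpose A) = transpose (map_mat (character_of \<phi>) A)" for A :: "('g free_alg)^'n^'n"
    by (simp add: map_mat_def transpose_def vec_eq_iff)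
  have o: "map_mat (character_of \<phi>) (mat 1 :: ('g free_alg)^'n^'n) = mat 1"
    by (auto simp: map_mat_def mat_def vec_eq_iff)
  show ?thesis unfolding rels_def by (intro conjI c) (simp_all add: map_mat_char_mult t assms o transpose_mat)
qed

text \<open>Unitarity of K v K^-1, multiplied out with scalar matrices, gives the cosovereign
  relations for F = K^-1 adjm(K^-1), whose inverse is adjm(K) K.\<close>

lemma free_unitary_rels_iff:
  fixes K :: "complex^'n^'n"
  assumes J: "two_sided J" and K: "invertible K"
  shows "free_unitary_relators K \<subseteq> J \<longleftrightarrow>
    rels J (matrix_inv K ** adjm (matrix_inv K)) (adjm K ** K) fu_u fu_v"
proof -
  let ?K = "matrix_inv K"
  note inv = matrix_inv_mult[OF K]
  have adj_inv: "adjm K ** adjm ?K = mat 1" "adjm ?K ** adjm K = mat 1"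
    using inv by (simp_all flip: adjm_mult)
  let ?k = "scal_mat K" and ?k' = "scal_mat ?K" and ?a = "scal_mat (adjm K)" and ?a' = "scal_mat (adjm ?K)"
  have cancel: "?k ** ?k' = mat 1" "?k' ** ?k = mat 1" "?a ** ?a' = mat 1" "?a' ** ?a = mat 1"
    using inv adj_inv by (simp_all flip: scal_mat_mult)
  have cancel': "W ** ?k ** ?k' = W" "W ** ?k' ** ?k = W" "W ** ?a ** ?a' = W" "W ** ?a' ** ?a = W"
    for W :: "(('n \<times> 'n) starred free_alg)^'n^'n"
    by (simp_all add: cancel flip: matrix_mul_assoc)
  let ?x = "?k ** fu_v ** ?k'"
  have adj_x: "adj_mat ?x = ?a' ** transpose fu_u ** ?a"
    by (simp add: adj_mat_mult adj_mat_scal adj_mat_fu matrix_mul_assoc)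
  have ent: "entries (A - B) \<subseteq> J \<longleftrightarrow> mcong J A B" for A B :: "(('n \<times> 'n) starred free_alg)^'n^'n"
    by (simp add: entries_subset_iff mcong_def)
  have F: "scal_mat (?K ** adjm ?K) = ?k' ** ?a'" and G: "scal_mat (adjm K ** K) = ?a ** ?k"
    by (simp_all add: scal_mat_mult)
  have 1: "mcong J (?x ** adj_mat ?x) (mat 1) \<longleftrightarrow> mcong J (fu_v ** scal_mat (?K ** adjm ?K) ** transpose fu_u) (scal_mat (?K ** adjm ?K))"
  proof
    assume "mcong J (?x ** adj_mat ?x) (mat 1)"
    from mcong_mult_right[OF J mcong_mult_left[OF J this, of ?k'], of ?a']
    show "mcong J (fu_v ** scal_mat (?K ** adjm ?K) ** transpose fu_u) (scal_mat (?K ** adjm ?K))"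
      unfolding adj_x F by (simp add: matrix_mul_assoc cancel cancel')
  next
    assume "mcong J (fu_v ** scal_mat (?K ** adjm ?K) ** transpose fu_u) (scal_mat (?K ** adjm ?K))"
    from mcong_mult_right[OF J mcong_mult_left[OF J this, of ?k], of ?a]
    show "mcong J (?x ** adj_mat ?x) (mat 1)"
      unfolding adj_x F by (simp add: matrix_mul_assoc cancel cancel')
  qed
  have 2: "mcong J (adj_mat ?x ** ?x) (mat 1) \<longleftrightarrow> mcong J (transpose fu_u ** scal_mat (adjm K ** K) ** fu_v) (scal_mat (adjm K ** K))"
  proof
    assume "mcong J (adj_mat ?x ** ?x) (mat 1)"
    from mcong_mult_right[OF J mcong_mult_left[OF J this, of ?a], of ?k]
    show "mcong J (transpose fu_u ** scal_mat (adjm K ** K) ** fu_v) (scal_mat (adjm K ** K))"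
      unfolding adj_x G by (simp add: matrix_mul_assoc cancel cancel')
  next
    assume "mcong J (transpose fu_u ** scal_mat (adjm K ** K) ** fu_v) (scal_mat (adjm K ** K))"
    from mcong_mult_right[OF J mcong_mult_left[OF J this, of ?a'], of ?k']
    show "mcong J (adj_mat ?x ** ?x) (mat 1)"
      unfolding adj_x G by (simp add: matrix_mul_assoc cancel cancel')
  qed
  show ?thesis
    unfolding free_unitary_relators_def unitary_relators_def fu_v_def[symmetric] Un_subset_iff ent 1 2 rels_def adj_mat_fu
    by blast
qed

lemma diagm_sandwich:
  fixes A B :: "('g free_alg)^'n^'n"
  shows "(A ** scal_mat (diagm d) ** B) $ i $ j = (\<Sum>k\<in>UNIV. scal (of_real (d k)) * (A $ i $ k * B $ k $ j))"
proof -
  have "(A ** scal_mat (diagm d)) $ i $ k = A $ i $ k * scal (of_real (d k))" for k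
    by (simp add: matrix_matrix_mult_def scal_mat_def diagm_def if_distrib[of scal] if_distrib[of "\<lambda>z. _ * z"] cong: if_cong)
  then show ?thesis by (simp add: matrix_matrix_mult_def[of "A ** scal_mat (diagm d)"] scal_commute mult.assoc)
qed

context haar
begin

lemma diag_rels_iff:
  "diag_rels \<subseteq> J \<longleftrightarrow> rels J (diagm f) (diagm (\<lambda>i. 1 / f i)) fu_u fu_v"
proof -
  have m: "mon [a, b] = gen a * gen b" for a b :: "('n \<times> 'n) starred" by (simp add: mon_Cons)
  have e: "relC True i j = (fu_u ** transpose fu_v - mat 1) $ i $ j"
    "relR False i j = (transpose fu_v ** fu_u - mat 1) $ i $ j"
    "relC False i j = (fu_v ** scal_mat (diagm f) ** transpose fu_u - scal_mat (diagm f)) $ i $ j"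
    "relR True i j = (transpose fu_u ** scal_mat (diagm (\<lambda>i. 1 / f i)) ** fu_v - scal_mat (diagm (\<lambda>i. 1 / f i))) $ i $ j" for i j
  proof -
    show "relC True i j = (fu_u ** transpose fu_v - mat 1) $ i $ j" "relR False i j = (transpose fu_v ** fu_u - mat 1) $ i $ j"
      by (simp_all add: relC_def relR_def cw_def rw_def lt_def m matrix_matrix_mult_def transpose_def fu_v_nth free_unitary_u_def mat_def)
    show "relC False i j = (fu_v ** scal_mat (diagm f) ** transpose fu_u - scal_mat (diagm f)) $ i $ j"
      "relR True i j = (transpose fu_u ** scal_mat (diagm (\<lambda>i. 1 / f i)) ** fu_v - scal_mat (diagm (\<lambda>i. 1 / f i))) $ i $ j"
      by (simp_all add: diagm_sandwich)
         (simp_all add: relC_def relR_def cw_def rw_def lt_def m transpose_def fu_v_nth free_unitary_u_def scal_mat_def diagm_def)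
  qed
  have "diag_rels \<subseteq> J \<longleftrightarrow> (\<forall>i j. relC True i j \<in> J \<and> relR False i j \<in> J \<and> relC False i j \<in> J \<and> relR True i j \<in> J)"
  proof -
    have "diag_rels \<subseteq> J \<longleftrightarrow> (\<forall>s i j. relC s i j \<in> J) \<and> (\<forall>s i j. relR s i j \<in> J)"
      unfolding diag_rels_def by blast
    then show ?thesis by (simp only: all_bool_eq) blast
  qed
  also have "\<dots> \<longleftrightarrow> rels J (diagm f) (diagm (\<lambda>i. 1 / f i)) fu_u fu_v"
    unfolding e rels_def mcong_def vector_minus_component by blast
  finally show ?thesis .
qed

end

lemma conj_mat_sandwich:
  fixes W :: "('g starred free_alg)^'n^'n"
  shows "conj_mat (scal_mat A ** W ** scal_mat B) = scal_mat (transpose (adjm A)) ** conj_mat W ** scal_mat (transpose (adjm B))"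
proof -
  have "star (scal c * x) = scal (cnj c) * star x" for c and x :: "'g starred free_alg"
    by (simp add: star_mult scal_commute)
  then show ?thesis
    by (simp add: vec_eq_iff sandwich_nth conj_mat_def star_sum) (simp add: transpose_def adjm_def)
qed

lemma subst_star:
  assumes "\<And>g. star (\<tau> g) = \<tau> (flip g)"
  shows "subst \<tau> (star x) = star (subst \<tau> x)"
proof (induction x rule: free_alg_induct)
  case (scal_mon c w)
  have "subst \<tau> (mon (rev (map flip w))) = star (subst \<tau> (mon w))"
  proof (induction w)
    case (Cons g w)
    have "subst \<tau> (mon (rev (map flip (g # w)))) = subst \<tau> (mon (rev (map flip w))) * \<tau> (flip g)"
      by (simp add: mon_append subst_mult flip: gen_eq_mon)
    also have "\<dots> = star (subst \<tau> (mon (g # w)))"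
      unfolding Cons mon_Cons subst_mult star_mult subst_gen assms ..
    finally show ?case .
  qed simp
  moreover have "star (mon w) = mon (rev (map flip w))" using star_scal_mon[of 1 w] by simp
  ultimately show ?case by (simp add: subst_mult star_mult scal_commute)
qed (simp add: star_add subst_add)

text \<open>Diagonalize F by a unitary P and pull the Haar operator seminorm back along the induced
  change of generators.\<close>

lemma separating_seminorm:
  fixes K :: "complex^'n^'n"
  assumes K: "invertible K"
  shows "\<exists>p. cstar_seminorm p \<and> (\<forall>r\<in>free_unitary_relators K. p r = 0) \<and>
    (\<forall>x. p x = 0 \<longrightarrow> x \<in> ideal_of (free_unitary_relators K))"
proof -
  let ?J = "ideal_of (free_unitary_relators K)"
  have J: "two_sided ?J" by (rule two_sided_ideal_of)
  let ?L = "matrix_inv K"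
  define F where "F = ?L ** adjm ?L"
  define G where "G = adjm K ** K"
  have fu_iff: "free_unitary_relators K \<subseteq> J \<longleftrightarrow> rels J F G fu_u fu_v" if "two_sided J" for J
    unfolding F_def G_def by (rule free_unitary_rels_iff[OF that K])
  note inv = matrix_inv_mult[OF K]
  have adj_inv: "adjm K ** adjm ?L = mat 1" "adjm ?L ** adjm K = mat 1"
    using inv by (simp_all flip: adjm_mult)
  have FG: "F ** G = mat 1" "G ** F = mat 1"
  proof -
    have "F ** G = ?L ** (adjm ?L ** adjm K) ** K" by (simp only: F_def G_def matrix_mul_assoc)
    then show "F ** G = mat 1" using inv adj_inv by simp
    then show "G ** F = mat 1" by (simp add: matrix_left_right_inverse)
  qed
  have "invertible ?L" using inv unfolding invertible_def by blast
  then obtain P :: "complex^'n^'n" and f where P: "P ** adjm P = mat 1" "adjm P ** P = mat 1" and PF: "P ** F ** adjm P = diagm f" and f: "\<And>i. 0 < f i"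
    using spectral_theorem[of ?L] unfolding F_def by blast
  interpret haar f by unfold_locales (rule f)
  let ?Q = "adjm P"
  have QQ: "adjm ?Q = P" by (simp add: adjm_def vec_eq_iff)
  have PG: "P ** G ** ?Q = diagm (\<lambda>i. 1 / f i)"
  proof -
    have nz: "f i \<noteq> 0" for i using f[of i] by simp
    have "(diagm f ** diagm (\<lambda>i. 1 / f i)) $ i $ j = (\<Sum>k\<in>UNIV. if k = i then (if i = j then 1 else 0) else 0)" for i j
    proof -
      have "(diagm f ** diagm (\<lambda>i. 1 / f i)) $ i $ j = (\<Sum>k\<in>UNIV. diagm f $ i $ k * diagm (\<lambda>i. 1 / f i) $ k $ j)"
        by (simp add: matrix_matrix_mult_def)
      also have "\<dots> = (\<Sum>k\<in>UNIV. if k = i then (if i = j then 1 else 0) else 0)"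
        by (intro sum.cong refl) (auto simp: nz diagm_def)
      finally show ?thesis .
    qed
    then have d: "diagm f ** diagm (\<lambda>i. 1 / f i) = mat 1" by (simp add: vec_eq_iff mat_def)
    have "P ** G ** ?Q ** (P ** F ** ?Q) = P ** (G ** (?Q ** P) ** F) ** ?Q" by (simp only: matrix_mul_assoc)
    also have "\<dots> = mat 1" using P FG by simp
    finally have "P ** G ** ?Q ** diagm f = mat 1" unfolding PF .
    then have "P ** G ** ?Q ** (diagm f ** diagm (\<lambda>i. 1 / f i)) = diagm (\<lambda>i. 1 / f i)"
      by (simp only: matrix_mul_assoc) simp
    then show ?thesis by (simp add: d)
  qed
  have PFr: "?Q ** diagm f ** P = F" "?Q ** diagm (\<lambda>i. 1 / f i) ** P = G"
    unfolding PF[symmetric] PG[symmetric]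
    by (simp_all add: matrix_mul_assoc P(2)) (simp_all add: P(2) flip: matrix_mul_assoc)
  define SU where "SU = scal_mat (transpose ?Q) ** fu_u ** scal_mat (transpose P)"
  define SV where "SV = scal_mat P ** fu_v ** scal_mat ?Q"
  define TU where "TU = scal_mat (transpose P) ** fu_u ** scal_mat (transpose ?Q)"
  define TV where "TV = scal_mat ?Q ** fu_v ** scal_mat P"
  define \<sigma> where "\<sigma> g = (case g of Gen x \<Rightarrow> SU $ fst x $ snd x | Adj x \<Rightarrow> SV $ fst x $ snd x)" for g
  define \<tau> where "\<tau> g = (case g of Gen x \<Rightarrow> TU $ fst x $ snd x | Adj x \<Rightarrow> TV $ fst x $ snd x)" for g
  have \<sigma>_mat: "map_mat (subst \<sigma>) fu_u = SU" "map_mat (subst \<sigma>) fu_v = SV"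
    and \<tau>_mat: "map_mat (subst \<tau>) fu_u = TU" "map_mat (subst \<tau>) fu_v = TV"
    by (simp_all add: map_mat_def free_unitary_u_def fu_v_nth \<sigma>_def \<tau>_def vec_eq_iff)
  have "rels ?J F G fu_u fu_v"
    unfolding fu_iff[OF J, symmetric] by (auto intro: ideal_of_base)
  from rels_conjugate[OF J this P]
  have "rels ?J (diagm f) (diagm (\<lambda>i. 1 / f i)) SU SV" by (simp only: PF PG SU_def SV_def)
  then have "diag_rels \<subseteq> {x. subst \<sigma> x \<in> ?J}"
    unfolding diag_rels_iff by (intro rels_preimage) (simp only: \<sigma>_mat)
  then have \<sigma>_ideal: "subst \<sigma> x \<in> ?J" if "x \<in> diag_ideal" for x
    using ideal_of_minimal[OF two_sided_preimage[OF J]] that unfolding diag_ideal_def by blast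
  have "rels diag_ideal (diagm f) (diagm (\<lambda>i. 1 / f i)) fu_u fu_v"
    unfolding diag_rels_iff[symmetric] diag_ideal_def by (auto intro: ideal_of_base)
  from rels_conjugate[OF two_sided_diag_ideal this P(2,1)]
  have "rels diag_ideal F G TU TV" by (simp only: PFr TU_def TV_def)
  then have "rels {x. subst \<tau> x \<in> diag_ideal} F G fu_u fu_v" by (intro rels_preimage) (simp only: \<tau>_mat)
  then have \<tau>_rel: "free_unitary_relators K \<subseteq> {x. subst \<tau> x \<in> diag_ideal}"
    unfolding fu_iff[OF two_sided_preimage[OF two_sided_diag_ideal]] .
  have SP: "scal_mat P ** scal_mat ?Q = mat 1" "scal_mat ?Q ** scal_mat P = mat 1"
    "scal_mat (transpose P) ** scal_mat (transpose ?Q) = mat 1" "scal_mat (transpose ?Q) ** scal_mat (transpose P) = mat 1"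
    using P by (simp_all flip: scal_mat_mult matrix_transpose_mul)
  have \<sigma>\<tau>: "subst \<sigma> (subst \<tau> x) = x" for x
  proof -
    have "map_mat (subst \<sigma>) TU = scal_mat (transpose P) ** scal_mat (transpose ?Q) ** fu_u ** (scal_mat (transpose P) ** scal_mat (transpose ?Q))"
      by (simp add: TU_def map_mat_mult \<sigma>_mat SU_def matrix_mul_assoc)
    then have U: "map_mat (subst \<sigma>) TU = fu_u" by (simp add: SP)
    have "map_mat (subst \<sigma>) TV = scal_mat ?Q ** scal_mat P ** fu_v ** (scal_mat ?Q ** scal_mat P)"
      by (simp add: TV_def map_mat_mult \<sigma>_mat SV_def matrix_mul_assoc)
    then have V: "map_mat (subst \<sigma>) TV = fu_v" by (simp add: SP)
    have "subst \<sigma> (\<tau> g) = gen g" for g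
    proof (cases g)
      case (Gen x)
      then show ?thesis
        using arg_cong[OF U, of "\<lambda>A. A $ fst x $ snd x"] by (simp add: \<tau>_def map_mat_def free_unitary_u_def)
    next
      case (Adj x)
      then show ?thesis
        using arg_cong[OF V, of "\<lambda>A. A $ fst x $ snd x"] by (simp add: \<tau>_def map_mat_def fu_v_nth)
    qed
    then show ?thesis by (simp add: subst_subst subst_gen_id)
  qed
  \<comment> \<open>As P is unitary, the change of generators respects the star, which is needed for
    the pullback to be a C*-seminorm.\<close>
  have "conj_mat TU = TV"
    unfolding TU_def TV_def conj_mat_sandwich fu_v_def
    by (simp add: adjm_def transpose_def)
  then have TUV: "star (TU $ i $ j) = TV $ i $ j" for i j by (simp add: conj_mat_def vec_eq_iff)
  have "star (\<tau> g) = \<tau> (flip g)" for g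
    by (cases g) (simp_all add: \<tau>_def TUV flip: TUV)
  then have \<tau>_star: "subst \<tau> (star x) = star (subst \<tau> x)" for x by (rule subst_star)
  let ?p = "\<lambda>x. op_norm (subst \<tau> x)"
  have "cstar_seminorm ?p"
    using cstar_seminorm_op_norm unfolding cstar_seminorm_def
    by (simp add: subst_add subst_mult \<tau>_star)
  moreover have "\<forall>r\<in>free_unitary_relators K. ?p r = 0" using \<tau>_rel by (auto simp: op_norm_ideal)
  moreover have "x \<in> ?J" if "?p x = 0" for x
    using \<sigma>_ideal[of "subst \<tau> x"] that by (simp add: op_norm_ideal \<sigma>\<tau>)
  ultimately show ?thesis by blast
qed

text \<open>The column sums of star u u equal 1 for every such seminorm, and all other summands are
  positive.\<close>

lemma free_unitary_bounded:
  assumes p: "cstar_seminorm p" "\<forall>r\<in>free_unitary_relators K. p r = 0"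
  shows "p (gen g) \<le> 1"
proof -
  interpret cstar p by unfold_locales (rule p(1))
  have le: "p (gen (Gen (i, j))) \<le> 1" for i j
  proof (rule p_le_1)
    let ?b = "\<Sum>k\<in>UNIV - {i}. star (gen (Gen (k, j))) * gen (Gen (k, j))"
    show "pos ?b" by (intro pos_sum pos_star_mult)
    have "(adj_mat fu_u ** fu_u - mat 1) $ j $ j \<in> free_unitary_relators K"
      unfolding free_unitary_relators_def unitary_relators_def entries_def by blast
    then have "p ((adj_mat fu_u ** fu_u - mat 1) $ j $ j) = 0" using p(2) by blast
    moreover have "(adj_mat fu_u ** fu_u - mat 1) $ j $ j = (\<Sum>k\<in>UNIV. star (gen (Gen (k, j))) * gen (Gen (k, j))) - 1"
      by (simp add: matrix_matrix_mult_def adj_mat_def conj_mat_def transpose_def free_unitary_u_def mat_def)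
    moreover have "(\<Sum>k\<in>UNIV. star (gen (Gen (k, j))) * gen (Gen (k, j))) = star (gen (Gen (i, j))) * gen (Gen (i, j)) + ?b"
      by (rule sum.remove) auto
    ultimately show "p (star (gen (Gen (i, j))) * gen (Gen (i, j)) + ?b - 1) = 0" by (simp only:)
  qed
  show ?thesis
  proof (cases g)
    case (Gen x)
    then show ?thesis using le[of "fst x" "snd x"] by simp
  next
    case (Adj x)
    then show ?thesis using le[of "fst x" "snd x"] p_star[of "gen (Gen x)"] by simp
  qed
qed

text \<open>The universal seminorm vanishes on the algebraic ideal only, so the polynomial algebra
  is the cosovereign algebra of F with u to u and v to the entrywise adjoint of u; its counit is the
  extension of the character by limits.\<close>

theorem free_unitary_resolution:
  fixes K :: "complex^'n^'n"
  assumes n: "CARD('n) \<ge> 2" and K: "invertible K"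
  shows "has_finite_free_resolution_of_length_3 (pol_free_unitary K) (char_module free_unitary_counit)"
proof -
  let ?S = "free_unitary_relators K"
  let ?J = "ideal_of ?S" and ?L = "matrix_inv K"
  have J: "two_sided ?J" by (rule two_sided_ideal_of)
  interpret universal_cstar ?S
    by unfold_locales (use free_unitary_bounded in blast)
  \<comment> \<open>No collapse in the completion: the separating seminorm is one of those in the
    supremum.\<close>
  have N0: "N x = 0 \<longleftrightarrow> x \<in> ?J" for x
  proof
    assume x: "N x = 0"
    obtain p where p: "cstar_seminorm p" "\<forall>r\<in>?S. p r = 0" "\<forall>x. p x = 0 \<longrightarrow> x \<in> ?J"
      using separating_seminorm[OF K] by blast
    have "p x \<le> 0" using seminorm_le[OF p(1), of x] p(2) x by simp
    moreover have "0 \<le> p x" using p(1) by (simp add: cstar_seminorm_def)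
    ultimately show "x \<in> ?J" using p(3) by simp
  qed (rule N_ideal)
  define F where "F = ?L ** adjm ?L"
  define G where "G = adjm K ** K"
  have fu_iff: "free_unitary_relators K \<subseteq> J \<longleftrightarrow> rels J F G fu_u fu_v" if "two_sided J" for J
    unfolding F_def G_def by (rule free_unitary_rels_iff[OF that K])
  note inv = matrix_inv_mult[OF K]
  have adj_inv: "adjm K ** adjm ?L = mat 1" "adjm ?L ** adjm K = mat 1"
    using inv by (simp_all flip: adjm_mult)
  have FG: "F ** G = mat 1" "G ** F = mat 1"
  proof -
    have "F ** G = ?L ** (adjm ?L ** adjm K) ** K" by (simp only: F_def G_def matrix_mul_assoc)
    then show "F ** G = mat 1" using inv adj_inv by simp
    then show "G ** F = mat 1" by (simp add: matrix_left_right_inverse)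
  qed
  then have F: "invertible F" unfolding invertible_def by blast
  have invF: "matrix_inv F = G"
  proof -
    have "matrix_inv F = matrix_inv F ** (F ** G)" by (simp add: FG)
    also have "\<dots> = G" by (simp only: matrix_mul_assoc matrix_inv_mult[OF F]) simp
    finally show ?thesis .
  qed
  let ?I = "cosov_ideal F"
  have I: "two_sided ?I" unfolding cosov_ideal_def by (rule two_sided_ideal_of)
  define \<rho> :: "'n cosov_gen \<Rightarrow> ('n \<times> 'n) starred free_alg"
    where "\<rho> g = (case g of U i j \<Rightarrow> gen (Gen (i, j)) | V i j \<Rightarrow> gen (Adj (i, j)))" for g
  define \<rho>' :: "('n \<times> 'n) starred \<Rightarrow> 'n cosov_gen free_alg"
    where "\<rho>' g = (case g of Gen x \<Rightarrow> gen (U (fst x) (snd x)) | Adj x \<Rightarrow> gen (V (fst x) (snd x)))" for g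
  have \<rho>_mat: "map_mat (subst \<rho>) cosov_u = fu_u" "map_mat (subst \<rho>) cosov_v = fu_v"
    and \<rho>'_mat: "map_mat (subst \<rho>') fu_u = cosov_u" "map_mat (subst \<rho>') fu_v = cosov_v"
    by (simp_all add: map_mat_def cosov_u_def cosov_v_def free_unitary_u_def fu_v_nth \<rho>_def \<rho>'_def vec_eq_iff)
  have "subst \<rho>' (\<rho> g) = gen g" for g by (cases g) (simp_all add: \<rho>_def \<rho>'_def)
  then have \<rho>'\<rho>: "subst \<rho>' (subst \<rho> x) = x" for x by (simp add: subst_subst subst_gen_id)
  have "subst \<rho> (\<rho>' g) = gen g" for g by (cases g) (simp_all add: \<rho>_def \<rho>'_def)
  then have \<rho>\<rho>': "subst \<rho> (subst \<rho>' x) = x" for x by (simp add: subst_subst subst_gen_id)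
  have "rels ?J F G fu_u fu_v"
    unfolding fu_iff[OF J, symmetric] by (auto intro: ideal_of_base)
  then have "rels {x. subst \<rho> x \<in> ?J} F (matrix_inv F) cosov_u cosov_v"
    unfolding invF by (intro rels_preimage) (simp only: \<rho>_mat)
  then have "cosov_relators F \<subseteq> {x. subst \<rho> x \<in> ?J}"
    unfolding cosov_rels_iff[OF two_sided_preimage[OF J] F, symmetric] cosov_relators_def Let_def .
  then have \<rho>_ideal: "subst \<rho> x \<in> ?J" if "x \<in> ?I" for x
    using ideal_of_minimal[OF two_sided_preimage[OF J]] that unfolding cosov_ideal_def by blast
  have "cosov_relators F \<subseteq> ?I" unfolding cosov_ideal_def by (auto intro: ideal_of_base)
  then have "rels ?I F G cosov_u cosov_v"
    unfolding invF[symmetric] cosov_rels_iff[OF I F, symmetric] cosov_relators_def Let_def .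
  then have "rels {x. subst \<rho>' x \<in> ?I} F G fu_u fu_v" by (intro rels_preimage) (simp only: \<rho>'_mat)
  then have "?S \<subseteq> {x. subst \<rho>' x \<in> ?I}"
    unfolding fu_iff[OF two_sided_preimage[OF I]] .
  then have \<rho>'_ideal: "subst \<rho>' x \<in> ?I" if "x \<in> ?J" for x
    using ideal_of_minimal[OF two_sided_preimage[OF I]] that by blast
  \<comment> \<open>The adjoints of the entries of u are reached by the star, so the generated
    subalgebra consists of all classes of constants.\<close>
  have pol: "pol_free_unitary K = (univ_cstar ?S)\<lparr>carrier := range (const_class ?S)\<rparr>"
  proof -
    have "star_subalgebra_generated ?S (const_class ?S ` entries fu_u) = range (const_class ?S)"
    proof (rule star_subalgebra_eq)
      fix g :: "('n \<times> 'n) starred"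
      let ?A = "star_subalgebra_generated ?S (const_class ?S ` entries fu_u)"
      have base: "const_class ?S (gen (Gen x)) \<in> ?A" for x
      proof (rule star_subalgebra_generated.base, rule imageI)
        show "gen (Gen x) \<in> entries fu_u" unfolding entries_def free_unitary_u_def by (cases x) auto
      qed
      show "const_class ?S (gen g) \<in> ?A"
      proof (cases g)
        case (Gen x)
        then show ?thesis using base by simp
      next
        case (Adj x)
        then show ?thesis
          using star_subalgebra_generated.star[OF base[of x]] unfolding class_star_const by simp
      qed
    qed blast
    then show ?thesis by (simp add: pol_free_unitary_def Let_def)
  qed
  interpret Q: quotient_map "(univ_cstar ?S)\<lparr>carrier := range (const_class ?S)\<rparr>" "const_class ?S" "{x. N x = 0}"
    by (rule const_quotient_map)
  have "quotient_map (pol_free_unitary K) (\<lambda>x. const_class ?S (subst \<rho> x)) ?I"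
    unfolding pol
  proof unfold_locales
    have "range (\<lambda>x. const_class ?S (subst \<rho> x)) = const_class ?S ` range (subst \<rho>)" by (simp add: image_image)
    also have "range (subst \<rho>) = UNIV" using surjI[of "subst \<rho>" "subst \<rho>'", OF \<rho>\<rho>'] .
    finally show "range (\<lambda>x. const_class ?S (subst \<rho> x)) = carrier ((univ_cstar ?S)\<lparr>carrier := range (const_class ?S)\<rparr>)"
      by simp
    show "const_class ?S (subst \<rho> x) = \<zero>\<^bsub>(univ_cstar ?S)\<lparr>carrier := range (const_class ?S)\<rparr>\<^esub> \<longleftrightarrow> x \<in> ?I" for x
      using \<rho>_ideal[of x] \<rho>'_ideal[of "subst \<rho> x"] unfolding Q.map_zero_iff by (auto simp: N0 \<rho>'\<rho>)
  qed (simp_all only: subst_add subst_mult subst_1 Q.map_add Q.map_mult Q.map_one)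
  moreover have "free_unitary_counit (const_class ?S (subst \<rho> x)) = character_of cosov_counit_gen x" for x
  proof -
    have cu: "map_mat (character_of free_unitary_counit_gen) fu_u = mat 1" "map_mat (character_of free_unitary_counit_gen) fu_v = mat 1"
      by (simp_all add: map_mat_def free_unitary_u_def fu_v_nth mat_def vec_eq_iff)
    have kill: "?S \<subseteq> {x. character_of free_unitary_counit_gen x = 0}"
      unfolding free_unitary_rels_iff[OF two_sided_character K] by (rule rels_character[OF cu])
    have "free_unitary_counit (const_class ?S (subst \<rho> x)) = character_of free_unitary_counit_gen (subst \<rho> x)"
      unfolding free_unitary_counit_def
    proof (rule character_limit)
      show "free_unitary_counit_gen (flip g) = cnj (free_unitary_counit_gen g)" for g :: "('n \<times> 'n) starred"
        by (cases g rule: free_unitary_counit_gen.cases) auto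
    qed (use kill in blast)
    also have "\<dots> = character_of cosov_counit_gen x"
    proof -
      have "character_of free_unitary_counit_gen (\<rho> g) = cosov_counit_gen g" for g by (cases g) (simp_all add: \<rho>_def)
      then show ?thesis by (simp add: character_of_subst)
    qed
    finally show ?thesis .
  qed
  ultimately show ?thesis by (rule cosov_resolution[OF n F])
qed

text \<open>The coset projection is a \<open>quotient_map\<close>, and the character is constant on
  cosets because it kills the relators.\<close>

theorem cosov_hopf_resolution:
  fixes F :: "complex^'n^'n"
  assumes n: "CARD('n) \<ge> 2" and F: "invertible F"
  shows "has_finite_free_resolution_of_length_3 (cosov F) (char_module cosov_counit)"
proof -
  let ?I = "cosov_ideal F" and ?R = "ring_of_type_algebra :: 'n cosov_gen free_alg ring"
  let ?\<pi> = "\<lambda>x. ?I +>\<^bsub>?R\<^esub> x"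
  have I: "two_sided ?I" unfolding cosov_ideal_def by (rule two_sided_ideal_of)
  have coset: "?\<pi> x = (\<lambda>i. i + x) ` ?I" for x
    by (auto simp: a_r_coset_def r_coset_def ring_of_type_algebra_def)
  have "quotient_map ((?R Quot ?I)\<lparr>carrier := range ?\<pi>\<rparr>) ?\<pi> {x. x \<in> ?I}"
    by (rule coset_quotient_map[OF ring_of_type_ring])
       (use I in \<open>simp_all add: two_sided_iff_ideal ring_of_type_algebra_def[where 'a = "'n cosov_gen free_alg"]\<close>)
  moreover have "(?R Quot ?I)\<lparr>carrier := range ?\<pi>\<rparr> = cosov F"
  proof -
    have "range ?\<pi> = a_rcosets\<^bsub>?R\<^esub> ?I"
      by (auto simp: A_RCOSETS_def' ring_of_type_algebra_def)
    then show ?thesis by (simp add: cosov_def FactRing_def)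
  qed
  ultimately have "quotient_map (cosov F) ?\<pi> ?I" by simp
  moreover have "cosov_counit (?\<pi> x) = character_of cosov_counit_gen x" for x
  proof -
    have cu: "map_mat (character_of cosov_counit_gen) cosov_u = mat 1" "map_mat (character_of cosov_counit_gen) cosov_v = mat 1"
      by (simp_all add: map_mat_def cosov_u_def cosov_v_def mat_def vec_eq_iff)
    have "cosov_relators F \<subseteq> {x. character_of cosov_counit_gen x = 0}"
      unfolding cosov_relators_def Let_def cosov_rels_iff[OF two_sided_character F] by (rule rels_character[OF cu])
    then have "?I \<subseteq> {x. character_of cosov_counit_gen x = 0}"
      unfolding cosov_ideal_def by (rule ideal_of_minimal[OF two_sided_character])
    then have "(\<lambda>i. character_of cosov_counit_gen (i + x)) ` ?I = (\<lambda>i. character_of cosov_counit_gen x) ` ?I"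
      by (intro image_cong refl) (auto simp: character_of_add)
    also have "\<dots> = {character_of cosov_counit_gen x}" by (rule image_constant[OF two_sided_0[OF I]])
    finally have "character_of cosov_counit_gen ` ?\<pi> x = {character_of cosov_counit_gen x}"
      unfolding coset by (simp add: image_image)
    then show ?thesis by (simp add: cosov_counit_def)
  qed
  ultimately show ?thesis by (rule cosov_resolution[OF n F])
qed

theorem theorem1:
  assumes "CARD('n::finite) \<ge> 2"
  shows "(\<forall>F :: complex^'n^'n. invertible F \<and> generic F \<longrightarrow>
           has_finite_free_resolution_of_length_3 (cosov F) (char_module cosov_counit)) \<and>
         (\<forall>K :: complex^'n^'n. invertible K \<longrightarrow>
           has_finite_free_resolution_of_length_3 (pol_free_unitary K)
             (char_module free_unitary_counit))"
    using cosov_hopf_resolution[OF assms] free_unitary_resolution[OF assms] by blast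

end
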